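(* Suppose that $n\ge3$, $0<\alpha<1$, $\Omega\subset\mathbb R^n$ is a bounded $C^{2,\alpha}$-domain, and $a_1,a_2\in C^{1,\alpha}(\overline\Omega\times\mathbb R^n)$ are positive nonlinearities. Assume that $$a_j(x,p)=\frac{\rho_j(x)}{\rho_j(p)},\qquad j=1,2,$$ where $\rho_j\in C_b^\infty(\mathbb R^n)$ are positive and satisfy $$\rho_1|_{\partial\Omega}=\rho_2|_{\partial\Omega}.$$ Let $\Phi(x)=|x|^2/2$ and $\phi=\Phi|_{\partial\Omega}$. If the nonlinear Cauchy data sets agree near the background $\Phi$, $$\mathscr C_{a_1}^{(\phi,\partial_\nu\Phi|_{\partial\Omega})}=\mathscr C_{a_2}^{(\phi,\partial_\nu\Phi|_{\partial\Omega})},$$ then $$\rho_1=\rho_2\quad\text{in }\Omega.$$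
   Context: $C_b^\infty(\mathbb R^n)$ denotes smooth functions that are bounded together with all derivatives. The function $\Phi(x)=|x|^2/2$ solves $\det D^2\Phi=1=a_j(x,\nabla\Phi)$ for $j=1,2$. $C^{k,\alpha}(\overline\Omega)$ is the usual Hölder space (norms required finite on unbounded sets); $C^{k,\alpha}(\partial\Omega)$ carries the quotient norm over extensions. $\nu$ is the exterior unit normal and $\partial_\nu$ the normal derivative. Nonlinear Cauchy data set: for $a=a_j$ (a function of $(x,p)$, independent of the value variable), local well-posedness provides $\delta>0$ and a neighbourhood $V$ of $\Phi$ in $C^{2,\alpha}(\overline\Omega)$ such that for every $\eta\in C^{2,\alpha}(\partial\Omega)$ with $\|\eta-\phi\|_{C^{2,\alpha}(\partial\Omega)}<\delta$ the problem $\det D^2u=a(x,\nabla u)$ in $\Omega$, $u=\eta$ on $\partial\Omega$ has a unique solution $u_\eta\in V$, and $\eta\mapsto u_\eta$ is of class $C^1$ (Fréchet, into $C^{2,\alpha}(\overline\Omega)$) near $\phi$ with $u_\phi=\Phi$. Then $$\mathscr C_a^{(\phi,\partial_\nu\Phi|_{\partial\Omega})}=\{(\eta,\partial_\nu u_\eta|_{\partial\Omega}):\ \|\eta-\phi\|_{C^{2,\alpha}(\partial\Omega)}<\delta\}\subset C^{2,\alpha}(\partial\Omega)\times C^{1,\alpha}(\partial\Omega).$$ *)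

theory Defs
  imports "HOL-Analysis.Analysis"
begin

text \<open>
  Functions on an open set, on its closure or on its boundary are total functions in HOL.
  Every notion below only looks at the values on the set concerned.
\<close>

section \<open>Hoelder spaces\<close>

primrec iterated_partial :: "'a::euclidean_space list \<Rightarrow> ('a \<Rightarrow> real) \<Rightarrow> 'a \<Rightarrow> real" where
  "iterated_partial [] u = u"
| "iterated_partial (b # bs) u = (\<lambda>x. frechet_derivative (iterated_partial bs u) (at x) b)"

definition partial_dirs :: "nat \<Rightarrow> 'a::euclidean_space list set" where
  "partial_dirs m = {bs. set bs \<subseteq> Basis \<and> length bs = m}"

definition C_k_on :: "nat \<Rightarrow> 'a::euclidean_space set \<Rightarrow> ('a \<Rightarrow> real) \<Rightarrow> bool" where
  "C_k_on k U u \<longleftrightarrow>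
     (\<forall>m<k. \<forall>bs\<in>partial_dirs m. \<forall>x\<in>U. iterated_partial bs u differentiable (at x)) \<and>
     (\<forall>m\<le>k. \<forall>bs\<in>partial_dirs m. continuous_on U (iterated_partial bs u))"

definition C_b_infinity :: "('a::euclidean_space \<Rightarrow> real) \<Rightarrow> bool" where
  "C_b_infinity u \<longleftrightarrow>
     (\<forall>k. C_k_on k UNIV u) \<and> (\<forall>m. \<forall>bs\<in>partial_dirs m. bounded (range (iterated_partial bs u)))"

definition holder_quotients :: "real \<Rightarrow> 'a::euclidean_space set \<Rightarrow> ('a \<Rightarrow> real) \<Rightarrow> real set" where
  "holder_quotients \<alpha> U f = {\<bar>f x - f y\<bar> / dist x y powr \<alpha> | x y. x \<in> U \<and> y \<in> U \<and> x \<noteq> y}"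

text \<open>
  \<open>u \<in> C\<^sup>k\<^sup>,\<^sup>\<alpha>(closure U)\<close> for an open set \<open>U\<close>: the derivatives are taken in \<open>U\<close> and have to extend
  continuously to the closure; \<open>u\<close> itself takes its boundary values continuously.
\<close>

definition holder_on :: "nat \<Rightarrow> real \<Rightarrow> 'a::euclidean_space set \<Rightarrow> ('a \<Rightarrow> real) \<Rightarrow> bool" where
  "holder_on k \<alpha> U u \<longleftrightarrow>
     C_k_on k U u \<and> continuous_on (closure U) u \<and>
     (\<forall>m\<le>k. \<forall>bs\<in>partial_dirs m.
        bounded (iterated_partial bs u ` U) \<and>
        (\<exists>g. continuous_on (closure U) g \<and> (\<forall>x\<in>U. g x = iterated_partial bs u x))) \<and>
     (\<forall>bs\<in>partial_dirs k. bdd_above (holder_quotients \<alpha> U (iterated_partial bs u)))"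

definition holder_norm :: "nat \<Rightarrow> real \<Rightarrow> 'a::euclidean_space set \<Rightarrow> ('a \<Rightarrow> real) \<Rightarrow> real" where
  "holder_norm k \<alpha> U u =
     (\<Sum>m\<le>k. Max ((\<lambda>bs. SUP x\<in>U. \<bar>iterated_partial bs u x\<bar>) ` partial_dirs m)) +
     Max ((\<lambda>bs. Sup (holder_quotients \<alpha> U (iterated_partial bs u))) ` partial_dirs k)"

definition boundary_holder :: "nat \<Rightarrow> real \<Rightarrow> 'a::euclidean_space set \<Rightarrow> ('a \<Rightarrow> real) \<Rightarrow> bool" where
  "boundary_holder k \<alpha> \<Omega> \<eta> \<longleftrightarrow> (\<exists>F. holder_on k \<alpha> \<Omega> F \<and> (\<forall>x\<in>frontier \<Omega>. F x = \<eta> x))"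

definition boundary_holder_norm :: "nat \<Rightarrow> real \<Rightarrow> 'a::euclidean_space set \<Rightarrow> ('a \<Rightarrow> real) \<Rightarrow> real"
  where
  "boundary_holder_norm k \<alpha> \<Omega> \<eta> =
     (INF F\<in>{F. holder_on k \<alpha> \<Omega> F \<and> (\<forall>x\<in>frontier \<Omega>. F x = \<eta> x)}. holder_norm k \<alpha> \<Omega> F)"


section \<open>Domains and their exterior normal\<close>

text \<open>
  The boundary is locally a \<open>C\<^sup>k\<^sup>,\<^sup>\<alpha>\<close> graph. A function of the \<open>n - 1\<close> coordinates orthogonal to the
  unit vector \<open>e\<close> is written as a function \<open>\<gamma>\<close> on the whole space that is constant in direction \<open>e\<close>.
\<close>

definition holder_domain :: "nat \<Rightarrow> real \<Rightarrow> 'a::euclidean_space set \<Rightarrow> bool" where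
  "holder_domain k \<alpha> \<Omega> \<longleftrightarrow>
     open \<Omega> \<and> connected \<Omega> \<and> \<Omega> \<noteq> {} \<and>
     (\<forall>z\<in>frontier \<Omega>. \<exists>r>0. \<exists>e \<gamma>.
        norm e = 1 \<and> (\<forall>x t. \<gamma> (x + t *\<^sub>R e) = \<gamma> x) \<and> holder_on k \<alpha> (ball z r) \<gamma> \<and>
        \<Omega> \<inter> ball z r = {x \<in> ball z r. \<gamma> x < x \<bullet> e})"

text \<open>
  The unit vector orthogonal to the boundary (to all velocities of curves in the boundary through
  \<open>x\<close>) that points out of \<open>\<Omega>\<close>; it exists and is unique at boundary points of a \<open>C\<^sup>1\<close> domain.
\<close>

definition exterior_normal :: "'a::euclidean_space set \<Rightarrow> 'a \<Rightarrow> 'a" where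
  "exterior_normal \<Omega> x = (THE \<nu>.
     norm \<nu> = 1 \<and>
     (\<forall>c v. c (0::real) = x \<and> (\<forall>\<^sub>F t in nhds 0. c t \<in> frontier \<Omega>) \<and>
        (c has_vector_derivative v) (at 0) \<longrightarrow> \<nu> \<bullet> v = 0) \<and>
     (\<forall>\<^sub>F t in at_right 0. x + t *\<^sub>R \<nu> \<notin> closure \<Omega>))"

definition gradient :: "(real^'n \<Rightarrow> real) \<Rightarrow> real^'n \<Rightarrow> real^'n" where
  "gradient u x = (\<chi> i. iterated_partial [axis i 1] u x)"

definition hessian :: "(real^'n \<Rightarrow> real) \<Rightarrow> real^'n \<Rightarrow> real^'n^'n" where
  "hessian u x = (\<chi> i j. iterated_partial [axis i 1, axis j 1] u x)"

text \<open>On the boundary, the gradient is the continuous extension of the gradient in \<open>\<Omega>\<close>.\<close>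

definition normal_derivative :: "(real^'n) set \<Rightarrow> (real^'n \<Rightarrow> real) \<Rightarrow> real^'n \<Rightarrow> real" where
  "normal_derivative \<Omega> u x = exterior_normal \<Omega> x \<bullet> Lim (at x within \<Omega>) (gradient u)"


section \<open>The Dirichlet problem for the Monge--Ampere equation\<close>

definition background :: "real^'n \<Rightarrow> real" where
  "background x = (norm x)\<^sup>2 / 2"

definition solves_dirichlet ::
    "(real^'n) set \<Rightarrow> ((real^'n) \<times> (real^'n) \<Rightarrow> real) \<Rightarrow> (real^'n \<Rightarrow> real) \<Rightarrow> (real^'n \<Rightarrow> real) \<Rightarrow> bool" where
  "solves_dirichlet \<Omega> a \<eta> u \<longleftrightarrow>
     (\<forall>x\<in>\<Omega>. det (hessian u x) = a (x, gradient u x)) \<and> (\<forall>x\<in>frontier \<Omega>. u x = \<eta> x)"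

text \<open>The solution \<open>u\<^sub>\<eta>\<close> in the neighbourhood \<open>V\<close>; only its values on \<open>closure \<Omega>\<close> are determined.\<close>

definition dirichlet_solution ::
    "(real^'n) set \<Rightarrow> ((real^'n) \<times> (real^'n) \<Rightarrow> real) \<Rightarrow> (real^'n \<Rightarrow> real) set \<Rightarrow>
     (real^'n \<Rightarrow> real) \<Rightarrow> real^'n \<Rightarrow> real" where
  "dirichlet_solution \<Omega> a V \<eta> = (SOME u. u \<in> V \<and> solves_dirichlet \<Omega> a \<eta> u)"

definition boundary_ball ::
    "real \<Rightarrow> (real^'n) set \<Rightarrow> real \<Rightarrow> (real^'n \<Rightarrow> real) set" where
  "boundary_ball \<alpha> \<Omega> \<delta> =
     {\<eta>. boundary_holder 2 \<alpha> \<Omega> \<eta> \<and> boundary_holder_norm 2 \<alpha> \<Omega> (\<lambda>x. \<eta> x - background x) < \<delta>}"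

definition bounded_linear_holder ::
    "real \<Rightarrow> (real^'n) set \<Rightarrow> ((real^'n \<Rightarrow> real) \<Rightarrow> real^'n \<Rightarrow> real) \<Rightarrow> bool" where
  "bounded_linear_holder \<alpha> \<Omega> A \<longleftrightarrow>
     (\<forall>h. boundary_holder 2 \<alpha> \<Omega> h \<longrightarrow> holder_on 2 \<alpha> \<Omega> (A h)) \<and>
     (\<forall>h k. boundary_holder 2 \<alpha> \<Omega> h \<longrightarrow> boundary_holder 2 \<alpha> \<Omega> k \<longrightarrow>
        (\<forall>x\<in>closure \<Omega>. A (\<lambda>y. h y + k y) x = A h x + A k x)) \<and>
     (\<forall>h c. boundary_holder 2 \<alpha> \<Omega> h \<longrightarrow> (\<forall>x\<in>closure \<Omega>. A (\<lambda>y. c * h y) x = c * A h x)) \<and>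
     (\<exists>K. \<forall>h. boundary_holder 2 \<alpha> \<Omega> h \<longrightarrow>
        holder_norm 2 \<alpha> \<Omega> (A h) \<le> K * boundary_holder_norm 2 \<alpha> \<Omega> h)"

definition frechet_derivative_holder ::
    "real \<Rightarrow> (real^'n) set \<Rightarrow> ((real^'n \<Rightarrow> real) \<Rightarrow> real^'n \<Rightarrow> real) \<Rightarrow> (real^'n \<Rightarrow> real) \<Rightarrow>
     ((real^'n \<Rightarrow> real) \<Rightarrow> real^'n \<Rightarrow> real) \<Rightarrow> bool" where
  "frechet_derivative_holder \<alpha> \<Omega> S \<eta> A \<longleftrightarrow>
     bounded_linear_holder \<alpha> \<Omega> A \<and>
     (\<forall>e>0. \<exists>d>0. \<forall>h. boundary_holder 2 \<alpha> \<Omega> h \<and> boundary_holder_norm 2 \<alpha> \<Omega> h < d \<longrightarrow>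
        holder_norm 2 \<alpha> \<Omega> (\<lambda>x. S (\<lambda>y. \<eta> y + h y) x - S \<eta> x - A h x)
          \<le> e * boundary_holder_norm 2 \<alpha> \<Omega> h)"

text \<open>
  \<open>S\<close> is continuously Frechet differentiable from the open set \<open>B\<close> of \<open>C\<^sup>2\<^sup>,\<^sup>\<alpha>(frontier \<Omega>)\<close> to
  \<open>C\<^sup>2\<^sup>,\<^sup>\<alpha>(closure \<Omega>)\<close>; the last conjunct is continuity of the derivative in operator norm.
\<close>

definition C1_frechet_on ::
    "real \<Rightarrow> (real^'n) set \<Rightarrow> (real^'n \<Rightarrow> real) set \<Rightarrow> ((real^'n \<Rightarrow> real) \<Rightarrow> real^'n \<Rightarrow> real) \<Rightarrow> bool" where
  "C1_frechet_on \<alpha> \<Omega> B S \<longleftrightarrow>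
     (\<exists>A. (\<forall>\<eta>\<in>B. frechet_derivative_holder \<alpha> \<Omega> S \<eta> (A \<eta>)) \<and>
        (\<forall>\<eta>\<in>B. \<forall>e>0. \<exists>d>0. \<forall>\<eta>'\<in>B. boundary_holder_norm 2 \<alpha> \<Omega> (\<lambda>x. \<eta>' x - \<eta> x) < d \<longrightarrow>
           (\<forall>h. boundary_holder 2 \<alpha> \<Omega> h \<longrightarrow>
              holder_norm 2 \<alpha> \<Omega> (\<lambda>x. A \<eta>' h x - A \<eta> h x) \<le> e * boundary_holder_norm 2 \<alpha> \<Omega> h)))"

definition background_neighbourhood ::
    "real \<Rightarrow> (real^'n) set \<Rightarrow> (real^'n \<Rightarrow> real) set \<Rightarrow> bool" where
  "background_neighbourhood \<alpha> \<Omega> V \<longleftrightarrow>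
     V \<subseteq> Collect (holder_on 2 \<alpha> \<Omega>) \<and>
     (\<exists>r>0. \<forall>u. holder_on 2 \<alpha> \<Omega> u \<and> holder_norm 2 \<alpha> \<Omega> (\<lambda>x. u x - background x) < r \<longrightarrow> u \<in> V)"

text \<open>
  \<open>\<delta>\<close> and \<open>V\<close> are as provided by local well-posedness near the background: existence and
  uniqueness (on \<open>closure \<Omega>\<close>) in \<open>V\<close> for boundary values in the \<open>\<delta>\<close>-ball, and a solution map that
  is \<open>C\<^sup>1\<close> near the boundary values of the background.
\<close>

definition locally_well_posed ::
    "real \<Rightarrow> (real^'n) set \<Rightarrow> ((real^'n) \<times> (real^'n) \<Rightarrow> real) \<Rightarrow> real \<Rightarrow> (real^'n \<Rightarrow> real) set \<Rightarrow> bool" where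
  "locally_well_posed \<alpha> \<Omega> a \<delta> V \<longleftrightarrow>
     \<delta> > 0 \<and> background_neighbourhood \<alpha> \<Omega> V \<and>
     (\<forall>\<eta>\<in>boundary_ball \<alpha> \<Omega> \<delta>.
        (\<exists>u\<in>V. solves_dirichlet \<Omega> a \<eta> u) \<and>
        (\<forall>u\<in>V. \<forall>v\<in>V. solves_dirichlet \<Omega> a \<eta> u \<longrightarrow> solves_dirichlet \<Omega> a \<eta> v \<longrightarrow>
           (\<forall>x\<in>closure \<Omega>. u x = v x))) \<and>
     (\<exists>\<epsilon>>0. \<epsilon> \<le> \<delta> \<and> C1_frechet_on \<alpha> \<Omega> (boundary_ball \<alpha> \<Omega> \<epsilon>) (dirichlet_solution \<Omega> a V)) \<and>
     (\<forall>x\<in>closure \<Omega>. dirichlet_solution \<Omega> a V background x = background x)"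

text \<open>The restriction makes the two components functions on the boundary only.\<close>

definition nonlinear_cauchy_data ::
    "real \<Rightarrow> (real^'n) set \<Rightarrow> ((real^'n) \<times> (real^'n) \<Rightarrow> real) \<Rightarrow> real \<Rightarrow> (real^'n \<Rightarrow> real) set \<Rightarrow>
     ((real^'n \<Rightarrow> real) \<times> (real^'n \<Rightarrow> real)) set" where
  "nonlinear_cauchy_data \<alpha> \<Omega> a \<delta> V =
     {(restrict \<eta> (frontier \<Omega>),
       restrict (normal_derivative \<Omega> (dirichlet_solution \<Omega> a V \<eta>)) (frontier \<Omega>)) | \<eta>.
       \<eta> \<in> boundary_ball \<alpha> \<Omega> \<delta>}"

end

theory Submission
  imports Defs
begin

text \<open>
  Differentiating the solution map at the background turns the equality of the nonlinear Cauchy data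
  into equality of the Cauchy data of the conductivity equations \<open>div (\<rho>\<^sub>j \<nabla>v) = 0\<close>: the linearization
  of \<open>det D\<^sup>2u = \<rho>\<^sub>j(x) / \<rho>\<^sub>j(\<nabla>u)\<close> at \<open>\<bar>x\<bar>\<^sup>2 / 2\<close> is \<open>\<Delta>v + \<nabla>(ln \<rho>\<^sub>j) \<cdot> \<nabla>v = 0\<close>. What remains is the
  inverse conductivity problem of Calderon in dimension at least three.

  Only first derivatives of the solutions are compared on the boundary, so no normal derivative
  of \<open>\<rho>\<^sub>j\<close> has to be determined there: with \<open>m = sqrt (\<rho>\<^sub>1 \<rho>\<^sub>2)\<close> and \<open>g = ln (\<rho>\<^sub>1 / \<rho>\<^sub>2)\<close>, an integration by
  parts gives \<open>\<integral> m \<nabla>g \<cdot> \<nabla>(u\<^sub>1 u\<^sub>2 / m) = 0\<close> for all solutions \<open>u\<^sub>j\<close> of the Schroedinger equations with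
  potential \<open>\<Delta>(sqrt \<rho>\<^sub>j) / sqrt \<rho>\<^sub>j\<close>. Products of complex geometric optics solutions approximate
  every plane wave of a lattice, and by Fourier expansion the identity holds with any
  smooth function in place of \<open>u\<^sub>1 u\<^sub>2\<close>. For \<open>m g\<close> it reads \<open>\<integral> m \<bar>\<nabla>g\<bar>\<^sup>2 = 0\<close>, and \<open>g = 0\<close> on the boundary.
  The potentials are smooth, so the geometric optics solutions can be
  constructed with absolutely convergent exponential sums instead of weighted Sobolev estimates.
\<close>

subsection \<open>Iterated partial derivatives\<close>

text \<open>No surface integral is ever formed. The linearized solutions are C^2 inside \<Omega>
  with derivatives that extend continuously to the boundary, so every integration by parts is done
  with a field that tends to 0 there, and translation invariance of Lebesgue measure does the rest.
  Hence the full gradients of two linearized solutions must agree at the boundary; beyond the normal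
  derivatives this uses that their boundary values are equal. The resulting identity contains first
  derivatives of products of solutions, so the geometric optics remainders must be small with their
  first derivatives, uniformly on \<Omega>; weighted sums of absolute values of Fourier coefficients
  control this. The obstacle is that the symbol of the conjugated Laplacian has zeros. If the real
  part of the exponent is a large multiple of an integer vector \<open>w\<close>, the products of
  \<open>w\<close> with lattice frequencies are discrete, and a shift by half a step keeps them, and
  with them the symbol, away from 0. Every lattice frequency has such a \<open>w\<close> orthogonal
  to it, and dimension three leaves a further direction in which the imaginary parts of the two
  exponents grow and cancel.\<close>

definition pd :: "'a::euclidean_space \<Rightarrow> ('a \<Rightarrow> 'b::real_normed_vector) \<Rightarrow> 'a \<Rightarrow> 'b" where
  "pd b f = (\<lambda>x. frechet_derivative f (at x) b)"

lemma pd_eqI: "(f has_derivative f') (at x) \<Longrightarrow> pd b f x = f' b"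
  unfolding pd_def by (metis frechet_derivative_at)

lemma has_derivative_pd:
  "f differentiable (at x) \<Longrightarrow> (f has_derivative (\<lambda>h. pd h f x)) (at x)"
  unfolding pd_def by (simp add: frechet_derivative_works)

text \<open>\<open>frechet_derivative\<close> is a choice among the possible derivatives. Near x the
  two functions coincide, so they have the same ones, and the values agree even where there is
  none.\<close>

lemma pd_cong_open:
  assumes "open U" "x \<in> U" "\<And>y. y \<in> U \<Longrightarrow> f y = g y"
  shows "pd b f x = pd b g x"
proof -
  have "(f has_derivative D) (at x) \<longleftrightarrow> (g has_derivative D) (at x)" for D
    using assms has_derivative_transform_within_open[of f D x UNIV U g]
      has_derivative_transform_within_open[of g D x UNIV U f] by auto
  then show ?thesis
    unfolding pd_def frechet_derivative_def by simp
qed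

lemma differentiable_cong_open:
  assumes "open U" "x \<in> U" "\<And>y. y \<in> U \<Longrightarrow> f y = g y"
  shows "f differentiable (at x) \<longleftrightarrow> g differentiable (at x)"
  using assms has_derivative_transform_within_open[of f _ x UNIV U g]
      has_derivative_transform_within_open[of g _ x UNIV U f]
  unfolding differentiable_def by metis

lemma iterated_partial_Cons: "iterated_partial (b # bs) u = pd b (iterated_partial bs u)"
  by (simp add: pd_def)

text \<open>The last entry of the list is differentiated first. Moving it onto the function leaves a
  shorter list for a new function, the shape needed by inductions over the order that let the
  function vary.\<close>

lemma iterated_partial_snoc: "iterated_partial (bs @ [b]) u = iterated_partial bs (pd b u)"
  by (induction bs) (simp_all add: pd_def)

lemma iterated_partial_cong_open:
  assumes "open U" "\<And>y. y \<in> U \<Longrightarrow> u y = v y" "x \<in> U"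
  shows "iterated_partial bs u x = iterated_partial bs v x"
  using \<open>x \<in> U\<close>
proof (induction bs arbitrary: x)
  case (Cons b bs)
  then show ?case
    unfolding iterated_partial_Cons using assms(1) by (intro pd_cong_open[of U]) auto
qed (simp add: assms)

lemma partial_dirs_0 [simp]: "partial_dirs 0 = {[]}"
  by (auto simp: partial_dirs_def)

lemma partial_dirs_Suc_snoc:
  "partial_dirs (Suc m) = (\<lambda>(bs, b). bs @ [b]) ` (partial_dirs m \<times> Basis)"
proof -
  have "bs \<in> (\<lambda>(bs, b). bs @ [b]) ` (partial_dirs m \<times> Basis)" if "bs \<in> partial_dirs (Suc m)" for bs :: "'a list"
    using that by (cases bs rule: rev_cases) (force simp: partial_dirs_def)+
  then show ?thesis by (auto simp: partial_dirs_def)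
qed

lemma partial_dirs_Suc_Cons:
  "partial_dirs (Suc m) = (\<lambda>(b, bs). b # bs) ` (Basis \<times> partial_dirs m)"
proof -
  have "bs \<in> (\<lambda>(b, bs). b # bs) ` (Basis \<times> partial_dirs m)" if "bs \<in> partial_dirs (Suc m)" for bs :: "'a list"
    using that by (cases bs) (force simp: partial_dirs_def)+
  then show ?thesis by (auto simp: partial_dirs_def)
qed

lemma finite_partial_dirs: "finite (partial_dirs m)"
  by (induction m) (auto simp: partial_dirs_Suc_Cons)

lemma partial_dirs_nonempty: "partial_dirs m \<noteq> {}"
  by (induction m) (auto simp: partial_dirs_Suc_Cons)

lemma C_k_on_0: "C_k_on 0 U u \<longleftrightarrow> continuous_on U u"
  by (simp add: C_k_on_def)

text \<open>Trades the quantifiers over lists of directions for a recursion on k; the closure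
  properties of \<open>C_k_on\<close> then follow by induction from the product and chain
  rules.\<close>

lemma C_k_on_Suc:
  fixes u :: "'a::euclidean_space \<Rightarrow> real"
  shows "C_k_on (Suc k) U u \<longleftrightarrow>
    (\<forall>x\<in>U. u differentiable (at x)) \<and> (\<forall>b\<in>Basis. C_k_on k U (pd b u))"
  (is "?L \<longleftrightarrow> ?R")
proof
  assume L: ?L
  have 1: "u differentiable (at x)" if "x \<in> U" for x
  proof -
    have "\<forall>m<Suc k. \<forall>bs\<in>partial_dirs m. \<forall>x\<in>U. iterated_partial bs u differentiable (at x)"
      using L unfolding C_k_on_def by blast
    from this[rule_format, of 0 "[]" x] that show ?thesis by simp
  qed
  moreover have "C_k_on k U (pd b u)" if b: "b \<in> Basis" for b
    unfolding C_k_on_def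
  proof (intro conjI ballI allI impI)
    fix m x and bs :: "'a list" assume *: "m < k" "bs \<in> partial_dirs m" "x \<in> U"
    then have "bs @ [b] \<in> partial_dirs (Suc m)" using b by (auto simp: partial_dirs_Suc_snoc)
    then show "iterated_partial bs (pd b u) differentiable (at x)"
      using L * unfolding C_k_on_def iterated_partial_snoc[symmetric] by (meson Suc_less_eq)
  next
    fix m and bs :: "'a list" assume *: "m \<le> k" "bs \<in> partial_dirs m"
    then have "bs @ [b] \<in> partial_dirs (Suc m)" using b by (auto simp: partial_dirs_Suc_snoc)
    then show "continuous_on U (iterated_partial bs (pd b u))"
      using L * unfolding C_k_on_def iterated_partial_snoc[symmetric] by (meson Suc_le_mono)
  qed
  ultimately show ?R by blast
next
  assume R: ?R
  have cont: "continuous_on U u"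
    using R by (auto intro!: continuous_at_imp_continuous_on differentiable_imp_continuous_within)
  show ?L
    unfolding C_k_on_def
  proof (intro conjI ballI allI impI)
    fix m x and bs :: "'a list" assume *: "m < Suc k" "bs \<in> partial_dirs m" "x \<in> U"
    show "iterated_partial bs u differentiable (at x)"
    proof (cases m)
      case 0 with * R show ?thesis by simp
    next
      case (Suc j)
      with * obtain cs b where "bs = cs @ [b]" "cs \<in> partial_dirs j" "b \<in> Basis"
        by (auto simp: partial_dirs_Suc_snoc)
      then show ?thesis using R * Suc unfolding C_k_on_def by (simp add: iterated_partial_snoc)
    qed
  next
    fix m and bs :: "'a list" assume *: "m \<le> Suc k" "bs \<in> partial_dirs m"
    show "continuous_on U (iterated_partial bs u)"
    proof (cases m)
      case 0 with * cont show ?thesis by simp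
    next
      case (Suc j)
      with * obtain cs b where "bs = cs @ [b]" "cs \<in> partial_dirs j" "b \<in> Basis"
        by (auto simp: partial_dirs_Suc_snoc)
      then show ?thesis using R * Suc unfolding C_k_on_def by (simp add: iterated_partial_snoc)
    qed
  qed
qed

lemma C_k_on_cong_open:
  assumes "open U" "\<And>x. x \<in> U \<Longrightarrow> u x = v x"
  shows "C_k_on k U u \<longleftrightarrow> C_k_on k U v"
  using assms(2)
proof (induction k arbitrary: u v)
  case 0
  then show ?case unfolding C_k_on_0 by (intro continuous_on_cong) auto
next
  case (Suc k)
  have "u differentiable (at x) \<longleftrightarrow> v differentiable (at x)" if "x \<in> U" for x
    using that assms(1) Suc.prems by (intro differentiable_cong_open) auto
  moreover have "C_k_on k U (pd b u) \<longleftrightarrow> C_k_on k U (pd b v)" for b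
    using assms(1) Suc.prems by (intro Suc.IH pd_cong_open[of U]) auto
  ultimately show ?case by (simp add: C_k_on_Suc)
qed

lemma C_k_on_mono: "C_k_on k U u \<Longrightarrow> j \<le> k \<Longrightarrow> C_k_on j U u"
  unfolding C_k_on_def by (meson le_trans less_le_trans)

lemma C_k_on_subset: "C_k_on k U u \<Longrightarrow> V \<subseteq> U \<Longrightarrow> C_k_on k V u"
  unfolding C_k_on_def by (meson continuous_on_subset subsetD)

lemma C_k_on_imp_continuous_on: "C_k_on k U u \<Longrightarrow> continuous_on U u"
  using C_k_on_mono[of k U u 0] by (simp add: C_k_on_0)

lemma C_k_on_imp_differentiable: "C_k_on k U u \<Longrightarrow> 0 < k \<Longrightarrow> x \<in> U \<Longrightarrow> u differentiable (at x)"
  using C_k_on_mono[of k U u "Suc 0"] by (auto simp: C_k_on_Suc)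

lemma C_k_on_pd: "C_k_on (Suc k) U u \<Longrightarrow> b \<in> Basis \<Longrightarrow> C_k_on k U (pd b u)"
  by (simp add: C_k_on_Suc)

lemma C_k_on_SucI:
  assumes "open U"
    and der: "\<And>x. x \<in> U \<Longrightarrow> (u has_derivative D x) (at x)"
    and "\<And>b. b \<in> Basis \<Longrightarrow> C_k_on k U (\<lambda>x. D x b)"
  shows "C_k_on (Suc k) U u"
  unfolding C_k_on_Suc
proof (intro conjI ballI)
  show "u differentiable (at x)" if "x \<in> U" for x using der[OF that] by (auto simp: differentiable_def)
  show "C_k_on k U (pd b u)" if "b \<in> Basis" for b
    using assms C_k_on_cong_open[OF assms(1), of "pd b u" "\<lambda>x. D x b"] that pd_eqI[OF der]
    by simp
qed

section \<open>Closure properties of the class C^k\<close>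

lemma C_k_on_const: "open U \<Longrightarrow> C_k_on k U (\<lambda>x. c)"
proof (induction k arbitrary: c)
  case (Suc k)
  then show ?case by (intro C_k_on_SucI[where D = "\<lambda>x h. 0"]) auto
qed (simp add: C_k_on_0)

lemma C_k_on_inner: "open U \<Longrightarrow> C_k_on k U (\<lambda>x. x \<bullet> a)"
proof (cases k)
  case (Suc j)
  assume "open U"
  then show ?thesis unfolding Suc
    by (intro C_k_on_SucI[where D = "\<lambda>x h. h \<bullet> a"] C_k_on_const)
      (auto intro!: derivative_eq_intros)
qed (auto simp add: C_k_on_0 intro!: continuous_intros)

lemma C_k_on_add:
  assumes "open U"
  shows "C_k_on k U u \<Longrightarrow> C_k_on k U v \<Longrightarrow> C_k_on k U (\<lambda>x. u x + v x)"
proof (induction k arbitrary: u v)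
  case (Suc k)
  show ?case
    using Suc.prems
    by (intro C_k_on_SucI[where D = "\<lambda>x h. pd h u x + pd h v x"] Suc.IH assms)
       (auto intro!: derivative_eq_intros has_derivative_pd simp: C_k_on_Suc)
qed (auto simp: C_k_on_0 intro!: continuous_intros)

lemma C_k_on_mult:
  assumes "open U"
  shows "C_k_on k U u \<Longrightarrow> C_k_on k U v \<Longrightarrow> C_k_on k U (\<lambda>x. u x * v x)"
proof (induction k arbitrary: u v)
  case (Suc k)
  have "C_k_on k U u" "C_k_on k U v"
    using Suc.prems C_k_on_mono by (metis le_SucI order_refl)+
  with Suc.prems show ?case
    by (intro C_k_on_SucI[where D = "\<lambda>x h. u x * pd h v x + pd h u x * v x"] Suc.IH assms C_k_on_add)
       (auto intro!: derivative_eq_intros has_derivative_pd simp: C_k_on_Suc)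
qed (auto simp: C_k_on_0 intro!: continuous_intros)

lemma C_k_on_cmult: "open U \<Longrightarrow> C_k_on k U u \<Longrightarrow> C_k_on k U (\<lambda>x. c * u x)"
  by (intro C_k_on_mult C_k_on_const)

lemma C_k_on_diff: "open U \<Longrightarrow> C_k_on k U u \<Longrightarrow> C_k_on k U v \<Longrightarrow> C_k_on k U (\<lambda>x. u x - v x)"
  using C_k_on_add[of U k u "\<lambda>x. - 1 * v x"] C_k_on_cmult[of U k v "-1"] by simp

lemma C_k_on_sum:
  assumes "open U"
  shows "(\<And>i. i \<in> I \<Longrightarrow> C_k_on k U (f i)) \<Longrightarrow> C_k_on k U (\<lambda>x. \<Sum>i\<in>I. f i x)"
  by (induction I rule: infinite_finite_induct)
    (auto intro!: C_k_on_add C_k_on_const assms)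

text \<open>The exponent varies in the induction because the derivative of the power contains the
  exponent \<open>s - 1\<close>. Square roots and reciprocals are both instances.\<close>

lemma C_k_on_powr:
  assumes "open U" "\<And>x. x \<in> U \<Longrightarrow> 0 < u x"
  shows "C_k_on k U u \<Longrightarrow> C_k_on k U (\<lambda>x. u x powr s)"
proof (induction k arbitrary: s)
  case 0
  then show ?case using assms(2) by (force simp: C_k_on_0 intro!: continuous_intros)
next
  case (Suc k)
  have 1: "C_k_on k U u"
    using Suc.prems C_k_on_mono by (metis le_SucI order_refl)
  have "((\<lambda>x. u x powr s) has_derivative (\<lambda>h. (s * u x powr (s - 1)) * pd h u x)) (at x)" if "x \<in> U" for x
  proof -
    have "(u has_derivative (\<lambda>h. pd h u x)) (at x)"
      using Suc.prems that by (intro has_derivative_pd) (auto simp: C_k_on_Suc)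
    moreover have "((\<lambda>t. t powr s) has_real_derivative s * u x powr (s - 1)) (at (u x))"
      using assms(2)[OF that] by (rule has_real_derivative_powr)
    ultimately show ?thesis
      using has_derivative_compose[of u "\<lambda>h. pd h u x" x UNIV "\<lambda>t. t powr s"]
      by (simp add: has_field_derivative_def)
  qed
  then show ?case
    using Suc 1
    by (intro C_k_on_SucI[where D = "\<lambda>x h. (s * u x powr (s - 1)) * pd h u x"] assms C_k_on_mult
         C_k_on_const) (auto simp: C_k_on_Suc)
qed

lemma C_k_on_inverse:
  assumes "open U" "\<And>x. x \<in> U \<Longrightarrow> 0 < u x" "C_k_on k U u"
  shows "C_k_on k U (\<lambda>x. inverse (u x))"
  using C_k_on_powr[OF assms, of "-1"] C_k_on_cong_open[OF assms(1), of "\<lambda>x. inverse (u x)" "\<lambda>x. u x powr -1"]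
  by (simp add: assms(2) powr_minus less_imp_le)

lemma C_k_on_divide:
  assumes "open U" "\<And>x. x \<in> U \<Longrightarrow> 0 < v x" "C_k_on k U u" "C_k_on k U v"
  shows "C_k_on k U (\<lambda>x. u x / v x)"
  using C_k_on_mult[OF assms(1,3) C_k_on_inverse[OF assms(1,2,4)]] by (simp add: divide_inverse)

lemma C_k_on_ln:
  assumes "open U" "\<And>x. x \<in> U \<Longrightarrow> 0 < u x"
  shows "C_k_on k U u \<Longrightarrow> C_k_on k U (\<lambda>x. ln (u x))"
proof (cases k)
  case 0
  assume "C_k_on k U u"
  then show ?thesis using assms 0 by (force simp: C_k_on_0 intro!: continuous_intros)
next
  case (Suc j)
  assume *: "C_k_on k U u"
  have "C_k_on j U u"
    using * Suc C_k_on_mono by (metis le_SucI order_refl)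
  then show ?thesis
    unfolding Suc using * assms Suc
    by (intro C_k_on_SucI[where D = "\<lambda>x h. inverse (u x) * pd h u x"] C_k_on_mult C_k_on_inverse)
      (force intro!: derivative_eq_intros has_derivative_pd simp: C_k_on_Suc divide_inverse)+
qed

subsection \<open>Hoelder functions\<close>

lemma partial_dirs_SucE:
  assumes "bs \<in> partial_dirs (Suc m)"
  obtains cs b where "bs = cs @ [b]" "cs \<in> partial_dirs m" "b \<in> Basis"
  using assms unfolding partial_dirs_Suc_snoc by auto

lemma iterated_partial_add:
  fixes u v :: "'a::euclidean_space \<Rightarrow> real"
  assumes "open U"
  shows "C_k_on k U u \<Longrightarrow> C_k_on k U v \<Longrightarrow> bs \<in> partial_dirs m \<Longrightarrow> m \<le> k \<Longrightarrow> x \<in> U \<Longrightarrow>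
    iterated_partial bs (\<lambda>x. u x + v x) x = iterated_partial bs u x + iterated_partial bs v x"
proof (induction m arbitrary: k u v bs x)
  case (Suc m)
  obtain j where k: "k = Suc j" using Suc.prems(4) by (cases k) auto
  obtain cs b where bs: "bs = cs @ [b]" "cs \<in> partial_dirs m" "b \<in> Basis"
    by (rule partial_dirs_SucE[OF Suc.prems(3)])
  have "pd b (\<lambda>x. u x + v x) y = pd b u y + pd b v y" if "y \<in> U" for y
    using Suc.prems that k
    by (intro pd_eqI[THEN trans]) (auto intro!: derivative_eq_intros has_derivative_pd simp: C_k_on_Suc)
  then have "iterated_partial cs (pd b (\<lambda>x. u x + v x)) x = iterated_partial cs (\<lambda>y. pd b u y + pd b v y) x"
    using assms Suc.prems by (intro iterated_partial_cong_open[of U]) auto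
  also have "\<dots> = iterated_partial cs (pd b u) x + iterated_partial cs (pd b v) x"
    using Suc.prems bs k by (intro Suc.IH[of j]) (auto simp: C_k_on_Suc)
  finally show ?case unfolding bs iterated_partial_snoc .
qed simp

lemma iterated_partial_cmult:
  fixes u :: "'a::euclidean_space \<Rightarrow> real"
  assumes "open U"
  shows "C_k_on k U u \<Longrightarrow> bs \<in> partial_dirs m \<Longrightarrow> m \<le> k \<Longrightarrow> x \<in> U \<Longrightarrow>
    iterated_partial bs (\<lambda>x. c * u x) x = c * iterated_partial bs u x"
proof (induction m arbitrary: k u bs x)
  case (Suc m)
  obtain j where k: "k = Suc j" using Suc.prems(3) by (cases k) auto
  obtain cs b where bs: "bs = cs @ [b]" "cs \<in> partial_dirs m" "b \<in> Basis"
    by (rule partial_dirs_SucE[OF Suc.prems(2)])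
  have "pd b (\<lambda>x. c * u x) y = c * pd b u y" if "y \<in> U" for y
    using Suc.prems that k
    by (intro pd_eqI[THEN trans]) (auto intro!: derivative_eq_intros has_derivative_pd simp: C_k_on_Suc)
  then have "iterated_partial cs (pd b (\<lambda>x. c * u x)) x = iterated_partial cs (\<lambda>y. c * pd b u y) x"
    using assms Suc.prems by (intro iterated_partial_cong_open[of U]) auto
  also have "\<dots> = c * iterated_partial cs (pd b u) x"
    using Suc.prems bs k by (intro Suc.IH[of j]) (auto simp: C_k_on_Suc)
  finally show ?case unfolding bs iterated_partial_snoc .
qed simp

lemma holder_on_C_k_on: "holder_on k \<alpha> U u \<Longrightarrow> C_k_on k U u"
  by (simp add: holder_on_def)

lemma holder_on_bounded:
  "holder_on k \<alpha> U u \<Longrightarrow> m \<le> k \<Longrightarrow> bs \<in> partial_dirs m \<Longrightarrow> bounded (iterated_partial bs u ` U)"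
  by (simp add: holder_on_def)

lemma holder_quotients_leI:
  assumes "\<And>x y. x \<in> U \<Longrightarrow> y \<in> U \<Longrightarrow> \<bar>f x - f y\<bar> \<le> M * dist x y powr \<alpha>"
    "q \<in> holder_quotients \<alpha> U f"
  shows "q \<le> M"
  using assms by (auto simp: holder_quotients_def divide_le_eq powr_gt_zero)

lemma bdd_above_holder_quotientsI:
  "(\<And>x y. x \<in> U \<Longrightarrow> y \<in> U \<Longrightarrow> \<bar>f x - f y\<bar> \<le> M * dist x y powr \<alpha>) \<Longrightarrow>
    bdd_above (holder_quotients \<alpha> U f)"
  using holder_quotients_leI by (intro bdd_aboveI[of _ M]) blast

lemma holder_quotients_leD:
  assumes "\<And>q. q \<in> holder_quotients \<alpha> U f \<Longrightarrow> q \<le> M" "x \<in> U" "y \<in> U"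
  shows "\<bar>f x - f y\<bar> \<le> M * dist x y powr \<alpha>"
proof (cases "x = y")
  case False
  then have "\<bar>f x - f y\<bar> / dist x y powr \<alpha> \<le> M" using assms by (force simp: holder_quotients_def)
  then show ?thesis using False by (simp add: divide_le_eq powr_gt_zero)
qed simp

lemma holder_quotients_bddD:
  assumes "bdd_above (holder_quotients \<alpha> U f)"
  obtains M where "\<And>x y. x \<in> U \<Longrightarrow> y \<in> U \<Longrightarrow> \<bar>f x - f y\<bar> \<le> M * dist x y powr \<alpha>"
  using assms holder_quotients_leD[of \<alpha> U f] unfolding bdd_above_def by metis

lemma holder_on_add:
  fixes u v :: "'a::euclidean_space \<Rightarrow> real"
  assumes U: "open U" and u: "holder_on k \<alpha> U u" and v: "holder_on k \<alpha> U v"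
  shows "holder_on k \<alpha> U (\<lambda>x. u x + v x)"
  unfolding holder_on_def
proof (intro conjI allI impI ballI)
  note C = u[THEN holder_on_C_k_on] v[THEN holder_on_C_k_on]
  show "C_k_on k U (\<lambda>x. u x + v x)" using C U by (intro C_k_on_add)
  show "continuous_on (closure U) (\<lambda>x. u x + v x)"
    using u v by (auto simp: holder_on_def intro!: continuous_intros)
  fix m and bs :: "'a list" assume *: "m \<le> k" "bs \<in> partial_dirs m"
  note eq = iterated_partial_add[OF U C *(2,1)]
  obtain M N where "\<And>x. x \<in> U \<Longrightarrow> \<bar>iterated_partial bs u x\<bar> \<le> M"
    "\<And>x. x \<in> U \<Longrightarrow> \<bar>iterated_partial bs v x\<bar> \<le> N"
    using holder_on_bounded[OF u *] holder_on_bounded[OF v *] by (auto simp: bounded_iff)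
  then show "bounded (iterated_partial bs (\<lambda>x. u x + v x) ` U)"
    unfolding bounded_iff using eq by (intro exI[of _ "M + N"]) (force)
  obtain g h where "continuous_on (closure U) g" "\<forall>x\<in>U. g x = iterated_partial bs u x"
    "continuous_on (closure U) h" "\<forall>x\<in>U. h x = iterated_partial bs v x"
    using u v * unfolding holder_on_def by meson
  then show "\<exists>g. continuous_on (closure U) g \<and> (\<forall>x\<in>U. g x = iterated_partial bs (\<lambda>x. u x + v x) x)"
    using eq by (intro exI[of _ "\<lambda>x. g x + h x"]) (auto intro!: continuous_intros)
next
  note C = u[THEN holder_on_C_k_on] v[THEN holder_on_C_k_on]
  fix bs :: "'a list" assume *: "bs \<in> partial_dirs k"
  note eq = iterated_partial_add[OF U C *(1) order_refl]
  obtain M where M: "\<And>x y. x \<in> U \<Longrightarrow> y \<in> U \<Longrightarrow> \<bar>iterated_partial bs u x - iterated_partial bs u y\<bar> \<le> M * dist x y powr \<alpha>"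
    using holder_quotients_bddD u * unfolding holder_on_def by metis
  obtain N where N: "\<And>x y. x \<in> U \<Longrightarrow> y \<in> U \<Longrightarrow> \<bar>iterated_partial bs v x - iterated_partial bs v y\<bar> \<le> N * dist x y powr \<alpha>"
    using holder_quotients_bddD v * unfolding holder_on_def by metis
  have "\<bar>iterated_partial bs (\<lambda>x. u x + v x) x - iterated_partial bs (\<lambda>x. u x + v x) y\<bar> \<le> (M + N) * dist x y powr \<alpha>"
    if "x \<in> U" "y \<in> U" for x y
    using M[OF that] N[OF that] eq that by (simp add: ring_distribs)
  then show "bdd_above (holder_quotients \<alpha> U (iterated_partial bs (\<lambda>x. u x + v x)))"
    by (rule bdd_above_holder_quotientsI)
qed

lemma holder_on_cmult:
  fixes u :: "'a::euclidean_space \<Rightarrow> real"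
  assumes U: "open U" and u: "holder_on k \<alpha> U u"
  shows "holder_on k \<alpha> U (\<lambda>x. c * u x)"
  unfolding holder_on_def
proof (intro conjI allI impI ballI)
  note C = u[THEN holder_on_C_k_on]
  show "C_k_on k U (\<lambda>x. c * u x)" using C U by (intro C_k_on_cmult)
  show "continuous_on (closure U) (\<lambda>x. c * u x)"
    using u by (auto simp: holder_on_def intro!: continuous_intros)
  fix m and bs :: "'a list" assume *: "m \<le> k" "bs \<in> partial_dirs m"
  note eq = iterated_partial_cmult[OF U C *(2,1)]
  obtain M where "\<And>x. x \<in> U \<Longrightarrow> \<bar>iterated_partial bs u x\<bar> \<le> M"
    using holder_on_bounded[OF u *] by (auto simp: bounded_iff)
  then show "bounded (iterated_partial bs (\<lambda>x. c * u x) ` U)"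
    unfolding bounded_iff using eq
    by (intro exI[of _ "\<bar>c\<bar> * M"]) (auto simp: abs_mult intro!: mult_left_mono)
  obtain g where "continuous_on (closure U) g" "\<forall>x\<in>U. g x = iterated_partial bs u x"
    using u * unfolding holder_on_def by meson
  then show "\<exists>g. continuous_on (closure U) g \<and> (\<forall>x\<in>U. g x = iterated_partial bs (\<lambda>x. c * u x) x)"
    using eq by (intro exI[of _ "\<lambda>x. c * g x"]) (auto intro!: continuous_intros)
next
  note C = u[THEN holder_on_C_k_on]
  fix bs :: "'a list" assume *: "bs \<in> partial_dirs k"
  note eq = iterated_partial_cmult[OF U C *(1) order_refl]
  obtain M where M: "\<And>x y. x \<in> U \<Longrightarrow> y \<in> U \<Longrightarrow> \<bar>iterated_partial bs u x - iterated_partial bs u y\<bar> \<le> M * dist x y powr \<alpha>"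
    using holder_quotients_bddD u * unfolding holder_on_def by metis
  have "\<bar>iterated_partial bs (\<lambda>x. c * u x) x - iterated_partial bs (\<lambda>x. c * u x) y\<bar> \<le> (\<bar>c\<bar> * M) * dist x y powr \<alpha>"
    if "x \<in> U" "y \<in> U" for x y
    using mult_left_mono[OF M[OF that], of "\<bar>c\<bar>"] eq that
    by (simp add: right_diff_distrib[symmetric] abs_mult mult.assoc)
  then show "bdd_above (holder_quotients \<alpha> U (iterated_partial bs (\<lambda>x. c * u x)))"
    by (rule bdd_above_holder_quotientsI)
qed

lemma holder_on_diff:
  fixes u v :: "'a::euclidean_space \<Rightarrow> real"
  assumes U: "open U" and u: "holder_on k \<alpha> U u" and v: "holder_on k \<alpha> U v"
  shows "holder_on k \<alpha> U (\<lambda>x. u x - v x)"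
  using holder_on_add[OF U u holder_on_cmult[OF U v, of "-1"]] by simp

lemma iterated_partial_diff:
  fixes u v :: "'a::euclidean_space \<Rightarrow> real"
  assumes "open U" "C_k_on k U u" "C_k_on k U v" "bs \<in> partial_dirs m" "m \<le> k" "x \<in> U"
  shows "iterated_partial bs (\<lambda>x. u x - v x) x = iterated_partial bs u x - iterated_partial bs v x"
  using iterated_partial_add[OF assms(1,2) C_k_on_cmult[OF assms(1,3)] assms(4-6), of "-1"]
    iterated_partial_cmult[OF assms(1,3-6), of "-1"] by simp

lemma C_k_on_iterated_partial:
  fixes u :: "'a::euclidean_space \<Rightarrow> real"
  shows "C_k_on (m + j) U u \<Longrightarrow> bs \<in> partial_dirs m \<Longrightarrow> C_k_on j U (iterated_partial bs u)"
proof (induction m arbitrary: u bs)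
  case (Suc m)
  obtain cs b where bs: "bs = cs @ [b]" "cs \<in> partial_dirs m" "b \<in> Basis"
    by (rule partial_dirs_SucE[OF Suc.prems(2)])
  then show ?case using Suc unfolding bs iterated_partial_snoc by (simp add: C_k_on_Suc)
qed simp

lemma pd_euclidean:
  assumes "f differentiable (at x)"
  shows "pd h f x = (\<Sum>b\<in>Basis. (h \<bullet> b) *\<^sub>R pd b f x)"
proof -
  interpret bounded_linear "\<lambda>h. pd h f x"
    using has_derivative_pd[OF assms] by (rule has_derivative_bounded_linear)
  have "pd h f x = pd (\<Sum>b\<in>Basis. (h \<bullet> b) *\<^sub>R b) f x" by (simp add: euclidean_representation)
  then show ?thesis by (simp add: sum scaleR)
qed

text \<open>U may be non-convex; the mean value inequality is applied on a closed ball containing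
  it, where the continuous partial derivatives are bounded by compactness.\<close>

lemma C_1_Lipschitz_on_bounded:
  fixes u :: "'a::euclidean_space \<Rightarrow> real"
  assumes "bounded U" "C_k_on 1 UNIV u"
  obtains L where "L \<ge> 0" "\<And>x y. x \<in> U \<Longrightarrow> y \<in> U \<Longrightarrow> \<bar>u x - u y\<bar> \<le> L * dist x y"
proof -
  obtain R where R: "U \<subseteq> cball 0 R" using assms(1) by (auto simp: bounded_iff subset_eq)
  have "\<exists>M. \<forall>x\<in>cball 0 R. \<bar>pd b u x\<bar> \<le> M" if "b \<in> Basis" for b
  proof -
    have "continuous_on (cball 0 R) (pd b u)"
      using C_k_on_pd[of 0 UNIV u b] assms that by (auto simp: C_k_on_0 intro: continuous_on_subset)
    then have "bounded (pd b u ` cball 0 R)" using compact_cball compact_continuous_image compact_imp_bounded by blast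
    then show ?thesis by (auto simp: bounded_iff)
  qed
  then obtain M where M: "\<And>b x. b \<in> Basis \<Longrightarrow> x \<in> cball 0 R \<Longrightarrow> \<bar>pd b u x\<bar> \<le> M b" by metis
  define L where "L = (\<Sum>b\<in>Basis. \<bar>M b\<bar>)"
  have dif: "u differentiable (at x)" for x using assms by (auto intro: C_k_on_imp_differentiable)
  have "\<bar>u x - u y\<bar> \<le> L * dist x y" if "x \<in> U" "y \<in> U" for x y
  proof -
    have "onorm (\<lambda>h. pd h u z) \<le> L" if z: "z \<in> cball 0 R" for z
    proof (rule onorm_le)
      fix h :: 'a
      have "\<bar>pd h u z\<bar> \<le> (\<Sum>b\<in>Basis. \<bar>h \<bullet> b\<bar> * \<bar>pd b u z\<bar>)"
        by (subst pd_euclidean[OF dif]) (rule order_trans[OF sum_abs], simp add: abs_mult)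
      also have "\<dots> \<le> (\<Sum>b\<in>Basis. norm h * \<bar>M b\<bar>)"
        using M z by (intro sum_mono mult_mono Basis_le_norm) force+
      finally show "norm (pd h u z) \<le> L * norm h" by (simp add: L_def sum_distrib_left mult.commute)
    qed
    then have "norm (u x - u y) \<le> L * norm (x - y)"
      using that R by (intro differentiable_bound[of "cball 0 R" u "\<lambda>z h. pd h u z"])
        (auto intro!: has_derivative_at_withinI has_derivative_pd[OF dif])
    then show ?thesis by (simp add: dist_norm)
  qed
  moreover have "L \<ge> 0" by (simp add: L_def sum_nonneg)
  ultimately show ?thesis using that by blast
qed

text \<open>One derivative more than the order makes the top derivatives Lipschitz on bounded sets,
  hence Hoelder. This supplies \<open>background\<close> and the smooth boundary values as elements
  of the Hoelder spaces.\<close>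

lemma C_k_on_imp_holder_on:
  fixes u :: "'a::euclidean_space \<Rightarrow> real"
  assumes "bounded U" "C_k_on (Suc k) UNIV u" "\<alpha> \<le> 1"
  shows "holder_on k \<alpha> U u"
  unfolding holder_on_def
proof (intro conjI allI impI ballI)
  show "C_k_on k U u" using assms by (meson C_k_on_mono C_k_on_subset le_SucI order_refl subset_UNIV)
  show "continuous_on (closure U) u"
    using assms C_k_on_imp_continuous_on continuous_on_subset by blast
  fix m and bs :: "'a list" assume *: "m \<le> k" "bs \<in> partial_dirs m"
  then have c: "continuous_on UNIV (iterated_partial bs u)"
    using assms(2) unfolding C_k_on_def by (meson le_SucI)
  then show "\<exists>g. continuous_on (closure U) g \<and> (\<forall>x\<in>U. g x = iterated_partial bs u x)"
    using continuous_on_subset by blast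
  have "compact (iterated_partial bs u ` closure U)"
    using assms c by (intro compact_continuous_image) (auto intro: continuous_on_subset)
  then show "bounded (iterated_partial bs u ` U)"
    by (meson bounded_subset closure_subset compact_imp_bounded image_mono)
next
  fix bs :: "'a list" assume *: "bs \<in> partial_dirs k"
  have "C_k_on 1 UNIV (iterated_partial bs u)"
    using assms C_k_on_iterated_partial[OF _ *, of 1 UNIV u] by simp
  then obtain L where L: "L \<ge> 0" "\<And>x y. x \<in> U \<Longrightarrow> y \<in> U \<Longrightarrow> \<bar>iterated_partial bs u x - iterated_partial bs u y\<bar> \<le> L * dist x y"
    using C_1_Lipschitz_on_bounded[OF assms(1)] by metis
  obtain D where D: "D > 0" "\<And>x y. x \<in> U \<Longrightarrow> y \<in> U \<Longrightarrow> dist x y \<le> D"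
  proof -
    obtain e where e: "\<And>x y. x \<in> U \<Longrightarrow> y \<in> U \<Longrightarrow> dist x y \<le> e"
      using assms(1) unfolding bounded_two_points by blast
    then show ?thesis by (intro that[of "\<bar>e\<bar> + 1"]) (simp, force intro: order_trans[OF e])
  qed
  have "\<bar>iterated_partial bs u x - iterated_partial bs u y\<bar> \<le> (L * D powr (1 - \<alpha>)) * dist x y powr \<alpha>"
    if "x \<in> U" "y \<in> U" for x y
  proof -
    \<comment> \<open>Only the factor with exponent \<alpha> is kept; the other is bounded through
      \<open>D\<close>, as \<open>1 - \<alpha>\<close> is nonnegative.\<close>
    have "dist x y = dist x y powr (1 - \<alpha>) * dist x y powr \<alpha>"
      by (cases "x = y") (simp_all add: powr_add[symmetric])
    also have "\<dots> \<le> D powr (1 - \<alpha>) * dist x y powr \<alpha>"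
      using D that assms(3) by (intro mult_right_mono powr_mono2) auto
    finally show ?thesis
      using L(2)[OF that] L(1) mult_left_mono by (metis mult.assoc order_trans)
  qed
  then show "bdd_above (holder_quotients \<alpha> U (iterated_partial bs u))"
    by (rule bdd_above_holder_quotientsI)
qed

section \<open>Estimates for Hoelder norms and boundary norms\<close>

lemma holder_quotients_nonempty:
  fixes U :: "'a::euclidean_space set"
  assumes "open U" "U \<noteq> {}"
  shows "holder_quotients \<alpha> U f \<noteq> {}"
proof -
  obtain x where x: "x \<in> U" using assms by auto
  then have "x islimpt U" using assms by (metis interior_limit_point interior_open)
  then obtain y where "y \<in> U" "y \<noteq> x" using assms x unfolding islimpt_def by blast
  then show ?thesis using x by (auto simp: holder_quotients_def)
qed

text \<open>The norm is a sum of maxima and suprema of reals, so a summand bounds a single value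
  only once the other summands are known to be nonnegative. This bound turns smallness in norm into
  pointwise smallness of derivatives.\<close>

lemma holder_norm_ge:
  fixes u :: "'a::euclidean_space \<Rightarrow> real"
  assumes U: "open U" and u: "holder_on k \<alpha> U u" and m: "m \<le> k" "bs \<in> partial_dirs m" "x \<in> U"
  shows "\<bar>iterated_partial bs u x\<bar> \<le> holder_norm k \<alpha> U u"
proof -
  define S where "S m = Max ((\<lambda>bs. SUP x\<in>U. \<bar>iterated_partial bs u x\<bar>) ` partial_dirs m)" for m
  have le: "\<bar>iterated_partial cs u y\<bar> \<le> S j" if "j \<le> k" "cs \<in> partial_dirs j" "y \<in> U" for cs j y
  proof -
    have "bdd_above ((\<lambda>x. \<bar>iterated_partial cs u x\<bar>) ` U)"
      using holder_on_bounded[OF u that(1,2)] by (auto simp: bounded_iff bdd_above_def)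
    then have "\<bar>iterated_partial cs u y\<bar> \<le> (SUP x\<in>U. \<bar>iterated_partial cs u x\<bar>)"
      using that(3) by (intro cSUP_upper)
    also have "\<dots> \<le> S j" unfolding S_def using that finite_partial_dirs by (intro Max_ge) auto
    finally show ?thesis .
  qed
  have S0: "0 \<le> S j" if "j \<le> k" for j
  proof -
    obtain cs :: "'a list" where cs: "cs \<in> partial_dirs j" using partial_dirs_nonempty by blast
    show ?thesis by (rule order_trans[OF abs_ge_zero le[OF that cs m(3)]])
  qed
  \<comment> \<open>The supremum of an empty set of quotients would be unspecified, so a second
    point of \<open>U\<close> is needed; openness gives one.\<close>
  have "0 \<le> Max ((\<lambda>bs. Sup (holder_quotients \<alpha> U (iterated_partial bs u))) ` partial_dirs k)"
  proof -
    obtain cs :: "'a list" where cs: "cs \<in> partial_dirs k" using partial_dirs_nonempty by blast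
    obtain q where q: "q \<in> holder_quotients \<alpha> U (iterated_partial cs u)"
      using holder_quotients_nonempty[OF U] m by blast
    have "0 \<le> q" using q by (auto simp: holder_quotients_def)
    also have "q \<le> Sup (holder_quotients \<alpha> U (iterated_partial cs u))"
      using u cs q by (auto simp: holder_on_def intro!: cSup_upper)
    also have "\<dots> \<le> Max ((\<lambda>bs. Sup (holder_quotients \<alpha> U (iterated_partial bs u))) ` partial_dirs k)"
      using cs finite_partial_dirs by (intro Max_ge) auto
    finally show ?thesis .
  qed
  moreover have "S m \<le> (\<Sum>j\<le>k. S j)" using m S0 by (intro member_le_sum) auto
  ultimately show ?thesis using le[OF m] unfolding holder_norm_def S_def by linarith
qed

text \<open>The factor counts the summands of the norm: \<open>k + 1\<close> suprema and one Hoelder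
  seminorm.\<close>

lemma holder_norm_le:
  fixes u :: "'a::euclidean_space \<Rightarrow> real"
  assumes U: "open U" "U \<noteq> {}"
    and "\<And>m bs x. m \<le> k \<Longrightarrow> bs \<in> partial_dirs m \<Longrightarrow> x \<in> U \<Longrightarrow> \<bar>iterated_partial bs u x\<bar> \<le> M"
    and "\<And>bs x y. bs \<in> partial_dirs k \<Longrightarrow> x \<in> U \<Longrightarrow> y \<in> U \<Longrightarrow>
      \<bar>iterated_partial bs u x - iterated_partial bs u y\<bar> \<le> M * dist x y powr \<alpha>"
  shows "holder_norm k \<alpha> U u \<le> (real k + 2) * M"
proof -
  have "(\<Sum>m\<le>k. Max ((\<lambda>bs. SUP x\<in>U. \<bar>iterated_partial bs u x\<bar>) ` partial_dirs m)) \<le> (\<Sum>m\<le>k. M)"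
    using assms by (intro sum_mono) (simp add: Max_le_iff finite_partial_dirs partial_dirs_nonempty cSUP_least)
  moreover have "Max ((\<lambda>bs. Sup (holder_quotients \<alpha> U (iterated_partial bs u))) ` partial_dirs k) \<le> M"
    using holder_quotients_leI[OF assms(4)]
    by (simp add: Max_le_iff finite_partial_dirs partial_dirs_nonempty)
      (metis cSup_least holder_quotients_nonempty U)
  ultimately show ?thesis unfolding holder_norm_def by (simp add: algebra_simps)
qed

lemma holder_norm_nonneg:
  fixes u :: "'a::euclidean_space \<Rightarrow> real"
  assumes "open U" "U \<noteq> {}" "holder_on k \<alpha> U u"
  shows "0 \<le> holder_norm k \<alpha> U u"
proof -
  obtain x where "x \<in> U" using assms by blast
  from holder_norm_ge[OF assms(1,3) le0 _ this, of "[]"] show ?thesis by simp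
qed

lemma boundary_holder_norm_le:
  assumes "open U" "U \<noteq> {}" "holder_on k \<alpha> U F" "\<And>x. x \<in> frontier U \<Longrightarrow> F x = \<eta> x"
  shows "boundary_holder_norm k \<alpha> U \<eta> \<le> holder_norm k \<alpha> U F"
  unfolding boundary_holder_norm_def
  using assms by (intro cINF_lower) (auto simp: bdd_below_def intro!: exI[of _ 0] holder_norm_nonneg)

text \<open>The boundary norm is an infimum over extensions, so the multiples of one fixed extension
  bound it from above, with a constant independent of t. Along the line through
  \<open>background\<close> in direction h the data thus stay in any given ball for small t.\<close>

lemma boundary_holder_norm_scaled:
  fixes F :: "'a::euclidean_space \<Rightarrow> real"
  assumes U: "open U" "U \<noteq> {}" and F: "holder_on k \<alpha> U F"
  obtains C where "C > 0"
    "\<And>t \<eta>. (\<And>x. x \<in> frontier U \<Longrightarrow> \<eta> x = t * F x) \<Longrightarrow> boundary_holder_norm k \<alpha> U \<eta> \<le> \<bar>t\<bar> * C"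
proof -
  have "\<exists>B. \<forall>x y. x \<in> U \<longrightarrow> y \<in> U \<longrightarrow> \<bar>iterated_partial bs F x - iterated_partial bs F y\<bar> \<le> B * dist x y powr \<alpha>"
    if "bs \<in> partial_dirs k" for bs
    using F that by (metis holder_on_def holder_quotients_bddD)
  then obtain B where B: "\<And>bs x y. bs \<in> partial_dirs k \<Longrightarrow> x \<in> U \<Longrightarrow> y \<in> U \<Longrightarrow>
      \<bar>iterated_partial bs F x - iterated_partial bs F y\<bar> \<le> B bs * dist x y powr \<alpha>" by metis
  define M where "M = holder_norm k \<alpha> U F + (\<Sum>bs\<in>partial_dirs k. \<bar>B bs\<bar>) + 1"
  have B0: "0 \<le> (\<Sum>bs\<in>partial_dirs k. \<bar>B bs\<bar>)" by (simp add: sum_nonneg)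
  have M: "M > 0" using holder_norm_nonneg[OF U F] B0 unfolding M_def by linarith
  have M1: "\<bar>iterated_partial bs F x\<bar> \<le> M" if "m \<le> k" "bs \<in> partial_dirs m" "x \<in> U" for m bs x
    using holder_norm_ge[OF U(1) F that] B0 unfolding M_def by linarith
  have M2: "\<bar>iterated_partial bs F x - iterated_partial bs F y\<bar> \<le> M * dist x y powr \<alpha>"
    if "bs \<in> partial_dirs k" "x \<in> U" "y \<in> U" for bs x y
  proof -
    have "\<bar>B bs\<bar> \<le> (\<Sum>bs\<in>partial_dirs k. \<bar>B bs\<bar>)"
      using that finite_partial_dirs by (intro member_le_sum) auto
    then have "B bs \<le> M" using holder_norm_nonneg[OF U F] unfolding M_def by linarith
    then show ?thesis using B[OF that] by (meson mult_right_mono order_trans powr_ge_zero)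
  qed
  show ?thesis
  proof
    show "0 < (real k + 2) * M" using M by simp
    fix t \<eta> assume eq: "\<And>x. x \<in> frontier U \<Longrightarrow> \<eta> x = t * F x"
    have "boundary_holder_norm k \<alpha> U \<eta> \<le> holder_norm k \<alpha> U (\<lambda>x. t * F x)"
      using eq by (intro boundary_holder_norm_le holder_on_cmult U F) auto
    also have "\<dots> \<le> (real k + 2) * (\<bar>t\<bar> * M)"
    proof (rule holder_norm_le[OF U])
      note eq = iterated_partial_cmult[OF U(1) holder_on_C_k_on[OF F]]
      show "\<bar>iterated_partial bs (\<lambda>x. t * F x) x\<bar> \<le> \<bar>t\<bar> * M" if "m \<le> k" "bs \<in> partial_dirs m" "x \<in> U" for m bs x
        using M1[OF that] eq that by (simp add: abs_mult mult_left_mono)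
      show "\<bar>iterated_partial bs (\<lambda>x. t * F x) x - iterated_partial bs (\<lambda>x. t * F x) y\<bar> \<le> \<bar>t\<bar> * M * dist x y powr \<alpha>"
        if "bs \<in> partial_dirs k" "x \<in> U" "y \<in> U" for bs x y
        using mult_left_mono[OF M2[OF that], of "\<bar>t\<bar>"] that
        by (simp add: eq[OF that(1) order_refl] right_diff_distrib[symmetric] abs_mult mult.assoc)
    qed
    finally show "boundary_holder_norm k \<alpha> U \<eta> \<le> \<bar>t\<bar> * ((real k + 2) * M)" by (simp add: ac_simps)
  qed
qed

subsection \<open>Integrals of derivatives of functions vanishing on the boundary\<close>

text \<open>Cut the interval at the first and the last zero of g. The function vanishes at both, and
  outside them the mean value theorem applies on intervals without inner zeros. Derivatives at the
  zeros, where an extension by 0 may have a kink, never enter.\<close>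

lemma Lipschitz_if_derivative_bounded_off_zeros:
  fixes g :: "real \<Rightarrow> 'b::euclidean_space"
  assumes cont: "continuous_on UNIV g"
    and der: "\<And>t. g t \<noteq> 0 \<Longrightarrow> (g has_vector_derivative g' t) (at t)"
    and M: "\<And>t. g t \<noteq> 0 \<Longrightarrow> norm (g' t) \<le> M" and "0 \<le> M" and st: "s \<le> t"
  shows "norm (g t - g s) \<le> M * (t - s)"
proof -
  have *: "norm (g b - g a) \<le> M * (b - a)" if "a \<le> b" "\<And>x. a < x \<Longrightarrow> x < b \<Longrightarrow> g x \<noteq> 0" for a b
  proof (cases "a = b")
    case False
    then have "a < b" using that by simp
    moreover have "continuous_on {a..b} g" using cont by (rule continuous_on_subset) simp
    moreover have "(g has_derivative (\<lambda>h. h *\<^sub>R g' x)) (at x)" if "a < x" "x < b" for x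
      using der[of x] \<open>\<And>x. a < x \<Longrightarrow> x < b \<Longrightarrow> g x \<noteq> 0\<close>[OF that] by (simp add: has_vector_derivative_def)
    ultimately obtain x where x: "x \<in> {a<..<b}" "norm (g b - g a) \<le> norm ((b - a) *\<^sub>R g' x)"
      using mvt_general[of a b g "\<lambda>x h. h *\<^sub>R g' x"] by blast
    have "g x \<noteq> 0" using that(2)[of x] x(1) by simp
    then have "norm (g' x) \<le> M" by (rule M)
    then have "norm (g' x) * (b - a) \<le> M * (b - a)" using \<open>a < b\<close> by (intro mult_right_mono) auto
    moreover have "norm ((b - a) *\<^sub>R g' x) = norm (g' x) * (b - a)" using \<open>a < b\<close> by simp
    ultimately show ?thesis using x(2) by linarith
  qed simp
  define Z where "Z = {s..t} \<inter> g -` {0}"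
  show ?thesis
  proof (cases "Z = {}")
    case True
    then have "g x \<noteq> 0" if "s < x" "x < t" for x using True that by (auto simp: Z_def disjoint_iff)
    then show ?thesis using st by (intro *) auto
  next
    case False
    have "closed Z"
      unfolding Z_def by (intro continuous_on_closed_vimage[THEN iffD1, rule_format] closed_Int)
        (use cont in \<open>auto simp: continuous_on_closed_vimage\<close>)
    then have c: "compact Z" by (auto simp: Z_def compact_eq_bounded_closed intro: bounded_Int)
    obtain p where p: "p \<in> Z" "\<And>y. y \<in> Z \<Longrightarrow> p \<le> y" using compact_attains_inf[OF c False] by auto
    obtain q where q: "q \<in> Z" "\<And>y. y \<in> Z \<Longrightarrow> y \<le> q" using compact_attains_sup[OF c False] by auto
    have "g x \<noteq> 0" if "s < x" "x < p" for x using that p(2)[of x] p(1) by (auto simp: Z_def)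
    then have "norm (g p - g s) \<le> M * (p - s)" using p(1) by (intro *) (auto simp: Z_def)
    moreover have "g x \<noteq> 0" if "q < x" "x < t" for x using that q(2)[of x] q(1) by (auto simp: Z_def)
    then have "norm (g t - g q) \<le> M * (t - q)" using q(1) by (intro *) (auto simp: Z_def)
    moreover have "g p = 0" "g q = 0" using p q by (auto simp: Z_def)
    moreover have "norm (g t - g s) \<le> norm (g t) + norm (g s)" by (rule norm_triangle_ineq4)
    moreover have "M * (p - s) + M * (t - q) \<le> M * (t - s)"
      using p(2)[OF q(1)] \<open>0 \<le> M\<close> by (simp add: distrib_left[symmetric] mult_left_mono)
    ultimately show ?thesis by simp
  qed
qed

lemma continuous_on_extend_by_zero:
  fixes f :: "'a::euclidean_space \<Rightarrow> 'b::real_normed_vector"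
  assumes "open \<Omega>" "continuous_on \<Omega> f" "\<And>x. x \<in> frontier \<Omega> \<Longrightarrow> (f \<longlongrightarrow> 0) (at x within \<Omega>)"
  shows "continuous_on UNIV (\<lambda>x. if x \<in> \<Omega> then f x else 0)" (is "continuous_on UNIV ?F")
proof -
  have "isCont ?F x" for x
  proof -
    consider "x \<in> \<Omega>" | "x \<in> - closure \<Omega>" | "x \<in> frontier \<Omega>"
      using assms(1) by (auto simp: frontier_def interior_open)
    then show ?thesis
    proof cases
      case 1
      have "isCont f x" using 1 assms by (simp add: continuous_on_eq_continuous_at)
      moreover have "\<forall>\<^sub>F y in nhds x. f y = ?F y"
        using eventually_nhds_in_open[OF assms(1) 1] by (rule eventually_mono) simp
      ultimately show ?thesis using isCont_cong[of f ?F x] by simp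
    next
      case 2
      have "\<forall>\<^sub>F y in nhds x. 0 = ?F y"
        using 2 open_Compl[OF closed_closure, of \<Omega>] closure_subset unfolding eventually_nhds by fastforce
      then show ?thesis using isCont_cong[of "\<lambda>_. 0" ?F x] by simp
    next
      case 3
      then have "x \<notin> \<Omega>" using assms(1) by (simp add: frontier_def interior_open)
      have "(?F \<longlongrightarrow> 0) (at x within \<Omega>)"
        using assms(3)[OF 3] by (rule Lim_transform_eventually) (simp add: eventually_at_filter)
      moreover have "(?F \<longlongrightarrow> 0) (at x within - \<Omega>)"
        by (rule Lim_transform_eventually[OF tendsto_const]) (simp add: eventually_at_filter)
      ultimately have "(?F \<longlongrightarrow> 0) (at x within (\<Omega> \<union> - \<Omega>))" by (rule Lim_Un)
      then show ?thesis using \<open>x \<notin> \<Omega>\<close> by (simp add: isCont_def)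
    qed
  qed
  then show ?thesis by (simp add: continuous_at_imp_continuous_on)
qed

lemma lborel_integral_translate:
  fixes F :: "'a::euclidean_space \<Rightarrow> 'b::{banach, second_countable_topology}"
  assumes "F \<in> borel_measurable borel"
  shows "(\<integral>x. F (c + x) \<partial>lborel) = (\<integral>x. F x \<partial>lborel)"
  using integral_distr[of "(+) c" lborel borel F] assms by (simp add: lborel_distr_plus)

lemma lborel_integrable_translate:
  fixes F :: "'a::euclidean_space \<Rightarrow> 'b::{banach, second_countable_topology}"
  assumes "F \<in> borel_measurable borel" "integrable lborel F"
  shows "integrable lborel (\<lambda>x. F (c + x))"
  using integrable_distr_eq[of "(+) c" lborel borel F] assms by (simp add: lborel_distr_plus)

lemma set_integrable_continuous_bounded:
  fixes f :: "'a::euclidean_space \<Rightarrow> 'b::euclidean_space"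
  assumes "open \<Omega>" "bounded \<Omega>" "continuous_on \<Omega> f" "bounded (f ` \<Omega>)"
  shows "set_integrable lborel \<Omega> f"
proof -
  obtain B where B: "\<And>x. x \<in> \<Omega> \<Longrightarrow> norm (f x) \<le> B" using assms(4) by (auto simp: bounded_iff)
  have m: "(\<lambda>x. indicator \<Omega> x *\<^sub>R f x) \<in> borel_measurable lborel"
    using borel_measurable_continuous_on_indicator[of \<Omega> f] assms by simp
  have "emeasure lborel \<Omega> < \<infinity>" using assms(2) by (rule emeasure_bounded_finite)
  then have "integrable lborel (\<lambda>x. indicator \<Omega> x *\<^sub>R B)"
    using assms(1) by (intro integrable_real_indicator integrable_scaleR_left) auto
  then show ?thesis
    unfolding set_integrable_def using m
    by (rule Bochner_Integration.integrable_bound)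
      (intro AE_I2, use B order_trans[OF _ abs_ge_self] in \<open>auto simp: indicator_def\<close>)
qed

lemma has_vector_derivative_quotient_tendsto:
  assumes "(\<phi> has_vector_derivative v) (at 0)"
  shows "((\<lambda>t. (\<phi> t - \<phi> 0) /\<^sub>R t) \<longlongrightarrow> v) (at 0)"
proof -
  have "((\<lambda>h. norm (\<phi> h - \<phi> 0 - h *\<^sub>R v) / norm h) \<longlongrightarrow> 0) (at 0)"
    using assms unfolding has_vector_derivative_def has_derivative_at by simp
  moreover have "\<forall>\<^sub>F h in at 0. norm (\<phi> h - \<phi> 0 - h *\<^sub>R v) / norm h = norm ((\<phi> h - \<phi> 0) /\<^sub>R h - v)"
    unfolding eventually_at_filter
  proof (intro always_eventually allI impI)
    fix h :: real assume "h \<noteq> 0"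
    then have "(\<phi> h - \<phi> 0) /\<^sub>R h - v = (\<phi> h - \<phi> 0 - h *\<^sub>R v) /\<^sub>R h" by (simp add: scaleR_diff_right)
    then show "norm (\<phi> h - \<phi> 0 - h *\<^sub>R v) / norm h = norm ((\<phi> h - \<phi> 0) /\<^sub>R h - v)"
      by (simp add: divide_inverse mult.commute)
  qed
  ultimately have "((\<lambda>h. norm ((\<phi> h - \<phi> 0) /\<^sub>R h - v)) \<longlongrightarrow> 0) (at 0)"
    by (rule Lim_transform_eventually)
  then have "((\<lambda>h. (\<phi> h - \<phi> 0) /\<^sub>R h - v) \<longlongrightarrow> 0) (at 0)" by (rule tendsto_norm_zero_cancel)
  then show ?thesis by (rule LIM_zero_cancel)
qed

lemma pd_scaleR: "f differentiable (at x) \<Longrightarrow> pd (c *\<^sub>R h) f x = c *\<^sub>R pd h f x"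
  using has_derivative_pd[of f x] by (intro linear_scale) (rule has_derivative_linear)

text \<open>Stands in for the divergence theorem. Difference quotients of the extension by 0 have
  integral 0 since Lebesgue measure is translation invariant; they converge to the derivative off
  the null frontier and are bounded by the Lipschitz constant of the extension, so dominated
  convergence gives the claim.\<close>

theorem integral_pd_eq_0:
  fixes f :: "'a::euclidean_space \<Rightarrow> 'b::euclidean_space"
  assumes \<Omega>: "open \<Omega>" "bounded \<Omega>" "negligible (frontier \<Omega>)"
    and dif: "\<And>x. x \<in> \<Omega> \<Longrightarrow> f differentiable (at x)"
    and bnd: "bounded (pd b f ` \<Omega>)"
    and lim: "\<And>x. x \<in> frontier \<Omega> \<Longrightarrow> (f \<longlongrightarrow> 0) (at x within \<Omega>)"
  shows "(LINT x:\<Omega>|lborel. pd b f x) = 0"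
proof -
  define F where "F x = (if x \<in> \<Omega> then f x else 0)" for x
  have contF: "continuous_on UNIV F"
    unfolding F_def
  proof (rule continuous_on_extend_by_zero[OF \<Omega>(1) _ lim])
    show "continuous_on \<Omega> f"
      using dif by (intro continuous_at_imp_continuous_on ballI differentiable_imp_continuous_within)
  qed
  then have measF [measurable]: "F \<in> borel_measurable borel" by (rule borel_measurable_continuous_onI)
  obtain M0 where M0: "\<And>x. x \<in> \<Omega> \<Longrightarrow> norm (pd b f x) \<le> M0" using bnd by (auto simp: bounded_iff)
  define M where "M = \<bar>M0\<bar>"
  have M: "0 \<le> M" "\<And>x. x \<in> \<Omega> \<Longrightarrow> norm (pd b f x) \<le> M"
    unfolding M_def using M0 order_trans[OF _ abs_ge_self] by auto
  have derF: "(F has_derivative (\<lambda>h. pd h f x)) (at x)" if "x \<in> \<Omega>" for x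
    using has_derivative_transform_within_open[OF has_derivative_pd[OF dif[OF that]] \<Omega>(1) that, of F]
    by (simp add: F_def)
  have Lip: "norm (F (x + t *\<^sub>R b) - F x) \<le> M * t" if "0 \<le> t" for x t
  proof -
    have "norm ((\<lambda>t. F (x + t *\<^sub>R b)) t - (\<lambda>t. F (x + t *\<^sub>R b)) 0) \<le> M * (t - 0)"
    proof (rule Lipschitz_if_derivative_bounded_off_zeros[where g' = "\<lambda>t. pd b f (x + t *\<^sub>R b)"])
      show "continuous_on UNIV (\<lambda>t. F (x + t *\<^sub>R b))"
        by (intro continuous_on_compose2[OF contF]) (auto intro!: continuous_intros)
      fix t assume nz: "F (x + t *\<^sub>R b) \<noteq> 0"
      then have in\<Omega>: "x + t *\<^sub>R b \<in> \<Omega>" by (auto simp: F_def split: if_splits)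
      then show "norm (pd b f (x + t *\<^sub>R b)) \<le> M" by (rule M)
      have "((\<lambda>t. F (x + t *\<^sub>R b)) has_derivative (\<lambda>h. pd (h *\<^sub>R b) f (x + t *\<^sub>R b))) (at t)"
        by (rule has_derivative_compose[of "\<lambda>t. x + t *\<^sub>R b" "\<lambda>h. h *\<^sub>R b" t UNIV F])
          (auto intro!: derivative_eq_intros derF in\<Omega>)
      moreover have "pd (h *\<^sub>R b) f (x + t *\<^sub>R b) = h *\<^sub>R pd b f (x + t *\<^sub>R b)" for h
        by (rule pd_scaleR[OF dif[OF in\<Omega>]])
      ultimately show "((\<lambda>t. F (x + t *\<^sub>R b)) has_vector_derivative pd b f (x + t *\<^sub>R b)) (at t)"
        by (simp add: has_vector_derivative_def)
    qed (use M that in auto)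
    then show ?thesis by simp
  qed
  obtain R where R: "\<Omega> \<subseteq> cball 0 R" using \<Omega>(2) by (auto simp: bounded_iff subset_eq)
  have "compact (F ` cball 0 R)" using contF by (intro compact_continuous_image) (auto intro: continuous_on_subset)
  then have "bounded (F ` \<Omega>)" using R by (meson bounded_subset compact_imp_bounded image_mono)
  then have "set_integrable lborel \<Omega> F"
    using \<Omega> contF by (intro set_integrable_continuous_bounded) (auto intro: continuous_on_subset)
  moreover have "(\<lambda>x. indicator \<Omega> x *\<^sub>R F x) = F" by (auto simp: F_def indicator_def)
  ultimately have intF: "integrable lborel F" by (simp add: set_integrable_def)
  define s where "s n x = real (Suc n) *\<^sub>R (F (inverse (real (Suc n)) *\<^sub>R b + x) - F x)" for n x
  have s0: "integral\<^sup>L lborel (s n) = 0" for n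
    unfolding s_def using intF lborel_integrable_translate[OF measF intF] lborel_integral_translate[OF measF]
    by simp
  \<comment> \<open>The shifts have length at most \<open>norm b\<close>, so all quotients are
    supported in this ball.\<close>
  define w where "w x = indicator (cball 0 (R + norm b)) x *\<^sub>R M" for x :: 'a
  have "(\<lambda>n. integral\<^sup>L lborel (s n)) \<longlonglongrightarrow> integral\<^sup>L lborel (\<lambda>x. indicator \<Omega> x *\<^sub>R pd b f x)"
  proof (rule integral_dominated_convergence[where w = w])
    have conv: "(\<lambda>n. s n x) \<longlonglongrightarrow> indicator \<Omega> x *\<^sub>R pd b f x" if "x \<notin> frontier \<Omega>" for x
    proof (cases "x \<in> \<Omega>")
      case True
      have "((\<lambda>t. F (x + t *\<^sub>R b)) has_vector_derivative pd b f x) (at 0)"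
      proof -
        have "((\<lambda>t. F (x + t *\<^sub>R b)) has_derivative (\<lambda>h. pd (h *\<^sub>R b) f x)) (at 0)"
          by (rule has_derivative_compose[of "\<lambda>t. x + t *\<^sub>R b" "\<lambda>h. h *\<^sub>R b" 0 UNIV F])
            (auto intro!: derivative_eq_intros derF True)
        moreover have "pd (h *\<^sub>R b) f x = h *\<^sub>R pd b f x" for h
          by (rule pd_scaleR[OF dif[OF True]])
        ultimately show ?thesis by (simp add: has_vector_derivative_def)
      qed
      then have "((\<lambda>t. (F (x + t *\<^sub>R b) - F x) /\<^sub>R t) \<longlongrightarrow> pd b f x) (at 0)"
        using has_vector_derivative_quotient_tendsto[of "\<lambda>t. F (x + t *\<^sub>R b)"] by simp
      moreover have "filterlim (\<lambda>n. inverse (real (Suc n))) (at 0) sequentially"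
        using LIMSEQ_inverse_real_of_nat by (auto simp: filterlim_at)
      ultimately have "(\<lambda>n. (F (x + inverse (real (Suc n)) *\<^sub>R b) - F x) /\<^sub>R inverse (real (Suc n))) \<longlonglongrightarrow> pd b f x"
        by (rule filterlim_compose)
      then show ?thesis using True by (simp add: s_def add.commute)
    next
      case False
      then have x: "x \<in> - closure \<Omega>" using that \<Omega>(1) by (auto simp: frontier_def interior_open)
      have "(\<lambda>n. inverse (real (Suc n)) *\<^sub>R b + x) \<longlonglongrightarrow> 0 *\<^sub>R b + x"
        by (intro tendsto_intros LIMSEQ_inverse_real_of_nat)
      then have "\<forall>\<^sub>F n in sequentially. inverse (real (Suc n)) *\<^sub>R b + x \<in> - closure \<Omega>"
        using x by (intro topological_tendstoD) auto
      then have "\<forall>\<^sub>F n in sequentially. 0 = s n x"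
        by eventually_elim (use x closure_subset in \<open>force simp: s_def F_def\<close>)
      then show ?thesis using False by (auto intro: Lim_transform_eventually[OF tendsto_const])
    qed
    have null: "frontier \<Omega> \<in> null_sets lborel"
      using \<Omega>(3) by (simp add: negligible_iff_null_sets null_sets_completion_iff2 null_sets_def)
    have ae: "AE x in lborel. x \<notin> frontier \<Omega>" using AE_not_in[OF null] .
    then show "AE x in lborel. (\<lambda>n. s n x) \<longlonglongrightarrow> indicator \<Omega> x *\<^sub>R pd b f x"
      by eventually_elim (rule conv)
    show "s n \<in> borel_measurable lborel" for n unfolding s_def by measurable
    have [measurable]: "\<Omega> \<in> sets borel" using \<Omega>(1) by simp
    \<comment> \<open>\<open>pd b f\<close> is not known to be continuous; it is measurable as a
      pointwise limit of the measurable \<open>s n\<close>.\<close>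
    define G where "G x = (if x \<in> \<Omega> then lim (\<lambda>n. s n x) else 0)" for x
    have "G \<in> borel_measurable lborel"
      unfolding G_def s_def by measurable
    moreover have "G x = indicator \<Omega> x *\<^sub>R pd b f x" for x
      using conv[of x] \<Omega>(1) by (cases "x \<in> \<Omega>") (auto simp: G_def frontier_def interior_open intro!: limI)
    ultimately show "(\<lambda>x. indicator \<Omega> x *\<^sub>R pd b f x) \<in> borel_measurable lborel"
      by (simp cong: measurable_cong)
    show "integrable lborel w"
      unfolding w_def by (intro integrable_scaleR_left integrable_real_indicator emeasure_bounded_finite) auto
    show "AE x in lborel. norm (s n x) \<le> w x" for n
    proof (rule AE_I2)
      fix x
      have a: "norm (s n x) \<le> M"
      proof -
        have "norm (s n x) = real (Suc n) * norm (F (x + inverse (real (Suc n)) *\<^sub>R b) - F x)"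
          by (simp only: s_def norm_scaleR abs_of_nat add.commute)
        also have "\<dots> \<le> real (Suc n) * (M * inverse (real (Suc n)))"
          by (intro mult_left_mono Lip) auto
        also have "\<dots> = M" by simp
        finally show ?thesis .
      qed
      have "s n x = 0" if "norm x > R + norm b"
      proof -
        have "norm (inverse (real (Suc n)) *\<^sub>R b) \<le> norm b"
          by (simp add: mult_left_le_one_le inverse_le_1_iff)
        moreover have "norm x \<le> norm (inverse (real (Suc n)) *\<^sub>R b + x) + norm (inverse (real (Suc n)) *\<^sub>R b)"
          using norm_triangle_ineq4[of "inverse (real (Suc n)) *\<^sub>R b + x" "inverse (real (Suc n)) *\<^sub>R b"] by simp
        ultimately have "norm (inverse (real (Suc n)) *\<^sub>R b + x) > R" using that by linarith
        moreover have "norm x > R" using that norm_ge_zero[of b] by linarith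
        ultimately have "inverse (real (Suc n)) *\<^sub>R b + x \<notin> \<Omega>" "x \<notin> \<Omega>" using R by force+
        then show ?thesis by (simp add: s_def F_def)
      qed
      then show "norm (s n x) \<le> w x" using a by (auto simp: w_def indicator_def not_le)
    qed
  qed
  then show ?thesis by (simp add: s0 LIMSEQ_const_iff set_lebesgue_integral_def)
qed

subsection \<open>Boundary graphs\<close>

text \<open>A single chart of the boundary, with \<Omega> above the graph in direction e. C^1 is
  what is kept of its regularity: it suffices for the normal and for limits of tangent
  vectors.\<close>

locale boundary_graph =
  fixes \<Omega> :: "'a::euclidean_space set" and z :: 'a and r :: real and e :: 'a and \<gamma> :: "'a \<Rightarrow> real"
  assumes open_\<Omega>: "open \<Omega>" and z: "z \<in> frontier \<Omega>" and r: "0 < r" and norm_e: "norm e = 1"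
    and \<gamma>_const: "\<gamma> (x + t *\<^sub>R e) = \<gamma> x"
    and \<gamma>_C1: "C_k_on 1 (ball z r) \<gamma>"
    and graph: "\<Omega> \<inter> ball z r = {x \<in> ball z r. \<gamma> x < x \<bullet> e}"
begin

lemma inner_e_e [simp]: "e \<bullet> e = 1" using norm_e by (simp add: norm_eq_1)

lemma \<gamma>_differentiable: "x \<in> ball z r \<Longrightarrow> \<gamma> differentiable (at x)"
  using \<gamma>_C1 by (rule C_k_on_imp_differentiable) auto

lemma z_ball: "z \<in> ball z r" using r by simp

lemma in_\<Omega>: "x \<in> ball z r \<Longrightarrow> x \<in> \<Omega> \<longleftrightarrow> \<gamma> x < x \<bullet> e"
  using graph by blast

lemma height_continuous: "continuous_on (ball z r) (\<lambda>x. \<gamma> x - x \<bullet> e)"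
  using \<gamma>_C1 C_k_on_imp_continuous_on by (intro continuous_intros) blast

lemma above_not_closure:
  assumes "x \<in> ball z r" "x \<bullet> e < \<gamma> x"
  shows "x \<notin> closure \<Omega>"
proof -
  define W where "W = ball z r \<inter> (\<lambda>x. \<gamma> x - x \<bullet> e) -` {0<..}"
  have "open W" unfolding W_def using height_continuous by (intro continuous_open_preimage) auto
  moreover have "x \<in> W" using assms by (simp add: W_def)
  moreover have "W \<inter> \<Omega> = {}" using in_\<Omega> by (fastforce simp: W_def)
  ultimately show ?thesis using open_Int_closure_eq_empty by blast
qed

lemma frontier_iff:
  assumes "x \<in> ball z r"
  shows "x \<in> frontier \<Omega> \<longleftrightarrow> \<gamma> x = x \<bullet> e"
proof
  assume "x \<in> frontier \<Omega>"
  then have "x \<in> closure \<Omega>" "x \<notin> \<Omega>" using open_\<Omega> by (auto simp: frontier_def interior_open)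
  then show "\<gamma> x = x \<bullet> e" using above_not_closure[OF assms] in_\<Omega>[OF assms] by force
next
  assume eq: "\<gamma> x = x \<bullet> e"
  then have "x \<notin> \<Omega>" using in_\<Omega>[OF assms] by simp
  moreover have "x \<in> closure \<Omega>"
  proof -
    have lim: "((\<lambda>s. x + s *\<^sub>R e) \<longlongrightarrow> x + 0 *\<^sub>R e) (at_right 0)" by (intro tendsto_intros)
    then have "\<forall>\<^sub>F s in at_right 0. x + s *\<^sub>R e \<in> ball z r"
      using assms by (intro topological_tendstoD) auto
    moreover have "\<forall>\<^sub>F s in at_right (0::real). 0 < s" by (simp add: eventually_at_right_less)
    ultimately have "\<forall>\<^sub>F s in at_right 0. x + s *\<^sub>R e \<in> closure \<Omega>"
    proof eventually_elim
      case (elim s)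
      then have "x + s *\<^sub>R e \<in> \<Omega>" using in_\<Omega>[OF elim(1)] eq by (simp add: \<gamma>_const inner_add_left)
      then show ?case using closure_subset by blast
    qed
    then show ?thesis using lim by (intro Lim_in_closed_set[of "closure \<Omega>" _ "at_right 0"]) auto
  qed
  ultimately show "x \<in> frontier \<Omega>" using open_\<Omega> by (simp add: frontier_def interior_open)
qed

lemma z_height: "\<gamma> z = z \<bullet> e"
  using frontier_iff[OF z_ball] z by simp

text \<open>The frontier in the ball lies in the image of a piece of a hyperplane under the vertical
  projection to the graph. This map is differentiable, and such maps preserve null sets.\<close>

lemma negligible_frontier_ball: "negligible (frontier \<Omega> \<inter> ball z r)"
proof -
  define H where "H = {x. e \<bullet> x = e \<bullet> z} \<inter> ball z r"
  have "negligible {x. e \<bullet> x = e \<bullet> z}" using norm_e by (intro negligible_hyperplane) auto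
  then have "negligible H" unfolding H_def using negligible_Int by blast
  moreover have "(\<lambda>x. x + (\<gamma> x - x \<bullet> e) *\<^sub>R e) differentiable_on H"
    unfolding differentiable_on_def
  proof
    fix x assume "x \<in> H"
    then have "\<gamma> differentiable (at x)" using \<gamma>_differentiable by (simp add: H_def)
    then have "(\<lambda>x. x + (\<gamma> x - x \<bullet> e) *\<^sub>R e) differentiable (at x)"
      by (intro derivative_intros) auto
    then show "(\<lambda>x. x + (\<gamma> x - x \<bullet> e) *\<^sub>R e) differentiable (at x within H)"
      by (rule differentiable_at_withinI)
  qed
  ultimately have neg: "negligible ((\<lambda>x. x + (\<gamma> x - x \<bullet> e) *\<^sub>R e) ` H)"
    by (intro negligible_differentiable_image_negligible) auto
  have "frontier \<Omega> \<inter> ball z r \<subseteq> (\<lambda>x. x + (\<gamma> x - x \<bullet> e) *\<^sub>R e) ` H"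
  proof
    fix p assume p: "p \<in> frontier \<Omega> \<inter> ball z r"
    define q where "q = p + ((z - p) \<bullet> e) *\<^sub>R e"
    have qe: "q \<bullet> e = z \<bullet> e" by (simp add: q_def algebra_simps)
    \<comment> \<open>q is the orthogonal projection of p to the hyperplane through z, so it cannot
      leave the ball in which \<gamma> is known to be differentiable.\<close>
    have "norm (q - z) \<le> norm (p - z)"
    proof -
      define d where "d = p - z"
      have "q - z = d - (d \<bullet> e) *\<^sub>R e" by (simp add: q_def d_def algebra_simps)
      then have "(q - z) \<bullet> (q - z) = d \<bullet> d - (d \<bullet> e) * (d \<bullet> e)"
        by (simp add: inner_diff_left inner_diff_right inner_commute)
      then have "(q - z) \<bullet> (q - z) \<le> d \<bullet> d" by simp
      then show ?thesis by (simp add: norm_le d_def)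
    qed
    then have "q \<in> H" using p qe by (auto simp: H_def dist_norm norm_minus_commute inner_commute)
    moreover have "\<gamma> q = p \<bullet> e" using p frontier_iff by (auto simp: q_def \<gamma>_const)
    then have "p = q + (\<gamma> q - q \<bullet> e) *\<^sub>R e" unfolding qe by (simp add: q_def algebra_simps)
    ultimately show "p \<in> (\<lambda>x. x + (\<gamma> x - x \<bullet> e) *\<^sub>R e) ` H" by blast
  qed
  then show ?thesis using neg negligible_subset by blast
qed

section \<open>The exterior normal in terms of the graph function\<close>

definition grad :: 'a where "grad = (\<Sum>b\<in>Basis. pd b \<gamma> z *\<^sub>R b)"

lemma grad_inner: "pd h \<gamma> z = grad \<bullet> h"
  by (subst pd_euclidean[OF \<gamma>_differentiable[OF z_ball]])
    (simp add: grad_def inner_sum_left mult.commute inner_commute[of h])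

lemma \<gamma>_has_derivative: "(\<gamma> has_derivative (\<lambda>h. grad \<bullet> h)) (at z)"
  using has_derivative_pd[OF \<gamma>_differentiable[OF z_ball]] by (simp add: grad_inner)

lemma grad_e: "grad \<bullet> e = 0"
proof -
  have "((\<lambda>t. \<gamma> (z + t *\<^sub>R e)) has_derivative (\<lambda>t. grad \<bullet> (t *\<^sub>R e))) (at 0)"
    by (rule has_derivative_compose[of "\<lambda>t. z + t *\<^sub>R e" "\<lambda>t. t *\<^sub>R e" 0 UNIV \<gamma>])
      (auto intro!: derivative_eq_intros \<gamma>_has_derivative)
  moreover have "((\<lambda>t. \<gamma> (z + t *\<^sub>R e)) has_derivative (\<lambda>t. 0)) (at 0)"
    by (simp add: \<gamma>_const)
  ultimately have "(\<lambda>t::real. grad \<bullet> (t *\<^sub>R e)) = (\<lambda>t. 0)" by (rule has_derivative_unique)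
  from fun_cong[OF this, of 1] show ?thesis by simp
qed

text \<open>The difference \<open>\<gamma> (c t) - c t \<bullet> e\<close> vanishes along a boundary
  curve; its derivative at 0 is the claim.\<close>

lemma curve_normal:
  assumes c: "c 0 = z" "\<forall>\<^sub>F t in nhds 0. c t \<in> frontier \<Omega>" "(c has_vector_derivative v) (at (0::real))"
  shows "(grad - e) \<bullet> v = 0"
proof -
  have der: "((\<lambda>t. \<gamma> (c t) - c t \<bullet> e) has_derivative (\<lambda>t. grad \<bullet> (t *\<^sub>R v) - (t *\<^sub>R v) \<bullet> e)) (at 0)"
  proof -
    have cd: "(c has_derivative (\<lambda>t. t *\<^sub>R v)) (at 0)" using c(3) by (simp add: has_vector_derivative_def)
    have "((\<lambda>t. \<gamma> (c t)) has_derivative (\<lambda>t. grad \<bullet> (t *\<^sub>R v))) (at 0)"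
      by (rule has_derivative_compose[OF cd]) (simp add: c(1) \<gamma>_has_derivative)
    moreover have "((\<lambda>t. c t \<bullet> e) has_derivative (\<lambda>t. (t *\<^sub>R v) \<bullet> e)) (at 0)"
      using cd by (rule has_derivative_inner_left)
    ultimately show ?thesis by (rule has_derivative_diff)
  qed
  have "isCont c 0" using c(3) has_vector_derivative_continuous by blast
  then have "(c \<longlongrightarrow> c 0) (nhds 0)" by (simp only: isCont_def tendsto_at_iff_tendsto_nhds)
  then have "(c \<longlongrightarrow> z) (nhds 0)" using c(1) by simp
  then have "\<forall>\<^sub>F t in nhds 0. c t \<in> ball z r" using z_ball by (intro topological_tendstoD) auto
  with c(2) have "\<forall>\<^sub>F t in nhds 0. \<gamma> (c t) - c t \<bullet> e = 0"
    by eventually_elim (simp add: frontier_iff)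
  then obtain S where S: "open S" "(0::real) \<in> S" "\<And>t. t \<in> S \<Longrightarrow> \<gamma> (c t) - c t \<bullet> e = 0"
    unfolding eventually_nhds by blast
  have "((\<lambda>t. 0) has_derivative (\<lambda>t. grad \<bullet> (t *\<^sub>R v) - (t *\<^sub>R v) \<bullet> e)) (at 0)"
    by (rule has_derivative_transform_within_open[OF der S(1,2)]) (use S(3) in auto)
  then have "(\<lambda>t. grad \<bullet> (t *\<^sub>R v) - (t *\<^sub>R v) \<bullet> e) = (\<lambda>t. 0)"
    by (rule has_derivative_unique) simp
  from fun_cong[OF this, of 1] show ?thesis by (simp add: inner_diff_left inner_commute[of v e])
qed

text \<open>Sign of the first order term of \<gamma> minus the height along a ray from z. A positive
  sign leads out of the closure, which the normal needs; a negative one leads into \<Omega>, which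
  excludes the opposite vector.\<close>

lemma ray:
  assumes "(grad - e) \<bullet> v \<noteq> 0"
  shows "\<forall>\<^sub>F t in at_right 0. z + t *\<^sub>R v \<in> ball z r \<and>
    (0 < (grad - e) \<bullet> v \<longrightarrow> (z + t *\<^sub>R v) \<bullet> e < \<gamma> (z + t *\<^sub>R v)) \<and>
    ((grad - e) \<bullet> v < 0 \<longrightarrow> \<gamma> (z + t *\<^sub>R v) < (z + t *\<^sub>R v) \<bullet> e)"
proof -
  have "((\<lambda>t. z + t *\<^sub>R v) \<longlongrightarrow> z + 0 *\<^sub>R v) (at_right 0)" by (intro tendsto_intros)
  then have ball: "\<forall>\<^sub>F t in at_right 0. z + t *\<^sub>R v \<in> ball z r"
    using z_ball by (intro topological_tendstoD) auto
  define \<phi> where "\<phi> t = \<gamma> (z + t *\<^sub>R v) - (z + t *\<^sub>R v) \<bullet> e" for t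
  have "((\<lambda>t. \<gamma> (z + t *\<^sub>R v)) has_derivative (\<lambda>t. grad \<bullet> (t *\<^sub>R v))) (at 0)"
    by (rule has_derivative_compose[of "\<lambda>t. z + t *\<^sub>R v" "\<lambda>t. t *\<^sub>R v" 0 UNIV \<gamma>])
      (auto intro!: derivative_eq_intros \<gamma>_has_derivative)
  moreover have "((\<lambda>t. (z + t *\<^sub>R v) \<bullet> e) has_derivative (\<lambda>t. (t *\<^sub>R v) \<bullet> e)) (at 0)"
    by (auto intro!: derivative_eq_intros)
  ultimately have "(\<phi> has_derivative (\<lambda>t. grad \<bullet> (t *\<^sub>R v) - (t *\<^sub>R v) \<bullet> e)) (at 0)"
    unfolding \<phi>_def by (rule has_derivative_diff)
  moreover have "(\<lambda>t. grad \<bullet> (t *\<^sub>R v) - (t *\<^sub>R v) \<bullet> e) = (*) ((grad - e) \<bullet> v)"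
    by (auto simp: algebra_simps inner_commute)
  ultimately have der: "(\<phi> has_real_derivative (grad - e) \<bullet> v) (at 0)" by (simp add: has_field_derivative_def)
  have \<phi>0: "\<phi> 0 = 0" by (simp add: \<phi>_def z_height)
  have pos: "\<forall>\<^sub>F t in at_right 0. 0 < (grad - e) \<bullet> v \<longrightarrow> 0 < \<phi> t"
  proof (cases "0 < (grad - e) \<bullet> v")
    case True
    then obtain d where "d > 0" "\<And>h. 0 < h \<Longrightarrow> h < d \<Longrightarrow> 0 < \<phi> h"
      using has_real_derivative_pos_inc_right[OF der] \<phi>0 by auto
    then show ?thesis unfolding eventually_at_right_field by (intro exI[of _ d]) auto
  qed simp
  have neg: "\<forall>\<^sub>F t in at_right 0. (grad - e) \<bullet> v < 0 \<longrightarrow> \<phi> t < 0"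
  proof (cases "(grad - e) \<bullet> v < 0")
    case True
    then obtain d where "d > 0" "\<And>h. 0 < h \<Longrightarrow> h < d \<Longrightarrow> \<phi> h < 0"
      using has_real_derivative_neg_dec_right[OF der] \<phi>0 by auto
    then show ?thesis unfolding eventually_at_right_field by (intro exI[of _ d]) auto
  qed simp
  from ball pos neg show ?thesis by eventually_elim (auto simp: \<phi>_def)
qed

text \<open>For \<tau> orthogonal to e this is the boundary curve over the line
  \<open>z + t *\<^sub>R \<tau>\<close>. As \<gamma> is constant along e, adding
  \<open>s *\<^sub>R e\<close> with \<open>s > 0\<close> moves it to height s above the graph, hence
  into \<Omega>.\<close>

definition lift :: "'a \<Rightarrow> real \<Rightarrow> 'a" where
  "lift \<tau> t = z + t *\<^sub>R \<tau> + (\<gamma> (z + t *\<^sub>R \<tau>) - z \<bullet> e) *\<^sub>R e"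

lemma lift_0: "lift \<tau> 0 = z"
  by (simp add: lift_def z_height)

lemma lift_has_derivative:
  assumes "z + t *\<^sub>R \<tau> \<in> ball z r"
  shows "(lift \<tau> has_vector_derivative (\<tau> + pd \<tau> \<gamma> (z + t *\<^sub>R \<tau>) *\<^sub>R e)) (at t)"
proof -
  note dif = \<gamma>_differentiable[OF assms]
  have "((\<lambda>t. \<gamma> (z + t *\<^sub>R \<tau>)) has_derivative (\<lambda>h. pd (h *\<^sub>R \<tau>) \<gamma> (z + t *\<^sub>R \<tau>))) (at t)"
    by (rule has_derivative_compose[of "\<lambda>t. z + t *\<^sub>R \<tau>" "\<lambda>h. h *\<^sub>R \<tau>" t UNIV \<gamma>])
      (auto intro!: derivative_eq_intros has_derivative_pd[OF dif])
  then have "((\<lambda>t. \<gamma> (z + t *\<^sub>R \<tau>)) has_vector_derivative pd \<tau> \<gamma> (z + t *\<^sub>R \<tau>)) (at t)"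
    by (simp add: pd_scaleR[OF dif] has_vector_derivative_def)
  then show ?thesis unfolding lift_def
    by (auto intro!: derivative_eq_intros simp: has_vector_derivative_def algebra_simps)
qed

lemma lift_height:
  assumes "\<tau> \<bullet> e = 0"
  shows "\<gamma> (lift \<tau> t + s *\<^sub>R e) = \<gamma> (z + t *\<^sub>R \<tau>)" "(lift \<tau> t + s *\<^sub>R e) \<bullet> e = \<gamma> (z + t *\<^sub>R \<tau>) + s"
  using assms unfolding lift_def by (simp_all add: \<gamma>_const inner_add_left)

lemma lift_in_frontier:
  assumes "\<tau> \<bullet> e = 0" "lift \<tau> t \<in> ball z r"
  shows "lift \<tau> t \<in> frontier \<Omega>"
  using lift_height[OF assms(1), of t 0] frontier_iff[OF assms(2)] by simp

lemma lift_in_\<Omega>: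
  assumes "\<tau> \<bullet> e = 0" "lift \<tau> t + s *\<^sub>R e \<in> ball z r" "0 < s"
  shows "lift \<tau> t + s *\<^sub>R e \<in> \<Omega>"
  using lift_height[OF assms(1), of t s] in_\<Omega>[OF assms(2)] assms(3) by simp

lemma isCont_lift: "isCont (lift \<tau>) 0"
  using lift_has_derivative[of 0 \<tau>] r has_vector_derivative_continuous by force

lemma eventually_lift_ball:
  shows "\<exists>d>0. \<forall>t. \<bar>t\<bar> < d \<longrightarrow> z + t *\<^sub>R \<tau> \<in> ball z r \<and> (\<forall>s. \<bar>s\<bar> < d \<longrightarrow> lift \<tau> t + s *\<^sub>R e \<in> ball z r)"
proof -
  have "(lift \<tau> \<longlongrightarrow> lift \<tau> 0) (nhds 0)"
    using isCont_lift[of \<tau>] by (simp only: isCont_def tendsto_at_iff_tendsto_nhds)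
  then have "(lift \<tau> \<longlongrightarrow> z) (nhds 0)" by (simp add: lift_0)
  then have "\<forall>\<^sub>F t in nhds 0. lift \<tau> t \<in> ball z (r/2)" using r by (intro topological_tendstoD) auto
  then obtain d1 where d1: "d1 > 0" "\<And>t. \<bar>t\<bar> < d1 \<Longrightarrow> dist z (lift \<tau> t) < r/2"
    unfolding eventually_nhds_metric by auto
  have "((\<lambda>t. z + t *\<^sub>R \<tau>) \<longlongrightarrow> z + 0 *\<^sub>R \<tau>) (nhds 0)" by (intro tendsto_intros filterlim_ident)
  then have "\<forall>\<^sub>F t in nhds 0. z + t *\<^sub>R \<tau> \<in> ball z r" using r by (intro topological_tendstoD) auto
  then obtain d2 where d2: "d2 > 0" "\<And>t. \<bar>t\<bar> < d2 \<Longrightarrow> z + t *\<^sub>R \<tau> \<in> ball z r"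
    unfolding eventually_nhds_metric by auto
  have "lift \<tau> t + s *\<^sub>R e \<in> ball z r" if "\<bar>t\<bar> < d1" "\<bar>s\<bar> < r/2" for t s
  proof -
    have "dist (lift \<tau> t) (lift \<tau> t + s *\<^sub>R e) < r/2" using that norm_e by (simp add: dist_norm)
    then show ?thesis using d1(2)[OF that(1)] dist_triangle[of z "lift \<tau> t + s *\<^sub>R e" "lift \<tau> t"] by simp
  qed
  then show ?thesis using d1 d2 r by (intro exI[of _ "min d1 (min d2 (r/2))"]) auto
qed

lemma exterior_normal_eq: "exterior_normal \<Omega> z = (grad - e) /\<^sub>R norm (grad - e)"
  unfolding exterior_normal_def
proof (rule the_equality)
  have "(grad - e) \<bullet> e = -1" by (simp add: inner_diff_left grad_e)
  then have nz: "grad - e \<noteq> 0" using norm_e by (auto simp: inner_diff_left)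
  let ?\<nu> = "(grad - e) /\<^sub>R norm (grad - e)"
  have pos: "0 < (grad - e) \<bullet> ?\<nu>" using nz by (simp add: power2_norm_eq_inner[symmetric])
  then have "(grad - e) \<bullet> ?\<nu> \<noteq> 0" by (rule less_imp_neq[THEN not_sym])
  from ray[OF this] have "\<forall>\<^sub>F t in at_right 0. z + t *\<^sub>R ?\<nu> \<notin> closure \<Omega>"
    by (rule eventually_mono) (use pos above_not_closure in blast)
  moreover have "norm ?\<nu> = 1" using nz by simp
  moreover have "?\<nu> \<bullet> v = 0" if "c 0 = z" "\<forall>\<^sub>F t in nhds 0. c t \<in> frontier \<Omega>"
    "(c has_vector_derivative v) (at (0::real))" for c v
    using curve_normal[OF that] by simp
  ultimately show "norm ?\<nu> = 1 \<and>
    (\<forall>c v. c (0::real) = z \<and> (\<forall>\<^sub>F t in nhds 0. c t \<in> frontier \<Omega>) \<and> (c has_vector_derivative v) (at 0) \<longrightarrow> ?\<nu> \<bullet> v = 0) \<and>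
    (\<forall>\<^sub>F t in at_right 0. z + t *\<^sub>R ?\<nu> \<notin> closure \<Omega>)" by blast
  fix \<nu>
  assume *: "norm \<nu> = 1 \<and>
    (\<forall>c v. c (0::real) = z \<and> (\<forall>\<^sub>F t in nhds 0. c t \<in> frontier \<Omega>) \<and> (c has_vector_derivative v) (at 0) \<longrightarrow> \<nu> \<bullet> v = 0) \<and>
    (\<forall>\<^sub>F t in at_right 0. z + t *\<^sub>R \<nu> \<notin> closure \<Omega>)"
  have tan: "\<nu> \<bullet> (\<tau> + (grad \<bullet> \<tau>) *\<^sub>R e) = 0" if \<tau>: "\<tau> \<bullet> e = 0" for \<tau>
  proof -
    obtain d where d: "d > 0" "\<And>t. \<bar>t\<bar> < d \<Longrightarrow> \<forall>s. \<bar>s\<bar> < d \<longrightarrow> lift \<tau> t + s *\<^sub>R e \<in> ball z r"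
      using eventually_lift_ball by metis
    have "lift \<tau> t \<in> frontier \<Omega>" if "\<bar>t\<bar> < d" for t
      using d(2)[OF that, rule_format, of 0] d(1) lift_in_frontier[OF \<tau>] by simp
    then have "\<forall>\<^sub>F t in nhds 0. lift \<tau> t \<in> frontier \<Omega>"
      unfolding eventually_nhds_metric using d(1) by (intro exI[of _ d]) auto
    moreover have "(lift \<tau> has_vector_derivative (\<tau> + (grad \<bullet> \<tau>) *\<^sub>R e)) (at 0)"
      using lift_has_derivative[of 0 \<tau>] r by (simp add: grad_inner)
    ultimately show ?thesis using * lift_0 by blast
  qed
  define a where "a = \<nu> \<bullet> e"
  \<comment> \<open>The part of \<nu> that is not a multiple of \<open>grad - e\<close>. Testing the
    orthogonality of \<nu> with the curve in direction \<tau> itself makes the terms with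
    \<open>grad\<close> cancel and leaves \<open>\<tau> \<bullet> \<tau> = 0\<close>.\<close>
  define \<tau> where "\<tau> = \<nu> - a *\<^sub>R e + a *\<^sub>R grad"
  have "\<tau> \<bullet> e = 0" by (simp add: \<tau>_def a_def inner_diff_left inner_add_left grad_e)
  then have "\<tau> \<bullet> \<tau> = 0"
    using tan[of \<tau>] by (simp add: \<tau>_def a_def algebra_simps inner_commute grad_e)
  then have "\<tau> = 0" by simp
  then have \<nu>: "\<nu> = - a *\<^sub>R (grad - e)" by (simp add: \<tau>_def algebra_simps eq_neg_iff_add_eq_0)
  then have "\<bar>a\<bar> * norm (grad - e) = 1" using * by (metis abs_minus norm_scaleR)
  then have aN: "\<bar>a\<bar> = inverse (norm (grad - e))" by (metis inverse_unique mult.commute)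
  \<comment> \<open>Orthogonality and length leave two opposite vectors; the one with positive a
    points into \<Omega>.\<close>
  have "\<not> 0 < a"
  proof
    assume "0 < a"
    then have neg: "(grad - e) \<bullet> \<nu> < 0" using nz by (simp add: \<nu>)
    then have "(grad - e) \<bullet> \<nu> \<noteq> 0" by simp
    from ray[OF this] have "\<forall>\<^sub>F t in at_right 0. z + t *\<^sub>R \<nu> \<in> \<Omega>"
      by (rule eventually_mono) (use neg in_\<Omega> in blast)
    moreover have "\<forall>\<^sub>F t in at_right 0. z + t *\<^sub>R \<nu> \<notin> closure \<Omega>" using * by blast
    ultimately have "\<forall>\<^sub>F t in at_right (0::real). False"
      by eventually_elim (use closure_subset in blast)
    then show False by simp
  qed
  then have "- a = inverse (norm (grad - e))" using aN by simp
  then show "\<nu> = ?\<nu>" using \<nu> by simp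
qed

text \<open>The gradient of w exists inside \<Omega> and has only a limit at z, so w cannot be
  differentiated along boundary curves. The curve is shifted into \<Omega> by so little that w is
  still tiny at both ends, and the mean value theorem gives interior points, tending to z, where the
  derivative along the curve tends to 0.\<close>

lemma tangential_gradient_zero:
  fixes w :: "'a \<Rightarrow> real"
  assumes cont: "continuous_on (closure \<Omega>) w" and w0: "\<And>x. x \<in> frontier \<Omega> \<Longrightarrow> w x = 0"
    and dif: "\<And>x. x \<in> \<Omega> \<Longrightarrow> w differentiable (at x)"
    and G: "\<And>b. b \<in> Basis \<Longrightarrow> (pd b w \<longlongrightarrow> G \<bullet> b) (at z within \<Omega>)"
    and \<tau>: "\<tau> \<bullet> e = 0"
  shows "G \<bullet> (\<tau> + (grad \<bullet> \<tau>) *\<^sub>R e) = 0"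
proof -
  obtain d where d: "d > 0" "\<And>t. \<bar>t\<bar> < d \<Longrightarrow> z + t *\<^sub>R \<tau> \<in> ball z r"
    "\<And>t s. \<bar>t\<bar> < d \<Longrightarrow> \<bar>s\<bar> < d \<Longrightarrow> lift \<tau> t + s *\<^sub>R e \<in> ball z r"
    using eventually_lift_ball[of \<tau>] by blast
  have small: "\<forall>\<^sub>F s in at_right 0. \<bar>w (lift \<tau> t + s *\<^sub>R e)\<bar> < \<epsilon>" if "\<bar>t\<bar> < d" "0 < \<epsilon>" for t \<epsilon>
  proof -
    have p: "lift \<tau> t \<in> frontier \<Omega>" using d(3)[OF that(1), of 0] d(1) lift_in_frontier[OF \<tau>] by simp
    have "((\<lambda>s. w (lift \<tau> t + s *\<^sub>R e)) \<longlongrightarrow> w (lift \<tau> t)) (at_right 0)"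
    proof (rule continuous_on_tendsto_compose[OF cont])
      have "((\<lambda>s. lift \<tau> t + s *\<^sub>R e) \<longlongrightarrow> lift \<tau> t + 0 *\<^sub>R e) (at_right 0)" by (intro tendsto_intros)
      then show "((\<lambda>s. lift \<tau> t + s *\<^sub>R e) \<longlongrightarrow> lift \<tau> t) (at_right 0)" by simp
      show "lift \<tau> t \<in> closure \<Omega>" using p by (simp add: frontier_def)
      show "\<forall>\<^sub>F s in at_right 0. lift \<tau> t + s *\<^sub>R e \<in> closure \<Omega>"
        unfolding eventually_at_right_field
        using d(1) d(3)[OF that(1)] lift_in_\<Omega>[OF \<tau>, of t] closure_subset[of \<Omega>]
        by (intro exI[of _ d]) auto
    qed
    then show ?thesis using w0[OF p] that(2) by (auto dest: tendstoD[of _ 0] simp: dist_real_def)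
  qed
  define t where "t n = d * inverse (real (Suc (Suc n)))" for n
  have t: "0 < t n" "t n < d" for n using d(1) by (auto simp: t_def field_simps intro: add_pos_nonneg)
  have t_lim: "t \<longlonglongrightarrow> 0"
    unfolding t_def by (rule tendsto_mult_right_zero[OF LIMSEQ_Suc[OF LIMSEQ_inverse_real_of_nat]])
  have "\<exists>\<xi> s. 0 < \<xi> \<and> \<xi> < t n \<and> 0 < s \<and> s < t n \<and>
     \<bar>pd (\<tau> + pd \<tau> \<gamma> (z + \<xi> *\<^sub>R \<tau>) *\<^sub>R e) w (lift \<tau> \<xi> + s *\<^sub>R e)\<bar> \<le> 2 * t n" for n
  proof -
    have pos: "\<forall>\<^sub>F s in at_right (0::real). 0 < s \<and> s < t n"
      unfolding eventually_at_right_field using t by (intro exI[of _ "t n"]) auto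
    have t2: "0 < (t n)\<^sup>2" using t(1)[of n] by simp
    have "\<forall>\<^sub>F s in at_right 0. 0 < s \<and> s < t n \<and> \<bar>w (lift \<tau> (t n) + s *\<^sub>R e)\<bar> < (t n)\<^sup>2 \<and> \<bar>w (lift \<tau> 0 + s *\<^sub>R e)\<bar> < (t n)\<^sup>2"
    proof -
      have "\<bar>t n\<bar> < d" "\<bar>0\<bar> < d" using t[of n] d(1) by auto
      from small[OF this(1) t2] small[OF this(2) t2] pos show ?thesis by eventually_elim blast
    qed
    \<comment> \<open>Errors below \<open>(t n)^2\<close> at both ends, against a parameter interval
      of length \<open>t n\<close>, leave a mean slope of at most \<open>2 * t n\<close>.\<close>
    then obtain s where s: "0 < s" "s < t n" "\<bar>w (lift \<tau> (t n) + s *\<^sub>R e)\<bar> < (t n)\<^sup>2" "\<bar>w (lift \<tau> 0 + s *\<^sub>R e)\<bar> < (t n)\<^sup>2"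
      using eventually_happens'[OF trivial_limit_at_right_real] by blast
    define \<phi> where "\<phi> \<xi> = w (lift \<tau> \<xi> + s *\<^sub>R e)" for \<xi>
    define v where "v \<xi> = \<tau> + pd \<tau> \<gamma> (z + \<xi> *\<^sub>R \<tau>) *\<^sub>R e" for \<xi>
    have der: "(\<phi> has_real_derivative pd (v \<xi>) w (lift \<tau> \<xi> + s *\<^sub>R e)) (at \<xi>)" if "0 \<le> \<xi>" "\<xi> \<le> t n" for \<xi>
    proof -
      have \<xi>: "\<bar>\<xi>\<bar> < d" "\<bar>s\<bar> < d" using that t[of n] s by auto
      have in\<Omega>: "lift \<tau> \<xi> + s *\<^sub>R e \<in> \<Omega>" by (rule lift_in_\<Omega>[OF \<tau> d(3)[OF \<xi>] s(1)])
      have "((\<lambda>\<xi>. lift \<tau> \<xi> + s *\<^sub>R e) has_derivative (\<lambda>h. h *\<^sub>R v \<xi>)) (at \<xi>)"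
        using lift_has_derivative[OF d(2)[OF \<xi>(1)]] unfolding v_def
        by (auto intro!: derivative_eq_intros simp: has_vector_derivative_def)
      then have "(\<phi> has_derivative (\<lambda>h. pd (h *\<^sub>R v \<xi>) w (lift \<tau> \<xi> + s *\<^sub>R e))) (at \<xi>)"
        unfolding \<phi>_def by (rule has_derivative_compose) (rule has_derivative_pd[OF dif[OF in\<Omega>]])
      then show ?thesis
        by (simp add: pd_scaleR[OF dif[OF in\<Omega>]] has_field_derivative_def mult_commute_abs)
    qed
    then obtain \<xi> where \<xi>: "0 < \<xi>" "\<xi> < t n" "\<phi> (t n) - \<phi> 0 = (t n - 0) * pd (v \<xi>) w (lift \<tau> \<xi> + s *\<^sub>R e)"
      using MVT2[OF t(1)[of n], of \<phi> "\<lambda>\<xi>. pd (v \<xi>) w (lift \<tau> \<xi> + s *\<^sub>R e)"] by blast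
    have "t n * \<bar>pd (v \<xi>) w (lift \<tau> \<xi> + s *\<^sub>R e)\<bar> = \<bar>\<phi> (t n) - \<phi> 0\<bar>"
      using \<xi>(3) t(1)[of n] by (simp add: abs_mult)
    also have "\<dots> \<le> t n * (2 * t n)" using s(3,4) by (simp add: \<phi>_def power2_eq_square)
    finally have "\<bar>pd (v \<xi>) w (lift \<tau> \<xi> + s *\<^sub>R e)\<bar> \<le> 2 * t n"
      using t(1)[of n] by (simp only: mult_le_cancel_left_pos)
    then show ?thesis using \<xi>(1,2) s(1,2) unfolding v_def by blast
  qed
  then obtain \<xi> s where \<xi>: "\<And>n. 0 < \<xi> n" "\<And>n. \<xi> n < t n" and s: "\<And>n. 0 < s n" "\<And>n. s n < t n"
    and bound: "\<And>n. \<bar>pd (\<tau> + pd \<tau> \<gamma> (z + \<xi> n *\<^sub>R \<tau>) *\<^sub>R e) w (lift \<tau> (\<xi> n) + s n *\<^sub>R e)\<bar> \<le> 2 * t n"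
    by metis
  define v where "v n = \<tau> + pd \<tau> \<gamma> (z + \<xi> n *\<^sub>R \<tau>) *\<^sub>R e" for n
  define p where "p n = lift \<tau> (\<xi> n) + s n *\<^sub>R e" for n
  have \<xi>_lim: "\<xi> \<longlonglongrightarrow> 0"
    by (rule tendsto_sandwich[OF _ _ tendsto_const t_lim]) (auto intro!: always_eventually less_imp_le \<xi>)
  have s_lim: "s \<longlonglongrightarrow> 0"
    by (rule tendsto_sandwich[OF _ _ tendsto_const t_lim]) (auto intro!: always_eventually less_imp_le s)
  have "(\<lambda>n. lift \<tau> (\<xi> n) + s n *\<^sub>R e) \<longlonglongrightarrow> lift \<tau> 0 + 0 *\<^sub>R e"
    by (intro tendsto_intros isCont_tendsto_compose[OF isCont_lift] \<xi>_lim s_lim)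
  then have p_lim: "p \<longlonglongrightarrow> z" by (simp add: p_def[abs_def] lift_0)
  have p\<Omega>: "p n \<in> \<Omega>" for n
    unfolding p_def using \<xi>[of n] s[of n] t[of n] by (intro lift_in_\<Omega>[OF \<tau> d(3)]) auto
  have "z \<notin> \<Omega>" using z open_\<Omega> by (simp add: frontier_def interior_open)
  then have p_filter: "filterlim p (at z within \<Omega>) sequentially"
    unfolding filterlim_at using p_lim p\<Omega> by (auto intro!: always_eventually)
  have "continuous_on (ball z r) (pd \<tau> \<gamma>)"
  proof -
    have "continuous_on (ball z r) (\<lambda>x. \<Sum>b\<in>Basis. (\<tau> \<bullet> b) *\<^sub>R pd b \<gamma> x)"
      using \<gamma>_C1 by (intro continuous_intros) (simp_all add: C_k_on_Suc C_k_on_0)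
    moreover have "pd \<tau> \<gamma> x = (\<Sum>b\<in>Basis. (\<tau> \<bullet> b) *\<^sub>R pd b \<gamma> x)" if "x \<in> ball z r" for x
      by (rule pd_euclidean[OF \<gamma>_differentiable[OF that]])
    ultimately show ?thesis by (simp only: cong: continuous_on_cong)
  qed
  then have "isCont (pd \<tau> \<gamma>) z" using r by (simp add: continuous_on_eq_continuous_at)
  moreover have "(\<lambda>n. z + \<xi> n *\<^sub>R \<tau>) \<longlonglongrightarrow> z + 0 *\<^sub>R \<tau>" by (intro tendsto_intros \<xi>_lim)
  ultimately have "(\<lambda>n. pd \<tau> \<gamma> (z + \<xi> n *\<^sub>R \<tau>)) \<longlonglongrightarrow> pd \<tau> \<gamma> z"
    using isCont_tendsto_compose by fastforce
  then have v_lim: "v \<longlonglongrightarrow> \<tau> + (grad \<bullet> \<tau>) *\<^sub>R e"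
    unfolding v_def grad_inner[symmetric] by (intro tendsto_intros)
  have "(\<lambda>n. \<Sum>b\<in>Basis. (v n \<bullet> b) *\<^sub>R pd b w (p n)) \<longlonglongrightarrow> (\<Sum>b\<in>Basis. ((\<tau> + (grad \<bullet> \<tau>) *\<^sub>R e) \<bullet> b) *\<^sub>R (G \<bullet> b))"
    by (intro tendsto_intros v_lim filterlim_compose[OF G p_filter])
  moreover have "(\<Sum>b\<in>Basis. (v n \<bullet> b) *\<^sub>R pd b w (p n)) = pd (v n) w (p n)" for n
    by (rule pd_euclidean[OF dif[OF p\<Omega>], symmetric])
  ultimately have "(\<lambda>n. pd (v n) w (p n)) \<longlonglongrightarrow> G \<bullet> (\<tau> + (grad \<bullet> \<tau>) *\<^sub>R e)"
    by (simp only: euclidean_inner[of G "\<tau> + (grad \<bullet> \<tau>) *\<^sub>R e"] mult.commute[of "G \<bullet> _"] real_scaleR_def)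
  moreover have "(\<lambda>n. pd (v n) w (p n)) \<longlonglongrightarrow> 0"
  proof (rule Lim_null_comparison)
    show "\<forall>\<^sub>F n in sequentially. norm (pd (v n) w (p n)) \<le> 2 * t n"
      using bound by (simp add: v_def p_def)
    show "(\<lambda>n. 2 * t n) \<longlonglongrightarrow> 0" using tendsto_mult_right_zero[OF t_lim] by simp
  qed
  ultimately show ?thesis using LIMSEQ_unique by blast
qed

lemma gradient_limit_zero:
  fixes w :: "'a \<Rightarrow> real"
  assumes "continuous_on (closure \<Omega>) w" "\<And>x. x \<in> frontier \<Omega> \<Longrightarrow> w x = 0"
    and "\<And>x. x \<in> \<Omega> \<Longrightarrow> w differentiable (at x)"
    and "\<And>b. b \<in> Basis \<Longrightarrow> (pd b w \<longlongrightarrow> G \<bullet> b) (at z within \<Omega>)"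
    and \<nu>: "exterior_normal \<Omega> z \<bullet> G = 0"
  shows "G = 0"
proof -
  have "(grad - e) \<bullet> e = -1" by (simp add: inner_diff_left grad_e)
  then have "grad - e \<noteq> 0" using norm_e by (auto simp: inner_diff_left)
  with \<nu> have "(grad - e) \<bullet> G = 0" by (simp add: exterior_normal_eq)
  then have eq: "grad \<bullet> G = G \<bullet> e" by (simp add: inner_diff_left inner_commute[of G e])
  \<comment> \<open>By the normal condition \<open>grad \<bullet> G = G \<bullet> e\<close>, so the
    tangent vector over this \<tau> is G itself.\<close>
  define \<tau> where "\<tau> = G - (G \<bullet> e) *\<^sub>R e"
  have "\<tau> \<bullet> e = 0" by (simp add: \<tau>_def inner_diff_left)
  with assms(1-4) have "G \<bullet> (\<tau> + (grad \<bullet> \<tau>) *\<^sub>R e) = 0" by (rule tangential_gradient_zero)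
  moreover have "grad \<bullet> \<tau> = G \<bullet> e" by (simp add: \<tau>_def inner_diff_right grad_e eq)
  ultimately have "G \<bullet> G = 0" by (simp add: \<tau>_def inner_add_right inner_diff_right)
  then show ?thesis by simp
qed

end

lemma holder_domain_boundary_graph:
  fixes \<Omega> :: "'a::euclidean_space set"
  assumes "holder_domain (Suc k) \<alpha> \<Omega>" "z \<in> frontier \<Omega>"
  obtains r e \<gamma> where "boundary_graph \<Omega> z r e \<gamma>"
proof -
  obtain r e \<gamma> where "r > 0" "norm e = 1" "\<And>x t. \<gamma> (x + t *\<^sub>R e) = \<gamma> x"
    "holder_on (Suc k) \<alpha> (ball z r) \<gamma>" "\<Omega> \<inter> ball z r = {x \<in> ball z r. \<gamma> x < x \<bullet> e}"
  proof -
    have "\<exists>r>0. \<exists>e \<gamma>. norm e = 1 \<and> (\<forall>x t. \<gamma> (x + t *\<^sub>R e) = \<gamma> x) \<and>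
      holder_on (Suc k) \<alpha> (ball z r) \<gamma> \<and> \<Omega> \<inter> ball z r = {x \<in> ball z r. \<gamma> x < x \<bullet> e}"
      using assms unfolding holder_domain_def by blast
    then show ?thesis using that by blast
  qed
  then have "boundary_graph \<Omega> z r e \<gamma>"
    using assms C_k_on_mono[OF holder_on_C_k_on, of "Suc k" \<alpha> "ball z r" \<gamma> 1]
    by unfold_locales (auto simp: holder_domain_def)
  then show ?thesis by (rule that)
qed

lemma negligible_frontier_holder_domain:
  fixes \<Omega> :: "'a::euclidean_space set"
  assumes "holder_domain (Suc k) \<alpha> \<Omega>"
  shows "negligible (frontier \<Omega>)"
proof (subst locally_negligible_alt, rule)
  fix z assume z: "z \<in> frontier \<Omega>"
  obtain r e \<gamma> where "boundary_graph \<Omega> z r e \<gamma>" by (rule holder_domain_boundary_graph[OF assms z])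
  then interpret boundary_graph \<Omega> z r e \<gamma> .
  have "openin (top_of_set (frontier \<Omega>)) (frontier \<Omega> \<inter> ball z r)" by (rule openin_open_Int) simp
  then show "\<exists>U. openin (top_of_set (frontier \<Omega>)) U \<and> z \<in> U \<and> negligible U"
    using negligible_frontier_ball z z_ball by blast
qed

subsection \<open>Linearization at the background\<close>

lemma sum_Basis_vec: "(\<Sum>b\<in>(Basis :: (real^'n) set). f b) = (\<Sum>i\<in>UNIV. f (axis i 1))"
proof -
  have "Basis = range (\<lambda>i::'n. axis i (1::real))" by (auto simp: Basis_vec_def)
  moreover have "inj (\<lambda>i::'n. axis i (1::real))" by (auto simp: inj_on_def axis_eq_axis)
  ultimately show ?thesis using sum.reindex[of "\<lambda>i::'n. axis i (1::real)" UNIV f] by simp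
qed

lemma axis_Basis: "axis i 1 \<in> (Basis :: (real^'n) set)"
  by (auto simp: Basis_vec_def)

lemma singleton_partial_dirs: "b \<in> Basis \<Longrightarrow> [b] \<in> partial_dirs 1"
  by (simp add: partial_dirs_def)

lemma pair_partial_dirs: "b \<in> Basis \<Longrightarrow> c \<in> Basis \<Longrightarrow> [b, c] \<in> partial_dirs 2"
  by (simp add: partial_dirs_def)

lemma iterated_partial_1: "iterated_partial [b] u = pd b u"
  by (simp add: pd_def)

lemma iterated_partial_2: "iterated_partial [b, c] u = pd b (pd c u)"
  by (simp add: pd_def)

lemma background_has_derivative: "(background has_derivative (\<lambda>h. x \<bullet> h)) (at x)"
proof -
  have "((\<lambda>x. x \<bullet> x / 2) has_derivative (\<lambda>h. x \<bullet> h)) (at x)"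
    by (auto intro!: derivative_eq_intros simp: inner_commute)
  then show ?thesis by (simp add: background_def[abs_def] power2_norm_eq_inner)
qed

lemma pd_background: "pd b background = (\<lambda>x. x \<bullet> b)"
  using pd_eqI[OF background_has_derivative] by blast

lemma pd_pd_background: "pd c (pd b background) x = c \<bullet> b"
  unfolding pd_background by (rule pd_eqI) (auto intro!: derivative_eq_intros)

lemma C_k_on_background: "C_k_on (Suc k) UNIV background"
  by (rule C_k_on_SucI[OF open_UNIV background_has_derivative C_k_on_inner[OF open_UNIV]])

lemma has_real_derivative_uniform:
  fixes f :: "real \<Rightarrow> real"
  assumes "\<And>e. 0 < e \<Longrightarrow> \<exists>d>0. \<forall>t. \<bar>t\<bar> < d \<longrightarrow> \<bar>f t - c - t * D\<bar> \<le> e * \<bar>t\<bar>"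
  shows "(f has_real_derivative D) (at 0)" "f 0 = c"
proof -
  show c: "f 0 = c"
  proof -
    obtain d where "d > 0" "\<And>t. \<bar>t\<bar> < d \<Longrightarrow> \<bar>f t - c - t * D\<bar> \<le> 1 * \<bar>t\<bar>" using assms[OF zero_less_one] by blast
    from this(2)[of 0] this(1) show ?thesis by simp
  qed
  show "(f has_real_derivative D) (at 0)"
    unfolding has_field_derivative_def has_derivative_at_alt
  proof (intro conjI allI impI)
    fix e :: real assume "0 < e"
    from assms[OF this] obtain d where "d > 0" "\<And>t. \<bar>t\<bar> < d \<Longrightarrow> \<bar>f t - c - t * D\<bar> \<le> e * \<bar>t\<bar>" by blast
    then show "\<exists>d>0. \<forall>y. norm (y - 0) < d \<longrightarrow> norm (f y - f 0 - D * (y - 0)) \<le> e * norm (y - 0)"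
      using c by (intro exI[of _ d]) (auto simp: mult.commute)
  qed (rule bounded_linear_mult_right)
qed

text \<open>In the Leibniz formula a permutation other than the identity moves at least two indices.
  Differentiating one factor leaves another off-diagonal factor, which is 0 at the identity matrix;
  only the diagonal product contributes.\<close>

lemma det_has_derivative_at_mat_1:
  fixes M :: "real \<Rightarrow> real^'n^'n"
  assumes der: "\<And>i j. ((\<lambda>t. M t $ i $ j) has_real_derivative D i j) (at 0)" and M0: "M 0 = mat 1"
  shows "((\<lambda>t. det (M t)) has_real_derivative (\<Sum>i\<in>UNIV. D i i)) (at 0)"
proof -
  have prod: "((\<lambda>t. \<Prod>i\<in>UNIV. M t $ i $ p i) has_real_derivative
      (\<Sum>i\<in>UNIV. D i (p i) * (\<Prod>j\<in>UNIV - {i}. M 0 $ j $ p j))) (at 0)" for p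
  proof -
    have "((\<lambda>t. \<Prod>i\<in>UNIV. M t $ i $ p i) has_derivative
        (\<lambda>y. \<Sum>i\<in>UNIV. D i (p i) * y * (\<Prod>j\<in>UNIV - {i}. M 0 $ j $ p j))) (at 0)"
      using der unfolding has_field_derivative_def by (intro has_derivative_prod)
    then show ?thesis
      unfolding has_field_derivative_def by (rule has_derivative_eq_rhs) (simp add: fun_eq_iff sum_distrib_left sum_distrib_right mult.assoc mult.left_commute mult.commute)
  qed
  have zero: "(\<Sum>i\<in>UNIV. D i (p i) * (\<Prod>j\<in>UNIV - {i}. M 0 $ j $ p j)) = (if p = id then \<Sum>i\<in>UNIV. D i i else 0)"
    if p: "p permutes UNIV" for p
  proof (cases "p = id")
    case True
    then show ?thesis by (simp add: M0 mat_def)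
  next
    case False
    have "(\<Prod>j\<in>UNIV - {i}. M 0 $ j $ p j) = 0" for i
    proof (rule prod_zero)
      obtain k where k: "p k \<noteq> k" using False by (auto simp: fun_eq_iff)
      have "\<exists>j. j \<noteq> i \<and> p j \<noteq> j"
      proof (cases "k = i")
        case True
        have "p (p k) \<noteq> p k" using k p by (metis permutes_def)
        then show ?thesis using True k by blast
      qed (use k in blast)
      then obtain j where "j \<noteq> i" "p j \<noteq> j" by blast
      then show "\<exists>j\<in>UNIV - {i}. M 0 $ j $ p j = 0" by (intro bexI[of _ j]) (auto simp: M0 mat_def)
    qed simp
    then show ?thesis using False by (simp del: prod_zero_iff)
  qed
  have "((\<lambda>t. \<Sum>p | p permutes UNIV. of_int (sign p) * (\<Prod>i\<in>UNIV. M t $ i $ p i)) has_real_derivative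
     (\<Sum>p | p permutes (UNIV :: 'n set). of_int (sign p) *
        (\<Sum>i\<in>UNIV. D i (p i) * (\<Prod>j\<in>UNIV - {i}. M 0 $ j $ p j)))) (at 0)"
    by (intro DERIV_sum DERIV_cmult prod)
  also have "(\<Sum>p | p permutes (UNIV :: 'n set). of_int (sign p) *
        (\<Sum>i\<in>UNIV. D i (p i) * (\<Prod>j\<in>UNIV - {i}. M 0 $ j $ p j))) =
      (\<Sum>p | p permutes (UNIV :: 'n set). if p = id then \<Sum>i\<in>UNIV. D i i else 0)"
    using zero by (intro sum.cong) (auto simp: sign_id)
  also have "\<dots> = (\<Sum>i\<in>UNIV. D i i)" by (simp add: permutes_id)
  finally show ?thesis by (simp add: det_def)
qed

lemma holder_on_limit:
  assumes "holder_on k \<alpha> U u" "m \<le> k" "bs \<in> partial_dirs m" "z \<in> closure U"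
  obtains L where "(iterated_partial bs u \<longlongrightarrow> L) (at z within U)"
proof -
  obtain g where g: "continuous_on (closure U) g" "\<forall>x\<in>U. g x = iterated_partial bs u x"
    using assms unfolding holder_on_def by meson
  have "(g \<longlongrightarrow> g z) (at z within U)"
    using g(1) assms(4) closure_subset unfolding continuous_on_def by (metis tendsto_within_subset)
  then have "(iterated_partial bs u \<longlongrightarrow> g z) (at z within U)"
    by (rule Lim_transform_eventually) (use g(2) in \<open>auto simp: eventually_at_filter\<close>)
  then show ?thesis by (rule that)
qed

lemma pd_limit:
  assumes "holder_on 2 \<alpha> U u" "b \<in> Basis" "z \<in> closure U"
  shows "\<exists>L. (pd b u \<longlongrightarrow> L) (at z within U)"
proof -
  obtain L where "(iterated_partial [b] u \<longlongrightarrow> L) (at z within U)"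
    by (rule holder_on_limit[OF assms(1) one_le_numeral singleton_partial_dirs[OF assms(2)] assms(3)])
  then show ?thesis unfolding iterated_partial_1 by blast
qed

text \<open>The predicate under \<open>SOME\<close> sees \<eta> only on the frontier, so equal
  boundary values give the same chosen function. Points of the Cauchy data set determine \<eta> only
  there.\<close>

lemma dirichlet_solution_cong:
  assumes "\<And>x. x \<in> frontier \<Omega> \<Longrightarrow> \<eta> x = \<eta>' x"
  shows "dirichlet_solution \<Omega> a V \<eta> = dirichlet_solution \<Omega> a V \<eta>'"
  unfolding dirichlet_solution_def solves_dirichlet_def using assms by metis

text \<open>\<open>v\<close> is the derivative of the solution map at the background in direction \<open>h\<close>.\<close>

definition linearized :: "real \<Rightarrow> (real^'n) set \<Rightarrow> ((real^'n) \<times> (real^'n) \<Rightarrow> real) \<Rightarrow> real \<Rightarrow>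
    (real^'n \<Rightarrow> real) set \<Rightarrow> (real^'n \<Rightarrow> real) \<Rightarrow> (real^'n \<Rightarrow> real) \<Rightarrow> bool" where
  "linearized \<alpha> \<Omega> a \<delta> V h v \<longleftrightarrow> holder_on 2 \<alpha> \<Omega> v \<and>
     (\<forall>e>0. \<exists>d>0. \<forall>t. \<bar>t\<bar> < d \<longrightarrow>
        (let \<eta> = (\<lambda>x. background x + t * h x); u = dirichlet_solution \<Omega> a V \<eta> in
          \<eta> \<in> boundary_ball \<alpha> \<Omega> \<delta> \<and> holder_on 2 \<alpha> \<Omega> u \<and> solves_dirichlet \<Omega> a \<eta> u \<and>
          (\<forall>m\<le>2. \<forall>bs\<in>partial_dirs m. \<forall>x\<in>\<Omega>. \<bar>iterated_partial bs u x -
             iterated_partial bs background x - t * iterated_partial bs v x\<bar> \<le> e * \<bar>t\<bar>)))"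

lemma linearizedD:
  assumes "linearized \<alpha> \<Omega> a \<delta> V h v" "0 < e"
  obtains d where "d > 0"
    "\<And>t. \<bar>t\<bar> < d \<Longrightarrow> (\<lambda>x. background x + t * h x) \<in> boundary_ball \<alpha> \<Omega> \<delta>"
    "\<And>t. \<bar>t\<bar> < d \<Longrightarrow> holder_on 2 \<alpha> \<Omega> (dirichlet_solution \<Omega> a V (\<lambda>x. background x + t * h x))"
    "\<And>t. \<bar>t\<bar> < d \<Longrightarrow> solves_dirichlet \<Omega> a (\<lambda>x. background x + t * h x)
       (dirichlet_solution \<Omega> a V (\<lambda>x. background x + t * h x))"
    "\<And>t m bs x. \<bar>t\<bar> < d \<Longrightarrow> m \<le> 2 \<Longrightarrow> bs \<in> partial_dirs m \<Longrightarrow> x \<in> \<Omega> \<Longrightarrow>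
       \<bar>iterated_partial bs (dirichlet_solution \<Omega> a V (\<lambda>x. background x + t * h x)) x -
             iterated_partial bs background x - t * iterated_partial bs v x\<bar> \<le> e * \<bar>t\<bar>"
proof -
  from assms obtain d where d: "d > 0" "\<forall>t. \<bar>t\<bar> < d \<longrightarrow>
        (let \<eta> = (\<lambda>x. background x + t * h x); u = dirichlet_solution \<Omega> a V \<eta> in
          \<eta> \<in> boundary_ball \<alpha> \<Omega> \<delta> \<and> holder_on 2 \<alpha> \<Omega> u \<and> solves_dirichlet \<Omega> a \<eta> u \<and>
          (\<forall>m\<le>2. \<forall>bs\<in>partial_dirs m. \<forall>x\<in>\<Omega>. \<bar>iterated_partial bs u x -
             iterated_partial bs background x - t * iterated_partial bs v x\<bar> \<le> e * \<bar>t\<bar>))"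
    unfolding linearized_def by blast
  show ?thesis by (rule that[OF d(1)]) (use d(2) in \<open>auto simp: Let_def\<close>)
qed

text \<open>With the direction h fixed, Frechet differentiability at \<open>background\<close>
  becomes a remainder estimate in t that is uniform on \<Omega> for all derivatives up to order two.
  The predicate \<open>linearized\<close> is all that later steps know about well-posedness.\<close>

lemma linearized_exists:
  fixes \<Omega> :: "(real^'n) set"
  assumes \<Omega>: "open \<Omega>" "bounded \<Omega>" "\<Omega> \<noteq> {}" and \<alpha>: "\<alpha> \<le> 1"
    and wp: "locally_well_posed \<alpha> \<Omega> a \<delta> V"
    and h: "holder_on 2 \<alpha> \<Omega> h"
  obtains v where "linearized \<alpha> \<Omega> a \<delta> V h v"
proof -
  define S where "S = dirichlet_solution \<Omega> a V"
  note hc = holder_on_C_k_on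
  have bg: "holder_on 2 \<alpha> \<Omega> background"
    using C_k_on_imp_holder_on[OF \<Omega>(2) C_k_on_background \<alpha>] .
  obtain C where C: "C > 0" "\<And>t \<eta>. (\<And>x. x \<in> frontier \<Omega> \<Longrightarrow> \<eta> x = t * h x) \<Longrightarrow> boundary_holder_norm 2 \<alpha> \<Omega> \<eta> \<le> \<bar>t\<bar> * C"
    using boundary_holder_norm_scaled[OF \<Omega>(1,3) h] by blast
  have th: "boundary_holder 2 \<alpha> \<Omega> (\<lambda>x. t * h x)" for t
    unfolding boundary_holder_def using holder_on_cmult[OF \<Omega>(1) h] by blast
  have in_ball: "(\<lambda>x. background x + t * h x) \<in> boundary_ball \<alpha> \<Omega> \<epsilon>" if "\<bar>t\<bar> * C < \<epsilon>" for t \<epsilon>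
  proof -
    have "boundary_holder 2 \<alpha> \<Omega> (\<lambda>x. background x + t * h x)"
      unfolding boundary_holder_def using holder_on_add[OF \<Omega>(1) bg holder_on_cmult[OF \<Omega>(1) h]] by blast
    moreover have "boundary_holder_norm 2 \<alpha> \<Omega> (\<lambda>x. background x + t * h x - background x) < \<epsilon>"
      using C(2)[of "\<lambda>x. background x + t * h x - background x" t] that by simp
    ultimately show ?thesis by (simp add: boundary_ball_def)
  qed
  have sol: "S \<eta> \<in> V \<and> solves_dirichlet \<Omega> a \<eta> (S \<eta>)" if "\<eta> \<in> boundary_ball \<alpha> \<Omega> \<delta>" for \<eta>
  proof -
    have "\<exists>u\<in>V. solves_dirichlet \<Omega> a \<eta> u" using wp that unfolding locally_well_posed_def by blast
    then have "\<exists>u. u \<in> V \<and> solves_dirichlet \<Omega> a \<eta> u" by blast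
    then show ?thesis unfolding S_def dirichlet_solution_def by (rule someI_ex)
  qed
  have V: "holder_on 2 \<alpha> \<Omega> u" if "u \<in> V" for u
    using wp that unfolding locally_well_posed_def background_neighbourhood_def by blast
  have Sbg: "S background x = background x" if "x \<in> closure \<Omega>" for x
    using wp that unfolding locally_well_posed_def S_def by blast
  obtain \<epsilon> where \<epsilon>: "\<epsilon> > 0" "\<epsilon> \<le> \<delta>" "C1_frechet_on \<alpha> \<Omega> (boundary_ball \<alpha> \<Omega> \<epsilon>) S"
    using wp unfolding locally_well_posed_def S_def by blast
  have bg_ball: "background \<in> boundary_ball \<alpha> \<Omega> \<epsilon>" if "\<epsilon> > 0" for \<epsilon>
    using in_ball[of 0 \<epsilon>] that by simp
  obtain A where "frechet_derivative_holder \<alpha> \<Omega> S background A"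
    using \<epsilon>(3) bg_ball[OF \<epsilon>(1)] unfolding C1_frechet_on_def by blast
  then have A: "bounded_linear_holder \<alpha> \<Omega> A"
    and fr: "\<And>e. e > 0 \<Longrightarrow> \<exists>d>0. \<forall>h. boundary_holder 2 \<alpha> \<Omega> h \<and> boundary_holder_norm 2 \<alpha> \<Omega> h < d \<longrightarrow>
        holder_norm 2 \<alpha> \<Omega> (\<lambda>x. S (\<lambda>y. background y + h y) x - S background x - A h x)
          \<le> e * boundary_holder_norm 2 \<alpha> \<Omega> h"
    unfolding frechet_derivative_holder_def by blast+
  have hb: "boundary_holder 2 \<alpha> \<Omega> h" using th[of 1] by simp
  have A_h: "holder_on 2 \<alpha> \<Omega> (A g)" if "boundary_holder 2 \<alpha> \<Omega> g" for g
    using A that unfolding bounded_linear_holder_def by blast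
  have A_lin: "A (\<lambda>y. t * h y) x = t * A h x" if "x \<in> closure \<Omega>" for t x
    using A hb that unfolding bounded_linear_holder_def by blast
  have "linearized \<alpha> \<Omega> a \<delta> V h (A h)"
    unfolding linearized_def Let_def
  proof (intro conjI allI impI)
    show "holder_on 2 \<alpha> \<Omega> (A h)" by (rule A_h[OF hb])
    fix e :: real assume "0 < e"
    \<comment> \<open>The boundary norm of \<open>t * h\<close> is at most
      \<open>\<bar>t\<bar> * C\<close>, which the tolerance \<open>e / C\<close> turns into
      \<open>e * \<bar>t\<bar>\<close>.\<close>
    then have "0 < e / C" using C(1) by simp
    from fr[OF this] obtain d where d: "d > 0" and
      fr': "\<And>g. boundary_holder 2 \<alpha> \<Omega> g \<Longrightarrow> boundary_holder_norm 2 \<alpha> \<Omega> g < d \<Longrightarrow>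
        holder_norm 2 \<alpha> \<Omega> (\<lambda>x. S (\<lambda>y. background y + g y) x - S background x - A g x)
          \<le> e / C * boundary_holder_norm 2 \<alpha> \<Omega> g" by blast
    define d' where "d' = min d \<epsilon> / C"
    have "d' > 0" using d \<epsilon>(1) C(1) by (simp add: d'_def)
    moreover have "(\<lambda>x. background x + t * h x) \<in> boundary_ball \<alpha> \<Omega> \<delta> \<and>
      holder_on 2 \<alpha> \<Omega> (S (\<lambda>x. background x + t * h x)) \<and>
      solves_dirichlet \<Omega> a (\<lambda>x. background x + t * h x) (S (\<lambda>x. background x + t * h x)) \<and>
      (\<forall>m\<le>2. \<forall>bs\<in>partial_dirs m. \<forall>x\<in>\<Omega>. \<bar>iterated_partial bs (S (\<lambda>x. background x + t * h x)) x -
             iterated_partial bs background x - t * iterated_partial bs (A h) x\<bar> \<le> e * \<bar>t\<bar>)" if t: "\<bar>t\<bar> < d'" for t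
    proof -
      let ?\<eta> = "\<lambda>x. background x + t * h x" and ?th = "\<lambda>x. t * h x"
      have tC: "\<bar>t\<bar> * C < d" "\<bar>t\<bar> * C < \<epsilon>"
        using t C(1) by (auto simp: d'_def less_divide_eq)
      have ball: "?\<eta> \<in> boundary_ball \<alpha> \<Omega> \<delta>" using tC(2) \<epsilon>(2) by (intro in_ball) simp
      note St = V[OF conjunct1[OF sol[OF ball]]]
      have "\<delta> > 0" using \<epsilon> by simp
      note S0 = V[OF conjunct1[OF sol[OF bg_ball[OF this]]]]
      note At = A_h[OF th[of t]]
      have norm_th: "boundary_holder_norm 2 \<alpha> \<Omega> ?th \<le> \<bar>t\<bar> * C" by (rule C(2)) simp
      define f where "f x = S ?\<eta> x - S background x - A ?th x" for x
      have f: "holder_on 2 \<alpha> \<Omega> f"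
        unfolding f_def by (intro holder_on_diff \<Omega>(1) St S0 At)
      have "holder_norm 2 \<alpha> \<Omega> f \<le> e / C * boundary_holder_norm 2 \<alpha> \<Omega> ?th"
        using fr'[OF th[of t]] norm_th tC(1) by (simp add: f_def[abs_def])
      also have "\<dots> \<le> e / C * (\<bar>t\<bar> * C)"
        using norm_th \<open>0 < e / C\<close> by (intro mult_left_mono) auto
      also have "\<dots> = e * \<bar>t\<bar>" using C(1) by simp
      finally have f_le: "holder_norm 2 \<alpha> \<Omega> f \<le> e * \<bar>t\<bar>" .
      have "\<bar>iterated_partial bs (S ?\<eta>) x - iterated_partial bs background x - t * iterated_partial bs (A h) x\<bar> \<le> e * \<bar>t\<bar>"
        if bs: "m \<le> 2" "bs \<in> partial_dirs m" "x \<in> \<Omega>" for m bs x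
      proof -
        have cl: "y \<in> closure \<Omega>" if "y \<in> \<Omega>" for y using that closure_subset by blast
        have "iterated_partial bs f x = iterated_partial bs (S ?\<eta>) x - iterated_partial bs (S background) x
            - iterated_partial bs (A ?th) x"
          unfolding f_def
          using iterated_partial_diff[OF \<Omega>(1) hc[OF holder_on_diff[OF \<Omega>(1) St S0]] hc[OF At] bs(2,1,3)]
            iterated_partial_diff[OF \<Omega>(1) hc[OF St] hc[OF S0] bs(2,1,3)] by simp
        \<comment> \<open>\<open>S background\<close> is a chosen function that is known to equal
          \<open>background\<close> on the closure; at points of the open \<Omega> this determines
          its derivatives.\<close>
        moreover have "iterated_partial bs (S background) x = iterated_partial bs background x"
          using Sbg cl bs(3) by (intro iterated_partial_cong_open[OF \<Omega>(1)]) auto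
        moreover have "iterated_partial bs (A ?th) x = t * iterated_partial bs (A h) x"
          using iterated_partial_cong_open[OF \<Omega>(1), of "A ?th" "\<lambda>x. t * A h x" x bs] A_lin cl bs(3)
            iterated_partial_cmult[OF \<Omega>(1) hc[OF A_h[OF hb]] bs(2,1,3), of t] by simp
        ultimately show ?thesis using holder_norm_ge[OF \<Omega>(1) f bs] f_le by simp
      qed
      then show ?thesis using ball St sol[OF ball] by blast
    qed
    ultimately show "\<exists>d>0. \<forall>t. \<bar>t\<bar> < d \<longrightarrow>
      (\<lambda>x. background x + t * h x) \<in> boundary_ball \<alpha> \<Omega> \<delta> \<and>
      holder_on 2 \<alpha> \<Omega> (dirichlet_solution \<Omega> a V (\<lambda>x. background x + t * h x)) \<and>
      solves_dirichlet \<Omega> a (\<lambda>x. background x + t * h x) (dirichlet_solution \<Omega> a V (\<lambda>x. background x + t * h x)) \<and>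
      (\<forall>m\<le>2. \<forall>bs\<in>partial_dirs m. \<forall>x\<in>\<Omega>. \<bar>iterated_partial bs (dirichlet_solution \<Omega> a V (\<lambda>x. background x + t * h x)) x -
             iterated_partial bs background x - t * iterated_partial bs (A h) x\<bar> \<le> e * \<bar>t\<bar>)"
      unfolding S_def by blast
  qed
  then show ?thesis by (rule that)
qed

text \<open>The expansion in t is known inside \<Omega>. Both sides are continuous up to the
  boundary, so for one small positive t it extends there, where the solution has the values
  \<open>background x + t * h x\<close>.\<close>

lemma linearized_boundary:
  assumes lin: "linearized \<alpha> \<Omega> a \<delta> V h v" and x: "x \<in> frontier \<Omega>"
  shows "v x = h x"
proof -
  have v: "holder_on 2 \<alpha> \<Omega> v" using lin by (simp add: linearized_def)
  have "\<bar>h x - v x\<bar> \<le> 0 + e" if e: "0 < e" for e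
  proof -
    obtain d where d: "d > 0"
      "\<And>t. \<bar>t\<bar> < d \<Longrightarrow> (\<lambda>x. background x + t * h x) \<in> boundary_ball \<alpha> \<Omega> \<delta>"
      "\<And>t. \<bar>t\<bar> < d \<Longrightarrow> holder_on 2 \<alpha> \<Omega> (dirichlet_solution \<Omega> a V (\<lambda>x. background x + t * h x))"
      "\<And>t. \<bar>t\<bar> < d \<Longrightarrow> solves_dirichlet \<Omega> a (\<lambda>x. background x + t * h x)
         (dirichlet_solution \<Omega> a V (\<lambda>x. background x + t * h x))"
      "\<And>t m bs x. \<bar>t\<bar> < d \<Longrightarrow> m \<le> 2 \<Longrightarrow> bs \<in> partial_dirs m \<Longrightarrow> x \<in> \<Omega> \<Longrightarrow>
       \<bar>iterated_partial bs (dirichlet_solution \<Omega> a V (\<lambda>x. background x + t * h x)) x -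
             iterated_partial bs background x - t * iterated_partial bs v x\<bar> \<le> e * \<bar>t\<bar>"
      by (rule linearizedD[OF lin e], rule that)
    define t where "t = d / 2"
    have t: "0 < t" "\<bar>t\<bar> < d" using d(1) by (auto simp: t_def)
    define u where "u = dirichlet_solution \<Omega> a V (\<lambda>x. background x + t * h x)"
    have "continuous_on (closure \<Omega>) (\<lambda>x. \<bar>u x - background x - t * v x\<bar>)"
      using d(3)[OF t(2)] v C_k_on_imp_continuous_on[OF C_k_on_background[of 0]]
      by (auto simp: u_def holder_on_def intro!: continuous_intros intro: continuous_on_subset)
    moreover have "\<bar>u x - background x - t * v x\<bar> \<le> e * t" if "x \<in> \<Omega>" for x
      using d(5)[OF t(2), of 0 "[]" x] that t by (simp add: u_def)
    ultimately have "\<bar>u x - background x - t * v x\<bar> \<le> e * t"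
      using continuous_le_on_closure[of \<Omega> "\<lambda>x. \<bar>u x - background x - t * v x\<bar>" x "e * t"] x
      by (simp add: frontier_def)
    moreover have "u x = background x + t * h x"
      using d(4)[OF t(2)] x by (simp add: u_def solves_dirichlet_def)
    ultimately have "\<bar>t * h x - t * v x\<bar> \<le> e * t" by simp
    then have "t * \<bar>h x - v x\<bar> \<le> t * e"
      using t(1) by (simp add: abs_mult right_diff_distrib[symmetric] mult.commute)
    then show ?thesis using t(1) by (simp only: mult_le_cancel_left_pos)
  qed
  then have "\<bar>h x - v x\<bar> \<le> 0" by (rule field_le_epsilon)
  then show ?thesis by simp
qed

text \<open>Multiplied out, the equation says that
  \<open>det (hessian u x) * \<rho> (gradient u x)\<close> is \<open>\<rho> x\<close>, independently
  of t. At \<open>t = 0\<close> the Hessian is the identity and the gradient is x, so the product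
  rule yields \<open>\<rho> x\<close> times the trace of \<open>hessian v x\<close> plus the
  derivative of \<rho> in the direction of the gradient of v.\<close>

lemma linearized_equation:
  fixes \<Omega> :: "(real^'n) set"
  assumes \<Omega>: "open \<Omega>" and lin: "linearized \<alpha> \<Omega> a \<delta> V h v"
    and \<rho>: "C_k_on 1 UNIV \<rho>" "\<And>x. 0 < \<rho> x"
    and a: "\<And>x p. x \<in> closure \<Omega> \<Longrightarrow> a (x, p) = \<rho> x / \<rho> p"
    and x: "x \<in> \<Omega>"
  shows "\<rho> x * (\<Sum>b\<in>Basis. pd b (pd b v) x) + (\<Sum>b\<in>Basis. pd b \<rho> x * pd b v x) = 0"
proof -
  define u where "u t = dirichlet_solution \<Omega> a V (\<lambda>x. background x + t * h x)" for t
  have der: "((\<lambda>t. iterated_partial bs (u t) x) has_real_derivative iterated_partial bs v x) (at 0)"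
    "iterated_partial bs (u 0) x = iterated_partial bs background x"
    if "m \<le> 2" "bs \<in> partial_dirs m" for m bs
  proof -
    have "\<exists>d>0. \<forall>t. \<bar>t\<bar> < d \<longrightarrow> \<bar>iterated_partial bs (u t) x - iterated_partial bs background x
        - t * iterated_partial bs v x\<bar> \<le> e * \<bar>t\<bar>" if e: "0 < e" for e
    proof -
      obtain d where "d > 0"
      "\<And>t. \<bar>t\<bar> < d \<Longrightarrow> (\<lambda>x. background x + t * h x) \<in> boundary_ball \<alpha> \<Omega> \<delta>"
      "\<And>t. \<bar>t\<bar> < d \<Longrightarrow> holder_on 2 \<alpha> \<Omega> (dirichlet_solution \<Omega> a V (\<lambda>x. background x + t * h x))"
      "\<And>t. \<bar>t\<bar> < d \<Longrightarrow> solves_dirichlet \<Omega> a (\<lambda>x. background x + t * h x)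
         (dirichlet_solution \<Omega> a V (\<lambda>x. background x + t * h x))"
      "\<And>t m bs x. \<bar>t\<bar> < d \<Longrightarrow> m \<le> 2 \<Longrightarrow> bs \<in> partial_dirs m \<Longrightarrow> x \<in> \<Omega> \<Longrightarrow>
       \<bar>iterated_partial bs (dirichlet_solution \<Omega> a V (\<lambda>x. background x + t * h x)) x -
             iterated_partial bs background x - t * iterated_partial bs v x\<bar> \<le> e * \<bar>t\<bar>"
      by (rule linearizedD[OF lin e], rule that)
      then show ?thesis using x \<open>m \<le> 2\<close> \<open>bs \<in> partial_dirs m\<close> unfolding u_def by blast
    qed
    from has_real_derivative_uniform[OF this]
    show "((\<lambda>t. iterated_partial bs (u t) x) has_real_derivative iterated_partial bs v x) (at 0)"
      "iterated_partial bs (u 0) x = iterated_partial bs background x" by auto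
  qed
  have hess0: "hessian (u 0) x = mat 1"
    using der(2)[OF order_refl pair_partial_dirs[OF axis_Basis axis_Basis]]
    by (simp add: hessian_def iterated_partial_2 pd_pd_background mat_def vec_eq_iff inner_axis_axis
        del: iterated_partial.simps)
  have grad0: "gradient (u 0) x = x"
    using der(2)[OF one_le_numeral singleton_partial_dirs[OF axis_Basis]]
    by (simp add: gradient_def iterated_partial_1 pd_background vec_eq_iff inner_axis
        del: iterated_partial.simps)
  have detder: "((\<lambda>t. det (hessian (u t) x)) has_real_derivative (\<Sum>i\<in>UNIV. pd (axis i 1) (pd (axis i 1) v) x)) (at 0)"
    using der(1)[OF order_refl pair_partial_dirs[OF axis_Basis axis_Basis]] hess0
    by (intro det_has_derivative_at_mat_1[where D = "\<lambda>i j. pd (axis i 1) (pd (axis j 1) v) x"])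
      (simp_all add: hessian_def iterated_partial_2 del: iterated_partial.simps)
  have gradder: "((\<lambda>t. gradient (u t) x) has_derivative (\<lambda>s. s *\<^sub>R (\<chi> i. pd (axis i 1) v x))) (at 0)"
  proof (subst has_derivative_componentwise_within, intro ballI)
    fix b :: "real^'n" assume "b \<in> Basis"
    then obtain i where b: "b = axis i 1" by (auto simp: Basis_vec_def)
    have "((\<lambda>t. pd (axis i 1) (u t) x) has_real_derivative pd (axis i 1) v x) (at 0)"
      using der(1)[OF one_le_numeral singleton_partial_dirs[OF axis_Basis[of i]]]
      by (simp add: iterated_partial_1 del: iterated_partial.simps)
    then show "((\<lambda>t. gradient (u t) x \<bullet> b) has_derivative (\<lambda>s. s *\<^sub>R (\<chi> i. pd (axis i 1) v x) \<bullet> b)) (at 0)"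
      unfolding has_field_derivative_def b gradient_def iterated_partial_1
      by (simp add: inner_axis mult_commute_abs)
  qed
  have dif\<rho>: "\<rho> differentiable (at y)" for y
    using \<rho>(1) by (rule C_k_on_imp_differentiable) auto
  have "((\<lambda>t. \<rho> (gradient (u t) x)) has_derivative (\<lambda>s. pd (s *\<^sub>R (\<chi> i. pd (axis i 1) v x)) \<rho> x)) (at 0)"
    by (rule has_derivative_compose[OF gradder]) (simp add: grad0 has_derivative_pd dif\<rho>)
  then have \<rho>der: "((\<lambda>t. \<rho> (gradient (u t) x)) has_real_derivative pd (\<chi> i. pd (axis i 1) v x) \<rho> x) (at 0)"
    by (simp add: has_field_derivative_def pd_scaleR[OF dif\<rho>] mult_commute_abs)
  obtain d where "d > 0"
      "\<And>t. \<bar>t\<bar> < d \<Longrightarrow> (\<lambda>x. background x + t * h x) \<in> boundary_ball \<alpha> \<Omega> \<delta>"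
      "\<And>t. \<bar>t\<bar> < d \<Longrightarrow> holder_on 2 \<alpha> \<Omega> (dirichlet_solution \<Omega> a V (\<lambda>x. background x + t * h x))"
      "\<And>t. \<bar>t\<bar> < d \<Longrightarrow> solves_dirichlet \<Omega> a (\<lambda>x. background x + t * h x)
         (dirichlet_solution \<Omega> a V (\<lambda>x. background x + t * h x))"
      "\<And>t m bs x. \<bar>t\<bar> < d \<Longrightarrow> m \<le> 2 \<Longrightarrow> bs \<in> partial_dirs m \<Longrightarrow> x \<in> \<Omega> \<Longrightarrow>
       \<bar>iterated_partial bs (dirichlet_solution \<Omega> a V (\<lambda>x. background x + t * h x)) x -
             iterated_partial bs background x - t * iterated_partial bs v x\<bar> \<le> 1 * \<bar>t\<bar>"
    by (rule linearizedD[OF lin zero_less_one], rule that)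
  then have d: "d > 0" "\<And>t. \<bar>t\<bar> < d \<Longrightarrow> solves_dirichlet \<Omega> a (\<lambda>x. background x + t * h x) (u t)"
    unfolding u_def by blast+
  have "det (hessian (u t) x) * \<rho> (gradient (u t) x) = \<rho> x" if "t \<in> {-d<..<d}" for t
  proof -
    have "det (hessian (u t) x) = \<rho> x / \<rho> (gradient (u t) x)"
      using d(2)[of t] that x a[of x] closure_subset[of \<Omega>] by (auto simp: solves_dirichlet_def)
    then show ?thesis using \<rho>(2)[of "gradient (u t) x"] by simp
  qed
  then have "((\<lambda>t. det (hessian (u t) x) * \<rho> (gradient (u t) x)) has_real_derivative 0) (at 0)"
    using has_field_derivative_transform_within_open[of "\<lambda>_. \<rho> x" 0 0 "{-d<..<d}"] d(1) by simp
  from DERIV_unique[OF DERIV_mult[OF detder \<rho>der] this]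
  have "(\<Sum>i\<in>UNIV. pd (axis i 1) (pd (axis i 1) v) x) * \<rho> x + pd (\<chi> i. pd (axis i 1) v x) \<rho> x = 0"
    by (simp add: grad0 hess0)
  moreover have "pd (\<chi> i. pd (axis i 1) v x) \<rho> x = (\<Sum>b\<in>Basis. pd b \<rho> x * pd b v x)"
    by (subst pd_euclidean[OF dif\<rho>]) (simp add: sum_Basis_vec inner_axis mult.commute)
  ultimately show ?thesis by (simp add: sum_Basis_vec mult.commute)
qed

text \<open>Equal Cauchy data give equal normal derivatives for each small positive t. Dividing the
  difference of the two expansions by t leaves an error of order e in each component, uniform up to
  the boundary, and e is arbitrary.\<close>

lemma linearized_normal_derivative:
  fixes \<Omega> :: "(real^'n) set"
  assumes \<Omega>: "open \<Omega>" and z: "z \<in> frontier \<Omega>"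
    and lin1: "linearized \<alpha> \<Omega> a\<^sub>1 \<delta>\<^sub>1 V\<^sub>1 h v\<^sub>1" and lin2: "linearized \<alpha> \<Omega> a\<^sub>2 \<delta>\<^sub>2 V\<^sub>2 h v\<^sub>2"
    and eq: "nonlinear_cauchy_data \<alpha> \<Omega> a\<^sub>1 \<delta>\<^sub>1 V\<^sub>1 = nonlinear_cauchy_data \<alpha> \<Omega> a\<^sub>2 \<delta>\<^sub>2 V\<^sub>2"
    and G: "\<And>b. b \<in> Basis \<Longrightarrow> ((\<lambda>x. pd b v\<^sub>1 x - pd b v\<^sub>2 x) \<longlongrightarrow> G \<bullet> b) (at z within \<Omega>)"
  shows "exterior_normal \<Omega> z \<bullet> G = 0"
proof -
  have zcl: "z \<in> closure \<Omega>" and "z \<notin> \<Omega>" using z \<Omega> by (auto simp: frontier_def interior_open)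
  then have nt: "at z within \<Omega> \<noteq> bot"
    by (simp add: trivial_limit_within islimpt_in_closure)
  define \<nu> where "\<nu> = exterior_normal \<Omega> z"
  have "\<bar>\<nu> \<bullet> G\<bar> \<le> e * (2 * (\<Sum>b\<in>Basis. \<bar>\<nu> \<bullet> b\<bar>))" if e: "0 < e" for e
  proof -
    obtain d1 where d1: "d1 > 0"
      "\<And>t. \<bar>t\<bar> < d1 \<Longrightarrow> (\<lambda>x. background x + t * h x) \<in> boundary_ball \<alpha> \<Omega> \<delta>\<^sub>1"
      "\<And>t. \<bar>t\<bar> < d1 \<Longrightarrow> holder_on 2 \<alpha> \<Omega> (dirichlet_solution \<Omega> a\<^sub>1 V\<^sub>1 (\<lambda>x. background x + t * h x))"
      "\<And>t. \<bar>t\<bar> < d1 \<Longrightarrow> solves_dirichlet \<Omega> a\<^sub>1 (\<lambda>x. background x + t * h x)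
         (dirichlet_solution \<Omega> a\<^sub>1 V\<^sub>1 (\<lambda>x. background x + t * h x))"
      "\<And>t m bs x. \<bar>t\<bar> < d1 \<Longrightarrow> m \<le> 2 \<Longrightarrow> bs \<in> partial_dirs m \<Longrightarrow> x \<in> \<Omega> \<Longrightarrow>
       \<bar>iterated_partial bs (dirichlet_solution \<Omega> a\<^sub>1 V\<^sub>1 (\<lambda>x. background x + t * h x)) x -
             iterated_partial bs background x - t * iterated_partial bs v\<^sub>1 x\<bar> \<le> e * \<bar>t\<bar>"
      by (rule linearizedD[OF lin1 e], rule that)
    obtain d2 where d2: "d2 > 0"
      "\<And>t. \<bar>t\<bar> < d2 \<Longrightarrow> (\<lambda>x. background x + t * h x) \<in> boundary_ball \<alpha> \<Omega> \<delta>\<^sub>2"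
      "\<And>t. \<bar>t\<bar> < d2 \<Longrightarrow> holder_on 2 \<alpha> \<Omega> (dirichlet_solution \<Omega> a\<^sub>2 V\<^sub>2 (\<lambda>x. background x + t * h x))"
      "\<And>t. \<bar>t\<bar> < d2 \<Longrightarrow> solves_dirichlet \<Omega> a\<^sub>2 (\<lambda>x. background x + t * h x)
         (dirichlet_solution \<Omega> a\<^sub>2 V\<^sub>2 (\<lambda>x. background x + t * h x))"
      "\<And>t m bs x. \<bar>t\<bar> < d2 \<Longrightarrow> m \<le> 2 \<Longrightarrow> bs \<in> partial_dirs m \<Longrightarrow> x \<in> \<Omega> \<Longrightarrow>
       \<bar>iterated_partial bs (dirichlet_solution \<Omega> a\<^sub>2 V\<^sub>2 (\<lambda>x. background x + t * h x)) x -
             iterated_partial bs background x - t * iterated_partial bs v\<^sub>2 x\<bar> \<le> e * \<bar>t\<bar>"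
      by (rule linearizedD[OF lin2 e], rule that)
    define t where "t = min d1 d2 / 2"
    have t: "0 < t" "\<bar>t\<bar> < d1" "\<bar>t\<bar> < d2" using d1(1) d2(1) by (auto simp: t_def)
    define \<eta> where "\<eta> x = background x + t * h x" for x
    define u1 where "u1 = dirichlet_solution \<Omega> a\<^sub>1 V\<^sub>1 \<eta>"
    define u2 where "u2 = dirichlet_solution \<Omega> a\<^sub>2 V\<^sub>2 \<eta>"
    have u: "holder_on 2 \<alpha> \<Omega> u1" "holder_on 2 \<alpha> \<Omega> u2"
      using d1(3)[OF t(2)] d2(3)[OF t(3)] by (simp_all add: u1_def u2_def \<eta>_def[abs_def])
    have "(restrict \<eta> (frontier \<Omega>), restrict (normal_derivative \<Omega> u1) (frontier \<Omega>))
       \<in> nonlinear_cauchy_data \<alpha> \<Omega> a\<^sub>1 \<delta>\<^sub>1 V\<^sub>1"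
      using d1(2)[OF t(2)] unfolding nonlinear_cauchy_data_def u1_def \<eta>_def[abs_def] by blast
    \<comment> \<open>The element of the second data set comes from some \<open>\<eta>'\<close> that
      is tied to \<eta> only on the frontier; \<open>dirichlet_solution_cong\<close> identifies the
      two solutions.\<close>
    then obtain \<eta>' where \<eta>': "restrict \<eta> (frontier \<Omega>) = restrict \<eta>' (frontier \<Omega>)"
      "restrict (normal_derivative \<Omega> u1) (frontier \<Omega>) =
       restrict (normal_derivative \<Omega> (dirichlet_solution \<Omega> a\<^sub>2 V\<^sub>2 \<eta>')) (frontier \<Omega>)"
      unfolding eq unfolding nonlinear_cauchy_data_def by blast
    have "dirichlet_solution \<Omega> a\<^sub>2 V\<^sub>2 \<eta>' = u2"
      unfolding u2_def using \<eta>'(1) by (intro dirichlet_solution_cong) (metis restrict_apply)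
    then have nd: "normal_derivative \<Omega> u1 z = normal_derivative \<Omega> u2 z"
      using fun_cong[OF \<eta>'(2), of z] z by simp
    have lim: "\<exists>L. (gradient u \<longlongrightarrow> L) (at z within \<Omega>)" if u: "holder_on 2 \<alpha> \<Omega> u" for u
    proof -
      have "\<exists>L. (pd b u \<longlongrightarrow> L) (at z within \<Omega>)" if "b \<in> Basis" for b
        by (rule pd_limit[OF u that zcl])
      then obtain L where L: "\<And>b. b \<in> Basis \<Longrightarrow> (pd b u \<longlongrightarrow> L b) (at z within \<Omega>)" by metis
      have "((\<lambda>x. \<chi> i. pd (axis i 1) u x) \<longlongrightarrow> (\<chi> i. L (axis i 1))) (at z within \<Omega>)"
        by (intro tendsto_vec_lambda L axis_Basis)
      then show ?thesis by (auto simp: gradient_def[abs_def] iterated_partial_1 simp del: iterated_partial.simps)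
    qed
    obtain L1 L2 where L: "(gradient u1 \<longlongrightarrow> L1) (at z within \<Omega>)" "(gradient u2 \<longlongrightarrow> L2) (at z within \<Omega>)"
      using lim[OF u(1)] lim[OF u(2)] by blast
    have "\<nu> \<bullet> (L1 - L2) = 0"
      using nd tendsto_Lim[OF nt L(1)] tendsto_Lim[OF nt L(2)]
      by (simp add: normal_derivative_def \<nu>_def inner_diff_right)
    moreover have "\<bar>(L1 - L2) \<bullet> b - t * (G \<bullet> b)\<bar> \<le> 2 * e * t" if b: "b \<in> Basis" for b
    proof (rule tendsto_upperbound[OF _ _ nt])
      obtain i where i: "b = axis i 1" using b by (auto simp: Basis_vec_def)
      have gc: "gradient u x \<bullet> b = pd b u x" for u x
        by (simp add: gradient_def iterated_partial_1 i inner_axis del: iterated_partial.simps)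
      show "((\<lambda>x. \<bar>(gradient u1 x - gradient u2 x) \<bullet> b - t * (pd b v\<^sub>1 x - pd b v\<^sub>2 x)\<bar>)
          \<longlongrightarrow> \<bar>(L1 - L2) \<bullet> b - t * (G \<bullet> b)\<bar>) (at z within \<Omega>)"
        by (intro tendsto_intros L G b)
      have "\<bar>(gradient u1 x - gradient u2 x) \<bullet> b - t * (pd b v\<^sub>1 x - pd b v\<^sub>2 x)\<bar> \<le> 2 * e * t" if "x \<in> \<Omega>" for x
        using d1(5)[OF t(2) one_le_numeral singleton_partial_dirs[OF b] that]
          d2(5)[OF t(3) one_le_numeral singleton_partial_dirs[OF b] that] t(1)
        unfolding iterated_partial_1 u1_def[symmetric] u2_def[symmetric] \<eta>_def[abs_def, symmetric]
        by (simp add: inner_diff_left gc algebra_simps)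
      then show "\<forall>\<^sub>F x in at z within \<Omega>. \<bar>(gradient u1 x - gradient u2 x) \<bullet> b - t * (pd b v\<^sub>1 x - pd b v\<^sub>2 x)\<bar> \<le> 2 * e * t"
        by (simp add: eventually_at_filter)
    qed
    moreover have "(\<Sum>b\<in>Basis. (\<nu> \<bullet> b) * ((L1 - L2) \<bullet> b - t * (G \<bullet> b))) = \<nu> \<bullet> (L1 - L2) - t * (\<nu> \<bullet> G)"
      by (simp only: euclidean_inner[of \<nu> "L1 - L2"] euclidean_inner[of \<nu> G] right_diff_distrib sum_subtractf
          sum_distrib_left mult.left_commute[of t])
    ultimately have "t * \<bar>\<nu> \<bullet> G\<bar> = \<bar>\<Sum>b\<in>Basis. (\<nu> \<bullet> b) * ((L1 - L2) \<bullet> b - t * (G \<bullet> b))\<bar>"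
      using t(1) by (simp add: abs_mult)
    also have "\<dots> \<le> (\<Sum>b\<in>Basis. \<bar>\<nu> \<bullet> b\<bar> * (2 * e * t))"
      using \<open>\<And>b. b \<in> Basis \<Longrightarrow> \<bar>(L1 - L2) \<bullet> b - t * (G \<bullet> b)\<bar> \<le> 2 * e * t\<close>
      by (intro order_trans[OF sum_abs] sum_mono) (auto simp: abs_mult intro!: mult_left_mono)
    also have "\<dots> = t * (e * (2 * (\<Sum>b\<in>Basis. \<bar>\<nu> \<bullet> b\<bar>)))" by (simp add: sum_distrib_right[symmetric])
    finally show ?thesis using t(1) by (simp only: mult_le_cancel_left_pos)
  qed
  then have bound: "\<bar>\<nu> \<bullet> G\<bar> \<le> e * (2 * (\<Sum>b\<in>Basis. \<bar>\<nu> \<bullet> b\<bar>))" if "0 < e" for e using that by blast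
  \<comment> \<open>The summand 1 makes the divisor positive whatever the value of \<nu>.\<close>
  define K where "K = 2 * (\<Sum>b\<in>Basis. \<bar>\<nu> \<bullet> b\<bar>) + 1"
  have K: "K > 0" by (simp add: K_def add_nonneg_pos sum_nonneg)
  have "\<bar>\<nu> \<bullet> G\<bar> \<le> 0 + e" if "0 < e" for e
  proof -
    have "\<bar>\<nu> \<bullet> G\<bar> \<le> e / K * (2 * (\<Sum>b\<in>Basis. \<bar>\<nu> \<bullet> b\<bar>))" using bound[of "e / K"] that K by simp
    also have "\<dots> \<le> e / K * K" using that K by (intro mult_left_mono) (auto simp: K_def)
    finally show ?thesis using K by simp
  qed
  then have "\<bar>\<nu> \<bullet> G\<bar> \<le> 0" by (rule field_le_epsilon)
  then show ?thesis by (simp add: \<nu>_def)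
qed

text \<open>The difference of the two functions vanishes on the frontier, which kills the tangential
  part of its boundary gradient; the normal part is killed by the equality of the Cauchy
  data.\<close>

lemma linearized_gradients_agree:
  fixes \<Omega> :: "(real^'n) set"
  assumes \<Omega>: "holder_domain 2 \<alpha> \<Omega>" and z: "z \<in> frontier \<Omega>"
    and lin1: "linearized \<alpha> \<Omega> a\<^sub>1 \<delta>\<^sub>1 V\<^sub>1 h v\<^sub>1" and lin2: "linearized \<alpha> \<Omega> a\<^sub>2 \<delta>\<^sub>2 V\<^sub>2 h v\<^sub>2"
    and eq: "nonlinear_cauchy_data \<alpha> \<Omega> a\<^sub>1 \<delta>\<^sub>1 V\<^sub>1 = nonlinear_cauchy_data \<alpha> \<Omega> a\<^sub>2 \<delta>\<^sub>2 V\<^sub>2"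
    and b: "b \<in> Basis"
  shows "((\<lambda>x. pd b v\<^sub>1 x - pd b v\<^sub>2 x) \<longlongrightarrow> 0) (at z within \<Omega>)"
proof -
  have op: "open \<Omega>" using \<Omega> by (simp add: holder_domain_def)
  have v: "holder_on 2 \<alpha> \<Omega> v\<^sub>1" "holder_on 2 \<alpha> \<Omega> v\<^sub>2" using lin1 lin2 by (auto simp: linearized_def)
  have dif: "v\<^sub>1 differentiable (at x)" "v\<^sub>2 differentiable (at x)" if "x \<in> \<Omega>" for x
    using v[THEN holder_on_C_k_on] that by (auto intro: C_k_on_imp_differentiable)
  have zcl: "z \<in> closure \<Omega>" using z by (simp add: frontier_def)
  have "\<exists>L. ((\<lambda>x. pd b v\<^sub>1 x - pd b v\<^sub>2 x) \<longlongrightarrow> L) (at z within \<Omega>)" if b: "b \<in> Basis" for b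
  proof -
    obtain L1 where "(pd b v\<^sub>1 \<longlongrightarrow> L1) (at z within \<Omega>)"
      using pd_limit[OF v(1) b zcl] by blast
    moreover obtain L2 where "(pd b v\<^sub>2 \<longlongrightarrow> L2) (at z within \<Omega>)"
      using pd_limit[OF v(2) b zcl] by blast
    ultimately show ?thesis by (blast intro: tendsto_diff)
  qed
  then obtain L where L: "\<And>b. b \<in> Basis \<Longrightarrow> ((\<lambda>x. pd b v\<^sub>1 x - pd b v\<^sub>2 x) \<longlongrightarrow> L b) (at z within \<Omega>)" by metis
  define G where "G = (\<Sum>b\<in>Basis. L b *\<^sub>R b)"
  have G: "((\<lambda>x. pd b v\<^sub>1 x - pd b v\<^sub>2 x) \<longlongrightarrow> G \<bullet> b) (at z within \<Omega>)" if "b \<in> Basis" for b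
    using L[OF that] that by (simp add: G_def)
  define w where "w x = v\<^sub>1 x - v\<^sub>2 x" for x
  have pdw: "pd b w x = pd b v\<^sub>1 x - pd b v\<^sub>2 x" if "x \<in> \<Omega>" for b x
    unfolding w_def by (intro pd_eqI has_derivative_diff has_derivative_pd dif that)
  obtain r e \<gamma> where "boundary_graph \<Omega> z r e \<gamma>"
    using holder_domain_boundary_graph[of 1 \<alpha> \<Omega> z] \<Omega> z unfolding Suc_1 by blast
  then interpret boundary_graph \<Omega> z r e \<gamma> .
  have "G = 0"
  proof (rule gradient_limit_zero[of w])
    show "continuous_on (closure \<Omega>) w"
      unfolding w_def using v by (auto simp: holder_on_def intro!: continuous_intros)
    show "w x = 0" if "x \<in> frontier \<Omega>" for x
      using linearized_boundary[OF lin1 that] linearized_boundary[OF lin2 that] by (simp add: w_def)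
    show "w differentiable (at x)" if "x \<in> \<Omega>" for x
      unfolding w_def using dif[OF that] by simp
    show "(pd b w \<longlongrightarrow> G \<bullet> b) (at z within \<Omega>)" if "b \<in> Basis" for b
      using G[OF that] by (rule Lim_transform_eventually) (auto simp: eventually_at_filter pdw)
    show "exterior_normal \<Omega> z \<bullet> G = 0"
      by (rule linearized_normal_derivative[OF op z lin1 lin2 eq G])
  qed
  then show ?thesis using G[OF b] by simp
qed

subsection \<open>The conductivity equation\<close>

definition lap :: "('a::euclidean_space \<Rightarrow> 'b::real_normed_vector) \<Rightarrow> 'a \<Rightarrow> 'b" where
  "lap u x = (\<Sum>b\<in>Basis. pd b (pd b u) x)"

text \<open>The equation \<open>div (\<rho> \<nabla>v) = 0\<close> with the divergence carried out,
  required pointwise inside \<Omega>.\<close>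

definition conductivity_solution :: "('a::euclidean_space \<Rightarrow> real) \<Rightarrow> 'a set \<Rightarrow> ('a \<Rightarrow> real) \<Rightarrow> bool" where
  "conductivity_solution \<rho> \<Omega> v \<longleftrightarrow>
     (\<forall>x\<in>\<Omega>. \<rho> x * lap v x + (\<Sum>b\<in>Basis. pd b \<rho> x * pd b v x) = 0)"

lemma pd_mult:
  fixes u v :: "'a::euclidean_space \<Rightarrow> real"
  assumes "u differentiable (at x)" "v differentiable (at x)"
  shows "pd b (\<lambda>x. u x * v x) x = u x * pd b v x + pd b u x * v x"
  using has_derivative_mult[OF assms[THEN has_derivative_pd]] by (rule pd_eqI)

lemma pd_diff:
  assumes "u differentiable (at x)" "v differentiable (at x)"
  shows "pd b (\<lambda>x. u x - v x) x = pd b u x - pd b v x"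
  using has_derivative_diff[OF assms[THEN has_derivative_pd]] by (rule pd_eqI)

lemma bounded_image_add:
  fixes f g :: "'a \<Rightarrow> 'b::real_normed_vector"
  assumes "bounded (f ` S)" "bounded (g ` S)"
  shows "bounded ((\<lambda>x. f x + g x) ` S)"
proof -
  obtain M N where "\<And>x. x \<in> S \<Longrightarrow> norm (f x) \<le> M" "\<And>x. x \<in> S \<Longrightarrow> norm (g x) \<le> N"
    using assms by (auto simp: bounded_iff)
  then show ?thesis
    unfolding bounded_iff by (intro exI[of _ "M + N"]) (auto intro!: norm_triangle_le add_mono)
qed

lemma bounded_image_mult:
  fixes f g :: "'a \<Rightarrow> real"
  assumes "bounded (f ` S)" "bounded (g ` S)"
  shows "bounded ((\<lambda>x. f x * g x) ` S)"
proof -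
  obtain M N where MN: "\<And>x. x \<in> S \<Longrightarrow> norm (f x) \<le> M" "\<And>x. x \<in> S \<Longrightarrow> norm (g x) \<le> N"
    using assms by (auto simp: bounded_iff)
  have "norm (f x * g x) \<le> M * N" if "x \<in> S" for x
    using mult_mono[OF MN[OF that]] norm_ge_zero[of "f x"] MN(1)[OF that]
    by (simp add: abs_mult)
  then show ?thesis unfolding bounded_iff by (intro exI[of _ "M * N"]) auto
qed

lemma bounded_image_uminus:
  "bounded (f ` S) \<Longrightarrow> bounded ((\<lambda>x. - f x :: 'b::real_normed_vector) ` S)"
  by (auto simp: bounded_iff)

lemma bounded_image_diff:
  fixes f g :: "'a \<Rightarrow> 'b::real_normed_vector"
  assumes "bounded (f ` S)" "bounded (g ` S)"
  shows "bounded ((\<lambda>x. f x - g x) ` S)"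
  using bounded_image_add[OF assms(1) bounded_image_uminus[OF assms(2)]] by simp

lemma bounded_image_sum:
  fixes f :: "'i \<Rightarrow> 'a \<Rightarrow> 'b::real_normed_vector"
  shows "(\<And>i. i \<in> I \<Longrightarrow> bounded (f i ` S)) \<Longrightarrow> bounded ((\<lambda>x. \<Sum>i\<in>I. f i x) ` S)"
proof (induction I rule: infinite_finite_induct)
  case (insert i I)
  then show ?case using bounded_image_add[of "f i" S "\<lambda>x. \<Sum>i\<in>I. f i x"] by simp
qed (auto simp: bounded_iff)

lemma bounded_image_continuous:
  fixes f :: "'a::euclidean_space \<Rightarrow> 'b::real_normed_vector"
  assumes "bounded S" "continuous_on UNIV f"
  shows "bounded (f ` S)"
proof -
  have "compact (f ` closure S)"
    using assms by (intro compact_continuous_image) (auto intro: continuous_on_subset)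
  then show ?thesis using closure_subset by (metis bounded_subset compact_imp_bounded image_mono)
qed

lemmas bounded_images = bounded_image_add bounded_image_mult bounded_image_diff bounded_image_sum

lemma integral_divergence_eq_0:
  fixes F :: "'a::euclidean_space \<Rightarrow> 'a \<Rightarrow> real"
  assumes \<Omega>: "open \<Omega>" "bounded \<Omega>" "negligible (frontier \<Omega>)"
    and C1: "\<And>b. b \<in> Basis \<Longrightarrow> C_k_on 1 \<Omega> (F b)"
    and bnd: "\<And>b. b \<in> Basis \<Longrightarrow> bounded (pd b (F b) ` \<Omega>)"
    and lim: "\<And>b x. b \<in> Basis \<Longrightarrow> x \<in> frontier \<Omega> \<Longrightarrow> (F b \<longlongrightarrow> 0) (at x within \<Omega>)"
  shows "(LINT x:\<Omega>|lborel. \<Sum>b\<in>Basis. pd b (F b) x) = 0"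
proof -
  have "set_integrable lborel \<Omega> (pd b (F b))" if "b \<in> Basis" for b
    using C1[OF that] bnd[OF that] \<Omega> that
    by (intro set_integrable_continuous_bounded) (auto simp: C_k_on_Suc C_k_on_0)
  then have "(LINT x:\<Omega>|lborel. \<Sum>b\<in>Basis. pd b (F b) x) = (\<Sum>b\<in>Basis. LINT x:\<Omega>|lborel. pd b (F b) x)"
    unfolding set_lebesgue_integral_def set_integrable_def
    by (subst Bochner_Integration.integral_sum[symmetric]) (simp_all add: sum_distrib_left)
  also have "\<dots> = 0"
  proof (intro sum.neutral ballI integral_pd_eq_0[OF \<Omega>])
    fix b x assume "b \<in> (Basis :: 'a set)" "x \<in> \<Omega>"
    then show "F b differentiable (at x)" using C1 by (auto simp: C_k_on_Suc)
  qed (use bnd lim in auto)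
  finally show ?thesis .
qed

lemma continuous_nonneg_integral_zero:
  fixes f :: "'a::euclidean_space \<Rightarrow> real"
  assumes "open \<Omega>" "bounded \<Omega>" and f: "continuous_on \<Omega> f" "bounded (f ` \<Omega>)"
    and nn: "\<And>x. x \<in> \<Omega> \<Longrightarrow> 0 \<le> f x" and 0: "(LINT x:\<Omega>|lborel. f x) = 0" and x: "x \<in> \<Omega>"
  shows "f x = 0"
proof (rule ccontr)
  assume nz: "f x \<noteq> 0"
  have "set_integrable lborel \<Omega> f" using assms by (intro set_integrable_continuous_bounded)
  then have "AE x in lborel. indicator \<Omega> x *\<^sub>R f x = 0"
    using 0 nn unfolding set_integrable_def set_lebesgue_integral_def
    by (subst integral_nonneg_eq_0_iff_AE[symmetric]) (auto simp: indicator_def)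
  then obtain N where N: "N \<in> null_sets lborel" "{x \<in> space lborel. indicator \<Omega> x *\<^sub>R f x \<noteq> 0} \<subseteq> N"
    by (rule AE_E3) auto
  define W where "W = {x \<in> \<Omega>. f x \<noteq> 0}"
  have "W = \<Omega> \<inter> f -` (- {0})" by (auto simp: W_def)
  moreover have "open (- {0::real})" by (simp add: open_Compl)
  ultimately have "open W" using continuous_open_preimage[OF f(1) assms(1), of "- {0}"] by simp
  moreover have "W \<noteq> {}" using x nz by (auto simp: W_def)
  moreover have "W \<subseteq> N" using N(2) by (auto simp: W_def indicator_def split: if_splits)
  then have "negligible W"
    using N(1) negligible_iff_null_sets negligible_subset null_sets_completionI by blast
  ultimately show False using open_not_negligible by blast
qed

lemma zero_gradient_imp_zero:
  fixes w :: "'a::euclidean_space \<Rightarrow> real"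
  assumes \<Omega>: "open \<Omega>" "connected \<Omega>" "bounded \<Omega>"
    and w: "continuous_on (closure \<Omega>) w" "\<And>x. x \<in> frontier \<Omega> \<Longrightarrow> w x = 0"
      "\<And>x. x \<in> \<Omega> \<Longrightarrow> w differentiable (at x)"
    and 0: "\<And>b x. b \<in> Basis \<Longrightarrow> x \<in> \<Omega> \<Longrightarrow> pd b w x = 0"
    and x: "x \<in> \<Omega>"
  shows "w x = 0"
proof -
  have "(w has_derivative (\<lambda>h. 0)) (at y within \<Omega>)" if "y \<in> \<Omega>" for y
  proof -
    have "pd h w y = 0" for h using 0 that by (subst pd_euclidean[OF w(3)[OF that]]) simp
    then show ?thesis using has_derivative_pd[OF w(3)[OF that]] by (simp add: has_derivative_at_withinI)
  qed
  then have "w constant_on \<Omega>"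
    using w(1) \<Omega> closure_subset[of \<Omega>]
    by (intro has_derivative_zero_connected_constant_on[of _ "{}"]) (auto intro: continuous_on_subset)
  then obtain c where c: "\<And>y. y \<in> \<Omega> \<Longrightarrow> w y = c" by (auto simp: constant_on_def)
  \<comment> \<open>Boundedness provides a frontier point, which carries the value 0 over to the
    constant.\<close>
  have "\<Omega> \<noteq> UNIV" using \<Omega>(3) not_bounded_UNIV by blast
  then obtain p where p: "p \<in> frontier \<Omega>" using frontier_not_empty x by blast
  have "w p = c"
    using continuous_constant_on_closure[OF w(1), of c p] c p by (auto simp: frontier_def)
  then show ?thesis using c[OF x] w(2)[OF p] by simp
qed

lemma holder_on_2_facts:
  assumes v: "holder_on 2 \<alpha> \<Omega> v" and b: "b \<in> Basis" "c \<in> Basis"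
  shows "C_k_on 1 \<Omega> v" "C_k_on 1 \<Omega> (pd b v)" "bounded (v ` \<Omega>)" "bounded (pd b v ` \<Omega>)" "bounded (pd c (pd b v) ` \<Omega>)"
proof -
  have 2: "C_k_on (Suc 1) \<Omega> v" using holder_on_C_k_on[OF v] by (simp add: numeral_2_eq_2)
  show "C_k_on 1 \<Omega> v" using 2 by (rule C_k_on_mono) simp
  show "C_k_on 1 \<Omega> (pd b v)" using 2 b(1) by (rule C_k_on_pd)
  show "bounded (v ` \<Omega>)" using holder_on_bounded[OF v, of 0 "[]"] by simp
  show "bounded (pd b v ` \<Omega>)"
    using holder_on_bounded[OF v one_le_numeral singleton_partial_dirs[OF b(1)]] by (simp only: iterated_partial_1)
  show "bounded (pd c (pd b v) ` \<Omega>)"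
    using holder_on_bounded[OF v order_refl pair_partial_dirs[OF b(2,1)]] by (simp only: iterated_partial_2)
qed

text \<open>Energy argument: for a solution w the divergence of \<open>\<rho> w \<nabla>w\<close> is
  \<rho> times the squared length of the gradient, and this field tends to 0 at the boundary because
  w does and its gradient has a limit. So the gradient vanishes and w is constant.\<close>

lemma conductivity_solution_unique:
  fixes w :: "'a::euclidean_space \<Rightarrow> real"
  assumes \<Omega>: "open \<Omega>" "connected \<Omega>" "bounded \<Omega>" "negligible (frontier \<Omega>)"
    and \<rho>: "C_k_on 1 UNIV \<rho>" "\<And>x. 0 < \<rho> x"
    and w: "holder_on 2 \<alpha> \<Omega> w" "\<And>x. x \<in> frontier \<Omega> \<Longrightarrow> w x = 0"
    and sol: "conductivity_solution \<rho> \<Omega> w"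
    and x: "x \<in> \<Omega>"
  shows "w x = 0"
proof -
  note wf = holder_on_2_facts[OF w(1)]
  have d: "\<rho> differentiable (at y)" for y using \<rho>(1) by (rule C_k_on_imp_differentiable) auto
  have dw: "w differentiable (at y)" if "y \<in> \<Omega>" for y
    using holder_on_C_k_on[OF w(1)] by (rule C_k_on_imp_differentiable) (use that in auto)
  have dpw: "pd b w differentiable (at y)" if "y \<in> \<Omega>" "b \<in> Basis" for y b
    using wf(2)[OF that(2,2)] by (rule C_k_on_imp_differentiable) (use that in auto)
  have \<rho>\<Omega>: "C_k_on 1 \<Omega> \<rho>" using \<rho>(1) C_k_on_subset by blast
  have b\<rho>: "bounded (\<rho> ` \<Omega>)" "\<And>b. b \<in> Basis \<Longrightarrow> bounded (pd b \<rho> ` \<Omega>)"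
    using \<rho>(1) C_k_on_imp_continuous_on[OF \<rho>(1)]
    by (auto intro!: bounded_image_continuous \<Omega>(3) simp: C_k_on_Suc C_k_on_0)
  define F where "F b x = (\<rho> x * w x) * pd b w x" for b x
  define E where "E x = \<rho> x * (\<Sum>b\<in>Basis. pd b w x * pd b w x)" for x
  have pdF: "pd b (F b) y = (\<rho> y * w y) * pd b (pd b w) y + (\<rho> y * pd b w y + pd b \<rho> y * w y) * pd b w y"
    if "y \<in> \<Omega>" "b \<in> Basis" for b y
    unfolding F_def using that d dw dpw by (subst pd_mult) (auto simp: pd_mult)
  have E: "(\<Sum>b\<in>Basis. pd b (F b) y) = E y" if y: "y \<in> \<Omega>" for y
  proof -
    have "(\<Sum>b\<in>Basis. pd b (F b) y) = (\<Sum>b\<in>Basis. w y * (\<rho> y * pd b (pd b w) y) + w y * (pd b \<rho> y * pd b w y)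
        + \<rho> y * (pd b w y * pd b w y))"
      using pdF[OF y] by (intro sum.cong) (auto simp: algebra_simps)
    also have "\<dots> = w y * (\<rho> y * lap w y + (\<Sum>b\<in>Basis. pd b \<rho> y * pd b w y)) + E y"
      by (simp add: sum.distrib sum_distrib_left lap_def E_def distrib_left)
    also have "\<dots> = E y" using sol y by (simp add: conductivity_solution_def)
    finally show ?thesis .
  qed
  have "(LINT y:\<Omega>|lborel. \<Sum>b\<in>Basis. pd b (F b) y) = 0"
  proof (rule integral_divergence_eq_0[OF \<Omega>(1,3,4)])
    fix b :: 'a assume b: "b \<in> Basis"
    show "C_k_on 1 \<Omega> (F b)" unfolding F_def by (intro C_k_on_mult \<Omega>(1) \<rho>\<Omega> wf(1)[OF b b] wf(2)[OF b b])
    have "bounded ((\<lambda>y. (\<rho> y * w y) * pd b (pd b w) y + (\<rho> y * pd b w y + pd b \<rho> y * w y) * pd b w y) ` \<Omega>)"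
      by (intro bounded_images b\<rho> wf[OF b b] b)
    then show "bounded (pd b (F b) ` \<Omega>)" using pdF[OF _ b] by (simp cong: image_cong)
    fix z assume z: "z \<in> frontier \<Omega>"
    then have zcl: "z \<in> closure \<Omega>" by (simp add: frontier_def)
    obtain L where L: "(pd b w \<longlongrightarrow> L) (at z within \<Omega>)" using pd_limit[OF w(1) b zcl] by blast
    have "(w \<longlongrightarrow> w z) (at z within closure \<Omega>)"
      using w(1) zcl by (auto simp: holder_on_def continuous_on_def)
    then have w0: "(w \<longlongrightarrow> 0) (at z within \<Omega>)"
      using w(2)[OF z] tendsto_within_subset[OF _ closure_subset] by fastforce
    have "isCont \<rho> z" using d differentiable_imp_continuous_within by blast
    then have "(\<rho> \<longlongrightarrow> \<rho> z) (at z within \<Omega>)" using continuous_at_imp_continuous_within continuous_within by blast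
    then show "(F b \<longlongrightarrow> 0) (at z within \<Omega>)"
      unfolding F_def using tendsto_mult[OF tendsto_mult[OF _ w0] L, of \<rho> "\<rho> z"] by simp
  qed
  moreover have "(LINT y:\<Omega>|lborel. \<Sum>b\<in>Basis. pd b (F b) y) = (LINT y:\<Omega>|lborel. E y)"
    using E by (intro set_lebesgue_integral_cong) (use \<Omega>(1) in auto)
  ultimately have int: "(LINT y:\<Omega>|lborel. E y) = 0" by simp
  have zero: "E y = 0" if "y \<in> \<Omega>" for y
  proof (rule continuous_nonneg_integral_zero[OF \<Omega>(1,3) _ _ _ int that])
    show "continuous_on \<Omega> E"
      unfolding E_def using \<rho>\<Omega> wf(2)[THEN C_k_on_imp_continuous_on]
      by (intro continuous_intros) (auto dest: C_k_on_imp_continuous_on)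
    show "bounded (E ` \<Omega>)" unfolding E_def by (intro bounded_images b\<rho> wf(4))
    show "0 \<le> E y" for y unfolding E_def using \<rho>(2)[of y] by (intro mult_nonneg_nonneg[OF _ sum_nonneg]) auto
  qed
  show ?thesis
  proof (rule zero_gradient_imp_zero[OF \<Omega>(1-3) _ w(2) dw _ x])
    show "continuous_on (closure \<Omega>) w" using w(1) by (simp add: holder_on_def)
    show "pd b w y = 0" if "b \<in> Basis" "y \<in> \<Omega>" for b y
    proof -
      have "(\<Sum>b\<in>Basis. pd b w y * pd b w y) = 0" using zero[OF that(2)] \<rho>(2)[of y] by (simp add: E_def)
      then have "pd b w y * pd b w y = 0" using that(1) by (simp add: sum_nonneg_eq_0_iff)
      then show ?thesis by simp
    qed
  qed
qed

text \<open>Liouville transform: with a the square root of \<rho> and \<open>u = a z\<close>, the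
  expression \<open>a \<Delta>u - u \<Delta>a\<close> is the divergence of
  \<open>a^2 \<nabla>z\<close>.\<close>

lemma schroedinger_imp_conductivity:
  fixes \<rho> :: "'a::euclidean_space \<Rightarrow> real"
  assumes \<rho>: "\<And>k. C_k_on k UNIV \<rho>" "\<And>x. 0 < \<rho> x" and u: "C_k_on 3 UNIV u"
    and eq: "\<And>x. x \<in> \<Omega> \<Longrightarrow> lap u x = lap (\<lambda>x. \<rho> x powr (1/2)) x / \<rho> x powr (1/2) * u x"
  shows "C_k_on 3 UNIV (\<lambda>x. u x / \<rho> x powr (1/2))" "conductivity_solution \<rho> \<Omega> (\<lambda>x. u x / \<rho> x powr (1/2))"
proof -
  define a where "a x = \<rho> x powr (1/2)" for x
  define z where "z x = u x / a x" for x
  have a: "C_k_on k UNIV a" for k unfolding a_def[abs_def] by (intro C_k_on_powr \<rho> open_UNIV)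
  have apos: "0 < a x" for x using \<rho>(2)[of x] by (simp add: a_def powr_gt_zero)
  have z: "C_k_on 3 UNIV z" unfolding z_def[abs_def] by (intro C_k_on_divide u a apos open_UNIV)
  then show "C_k_on 3 UNIV (\<lambda>x. u x / \<rho> x powr (1/2))" by (simp add: z_def[abs_def] a_def)
  have uz: "u = (\<lambda>x. a x * z x)" using apos by (simp add: z_def fun_eq_iff less_imp_neq[THEN not_sym])
  have \<rho>a: "\<rho> = (\<lambda>x. a x * a x)" using \<rho>(2) by (auto simp: a_def powr_add[symmetric] less_imp_le)
  have d: "a differentiable (at x)" "z differentiable (at x)" for x
    using a[of 1] z by (auto intro: C_k_on_imp_differentiable)
  have d': "pd b a differentiable (at x)" "pd b z differentiable (at x)" if "b \<in> Basis" for b x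
    using C_k_on_pd[OF a[of 2, unfolded numeral_2_eq_2] that] C_k_on_pd[OF z[unfolded numeral_3_eq_3] that]
    by (auto intro: C_k_on_imp_differentiable)
  have pdu: "pd b u = (\<lambda>x. a x * pd b z x + pd b a x * z x)" for b
    unfolding uz by (intro ext pd_mult d)
  have "pd b (pd b u) x = a x * pd b (pd b z) x + 2 * (pd b a x * pd b z x) + pd b (pd b a) x * z x" if b: "b \<in> Basis" for b x
  proof -
    have "pd b (pd b u) x = (a x * pd b (pd b z) x + pd b a x * pd b z x) + (pd b a x * pd b z x + pd b (pd b a) x * z x)"
      unfolding pdu by (rule pd_eqI[of _ "\<lambda>h. (a x * pd h (pd b z) x + pd h a x * pd b z x) + (pd b a x * pd h z x + pd h (pd b a) x * z x)"])
        (intro has_derivative_add has_derivative_mult has_derivative_pd d d'[OF b])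
    then show ?thesis by simp
  qed
  then have lapu: "lap u x = a x * lap z x + 2 * (\<Sum>b\<in>Basis. pd b a x * pd b z x) + lap a x * z x" for x
    by (simp add: lap_def sum.distrib sum_distrib_left sum_distrib_right)
  have pd\<rho>: "pd b \<rho> x = 2 * a x * pd b a x" for b x
    by (subst \<rho>a, subst pd_mult[OF d(1) d(1)]) simp
  have "conductivity_solution \<rho> \<Omega> z"
    unfolding conductivity_solution_def
  proof
    fix x assume x: "x \<in> \<Omega>"
    have "lap u x = lap a x * z x" using eq[OF x] by (simp add: a_def[abs_def] z_def)
    then have 0: "a x * lap z x + 2 * (\<Sum>b\<in>Basis. pd b a x * pd b z x) = 0" using lapu[of x] by simp
    have "\<rho> x * lap z x + (\<Sum>b\<in>Basis. pd b \<rho> x * pd b z x) =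
       a x * (a x * lap z x + 2 * (\<Sum>b\<in>Basis. pd b a x * pd b z x))"
      using fun_cong[OF \<rho>a, of x] by (simp add: pd\<rho> distrib_left sum_distrib_left mult.assoc mult.left_commute)
    then show "\<rho> x * lap z x + (\<Sum>b\<in>Basis. pd b \<rho> x * pd b z x) = 0" using 0 by simp
  qed
  then show "conductivity_solution \<rho> \<Omega> (\<lambda>x. u x / \<rho> x powr (1/2))" by (simp add: z_def[abs_def] a_def)
qed

text \<open>The assumption \<open>cauchy\<close> records what the nonlinear data yield: for smooth
  boundary values, solutions of both equations whose gradients agree at the boundary as limits from
  inside. The nonlinear problem enters the rest of the argument only through it.\<close>

locale conductivity_pair =
  fixes \<Omega> :: "'a::euclidean_space set" and \<alpha> :: real and \<rho>\<^sub>1 \<rho>\<^sub>2 :: "'a \<Rightarrow> real"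
  assumes \<Omega>: "open \<Omega>" "connected \<Omega>" "bounded \<Omega>" "negligible (frontier \<Omega>)" and \<alpha>: "\<alpha> \<le> 1"
    and smooth: "\<And>k. C_k_on k UNIV \<rho>\<^sub>1" "\<And>k. C_k_on k UNIV \<rho>\<^sub>2"
    and pos: "\<And>x. 0 < \<rho>\<^sub>1 x" "\<And>x. 0 < \<rho>\<^sub>2 x"
    and boundary: "\<And>x. x \<in> frontier \<Omega> \<Longrightarrow> \<rho>\<^sub>1 x = \<rho>\<^sub>2 x"
    and cauchy: "\<And>h. C_k_on 3 UNIV h \<Longrightarrow> \<exists>v\<^sub>1 v\<^sub>2.
      holder_on 2 \<alpha> \<Omega> v\<^sub>1 \<and> conductivity_solution \<rho>\<^sub>1 \<Omega> v\<^sub>1 \<and> (\<forall>x\<in>frontier \<Omega>. v\<^sub>1 x = h x) \<and>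
      holder_on 2 \<alpha> \<Omega> v\<^sub>2 \<and> conductivity_solution \<rho>\<^sub>2 \<Omega> v\<^sub>2 \<and> (\<forall>x\<in>frontier \<Omega>. v\<^sub>2 x = h x) \<and>
      (\<forall>z\<in>frontier \<Omega>. \<forall>b\<in>Basis. ((\<lambda>x. pd b v\<^sub>1 x - pd b v\<^sub>2 x) \<longlongrightarrow> 0) (at z within \<Omega>))"
begin

text \<open>The geometric mean: its logarithmic gradient is the average of those of the two
  coefficients. With this average the first order terms in \<open>integral_product_identity\<close>
  combine to the gradient of \<open>gap\<close>.\<close>

definition "mean x = (\<rho>\<^sub>1 x * \<rho>\<^sub>2 x) powr (1/2)"
definition "gap x = ln (\<rho>\<^sub>1 x) - ln (\<rho>\<^sub>2 x)"

lemma differentiable_\<rho>: "\<rho>\<^sub>1 differentiable (at x)" "\<rho>\<^sub>2 differentiable (at x)"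
  using smooth[of 1] by (auto intro: C_k_on_imp_differentiable)

lemma mean_pos: "0 < mean x"
  using pos[of x] by (simp add: mean_def powr_gt_zero)

lemma mean_smooth: "C_k_on k UNIV mean"
  unfolding mean_def[abs_def] using smooth pos by (intro C_k_on_powr C_k_on_mult) auto

lemma gap_smooth: "C_k_on k UNIV gap"
  unfolding gap_def[abs_def] using smooth pos by (intro C_k_on_diff C_k_on_ln) auto

lemma pd_mean: "pd b mean x = mean x * (pd b \<rho>\<^sub>1 x / \<rho>\<^sub>1 x + pd b \<rho>\<^sub>2 x / \<rho>\<^sub>2 x) / 2"
proof -
  have "(mean has_derivative (\<lambda>h. (1/2 * (\<rho>\<^sub>1 x * \<rho>\<^sub>2 x) powr (1/2 - 1)) * (\<rho>\<^sub>1 x * pd h \<rho>\<^sub>2 x + pd h \<rho>\<^sub>1 x * \<rho>\<^sub>2 x))) (at x)"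
  proof -
    have "((\<lambda>t. t powr (1/2)) has_real_derivative 1/2 * (\<rho>\<^sub>1 x * \<rho>\<^sub>2 x) powr (1/2 - 1)) (at (\<rho>\<^sub>1 x * \<rho>\<^sub>2 x))"
      using pos[of x] by (intro has_real_derivative_powr) auto
    from has_derivative_compose[OF has_derivative_mult[OF differentiable_\<rho>[THEN has_derivative_pd]]
        this[unfolded has_field_derivative_def]]
    show ?thesis by (simp add: mean_def[abs_def])
  qed
  then have "pd b mean x = 1/2 * (\<rho>\<^sub>1 x * \<rho>\<^sub>2 x) powr (1/2 - 1) * (\<rho>\<^sub>1 x * pd b \<rho>\<^sub>2 x + pd b \<rho>\<^sub>1 x * \<rho>\<^sub>2 x)"
    by (rule pd_eqI)
  also have "(\<rho>\<^sub>1 x * \<rho>\<^sub>2 x) powr (1/2 - 1) = mean x / (\<rho>\<^sub>1 x * \<rho>\<^sub>2 x)"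
    using pos[of x] by (subst powr_diff) (simp_all add: mean_def)
  finally show ?thesis using pos[of x] by (simp add: field_simps)
qed

lemma pd_gap: "pd b gap x = pd b \<rho>\<^sub>1 x / \<rho>\<^sub>1 x - pd b \<rho>\<^sub>2 x / \<rho>\<^sub>2 x"
proof -
  have "(gap has_derivative (\<lambda>h. inverse (\<rho>\<^sub>1 x) * pd h \<rho>\<^sub>1 x - inverse (\<rho>\<^sub>2 x) * pd h \<rho>\<^sub>2 x)) (at x)"
    unfolding gap_def[abs_def] using pos[of x] differentiable_\<rho>[THEN has_derivative_pd, of x]
    by (auto intro!: derivative_eq_intros simp: divide_inverse)
  from pd_eqI[OF this] show ?thesis by (simp add: divide_inverse)
qed

text \<open>For solutions \<open>z\<close>, \<open>v\<close> of the two equations, the field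
  \<open>\<rho>\<^sub>1 (v\<^sub>1 \<nabla>z - z \<nabla>v\<^sub>1) + mean (z \<nabla>v - v \<nabla>z)\<close>, where \<open>v\<^sub>1\<close> solves the first equation with the
  boundary values of \<open>v\<close>, vanishes on the boundary because the Cauchy data agree; its first half is
  divergence free and the divergence of the second half involves only first derivatives.\<close>

lemma integral_product_identity:
  assumes z: "C_k_on 3 UNIV z" "conductivity_solution \<rho>\<^sub>1 \<Omega> z"
    and v: "C_k_on 3 UNIV v" "conductivity_solution \<rho>\<^sub>2 \<Omega> v"
  shows "(LINT x:\<Omega>|lborel. mean x * (\<Sum>b\<in>Basis. pd b gap x * pd b (\<lambda>x. z x * v x) x)) = 0"
proof -
  obtain v1 v2 where v1: "holder_on 2 \<alpha> \<Omega> v1" "conductivity_solution \<rho>\<^sub>1 \<Omega> v1" "\<And>x. x \<in> frontier \<Omega> \<Longrightarrow> v1 x = v x"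
    and v2: "holder_on 2 \<alpha> \<Omega> v2" "conductivity_solution \<rho>\<^sub>2 \<Omega> v2" "\<And>x. x \<in> frontier \<Omega> \<Longrightarrow> v2 x = v x"
    and gr: "\<And>y b. y \<in> frontier \<Omega> \<Longrightarrow> b \<in> Basis \<Longrightarrow> ((\<lambda>x. pd b v1 x - pd b v2 x) \<longlongrightarrow> 0) (at y within \<Omega>)"
    using cauchy[OF v(1)] by blast
  have vh: "holder_on 2 \<alpha> \<Omega> v" and zh: "holder_on 2 \<alpha> \<Omega> z"
    using v(1) z(1) \<Omega> \<alpha> by (auto intro!: C_k_on_imp_holder_on simp: numeral_3_eq_3)
  have dif2: "u differentiable (at x)" "b \<in> Basis \<Longrightarrow> pd b u differentiable (at x)"
    if "holder_on 2 \<alpha> \<Omega> u" "x \<in> \<Omega>" for u b x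
    using C_k_on_imp_differentiable[OF holder_on_C_k_on[OF that(1)] _ that(2)]
      C_k_on_imp_differentiable[OF holder_on_2_facts(2)[OF that(1)] _ that(2)] by auto
  \<comment> \<open>Uniqueness for the second equation identifies v2 with the given v inside
    \<Omega>, so the gradients of v1 and v agree at the boundary.\<close>
  have v2v: "v2 x = v x" if x: "x \<in> \<Omega>" for x
  proof -
    have "v2 x - v x = 0"
    proof (rule conductivity_solution_unique[OF \<Omega> smooth(2) pos(2) _ _ _ x, where w = "\<lambda>x. v2 x - v x"])
      show "holder_on 2 \<alpha> \<Omega> (\<lambda>x. v2 x - v x)" using \<Omega>(1) v2(1) vh by (rule holder_on_diff)
      show "v2 x - v x = 0" if "x \<in> frontier \<Omega>" for x using v2(3)[OF that] by simp
      show "conductivity_solution \<rho>\<^sub>2 \<Omega> (\<lambda>x. v2 x - v x)"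
        unfolding conductivity_solution_def
      proof
        fix y assume y: "y \<in> \<Omega>"
        have p: "pd b (\<lambda>x. v2 x - v x) x = pd b v2 x - pd b v x" if "x \<in> \<Omega>" for b x
          using dif2[OF v2(1) that] dif2[OF vh that] by (intro pd_diff)
        then have "pd b (pd b (\<lambda>x. v2 x - v x)) y = pd b (\<lambda>x. pd b v2 x - pd b v x) y" for b
          by (intro pd_cong_open[OF \<Omega>(1) y])
        then have "pd b (pd b (\<lambda>x. v2 x - v x)) y = pd b (pd b v2) y - pd b (pd b v) y" if "b \<in> Basis" for b
          using dif2(2)[OF v2(1) y that] dif2(2)[OF vh y that] by (simp add: pd_diff)
        then have l: "lap (\<lambda>x. v2 x - v x) y = lap v2 y - lap v y" by (simp add: lap_def sum_subtractf)
        have s: "\<rho>\<^sub>2 y * lap v2 y + (\<Sum>b\<in>Basis. pd b \<rho>\<^sub>2 y * pd b v2 y) = 0"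
           "\<rho>\<^sub>2 y * lap v y + (\<Sum>b\<in>Basis. pd b \<rho>\<^sub>2 y * pd b v y) = 0"
          using v2(2) v(2) y by (auto simp: conductivity_solution_def)
        then show "\<rho>\<^sub>2 y * lap (\<lambda>x. v2 x - v x) y + (\<Sum>b\<in>Basis. pd b \<rho>\<^sub>2 y * pd b (\<lambda>x. v2 x - v x) y) = 0"
          by (simp add: l p[OF y] right_diff_distrib sum_subtractf)
      qed
    qed
    then show ?thesis by simp
  qed
  define Y where "Y b x = \<rho>\<^sub>1 x * (v1 x * pd b z x - z x * pd b v1 x) + mean x * (z x * pd b v x - v x * pd b z x)" for b x
  have dm: "mean differentiable (at x)" for x using mean_smooth[of 1] by (auto intro: C_k_on_imp_differentiable)
  define D where "D b x = \<rho>\<^sub>1 x * (v1 x * pd b (pd b z) x + pd b v1 x * pd b z x - (z x * pd b (pd b v1) x + pd b z x * pd b v1 x))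
      + pd b \<rho>\<^sub>1 x * (v1 x * pd b z x - z x * pd b v1 x)
      + (mean x * (z x * pd b (pd b v) x + pd b z x * pd b v x - (v x * pd b (pd b z) x + pd b v x * pd b z x))
      + pd b mean x * (z x * pd b v x - v x * pd b z x))" for b x
  have pdY: "pd b (Y b) x = D b x" if b: "b \<in> Basis" and x: "x \<in> \<Omega>" for b x
  proof -
    note d = dif2[OF v1(1) x] dif2[OF zh x] dif2[OF vh x] dm differentiable_\<rho>
    have "(Y b has_derivative (\<lambda>h. \<rho>\<^sub>1 x * ((v1 x * pd h (pd b z) x + pd h v1 x * pd b z x) - (z x * pd h (pd b v1) x + pd h z x * pd b v1 x))
      + pd h \<rho>\<^sub>1 x * (v1 x * pd b z x - z x * pd b v1 x)
      + (mean x * ((z x * pd h (pd b v) x + pd h z x * pd b v x) - (v x * pd h (pd b z) x + pd h v x * pd b z x))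
      + pd h mean x * (z x * pd b v x - v x * pd b z x)))) (at x)"
      unfolding Y_def
      by (intro has_derivative_add has_derivative_mult has_derivative_diff has_derivative_pd d b)
    from pd_eqI[OF this] show ?thesis by (simp add: D_def)
  qed
  have main: "(\<Sum>b\<in>Basis. D b x) = (mean x * (\<Sum>b\<in>Basis. pd b gap x * pd b (\<lambda>x. z x * v x) x)) / 2"
    if x: "x \<in> \<Omega>" for x
  proof -
    have e: "\<rho>\<^sub>1 x * lap z x + (\<Sum>b\<in>Basis. pd b \<rho>\<^sub>1 x * pd b z x) = 0"
      "\<rho>\<^sub>1 x * lap v1 x + (\<Sum>b\<in>Basis. pd b \<rho>\<^sub>1 x * pd b v1 x) = 0"
      "\<rho>\<^sub>2 x * lap v x + (\<Sum>b\<in>Basis. pd b \<rho>\<^sub>2 x * pd b v x) = 0"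
      using z(2) v1(2) v(2) x by (auto simp: conductivity_solution_def)
    have l: "lap z x = - (\<Sum>b\<in>Basis. pd b \<rho>\<^sub>1 x * pd b z x) / \<rho>\<^sub>1 x" "lap v x = - (\<Sum>b\<in>Basis. pd b \<rho>\<^sub>2 x * pd b v x) / \<rho>\<^sub>2 x"
      using e(1,3) pos[of x] by (simp_all add: field_simps)
    have "(\<Sum>b\<in>Basis. D b x) =
        v1 x * (\<rho>\<^sub>1 x * lap z x + (\<Sum>b\<in>Basis. pd b \<rho>\<^sub>1 x * pd b z x))
        - z x * (\<rho>\<^sub>1 x * lap v1 x + (\<Sum>b\<in>Basis. pd b \<rho>\<^sub>1 x * pd b v1 x))
        + mean x * (z x * lap v x - v x * lap z x) + (\<Sum>b\<in>Basis. pd b mean x * (z x * pd b v x - v x * pd b z x))"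
      unfolding lap_def D_def
      by (simp add: sum.distrib sum_subtractf sum_distrib_left distrib_left right_diff_distrib mult.left_commute)
    also have "\<dots> = mean x * (z x * lap v x - v x * lap z x) + (\<Sum>b\<in>Basis. pd b mean x * (z x * pd b v x - v x * pd b z x))"
      by (simp only: e)
    also have "mean x * (z x * lap v x - v x * lap z x) =
        (\<Sum>b\<in>Basis. mean x * (v x * (pd b \<rho>\<^sub>1 x / \<rho>\<^sub>1 x) * pd b z x - z x * (pd b \<rho>\<^sub>2 x / \<rho>\<^sub>2 x) * pd b v x))"
      unfolding l by (simp add: sum_subtractf sum_distrib_left sum_divide_distrib right_diff_distrib mult.assoc)
    also have "\<dots> + (\<Sum>b\<in>Basis. pd b mean x * (z x * pd b v x - v x * pd b z x)) =
        (\<Sum>b\<in>Basis. mean x * (pd b gap x * (z x * pd b v x + pd b z x * v x)) / 2)"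
    proof -
      \<comment> \<open>A and B are the logarithmic derivatives of the two coefficients, p and q the
        values of z and v. The two parts add up to half of \<open>A - B\<close> times the derivative
        of the product.\<close>
      have "m * (q * A * p' - p * B * q') + m * (A + B) / 2 * (p * q' - q * p') = m * ((A - B) * (p * q' + p' * q)) / 2"
        for m p q p' q' A B :: real by (simp add: field_simps)
      then show ?thesis unfolding sum.distrib[symmetric] pd_mean pd_gap by (intro sum.cong refl)
    qed
    also have "\<dots> = (mean x * (\<Sum>b\<in>Basis. pd b gap x * (z x * pd b v x + pd b z x * v x))) / 2"
      by (simp add: sum_distrib_left sum_divide_distrib)
    finally show ?thesis using dif2(1)[OF zh x] dif2(1)[OF vh x] by (simp add: pd_mult)
  qed
  have cont\<rho>: "continuous_on UNIV \<rho>\<^sub>1" "continuous_on UNIV mean"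
    using smooth mean_smooth C_k_on_imp_continuous_on by blast+
  have "(LINT x:\<Omega>|lborel. \<Sum>b\<in>Basis. pd b (Y b) x) = 0"
  proof (rule integral_divergence_eq_0[OF \<Omega>(1,3,4)])
    fix b :: 'a assume b: "b \<in> Basis"
    note f = holder_on_2_facts[OF v1(1) b b] holder_on_2_facts[OF zh b b] holder_on_2_facts[OF vh b b]
    have "C_k_on 1 \<Omega> \<rho>\<^sub>1" "C_k_on 1 \<Omega> mean" using smooth mean_smooth C_k_on_subset by blast+
    then show "C_k_on 1 \<Omega> (Y b)"
      unfolding Y_def by (intro C_k_on_mult C_k_on_add C_k_on_diff \<Omega>(1) f)
    have "bounded (\<rho>\<^sub>1 ` \<Omega>)" "bounded (mean ` \<Omega>)" "bounded (pd b \<rho>\<^sub>1 ` \<Omega>)" "bounded (pd b mean ` \<Omega>)"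
      using cont\<rho> C_k_on_pd[OF smooth(1) b, of 0] C_k_on_pd[OF mean_smooth b, of 0]
      by (auto intro!: bounded_image_continuous \<Omega>(3) simp: C_k_on_0)
    then have "bounded (D b ` \<Omega>)"
      unfolding D_def by (intro bounded_images f)
    then show "bounded (pd b (Y b) ` \<Omega>)" using pdY[OF b] by (simp cong: image_cong)
    fix y assume y: "y \<in> frontier \<Omega>"
    then have ycl: "y \<in> closure \<Omega>" by (simp add: frontier_def)
    have lim: "(u \<longlongrightarrow> u y) (at y within \<Omega>)" if "holder_on 2 \<alpha> \<Omega> u" for u
      using that ycl closure_subset unfolding holder_on_def continuous_on_def by (metis tendsto_within_subset)
    have lim': "(u \<longlongrightarrow> u y) (at y within \<Omega>)" if "continuous_on UNIV u" for u
      using that unfolding continuous_on_def by (metis UNIV_I subset_UNIV tendsto_within_subset)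
    obtain Lz Lv L1 where L: "(pd b z \<longlongrightarrow> Lz) (at y within \<Omega>)" "(pd b v \<longlongrightarrow> Lv) (at y within \<Omega>)"
       "(pd b v1 \<longlongrightarrow> L1) (at y within \<Omega>)"
      using pd_limit[OF zh b ycl] pd_limit[OF vh b ycl] pd_limit[OF v1(1) b ycl] by blast
    have "((\<lambda>x. pd b v1 x - pd b v x) \<longlongrightarrow> 0) (at y within \<Omega>)"
    proof (rule Lim_transform_eventually[OF gr[OF y b]])
      show "\<forall>\<^sub>F x in at y within \<Omega>. pd b v1 x - pd b v2 x = pd b v1 x - pd b v x"
        using pd_cong_open[OF \<Omega>(1), of _ v2 v b] v2v by (simp add: eventually_at_filter)
    qed
    moreover have "((\<lambda>x. pd b v1 x - pd b v x) \<longlongrightarrow> L1 - Lv) (at y within \<Omega>)" by (intro tendsto_intros L)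
    moreover have "y \<notin> \<Omega>" using y \<Omega>(1) by (simp add: frontier_def interior_open)
    then have "at y within \<Omega> \<noteq> bot" using ycl by (simp add: trivial_limit_within islimpt_in_closure)
    ultimately have "L1 = Lv" using tendsto_unique by fastforce
    \<comment> \<open>Equal boundary values of the coefficients make the two weights coincide here;
      with \<open>v1 y = v y\<close> and \<open>L1 = Lv\<close> the two halves of the limit
      cancel.\<close>
    moreover have "mean y = \<rho>\<^sub>1 y"
      using boundary[OF y] pos[of y] by (simp add: mean_def powr_half_sqrt)
    ultimately have "\<rho>\<^sub>1 y * (v1 y * Lz - z y * L1) + mean y * (z y * Lv - v y * Lz) = 0"
      using v1(3)[OF y] by (simp add: algebra_simps)
    moreover have "(Y b \<longlongrightarrow> \<rho>\<^sub>1 y * (v1 y * Lz - z y * L1) + mean y * (z y * Lv - v y * Lz)) (at y within \<Omega>)"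
      unfolding Y_def by (intro tendsto_intros L lim lim' cont\<rho> zh vh v1(1))
    ultimately show "(Y b \<longlongrightarrow> 0) (at y within \<Omega>)" by simp
  qed
  moreover have "(LINT x:\<Omega>|lborel. \<Sum>b\<in>Basis. pd b (Y b) x) =
      (LINT x:\<Omega>|lborel. (mean x * (\<Sum>b\<in>Basis. pd b gap x * pd b (\<lambda>x. z x * v x) x)) / 2)"
    using pdY main by (intro set_lebesgue_integral_cong) (use \<Omega>(1) in auto)
  ultimately show ?thesis by simp
qed

text \<open>The integral of \<open>mean\<close> times the inner product of the gradients of
  \<open>gap\<close> and of \<open>G / mean\<close>, with the quotient rule carried out so that it
  is visibly linear in G and its first derivatives.\<close>

definition functional :: "('a \<Rightarrow> real) \<Rightarrow> real" where
  "functional G = (LINT x:\<Omega>|lborel. \<Sum>b\<in>Basis. pd b gap x * (pd b G x - G x * (pd b mean x / mean x)))"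

definition schroedinger :: "('a \<Rightarrow> real) \<Rightarrow> ('a \<Rightarrow> real) \<Rightarrow> bool" where
  "schroedinger \<rho> u \<longleftrightarrow> C_k_on 3 UNIV u \<and>
     (\<forall>x\<in>\<Omega>. lap u x = lap (\<lambda>x. \<rho> x powr (1/2)) x / \<rho> x powr (1/2) * u x)"

text \<open>Dividing each factor by the root of its coefficient gives two conductivity solutions,
  and the product of the two roots is \<open>mean\<close>; so \<open>G / mean\<close> is the product
  in \<open>integral_product_identity\<close>.\<close>

lemma functional_product:
  assumes u: "schroedinger \<rho>\<^sub>1 u\<^sub>1" "schroedinger \<rho>\<^sub>2 u\<^sub>2"
  shows "functional (\<lambda>x. u\<^sub>1 x * u\<^sub>2 x) = 0"
proof -
  note s1 = schroedinger_imp_conductivity[OF smooth(1) pos(1), of u\<^sub>1 \<Omega>]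
  note s2 = schroedinger_imp_conductivity[OF smooth(2) pos(2), of u\<^sub>2 \<Omega>]
  define z where "z x = u\<^sub>1 x / \<rho>\<^sub>1 x powr (1/2)" for x
  define v where "v x = u\<^sub>2 x / \<rho>\<^sub>2 x powr (1/2)" for x
  have zv: "C_k_on 3 UNIV z" "conductivity_solution \<rho>\<^sub>1 \<Omega> z" "C_k_on 3 UNIV v" "conductivity_solution \<rho>\<^sub>2 \<Omega> v"
    using s1 s2 u unfolding schroedinger_def z_def[abs_def] v_def[abs_def] by blast+
  have eq: "(\<lambda>x. u\<^sub>1 x * u\<^sub>2 x) = (\<lambda>x. mean x * (z x * v x))"
    using pos by (auto simp: fun_eq_iff mean_def z_def v_def powr_mult less_imp_le less_imp_neq[THEN not_sym])
  have "mean x * pd b (\<lambda>x. z x * v x) x = pd b (\<lambda>x. u\<^sub>1 x * u\<^sub>2 x) x - u\<^sub>1 x * u\<^sub>2 x * (pd b mean x / mean x)" for b x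
  proof -
    have "C_k_on 3 UNIV (\<lambda>x. z x * v x)" using zv by (intro C_k_on_mult open_UNIV)
    then have "(\<lambda>x. z x * v x) differentiable (at x)" by (rule C_k_on_imp_differentiable) auto
    moreover have "mean differentiable (at x)" using mean_smooth[of 1] by (auto intro: C_k_on_imp_differentiable)
    ultimately have "pd b (\<lambda>x. u\<^sub>1 x * u\<^sub>2 x) x = mean x * pd b (\<lambda>x. z x * v x) x + pd b mean x * (z x * v x)"
      unfolding eq by (intro pd_mult)
    then show ?thesis using fun_cong[OF eq, of x] mean_pos[of x] by simp
  qed
  then have "(\<Sum>b\<in>Basis. pd b gap x * (pd b (\<lambda>x. u\<^sub>1 x * u\<^sub>2 x) x - u\<^sub>1 x * u\<^sub>2 x * (pd b mean x / mean x))) =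
      mean x * (\<Sum>b\<in>Basis. pd b gap x * pd b (\<lambda>x. z x * v x) x)" for x
    unfolding sum_distrib_left by (intro sum.cong refl) (simp only: mult.left_commute[of "mean x"])
  then have "functional (\<lambda>x. u\<^sub>1 x * u\<^sub>2 x) = (LINT x:\<Omega>|lborel. mean x * (\<Sum>b\<in>Basis. pd b gap x * pd b (\<lambda>x. z x * v x) x))"
    unfolding functional_def by (simp only:)
  then show ?thesis using integral_product_identity[OF zv] by simp
qed

end

subsection \<open>Absolutely convergent exponential sums\<close>

text \<open>Finiteness of this sum controls N derivatives of the exponential sum uniformly. The
  index set is arbitrary: lattice points for potentials, lists of lattice points for
  solutions.\<close>

definition weighted_summable :: "nat \<Rightarrow> ('i \<Rightarrow> complex) \<Rightarrow> ('i \<Rightarrow> 'a::euclidean_space) \<Rightarrow> bool" where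
  "weighted_summable N C \<xi> \<longleftrightarrow> (\<lambda>i. norm (C i) * (1 + norm (\<xi> i)) ^ N) summable_on UNIV"

definition weighted_norm :: "nat \<Rightarrow> ('i \<Rightarrow> complex) \<Rightarrow> ('i \<Rightarrow> 'a::euclidean_space) \<Rightarrow> real" where
  "weighted_norm N C \<xi> = (\<Sum>\<^sub>\<infinity>i. norm (C i) * (1 + norm (\<xi> i)) ^ N)"

definition exp_sum :: "('i \<Rightarrow> complex) \<Rightarrow> ('i \<Rightarrow> 'a::euclidean_space) \<Rightarrow> 'a \<Rightarrow> complex" where
  "exp_sum C \<xi> x = (\<Sum>\<^sub>\<infinity>i. C i * cis (\<xi> i \<bullet> x))"

lemma summable_on_nonneg_comparison:
  fixes f g :: "'i \<Rightarrow> real"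
  assumes "g summable_on A" "\<And>i. i \<in> A \<Longrightarrow> 0 \<le> f i" "\<And>i. i \<in> A \<Longrightarrow> f i \<le> g i"
  shows "f summable_on A"
  using assms by (intro summable_on_comparison_test[of g A f]) auto

lemma weighted_summable_le:
  assumes "weighted_summable N C \<xi>"
    and le: "\<And>i. norm (D i) * (1 + norm (\<zeta> i)) ^ M \<le> K * (norm (C i) * (1 + norm (\<xi> i)) ^ N)"
  shows "weighted_summable M D \<zeta>"
  unfolding weighted_summable_def
proof (rule summable_on_nonneg_comparison)
  show "(\<lambda>i. K * (norm (C i) * (1 + norm (\<xi> i)) ^ N)) summable_on UNIV"
    using assms(1) unfolding weighted_summable_def by (rule summable_on_cmult_right)
  show "norm (D i) * (1 + norm (\<zeta> i)) ^ M \<le> K * (norm (C i) * (1 + norm (\<xi> i)) ^ N)" for i by (rule le)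
qed simp

lemma weighted_summable_mono:
  assumes "weighted_summable N C \<xi>" "M \<le> N"
  shows "weighted_summable M C \<xi>"
  using assms by (intro weighted_summable_le[of N C \<xi> C \<xi> M 1]) (auto intro!: mult_left_mono power_increasing)

lemma exp_sum_terms_summable:
  assumes "weighted_summable N C \<xi>"
  shows "(\<lambda>i. C i * cis (\<xi> i \<bullet> x)) summable_on UNIV" "(\<lambda>i. norm (C i)) summable_on UNIV"
proof -
  show n: "(\<lambda>i. norm (C i)) summable_on UNIV"
    using weighted_summable_mono[OF assms, of 0] by (simp add: weighted_summable_def)
  show "(\<lambda>i. C i * cis (\<xi> i \<bullet> x)) summable_on UNIV"
    by (rule abs_summable_summable) (simp add: norm_mult n)
qed

lemma exp_sum_norm_le:
  assumes "weighted_summable N C \<xi>"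
  shows "norm (exp_sum C \<xi> x) \<le> (\<Sum>\<^sub>\<infinity>i. norm (C i))"
  unfolding exp_sum_def
proof (rule norm_infsum_le[OF has_sum_infsum has_sum_infsum])
  show "(\<lambda>i. C i * cis (\<xi> i \<bullet> x)) summable_on UNIV" "(\<lambda>i. norm (C i)) summable_on UNIV"
    using exp_sum_terms_summable[OF assms] by auto
qed (simp add: norm_mult)

lemma inner_le_weight: "\<bar>x \<bullet> h\<bar> \<le> norm h * (1 + norm x)"
  using Cauchy_Schwarz_ineq2[of x h] by (simp add: distrib_left mult.commute add_increasing)

lemma weighted_summable_pd:
  assumes "weighted_summable (Suc N) C \<xi>"
  shows "weighted_summable N (\<lambda>i. \<i> * of_real (\<xi> i \<bullet> h) * C i) \<xi>"
proof (rule weighted_summable_le[OF assms, of _ _ _ "norm h"])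
  fix i
  have "\<bar>\<xi> i \<bullet> h\<bar> \<le> norm h * (1 + norm (\<xi> i))"
    by (rule inner_le_weight)
  then have "\<bar>\<xi> i \<bullet> h\<bar> * (norm (C i) * (1 + norm (\<xi> i)) ^ N) \<le> norm h * (1 + norm (\<xi> i)) * (norm (C i) * (1 + norm (\<xi> i)) ^ N)"
    by (intro mult_right_mono) auto
  then show "norm (\<i> * of_real (\<xi> i \<bullet> h) * C i) * (1 + norm (\<xi> i)) ^ N \<le> norm h * (norm (C i) * (1 + norm (\<xi> i)) ^ Suc N)"
    by (simp add: norm_mult algebra_simps)
qed

text \<open>A quadratic remainder valid for all real t, so that the expansions of all terms of an
  exponential sum can be added up.\<close>

lemma cis_Taylor: "norm (cis t - 1 - \<i> * of_real t) \<le> t\<^sup>2"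
proof -
  have "\<bar>cos t - 1\<bar> \<le> t\<^sup>2 / 2"
    using cos_double_sin[of "t/2"] abs_le_square_iff[THEN iffD1, OF abs_sin_x_le_abs_x[of "t/2"]]
    by (simp add: power_divide)
  moreover have "\<bar>sin t - t\<bar> \<le> t\<^sup>2 / 2"
  proof -
    have *: "\<bar>sin s - s\<bar> \<le> s\<^sup>2 / 2" if s: "0 \<le> s" for s :: real
    proof -
      define f where "f u = u - sin u" for u :: real
      have "f 0 \<le> f s" using s
        by (rule DERIV_nonneg_imp_nondecreasing) (auto simp: f_def intro!: exI[of _ "1 - cos _"] derivative_eq_intros)
      moreover have "(\<lambda>u. u\<^sup>2 / 2 - f u) 0 \<le> (\<lambda>u. u\<^sup>2 / 2 - f u) s" using s
      proof (rule DERIV_nonneg_imp_nondecreasing)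
        fix u :: real assume u: "0 \<le> u" "u \<le> s"
        have "((\<lambda>u. u\<^sup>2 / 2 - f u) has_real_derivative u - (1 - cos u)) (at u)"
          unfolding f_def by (auto intro!: derivative_eq_intros)
        moreover have "1 - cos u \<le> u"
        proof -
          have "\<bar>1 - cos u\<bar> \<le> 2 * \<bar>sin (u/2)\<bar>"
            using cos_double_sin[of "u/2"] mult_left_mono[OF abs_sin_le_one[of "u/2"] abs_ge_zero[of "sin (u/2)"]]
            by (simp add: power2_eq_square)
          also have "\<dots> \<le> 2 * \<bar>u/2\<bar>" using abs_sin_x_le_abs_x[of "u/2"] by simp
          finally show ?thesis using u by simp
        qed
        ultimately show "\<exists>y. ((\<lambda>u. u\<^sup>2 / 2 - f u) has_real_derivative y) (at u) \<and> 0 \<le> y" by force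
      qed
      ultimately show ?thesis by (simp add: f_def)
    qed
    show ?thesis using *[of t] *[of "- t"] by (cases "0 \<le> t") (auto simp: abs_minus_commute)
  qed
  moreover have "norm (cis t - 1 - \<i> * of_real t) \<le> \<bar>Re (cis t - 1 - \<i> * of_real t)\<bar> + \<bar>Im (cis t - 1 - \<i> * of_real t)\<bar>"
    by (rule cmod_le)
  ultimately show ?thesis by simp
qed

lemma exp_sum_add:
  assumes "weighted_summable 0 C \<xi>" "weighted_summable 0 D \<xi>"
  shows "exp_sum (\<lambda>i. C i + D i) \<xi> x = exp_sum C \<xi> x + exp_sum D \<xi> x"
  unfolding exp_sum_def using exp_sum_terms_summable(1)[OF assms(1)] exp_sum_terms_summable(1)[OF assms(2)]
  by (subst infsum_add[symmetric]) (auto simp: ring_distribs)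

lemma exp_sum_cmult: "exp_sum (\<lambda>i. c * C i) \<xi> x = c * exp_sum C \<xi> x"
  unfolding exp_sum_def mult.assoc by (rule infsum_cmult_right')

lemma has_sum_minus:
  fixes f g :: "'i \<Rightarrow> complex"
  assumes "(f has_sum a) A" "(g has_sum b) A"
  shows "((\<lambda>i. f i - g i) has_sum (a - b)) A"
  using has_sum_add[OF assms(1), of "\<lambda>i. - g i" "- b"] assms(2) by (simp add: has_sum_uminus)

text \<open>Expanding each term to first order leaves a remainder of at most
  \<open>norm (C i) * (\<xi> i \<bullet> h)^2\<close>. The sum of these is quadratic in h and finite
  for weight 2, one more than the termwise derivative itself requires.\<close>

lemma exp_sum_has_derivative:
  assumes "weighted_summable 2 C \<xi>"
  shows "(exp_sum C \<xi> has_derivative (\<lambda>h. exp_sum (\<lambda>i. \<i> * of_real (\<xi> i \<bullet> h) * C i) \<xi> x)) (at x)"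
proof -
  define D where "D h = exp_sum (\<lambda>i. \<i> * of_real (\<xi> i \<bullet> h) * C i) \<xi> x" for h
  have w1: "weighted_summable (Suc 0) C \<xi>" using assms by (rule weighted_summable_mono) simp
  have w0: "weighted_summable 0 (\<lambda>i. \<i> * of_real (\<xi> i \<bullet> h) * C i) \<xi>" for h by (rule weighted_summable_pd[OF w1])
  have lin: "bounded_linear D"
  proof (rule bounded_linear_intro)
    show "D (g + h) = D g + D h" for g h
      unfolding D_def exp_sum_add[OF w0 w0, symmetric] by (simp add: inner_add_right algebra_simps)
    show "D (r *\<^sub>R h) = r *\<^sub>R D h" for r h
      using exp_sum_cmult[of "of_real r" "\<lambda>i. \<i> * of_real (\<xi> i \<bullet> h) * C i" \<xi> x]
      by (simp add: D_def scaleR_conv_of_real algebra_simps)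
    have s: "(\<lambda>i. norm (C i) * (1 + norm (\<xi> i)) ^ Suc 0) summable_on UNIV" using w1 by (simp add: weighted_summable_def)
    show "norm (D h) \<le> norm h * weighted_norm (Suc 0) C \<xi>" for h
      unfolding D_def
    proof (rule order_trans[OF exp_sum_norm_le[OF w0]])
      have "(\<Sum>\<^sub>\<infinity>i. norm (\<i> * of_real (\<xi> i \<bullet> h) * C i)) \<le> (\<Sum>\<^sub>\<infinity>i. norm h * (norm (C i) * (1 + norm (\<xi> i)) ^ Suc 0))"
      proof (rule infsum_mono)
        show "(\<lambda>i. norm (\<i> * of_real (\<xi> i \<bullet> h) * C i)) summable_on UNIV" by (rule exp_sum_terms_summable(2)[OF w0])
        show "(\<lambda>i. norm h * (norm (C i) * (1 + norm (\<xi> i)) ^ Suc 0)) summable_on UNIV" by (rule summable_on_cmult_right[OF s])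
        fix i
        have "\<bar>\<xi> i \<bullet> h\<bar> * norm (C i) \<le> (norm h * (1 + norm (\<xi> i))) * norm (C i)"
          by (intro mult_right_mono inner_le_weight norm_ge_zero)
        then show "norm (\<i> * of_real (\<xi> i \<bullet> h) * C i) \<le> norm h * (norm (C i) * (1 + norm (\<xi> i)) ^ Suc 0)"
          by (simp add: norm_mult algebra_simps)
      qed
      also have "\<dots> = norm h * weighted_norm (Suc 0) C \<xi>" unfolding weighted_norm_def by (rule infsum_cmult_right')
      finally show "(\<Sum>\<^sub>\<infinity>i. norm (\<i> * of_real (\<xi> i \<bullet> h) * C i)) \<le> norm h * weighted_norm (Suc 0) C \<xi>" .
    qed
  qed
  define K where "K = weighted_norm 2 C \<xi>"
  have K: "0 \<le> K" unfolding K_def weighted_norm_def by (intro infsum_nonneg) auto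
  have rem: "norm (exp_sum C \<xi> (x + h) - exp_sum C \<xi> x - D h) \<le> K * (norm h)\<^sup>2" for h
  proof -
    have "((\<lambda>i. C i * cis (\<xi> i \<bullet> (x + h)) - C i * cis (\<xi> i \<bullet> x) - \<i> * of_real (\<xi> i \<bullet> h) * C i * cis (\<xi> i \<bullet> x))
        has_sum (exp_sum C \<xi> (x + h) - exp_sum C \<xi> x - D h)) UNIV"
      unfolding exp_sum_def D_def
      using exp_sum_terms_summable(1)[OF assms] exp_sum_terms_summable(1)[OF w0]
      by (intro has_sum_minus has_sum_infsum)
    moreover have "((\<lambda>i. (norm h)\<^sup>2 * (norm (C i) * (1 + norm (\<xi> i))\<^sup>2)) has_sum (norm h)\<^sup>2 * K) UNIV"
      unfolding K_def weighted_norm_def using assms unfolding weighted_summable_def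
      by (intro has_sum_cmult_right has_sum_infsum)
    ultimately have "norm (exp_sum C \<xi> (x + h) - exp_sum C \<xi> x - D h) \<le> (norm h)\<^sup>2 * K"
    proof (rule norm_infsum_le)
      fix i
      have "C i * cis (\<xi> i \<bullet> (x + h)) - C i * cis (\<xi> i \<bullet> x) - \<i> * of_real (\<xi> i \<bullet> h) * C i * cis (\<xi> i \<bullet> x) =
          C i * cis (\<xi> i \<bullet> x) * (cis (\<xi> i \<bullet> h) - 1 - \<i> * of_real (\<xi> i \<bullet> h))"
        by (simp add: inner_add_right cis_mult[symmetric] algebra_simps)
      also have "norm \<dots> \<le> norm (C i) * (\<xi> i \<bullet> h)\<^sup>2"
        by (simp add: norm_mult mult_left_mono cis_Taylor)
      also have "\<dots> \<le> norm (C i) * (norm h * (1 + norm (\<xi> i)))\<^sup>2"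
        using power_mono[OF inner_le_weight[of "\<xi> i" h] abs_ge_zero, of 2] by (intro mult_left_mono) simp_all
      finally show "norm (C i * cis (\<xi> i \<bullet> (x + h)) - C i * cis (\<xi> i \<bullet> x) - \<i> * of_real (\<xi> i \<bullet> h) * C i * cis (\<xi> i \<bullet> x))
         \<le> (norm h)\<^sup>2 * (norm (C i) * (1 + norm (\<xi> i))\<^sup>2)" by (simp add: power_mult_distrib mult.left_commute)
    qed
    then show ?thesis by (simp add: mult.commute)
  qed
  have "(exp_sum C \<xi> has_derivative D) (at x)"
    unfolding has_derivative_at_alt
  proof (intro conjI allI impI lin)
    fix e :: real assume e: "0 < e"
    have "norm (exp_sum C \<xi> y - exp_sum C \<xi> x - D (y - x)) \<le> e * norm (y - x)" if "norm (y - x) < e / (K + 1)" for y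
    proof -
      have "K * norm (y - x) \<le> (K + 1) * (e / (K + 1))" using that K e by (intro mult_mono) auto
      then have "K * norm (y - x) * norm (y - x) \<le> e * norm (y - x)" using K by (intro mult_right_mono) auto
      then show ?thesis using rem[of "y - x"] by (simp add: power2_eq_square)
    qed
    then show "\<exists>d>0. \<forall>y. norm (y - x) < d \<longrightarrow> norm (exp_sum C \<xi> y - exp_sum C \<xi> x - D (y - x)) \<le> e * norm (y - x)"
      using e K by (intro exI[of _ "e / (K + 1)"]) auto
  qed
  then show ?thesis by (simp only: D_def[abs_def])
qed

lemma pd_exp_sum:
  assumes "weighted_summable 2 C \<xi>"
  shows "pd b (exp_sum C \<xi>) = exp_sum (\<lambda>i. \<i> * of_real (\<xi> i \<bullet> b) * C i) \<xi>"
  using pd_eqI[OF exp_sum_has_derivative[OF assms]] by blast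

section \<open>Complex valued functions of class C^k\<close>

definition complex_C_k :: "nat \<Rightarrow> ('a::euclidean_space \<Rightarrow> complex) \<Rightarrow> bool" where
  "complex_C_k k F \<longleftrightarrow> C_k_on k UNIV (\<lambda>x. Re (F x)) \<and> C_k_on k UNIV (\<lambda>x. Im (F x))"

lemma complex_C_k_mono: "complex_C_k k F \<Longrightarrow> j \<le> k \<Longrightarrow> complex_C_k j F"
  unfolding complex_C_k_def using C_k_on_mono by blast

lemma complex_C_k_mult: "complex_C_k k F \<Longrightarrow> complex_C_k k G \<Longrightarrow> complex_C_k k (\<lambda>x. F x * G x)"
  unfolding complex_C_k_def by (auto intro!: C_k_on_add C_k_on_diff C_k_on_mult)

lemma complex_C_k_SucI:
  assumes der: "\<And>x. (F has_derivative D x) (at x)" and "\<And>b. b \<in> Basis \<Longrightarrow> complex_C_k k (\<lambda>x. D x b)"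
  shows "complex_C_k (Suc k) F"
  using assms(2) unfolding complex_C_k_def
  by (auto intro!: C_k_on_SucI[OF open_UNIV bounded_linear.has_derivative[OF bounded_linear_Re der]]
      C_k_on_SucI[OF open_UNIV bounded_linear.has_derivative[OF bounded_linear_Im der]])

text \<open>Each derivative multiplies the coefficients by a frequency component and uses up one
  unit of weight; two more units make the last sum differentiable, hence continuous.\<close>

lemma complex_C_k_exp_sum: "weighted_summable (k + 2) C \<xi> \<Longrightarrow> complex_C_k k (exp_sum C \<xi>)"
proof (induction k arbitrary: C)
  case 0
  have "continuous_on UNIV (exp_sum C \<xi>)"
    using has_derivative_continuous[OF exp_sum_has_derivative] 0
    by (auto intro!: continuous_at_imp_continuous_on simp: numeral_2_eq_2)
  then show ?case by (auto simp: complex_C_k_def C_k_on_0 intro!: continuous_intros)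
next
  case (Suc k)
  show ?case
  proof (rule complex_C_k_SucI[OF exp_sum_has_derivative])
    show "weighted_summable 2 C \<xi>" using Suc.prems by (rule weighted_summable_mono) simp
    show "complex_C_k k (exp_sum (\<lambda>i. \<i> * of_real (\<xi> i \<bullet> b) * C i) \<xi>)" for b
      using Suc.prems by (intro Suc.IH weighted_summable_pd) simp
  qed
qed

lemma complex_C_k_differentiable:
  assumes "complex_C_k (Suc k) F"
  shows "F differentiable (at x)"
proof -
  have "(\<lambda>x. Re (F x)) differentiable (at x)" "(\<lambda>x. Im (F x)) differentiable (at x)"
    using assms by (auto simp: complex_C_k_def C_k_on_Suc)
  then have "(\<lambda>x. Re (F x) *\<^sub>R 1 + Im (F x) *\<^sub>R \<i>) differentiable (at x)"
    by (intro differentiable_add differentiable_scaleR differentiable_const)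
  moreover have "(\<lambda>x. Re (F x) *\<^sub>R 1 + Im (F x) *\<^sub>R \<i>) = F" by (auto simp: complex_eq_iff)
  ultimately show ?thesis by simp
qed

lemma pd_Re_Im:
  assumes "F differentiable (at x)"
  shows "pd b (\<lambda>x. Re (F x)) x = Re (pd b F x)" "pd b (\<lambda>x. Im (F x)) x = Im (pd b F x)"
  using bounded_linear.has_derivative[OF bounded_linear_Re has_derivative_pd[OF assms]]
    bounded_linear.has_derivative[OF bounded_linear_Im has_derivative_pd[OF assms]] by (auto intro: pd_eqI)

lemma summable_tail:
  fixes f :: "'i \<Rightarrow> real"
  assumes "f summable_on UNIV" "\<And>i. 0 \<le> f i" "0 < e"
  obtains F where "finite F" "(\<lambda>i. if i \<in> F then 0 else f i) summable_on UNIV"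
    "(\<Sum>\<^sub>\<infinity>i. if i \<in> F then 0 else f i) < e"
proof -
  obtain F where F: "finite F" "dist (sum f F) (infsum f UNIV) \<le> e / 2"
    using infsum_finite_approximation[OF assms(1), of "e/2"] assms(3) by (metis half_gt_zero subset_UNIV)
  have s: "(\<lambda>i. if i \<in> F then f i else 0) summable_on UNIV"
    by (rule summable_on_nonneg_comparison[OF assms(1)]) (auto simp: assms(2))
  have sF: "(\<Sum>\<^sub>\<infinity>i. if i \<in> F then f i else 0) = sum f F"
    using infsum_cong_neutral[of F UNIV f "\<lambda>i. if i \<in> F then f i else 0"] F(1) by auto
  have eq: "(\<lambda>i. if i \<in> F then 0 else f i) = (\<lambda>i. f i + (- 1) * (if i \<in> F then f i else 0))" by auto
  have s2: "(\<lambda>i. - 1 * (if i \<in> F then f i else 0)) summable_on UNIV" using s by (rule summable_on_cmult_right)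
  show ?thesis
  proof
    show "finite F" by fact
    show "(\<lambda>i. if i \<in> F then 0 else f i) summable_on UNIV" unfolding eq by (rule summable_on_add[OF assms(1) s2])
    have "(\<Sum>\<^sub>\<infinity>i. if i \<in> F then 0 else f i) = infsum f UNIV + (-1) * sum f F"
      unfolding eq infsum_add[OF assms(1) s2] infsum_cmult_right' sF ..
    then show "(\<Sum>\<^sub>\<infinity>i. if i \<in> F then 0 else f i) < e" using F(2) assms(3) unfolding dist_real_def by linarith
  qed
qed

text \<open>Coefficients are set to 0 on F rather than dropped, so that the tail is again an
  exponential sum over the same index set.\<close>

lemma exp_sum_approx:
  assumes "weighted_summable N C \<xi>" "0 < e"
  obtains F where "finite F" "weighted_summable N (\<lambda>i. if i \<in> F then 0 else C i) \<xi>"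
    "weighted_norm N (\<lambda>i. if i \<in> F then 0 else C i) \<xi> < e"
    "\<And>x. exp_sum C \<xi> x = (\<Sum>i\<in>F. C i * cis (\<xi> i \<bullet> x)) + exp_sum (\<lambda>i. if i \<in> F then 0 else C i) \<xi> x"
proof -
  obtain F where F: "finite F" "(\<lambda>i. if i \<in> F then 0 else norm (C i) * (1 + norm (\<xi> i)) ^ N) summable_on UNIV"
    "(\<Sum>\<^sub>\<infinity>i. if i \<in> F then 0 else norm (C i) * (1 + norm (\<xi> i)) ^ N) < e"
    by (rule summable_tail[OF assms(1)[unfolded weighted_summable_def] _ assms(2)]) auto
  have eq: "(\<lambda>i. norm (if i \<in> F then 0 else C i) * (1 + norm (\<xi> i)) ^ N) =
     (\<lambda>i. if i \<in> F then 0 else norm (C i) * (1 + norm (\<xi> i)) ^ N)" by auto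
  have w: "weighted_summable N (\<lambda>i. if i \<in> F then 0 else C i) \<xi>" unfolding weighted_summable_def eq by (rule F(2))
  have "exp_sum C \<xi> x = (\<Sum>i\<in>F. C i * cis (\<xi> i \<bullet> x)) + exp_sum (\<lambda>i. if i \<in> F then 0 else C i) \<xi> x" for x
  proof -
    have "((\<lambda>i. if i \<in> F then C i * cis (\<xi> i \<bullet> x) else 0) has_sum (\<Sum>i\<in>F. C i * cis (\<xi> i \<bullet> x))) UNIV"
      by (rule has_sum_cong_neutral[THEN iffD1, OF _ _ _ has_sum_finite[OF F(1)]]) auto
    moreover have "((\<lambda>i. (if i \<in> F then 0 else C i) * cis (\<xi> i \<bullet> x)) has_sum exp_sum (\<lambda>i. if i \<in> F then 0 else C i) \<xi> x) UNIV"
      unfolding exp_sum_def by (rule has_sum_infsum[OF exp_sum_terms_summable(1)[OF w]])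
    ultimately have "((\<lambda>i. (if i \<in> F then C i * cis (\<xi> i \<bullet> x) else 0) + (if i \<in> F then 0 else C i) * cis (\<xi> i \<bullet> x)) has_sum
       ((\<Sum>i\<in>F. C i * cis (\<xi> i \<bullet> x)) + exp_sum (\<lambda>i. if i \<in> F then 0 else C i) \<xi> x)) UNIV" by (rule has_sum_add)
    moreover have "(\<lambda>i. (if i \<in> F then C i * cis (\<xi> i \<bullet> x) else 0) + (if i \<in> F then 0 else C i) * cis (\<xi> i \<bullet> x)) = (\<lambda>i. C i * cis (\<xi> i \<bullet> x))"
      by auto
    ultimately show ?thesis unfolding exp_sum_def[of C] by (simp add: infsumI)
  qed
  then show ?thesis using that[OF F(1) w] F(3) unfolding weighted_norm_def eq by blast
qed

subsection \<open>A smooth cutoff function\<close>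

text \<open>For \<open>j = 0\<close> this is the standard flat function. Derivatives are
  combinations of members with larger j, so the family is closed under differentiation and a single
  induction gives smoothness.\<close>

definition flat :: "nat \<Rightarrow> real \<Rightarrow> real" where
  "flat j t = (if 0 < t then (1 / t) ^ j * exp (- (1 / t)) else 0)"

lemma flat_tendsto: "(flat j \<longlongrightarrow> 0) (at_right 0)"
proof -
  have "((\<lambda>t. (inverse t) ^ j / exp (inverse t)) \<longlongrightarrow> 0) (at_right (0::real))"
    by (rule filterlim_compose[OF tendsto_power_div_exp_0 filterlim_inverse_at_top_right])
  then show ?thesis
    by (rule Lim_transform_eventually)
      (auto simp: eventually_at_filter flat_def exp_minus divide_inverse)
qed

lemma flat_has_derivative: "(flat j has_real_derivative flat (j + 2) t - real j * flat (j + 1) t) (at t)"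
proof -
  consider "t < 0" | "t = 0" | "0 < t" by linarith
  then show ?thesis
  proof cases
    case 1
    have "((\<lambda>_. 0) has_real_derivative 0) (at t)" by simp
    then have "(flat j has_real_derivative 0) (at t)"
      by (rule has_field_derivative_transform_within_open[of _ _ _ "{..<0}"]) (use 1 in \<open>auto simp: flat_def\<close>)
    then show ?thesis using 1 by (simp add: flat_def)
  next
    case 2
    \<comment> \<open>From the right the difference quotient is \<open>flat (Suc j)\<close>, from
      the left it is 0.\<close>
    have "((\<lambda>h. (flat j h - flat j 0) / (h - 0)) \<longlongrightarrow> 0) (at 0)"
    proof (rule filterlim_split_at)
      show "((\<lambda>h. (flat j h - flat j 0) / (h - 0)) \<longlongrightarrow> 0) (at_right 0)"
        by (rule Lim_transform_eventually[OF flat_tendsto[of "Suc j"]])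
          (auto simp: eventually_at_filter flat_def)
      show "((\<lambda>h. (flat j h - flat j 0) / (h - 0)) \<longlongrightarrow> 0) (at_left 0)"
        by (rule Lim_transform_eventually[OF tendsto_const])
          (auto simp: eventually_at_filter flat_def)
    qed
    then show ?thesis using 2 by (simp add: has_field_derivative_iff flat_def)
  next
    case 3
    have inv: "((\<lambda>t. 1 / t) has_real_derivative - (1 / t)\<^sup>2) (at t)"
      using 3 by (auto intro!: derivative_eq_intros simp: power2_eq_square)
    have "((\<lambda>t. (1 / t) ^ j * exp (- (1 / t))) has_real_derivative
      (real j * (- (1 / t)\<^sup>2 * (1 / t) ^ (j - Suc 0))) * exp (- (1 / t)) + exp (- (1 / t)) * - (- (1 / t)\<^sup>2) * (1 / t) ^ j) (at t)"
      by (rule DERIV_cong[OF DERIV_mult[OF DERIV_power[OF inv, of j] DERIV_fun_exp[OF DERIV_minus[OF inv]]]]) simp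
    moreover have "real j * (- q\<^sup>2 * q ^ (j - Suc 0)) * E + E * - (- q\<^sup>2) * q ^ j =
        q ^ (j + 2) * E - real j * (q ^ (j + 1) * E)" for q E :: real
      by (cases j) (simp_all add: power2_eq_square algebra_simps)
    ultimately have "((\<lambda>t. (1 / t) ^ j * exp (- (1 / t))) has_real_derivative
      (1 / t) ^ (j + 2) * exp (- (1 / t)) - real j * ((1 / t) ^ (j + 1) * exp (- (1 / t)))) (at t)"
      by (simp only:)
    then have "(flat j has_real_derivative
      (1 / t) ^ (j + 2) * exp (- (1 / t)) - real j * ((1 / t) ^ (j + 1) * exp (- (1 / t)))) (at t)"
      by (rule has_field_derivative_transform_within_open[of _ _ _ "{0<..}"]) (use 3 in \<open>auto simp: flat_def\<close>)
    then show ?thesis using 3 by (simp add: flat_def)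
  qed
qed

lemma C_k_on_flat:
  assumes "open U"
  shows "C_k_on k U u \<Longrightarrow> C_k_on k U (\<lambda>x. flat j (u x))"
proof (induction k arbitrary: j)
  case 0
  have "continuous_on UNIV (flat j)"
    by (intro continuous_at_imp_continuous_on ballI DERIV_isCont[OF flat_has_derivative])
  then show ?case using 0 unfolding C_k_on_0 by (rule continuous_on_compose2) simp
next
  case (Suc k)
  have u: "C_k_on k U u" using Suc.prems by (rule C_k_on_mono) simp
  have "((\<lambda>x. flat j (u x)) has_derivative (\<lambda>h. (flat (j + 2) (u x) - real j * flat (j + 1) (u x)) * pd h u x)) (at x)"
    if "x \<in> U" for x
  proof -
    have "(u has_derivative (\<lambda>h. pd h u x)) (at x)"
      using Suc.prems that by (intro has_derivative_pd) (auto simp: C_k_on_Suc)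
    from has_derivative_compose[OF this flat_has_derivative[unfolded has_field_derivative_def]]
    show ?thesis .
  qed
  then show ?case
  proof (rule C_k_on_SucI[OF assms])
    fix b :: 'a assume "b \<in> Basis"
    then show "C_k_on k U (\<lambda>x. (flat (j + 2) (u x) - real j * flat (j + 1) (u x)) * pd b u x)"
      using Suc.prems by (intro C_k_on_mult C_k_on_diff C_k_on_const Suc.IH u assms C_k_on_pd)
  qed
qed

text \<open>The norm enters squared because it is not smooth at 0. The denominator is positive since
  for \<open>R > 0\<close> the conditions \<open>x \<bullet> x < 4 * R^2\<close> and
  \<open>x \<bullet> x > R^2\<close> cover all points.\<close>

definition cutoff :: "real \<Rightarrow> 'a::euclidean_space \<Rightarrow> real" where
  "cutoff R x = flat 0 (4 * R\<^sup>2 - x \<bullet> x) / (flat 0 (4 * R\<^sup>2 - x \<bullet> x) + flat 0 (x \<bullet> x - R\<^sup>2))"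

lemma cutoff_smooth: "0 < R \<Longrightarrow> C_k_on k UNIV (cutoff R :: 'a::euclidean_space \<Rightarrow> real)"
proof -
  assume R: "0 < R"
  have "C_k_on k UNIV (\<lambda>x::'a. \<Sum>b\<in>Basis. (x \<bullet> b) * (x \<bullet> b))"
    by (intro C_k_on_sum C_k_on_mult C_k_on_inner open_UNIV)
  then have s: "C_k_on k UNIV (\<lambda>x::'a. x \<bullet> x)" by (simp add: euclidean_inner[symmetric])
  have "0 < flat 0 (4 * R\<^sup>2 - x \<bullet> x) + flat 0 (x \<bullet> x - R\<^sup>2)" for x :: 'a
  proof (cases "x \<bullet> x < 4 * R\<^sup>2")
    case False
    moreover have "0 < R\<^sup>2" using R by simp
    ultimately have "R\<^sup>2 < x \<bullet> x" by linarith
    then show ?thesis using False by (simp add: flat_def)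
  qed (simp add: flat_def add_pos_nonneg)
  then show ?thesis
    unfolding cutoff_def[abs_def]
    by (intro C_k_on_divide C_k_on_add C_k_on_flat C_k_on_diff C_k_on_const s open_UNIV)
qed

lemma cutoff_1: "norm x \<le> R \<Longrightarrow> 0 < R \<Longrightarrow> cutoff R x = 1"
proof -
  assume *: "norm x \<le> R" "0 < R"
  then have "x \<bullet> x \<le> R\<^sup>2" by (simp add: dot_square_norm power_mono)
  moreover have "0 < R\<^sup>2" using *(2) by simp
  ultimately have "x \<bullet> x < 4 * R\<^sup>2" "x \<bullet> x \<le> R\<^sup>2" by linarith+
  then show ?thesis by (simp add: cutoff_def flat_def)
qed

lemma cutoff_0: "2 * R < norm x \<Longrightarrow> 0 < R \<Longrightarrow> cutoff R x = 0"
proof -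
  assume *: "2 * R < norm x" "0 < R"
  then have "(2 * R)\<^sup>2 < (norm x)\<^sup>2" by (intro power_strict_mono) auto
  then show ?thesis by (simp add: cutoff_def flat_def dot_square_norm power_mult_distrib)
qed

subsection \<open>Decay of Fourier coefficients\<close>

text \<open>For functions supported in a smaller ball this is the Fourier transform, taken over a
  bounded set so that continuity alone gives integrability.\<close>

definition fourier :: "real \<Rightarrow> ('a::euclidean_space \<Rightarrow> real) \<Rightarrow> 'a \<Rightarrow> complex" where
  "fourier r u \<xi> = (LINT x:ball 0 r|lborel. u x *\<^sub>R cis (- (\<xi> \<bullet> x)))"

lemma cis_inner_has_derivative:
  "((\<lambda>x. cis (- (\<xi> \<bullet> x))) has_derivative (\<lambda>h. - (\<i> * of_real (\<xi> \<bullet> h)) * cis (- (\<xi> \<bullet> x)))) (at x)"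
proof -
  have "((\<lambda>x. \<i> * of_real (- (\<xi> \<bullet> x))) has_derivative (\<lambda>h. \<i> * of_real (- (\<xi> \<bullet> h)))) (at x)"
    by (intro has_derivative_mult_right has_derivative_of_real has_derivative_minus has_derivative_inner_right
        has_derivative_ident)
  from has_derivative_compose[OF this DERIV_exp[unfolded has_field_derivative_def]]
  show ?thesis by (simp add: cis_conv_exp mult.commute)
qed

lemma fourier_integrable:
  assumes "continuous_on UNIV u"
  shows "set_integrable lborel (ball 0 r) (\<lambda>x. u x *\<^sub>R cis (- (\<xi> \<bullet> x)))"
proof (rule set_integrable_continuous_bounded)
  have c: "continuous_on UNIV (\<lambda>x. u x *\<^sub>R cis (- (\<xi> \<bullet> x)))"
    using assms by (intro continuous_intros)
  then show "continuous_on (ball 0 r) (\<lambda>x. u x *\<^sub>R cis (- (\<xi> \<bullet> x)))" by (rule continuous_on_subset) simp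
  show "bounded ((\<lambda>x. u x *\<^sub>R cis (- (\<xi> \<bullet> x))) ` ball 0 r)"
    by (rule bounded_image_continuous[OF _ c]) simp
qed auto

lemma fourier_add: "continuous_on UNIV u \<Longrightarrow> continuous_on UNIV v \<Longrightarrow>
    fourier r (\<lambda>x. u x + v x) \<xi> = fourier r u \<xi> + fourier r v \<xi>"
  unfolding fourier_def scaleR_left_distrib
  by (rule set_integral_add(2)[OF fourier_integrable fourier_integrable])

lemma fourier_cmult: "fourier r (\<lambda>x. c * u x) \<xi> = of_real c * fourier r u \<xi>"
proof -
  have "(c * u x) *\<^sub>R cis (- (\<xi> \<bullet> x)) = of_real c * (u x *\<^sub>R cis (- (\<xi> \<bullet> x)))" for x
    by (simp add: scaleR_conv_of_real)
  then show ?thesis unfolding fourier_def by (simp only: set_integral_mult_right)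
qed

lemma fourier_sum:
  assumes "finite I" "\<And>i. i \<in> I \<Longrightarrow> continuous_on UNIV (f i)"
  shows "fourier r (\<lambda>x. \<Sum>i\<in>I. f i x) \<xi> = (\<Sum>i\<in>I. fourier r (f i) \<xi>)"
  using assms
proof (induction I)
  case empty
  show ?case using fourier_cmult[of r 0 "\<lambda>_. 0" \<xi>] by simp
next
  case (insert i I)
  then show ?case by (simp add: fourier_add continuous_on_sum)
qed

lemma pd_zero_outside:
  assumes "\<And>x. r' < norm x \<Longrightarrow> u x = 0" "r' < norm x"
  shows "pd b u x = 0"
proof -
  have "open (- cball (0::'a) r')" by (simp add: open_Compl)
  then have "pd b u x = pd b (\<lambda>_. 0) x"
    using assms by (intro pd_cong_open[of "- cball 0 r'"]) auto
  then show ?thesis using pd_eqI[OF has_derivative_const, of b] by simp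
qed

text \<open>Integration by parts on the ball: u vanishes near the bounding sphere, so
  \<open>integral_pd_eq_0\<close> applies to its product with the exponential.\<close>

lemma fourier_pd:
  fixes u :: "'a::euclidean_space \<Rightarrow> real"
  assumes u: "C_k_on 1 UNIV u" and supp: "\<And>x. r' < norm x \<Longrightarrow> u x = 0" and r: "0 < r" "r' < r" and b: "b \<in> Basis"
  shows "fourier r (pd b u) \<xi> = \<i> * of_real (\<xi> \<bullet> b) * fourier r u \<xi>"
proof -
  define f where "f x = u x *\<^sub>R cis (- (\<xi> \<bullet> x))" for x
  have cu: "continuous_on UNIV u" "continuous_on UNIV (pd b u)"
    using u b C_k_on_imp_continuous_on[OF u] by (auto simp: C_k_on_Suc C_k_on_0)
  have du: "u differentiable (at x)" for x using u by (rule C_k_on_imp_differentiable) auto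
  have der: "(f has_derivative (\<lambda>h. u x *\<^sub>R (- (\<i> * of_real (\<xi> \<bullet> h)) * cis (- (\<xi> \<bullet> x))) + pd h u x *\<^sub>R cis (- (\<xi> \<bullet> x)))) (at x)" for x
    unfolding f_def by (intro has_derivative_scaleR has_derivative_pd du cis_inner_has_derivative)
  have pdf: "pd b f x = - (\<i> * of_real (\<xi> \<bullet> b)) * (u x *\<^sub>R cis (- (\<xi> \<bullet> x))) + pd b u x *\<^sub>R cis (- (\<xi> \<bullet> x))" for x
    using pd_eqI[OF der, of b] by simp
  have i1: "set_integrable lborel (ball 0 r) (\<lambda>x. - (\<i> * of_real (\<xi> \<bullet> b)) * (u x *\<^sub>R cis (- (\<xi> \<bullet> x))))"
    by (rule set_integrable_mult_right) (rule fourier_integrable[OF cu(1)])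
  have dif: "f differentiable (at x)" for x using der by (auto simp: differentiable_def)
  have bnd: "bounded (pd b f ` ball 0 r)"
  proof -
    have "continuous_on UNIV (pd b f)"
      unfolding pdf[abs_def] using cu by (intro continuous_intros)
    then show ?thesis by (rule bounded_image_continuous[rotated]) simp
  qed
  have lim: "(f \<longlongrightarrow> 0) (at x within ball 0 r)" if "x \<in> frontier (ball 0 r)" for x
  proof -
    have "f x = 0" using that r supp[of x] by (simp add: f_def)
    moreover have "isCont f x" using der has_derivative_continuous by blast
    ultimately show ?thesis by (metis continuous_at_imp_continuous_within continuous_within)
  qed
  have neg: "negligible (frontier (ball (0::'a) r))" by (rule negligible_convex_frontier) simp
  have "(LINT x:ball 0 r|lborel. pd b f x) = 0"
    using dif bnd lim by (intro integral_pd_eq_0[OF open_ball bounded_ball neg])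
  moreover have "(LINT x:ball 0 r|lborel. pd b f x) = - (\<i> * of_real (\<xi> \<bullet> b)) * fourier r u \<xi> + fourier r (pd b u) \<xi>"
    unfolding pdf fourier_def
    by (simp only: set_integral_add(2)[OF i1 fourier_integrable[OF cu(2)]] set_integral_mult_right)
  ultimately have "- (\<i> * of_real (\<xi> \<bullet> b)) * fourier r u \<xi> + fourier r (pd b u) \<xi> = 0" by simp
  then show ?thesis by (simp add: algebra_simps)
qed

text \<open>The operator \<open>1 - \<Delta>\<close>. Under the Fourier transform it multiplies by
  \<open>1 + (norm \<xi>)^2\<close>, which grows in all directions at once, so that powers of one
  operator give decay of every order.\<close>

definition bessel :: "('a::euclidean_space \<Rightarrow> real) \<Rightarrow> 'a \<Rightarrow> real" where
  "bessel u = (\<lambda>x. u x + (- 1) * (\<Sum>b\<in>Basis. pd b (pd b u) x))"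

lemma fourier_bessel:
  fixes u :: "'a::euclidean_space \<Rightarrow> real"
  assumes u: "C_k_on 2 UNIV u" and supp: "\<And>x. r' < norm x \<Longrightarrow> u x = 0" and r: "0 < r" "r' < r"
  shows "fourier r (bessel u) \<xi> = of_real (1 + (norm \<xi>)\<^sup>2) * fourier r u \<xi>"
proof -
  have u2: "C_k_on (Suc (Suc 0)) UNIV u" using u by (simp add: numeral_2_eq_2)
  have c: "continuous_on UNIV u" using u by (rule C_k_on_imp_continuous_on)
  have cp: "C_k_on 1 UNIV (pd b u)" "continuous_on UNIV (pd b (pd b u))" if "b \<in> Basis" for b
    using C_k_on_pd[OF u2 that] C_k_on_pd[OF C_k_on_pd[OF u2 that] that] by (auto simp: C_k_on_0)
  have "fourier r (pd b (pd b u)) \<xi> = - of_real ((\<xi> \<bullet> b)\<^sup>2) * fourier r u \<xi>" if b: "b \<in> Basis" for b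
  proof -
    have "fourier r (pd b (pd b u)) \<xi> = \<i> * of_real (\<xi> \<bullet> b) * fourier r (pd b u) \<xi>"
      using pd_zero_outside[OF supp] by (intro fourier_pd[OF cp(1)[OF b] _ r b])
    also have "fourier r (pd b u) \<xi> = \<i> * of_real (\<xi> \<bullet> b) * fourier r u \<xi>"
      using C_k_on_mono[OF u, of 1] by (intro fourier_pd[OF _ supp r b]) auto
    finally show ?thesis by (simp add: power2_eq_square algebra_simps)
  qed
  then have "(\<Sum>b\<in>Basis. fourier r (pd b (pd b u)) \<xi>) = (\<Sum>b\<in>Basis. - of_real ((\<xi> \<bullet> b)\<^sup>2) * fourier r u \<xi>)" by simp
  also have "\<dots> = - of_real ((norm \<xi>)\<^sup>2) * fourier r u \<xi>"
  proof -
    have "(norm \<xi>)\<^sup>2 = (\<Sum>b\<in>Basis. (\<xi> \<bullet> b)\<^sup>2)"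
      unfolding power2_norm_eq_inner euclidean_inner[of \<xi> \<xi>] by (simp only: power2_eq_square)
    then show ?thesis by (simp only: of_real_sum sum_distrib_right sum_negf[symmetric] mult_minus_left)
  qed
  finally have s: "(\<Sum>b\<in>Basis. fourier r (pd b (pd b u)) \<xi>) = - of_real ((norm \<xi>)\<^sup>2) * fourier r u \<xi>" .
  have "fourier r (bessel u) \<xi> = fourier r u \<xi> + of_real (- 1) * (\<Sum>b\<in>Basis. fourier r (pd b (pd b u)) \<xi>)"
  proof -
    have s: "continuous_on UNIV (\<lambda>x. \<Sum>b\<in>Basis. pd b (pd b u) x)" using cp(2) by (intro continuous_on_sum)
    have "fourier r (bessel u) \<xi> = fourier r u \<xi> + fourier r (\<lambda>x. (- 1) * (\<Sum>b\<in>Basis. pd b (pd b u) x)) \<xi>"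
      unfolding bessel_def by (rule fourier_add[OF c continuous_on_mult[OF continuous_on_const s]])
    also have "fourier r (\<lambda>x. (- 1) * (\<Sum>b\<in>Basis. pd b (pd b u) x)) \<xi> =
        of_real (- 1) * fourier r (\<lambda>x. \<Sum>b\<in>Basis. pd b (pd b u) x) \<xi>" by (rule fourier_cmult)
    also have "fourier r (\<lambda>x. \<Sum>b\<in>Basis. pd b (pd b u) x) \<xi> = (\<Sum>b\<in>Basis. fourier r (pd b (pd b u)) \<xi>)"
      using cp(2) by (intro fourier_sum) auto
    finally show ?thesis .
  qed
  then show ?thesis unfolding s by (simp add: algebra_simps)
qed

lemma bessel_iterate:
  fixes u :: "'a::euclidean_space \<Rightarrow> real"
  assumes u: "\<And>k. C_k_on k UNIV u" and supp: "\<And>x. r' < norm x \<Longrightarrow> u x = 0" and r: "0 < r" "r' < r"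
  shows "(\<forall>k. C_k_on k UNIV ((bessel ^^ K) u)) \<and> (\<forall>x. r' < norm x \<longrightarrow> (bessel ^^ K) u x = 0) \<and>
    (\<forall>\<xi>. fourier r ((bessel ^^ K) u) \<xi> = of_real ((1 + (norm \<xi>)\<^sup>2) ^ K) * fourier r u \<xi>)"
proof (induction K)
  case (Suc K)
  define v where "v = (bessel ^^ K) u"
  have v: "\<And>k. C_k_on k UNIV v" "\<And>x. r' < norm x \<Longrightarrow> v x = 0"
    "\<And>\<xi>. fourier r v \<xi> = of_real ((1 + (norm \<xi>)\<^sup>2) ^ K) * fourier r u \<xi>"
    using Suc by (auto simp: v_def)
  have "C_k_on k UNIV (bessel v)" for k
    unfolding bessel_def
    by (intro C_k_on_add C_k_on_cmult C_k_on_sum C_k_on_pd open_UNIV v(1))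
  moreover have "bessel v x = 0" if "r' < norm x" for x
  proof -
    have "pd b v y = 0" if "r' < norm y" for b y using v(2) that by (rule pd_zero_outside)
    then have "pd b (pd b v) x = 0" for b using that by (rule pd_zero_outside)
    then show ?thesis using v(2)[OF that] by (simp add: bessel_def)
  qed
  moreover have "fourier r (bessel v) \<xi> = of_real ((1 + (norm \<xi>)\<^sup>2) ^ Suc K) * fourier r u \<xi>" for \<xi>
    using fourier_bessel[OF v(1) v(2) r] by (simp add: v(3))
  ultimately show ?case by (simp add: v_def)
qed (use assms in auto)

text \<open>The coefficient of \<open>(bessel ^^ K) u\<close> is bounded by the integral of its
  absolute value, and it is the coefficient of u multiplied by the given power.\<close>

lemma fourier_decay:
  fixes u :: "'a::euclidean_space \<Rightarrow> real"
  assumes u: "\<And>k. C_k_on k UNIV u" and supp: "\<And>x. r' < norm x \<Longrightarrow> u x = 0" and r: "0 < r" "r' < r"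
  obtains C where "\<And>\<xi>. (1 + (norm \<xi>)\<^sup>2) ^ K * norm (fourier r u \<xi>) \<le> C"
proof
  fix \<xi> :: 'a
  define v where "v = (bessel ^^ K) u"
  have "fourier r v \<xi> = of_real ((1 + (norm \<xi>)\<^sup>2) ^ K) * fourier r u \<xi>" and "C_k_on 0 UNIV v"
    using bessel_iterate[of u r' r K] assms by (auto simp: v_def)
  then have c: "continuous_on UNIV v" and e: "norm (fourier r v \<xi>) = (1 + (norm \<xi>)\<^sup>2) ^ K * norm (fourier r u \<xi>)"
    by (simp_all add: C_k_on_0 norm_mult norm_power del: of_real_power of_real_add)
  have "norm (fourier r v \<xi>) \<le> (LINT x|lborel. norm (indicator (ball 0 r) x *\<^sub>R (v x *\<^sub>R cis (- (\<xi> \<bullet> x)))))"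
    unfolding fourier_def set_lebesgue_integral_def by (rule integral_norm_bound)
  also have "\<dots> = (LINT x:ball 0 r|lborel. \<bar>v x\<bar>)"
    unfolding set_lebesgue_integral_def by (intro Bochner_Integration.integral_cong) (auto simp: indicator_def)
  finally have "norm (fourier r v \<xi>) \<le> (LINT x:ball 0 r|lborel. \<bar>v x\<bar>)" .
  from this[unfolded e] show "(1 + (norm \<xi>)\<^sup>2) ^ K * norm (fourier r u \<xi>) \<le> (LINT x:ball 0 r|lborel. \<bar>(bessel ^^ K) u x\<bar>)"
    by (simp only: v_def)
qed

subsection \<open>The lattice of frequencies\<close>

text \<open>The frequencies of functions with period \<open>2 * pi / \<kappa>\<close> in each
  coordinate.\<close>

definition lattice :: "real \<Rightarrow> int^'n \<Rightarrow> real^'n" where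
  "lattice \<kappa> m = (\<chi> i. \<kappa> * of_int (m $ i))"

lemma summable_int_inverse_square:
  fixes \<kappa> :: real
  assumes "0 < \<kappa>"
  shows "(\<lambda>j::int. 1 / (1 + (\<kappa> * of_int j)\<^sup>2)) summable_on UNIV"
proof -
  define a where "a j = 1 / (1 + (\<kappa> * of_int j)\<^sup>2)" for j :: int
  have s: "summable (\<lambda>n. a (int n))"
  proof (rule summable_comparison_test[of _ "\<lambda>n. (1 / \<kappa>\<^sup>2) * inverse (real n ^ 2)"])
    show "summable (\<lambda>n. (1 / \<kappa>\<^sup>2) * inverse (real n ^ 2))"
      by (intro summable_mult inverse_power_summable) simp
    have "norm (a (int n)) \<le> (1 / \<kappa>\<^sup>2) * inverse (real n ^ 2)" if "1 \<le> n" for n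
    proof -
      have "1 / (1 + (\<kappa> * real n)\<^sup>2) \<le> 1 / (\<kappa> * real n)\<^sup>2"
        using that assms by (intro divide_left_mono) (auto intro!: add_pos_nonneg mult_pos_pos)
      then show ?thesis by (simp add: a_def power_mult_distrib divide_inverse)
    qed
    then show "\<exists>N. \<forall>n\<ge>N. norm (a (int n)) \<le> (1 / \<kappa>\<^sup>2) * inverse (real n ^ 2)" by blast
  qed
  have nn: "0 \<le> a j" for j by (simp add: a_def)
  have n: "(\<lambda>n. a (int n)) summable_on UNIV"
    using s nn by (intro norm_summable_imp_summable_on) simp
  have "a summable_on range int"
    using n by (subst summable_on_reindex) (auto simp: o_def)
  moreover have "a summable_on range (\<lambda>n. - int n)"
    using n by (subst summable_on_reindex) (auto simp: o_def a_def inj_on_def)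
  ultimately have "a summable_on (range int \<union> range (\<lambda>n. - int n))" by (rule summable_on_union)
  moreover have "range int \<union> range (\<lambda>n. - int n) = UNIV"
  proof -
    have "j \<in> range int \<union> range (\<lambda>n. - int n)" for j
      by (cases j rule: int_cases2) auto
    then show ?thesis by blast
  qed
  ultimately show ?thesis by (simp add: a_def[abs_def])
qed

text \<open>A finite set of lattice points lies in a box of finite coordinate sets, over which the
  sum of the products factors into a product of one-dimensional sums.\<close>

lemma summable_lattice_product:
  fixes a :: "int \<Rightarrow> real"
  assumes a: "a summable_on UNIV" "\<And>j. 0 \<le> a j"
  shows "(\<lambda>m::int^'n. \<Prod>i\<in>UNIV. a (m $ i)) summable_on UNIV"
proof (rule nonneg_bdd_above_summable_on)
  show "bdd_above (sum (\<lambda>m::int^'n. \<Prod>i\<in>UNIV. a (m $ i)) ` {F. F \<subseteq> UNIV \<and> finite F})"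
  proof (rule bdd_aboveI2)
    fix F :: "(int^'n) set" assume "F \<in> {F. F \<subseteq> UNIV \<and> finite F}"
    then have F: "finite F" by simp
    define J where "J = (\<Union>m\<in>F. range (\<lambda>i. m $ i))"
    have J: "finite J" unfolding J_def using F by auto
    have "(\<Sum>m\<in>F. \<Prod>i\<in>UNIV. a (m $ i)) = (\<Sum>g\<in>vec_nth ` F. \<Prod>i\<in>UNIV. a (g i))"
      by (subst sum.reindex) (auto simp: inj_on_def vec_nth_inject)
    also have "\<dots> \<le> (\<Sum>g\<in>PiE (UNIV::'n set) (\<lambda>_. J). \<Prod>i\<in>UNIV. a (g i))"
    proof (rule sum_mono2)
      show "finite (PiE (UNIV::'n set) (\<lambda>_. J))" using J by (intro finite_PiE) auto
      show "vec_nth ` F \<subseteq> PiE UNIV (\<lambda>_. J)" by (auto simp: J_def)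
    qed (auto intro!: prod_nonneg a(2))
    also have "\<dots> = (\<Prod>i\<in>(UNIV::'n set). \<Sum>j\<in>J. a j)"
      using J by (subst prod_sum_PiE) auto
    also have "\<dots> \<le> (\<Prod>i\<in>(UNIV::'n set). infsum a UNIV)"
      using J a by (intro prod_mono conjI sum_nonneg finite_sum_le_infsum) auto
    finally show "(\<Sum>m\<in>F. \<Prod>i\<in>UNIV. a (m $ i)) \<le> (\<Prod>i\<in>(UNIV::'n set). infsum a UNIV)" .
  qed
qed (auto intro!: prod_nonneg a(2))

text \<open>Of the decay exponent, N powers absorb the weight, and the other \<open>CARD('n)\<close>
  powers dominate the product over the coordinates, each factor of which is at most one plus the
  squared norm.\<close>

lemma weighted_summable_lattice:
  fixes c :: "int^'n \<Rightarrow> complex"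
  assumes \<kappa>: "0 < \<kappa>"
    and c: "\<And>m. (1 + (norm (lattice \<kappa> m))\<^sup>2) ^ (N + CARD('n)) * norm (c m) \<le> C"
  shows "weighted_summable N c (lattice \<kappa>)"
  unfolding weighted_summable_def
proof (rule summable_on_nonneg_comparison)
  have "(\<lambda>m::int^'n. \<Prod>i\<in>UNIV. 1 / (1 + (\<kappa> * of_int (m $ i))\<^sup>2)) summable_on UNIV"
    by (rule summable_lattice_product[OF summable_int_inverse_square[OF \<kappa>]]) simp
  then show "(\<lambda>m::int^'n. 2 ^ N * C * (\<Prod>i\<in>UNIV. 1 / (1 + (\<kappa> * of_int (m $ i))\<^sup>2))) summable_on UNIV"
    by (rule summable_on_cmult_right)
  fix m :: "int^'n"
  define t where "t = norm (lattice \<kappa> m)"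
  have t: "0 \<le> t" by (simp add: t_def)
  have comp: "1 + (\<kappa> * of_int (m $ i))\<^sup>2 \<le> 1 + t\<^sup>2" for i
  proof -
    have "\<bar>lattice \<kappa> m $ i\<bar> \<le> t" unfolding t_def by (rule component_le_norm_cart)
    then have "(lattice \<kappa> m $ i)\<^sup>2 \<le> t\<^sup>2" by (metis abs_ge_zero power2_abs power_mono)
    then show ?thesis by (simp add: lattice_def)
  qed
  have "(\<Prod>i\<in>(UNIV::'n set). 1 + (\<kappa> * of_int (m $ i))\<^sup>2) \<le> (\<Prod>i\<in>(UNIV::'n set). 1 + t\<^sup>2)"
    using comp by (intro prod_mono) (auto intro: add_nonneg_nonneg)
  then have P: "(\<Prod>i\<in>(UNIV::'n set). 1 + (\<kappa> * of_int (m $ i))\<^sup>2) \<le> (1 + t\<^sup>2) ^ CARD('n)" by simp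
  have Ppos: "0 < (\<Prod>i\<in>(UNIV::'n set). 1 + (\<kappa> * of_int (m $ i))\<^sup>2)"
    by (intro prod_pos) (auto intro: add_pos_nonneg)
  have "2 * t \<le> t\<^sup>2 + 1" "0 \<le> t\<^sup>2" using sum_squares_bound[of t 1] by simp_all
  then have "1 + t \<le> 2 * (1 + t\<^sup>2)" by argo
  then have "(1 + t) ^ N \<le> (2 * (1 + t\<^sup>2)) ^ N" using t by (intro power_mono) auto
  then have T: "(1 + t) ^ N \<le> 2 ^ N * (1 + t\<^sup>2) ^ N" by (simp only: power_mult_distrib)
  have "norm (c m) * (1 + t) ^ N * (\<Prod>i\<in>(UNIV::'n set). 1 + (\<kappa> * of_int (m $ i))\<^sup>2)
      \<le> norm (c m) * (2 ^ N * (1 + t\<^sup>2) ^ N) * (1 + t\<^sup>2) ^ CARD('n)"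
    using T P Ppos t by (intro mult_mono mult_left_mono) auto
  also have "\<dots> = 2 ^ N * ((1 + t\<^sup>2) ^ (N + CARD('n)) * norm (c m))" by (simp add: power_add algebra_simps)
  also have "\<dots> \<le> 2 ^ N * C" using c[of m] by (intro mult_left_mono) (auto simp: t_def)
  finally have "norm (c m) * (1 + t) ^ N \<le> 2 ^ N * C / (\<Prod>i\<in>(UNIV::'n set). 1 + (\<kappa> * of_int (m $ i))\<^sup>2)"
    using Ppos by (simp add: pos_le_divide_eq)
  then show "norm (c m) * (1 + norm (lattice \<kappa> m)) ^ N \<le> 2 ^ N * C * (\<Prod>i\<in>UNIV. 1 / (1 + (\<kappa> * of_int (m $ i))\<^sup>2))"
    by (simp add: t_def prod_dividef)
qed simp

subsection \<open>Fourier series on a cube\<close>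

text \<open>A period cell for the frequencies \<open>lattice (1 / R)\<close>. Since
  \<open>pi > 3\<close> it contains the ball of radius \<open>3 * R\<close>, which leaves room for a
  cutoff supported in radius \<open>2 * R\<close>.\<close>

definition cube :: "real \<Rightarrow> 'a::euclidean_space set" where
  "cube R = cbox (\<Sum>b\<in>Basis. (- (pi * R)) *\<^sub>R b) (\<Sum>b\<in>Basis. (pi * R) *\<^sub>R b)"

lemma mem_cube: "x \<in> cube R \<longleftrightarrow> (\<forall>b\<in>Basis. \<bar>x \<bullet> b\<bar> \<le> pi * R)"
  unfolding cube_def mem_box
  by (intro ball_cong refl) (simp only: inner_sum_left_Basis abs_le_iff, auto)

lemma compact_cube: "compact (cube R)"
  by (simp add: cube_def compact_cbox)

lemma cube_borel: "cube R \<in> sets borel"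
  by (simp add: cube_def)

lemma ball_subset_cube:
  assumes "r \<le> 3 * R"
  shows "ball 0 r \<subseteq> (cube R :: 'a::euclidean_space set)"
proof
  fix x :: 'a assume x: "x \<in> ball 0 r"
  then have "0 < r" using norm_ge_zero[of x] by (simp del: norm_ge_zero)
  then have "0 \<le> R" using assms by simp
  then have "3 * R \<le> pi * R" using pi_gt3 by (intro mult_right_mono) auto
  then show "x \<in> cube R"
    unfolding mem_cube using Basis_le_norm[of _ x] x assms by fastforce
qed

text \<open>\<open>lborel\<close> is the image of a finite product of one-dimensional Lebesgue
  measures under the coordinate map, so Fubini for finite products applies.\<close>

lemma integral_coordinate_product:
  fixes g :: "'a::euclidean_space \<Rightarrow> real \<Rightarrow> complex"
  assumes "\<And>b. b \<in> Basis \<Longrightarrow> integrable lborel (g b)"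
  shows "(\<integral>x. (\<Prod>b\<in>Basis. g b (x \<bullet> b)) \<partial>lborel) = (\<Prod>b\<in>Basis. \<integral>t. g b t \<partial>lborel)"
proof -
  interpret product_sigma_finite "\<lambda>_::'a. lborel :: real measure" by standard
  have [measurable]: "g b \<in> borel_measurable borel" if "b \<in> Basis" for b
    using assms[OF that] by (simp add: borel_measurable_integrable)
  have "(\<lambda>x::'a. \<Prod>b\<in>Basis. g b (x \<bullet> b)) \<in> borel_measurable borel" by measurable
  then have "(\<integral>x. (\<Prod>b\<in>Basis. g b (x \<bullet> b)) \<partial>lborel) =
      (\<integral>f. (\<Prod>b\<in>Basis. g b ((\<Sum>c\<in>Basis. f c *\<^sub>R c) \<bullet> b)) \<partial>(\<Pi>\<^sub>M b\<in>Basis. lborel))"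
    by (subst lborel_eq, subst integral_distr) auto
  also have "\<dots> = (\<integral>f. (\<Prod>b\<in>Basis. g b (f b)) \<partial>(\<Pi>\<^sub>M b\<in>Basis. lborel))"
    by (intro Bochner_Integration.integral_cong prod.cong) auto
  also have "\<dots> = (\<Prod>b\<in>Basis. \<integral>t. g b t \<partial>lborel)"
    using assms by (intro product_integral_prod) auto
  finally show ?thesis .
qed

lemma cis_sum: "cis (\<Sum>i\<in>I. f i) = (\<Prod>i\<in>I. cis (f i))"
  by (induction I rule: infinite_finite_induct) (simp_all add: cis_mult[symmetric])

lemma cis_has_vector_derivative:
  "((\<lambda>t. cis (a * t)) has_vector_derivative \<i> * of_real a * cis (a * t)) (at t within S)"
proof -
  have "((\<lambda>t. cis (a * t)) has_derivative (\<lambda>h. \<i> * (of_real a * of_real h) * cis (a * t))) (at t within S)"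
    using has_derivative_at_withinI[OF cis_inner_has_derivative[of "- a" t], of S] by simp
  then show ?thesis
    unfolding has_vector_derivative_def by (rule has_derivative_eq_rhs) (auto simp: scaleR_conv_of_real)
qed

lemma integral_cis_period:
  fixes k :: int
  assumes R: "0 < R"
  shows "(\<integral>t. indicator {- (pi * R)..pi * R} t *\<^sub>R cis ((1 / R * of_int k) * t) \<partial>lborel) =
    (if k = 0 then of_real (2 * pi * R) else 0)"
    and "integrable lborel (\<lambda>t. indicator {- (pi * R)..pi * R} t *\<^sub>R cis (a * t))"
proof -
  show "integrable lborel (\<lambda>t. indicator {- (pi * R)..pi * R} t *\<^sub>R cis (a * t))"
    by (intro borel_integrable_compact compact_Icc continuous_intros)
  have ab: "- (pi * R) \<le> pi * R" using R by simp
  show "(\<integral>t. indicator {- (pi * R)..pi * R} t *\<^sub>R cis ((1 / R * of_int k) * t) \<partial>lborel) =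
    (if k = 0 then of_real (2 * pi * R) else 0)"
  proof (cases "k = 0")
    case True
    have "(\<integral>t. indicator {- (pi * R)..pi * R} t *\<^sub>R (1::complex) \<partial>lborel) = of_real (pi * R) - of_real (- (pi * R))"
      by (rule integral_FTC_Icc[OF ab]) (auto intro!: derivative_eq_intros continuous_intros simp: has_vector_derivative_def scaleR_conv_of_real)
    then show ?thesis using True by simp
  next
    case False
    define a where "a = 1 / R * of_int k"
    have a: "a \<noteq> 0" using False R by (simp add: a_def)
    define F where "F t = (1 / (\<i> * of_real a)) * cis (a * t)" for t
    have "(\<integral>t. indicator {- (pi * R)..pi * R} t *\<^sub>R cis (a * t) \<partial>lborel) = F (pi * R) - F (- (pi * R))"
    proof (rule integral_FTC_Icc[OF ab])
      fix t
      have "(F has_vector_derivative (1 / (\<i> * of_real a)) * (\<i> * of_real a * cis (a * t))) (at t within {- (pi * R)..pi * R})"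
        unfolding F_def by (rule has_vector_derivative_mult_right[OF cis_has_vector_derivative])
      then show "(F has_vector_derivative cis (a * t)) (at t within {- (pi * R)..pi * R})" using a by simp
    qed (intro continuous_intros)
    \<comment> \<open>The endpoints differ by k full periods of the exponential.\<close>
    moreover have "cis (a * (pi * R)) = cis (a * - (pi * R))"
    proof -
      have eq: "a * (pi * R) = pi * of_int k" using R by (simp add: a_def)
      show ?thesis unfolding mult_minus_right eq by (simp add: complex_eq_iff)
    qed
    ultimately show ?thesis using False by (simp add: F_def a_def del: mult_minus_right)
  qed
qed

lemma lattice_0: "lattice \<kappa> 0 = 0"
  by (simp add: lattice_def vec_eq_iff)

lemma lattice_inner_axis: "lattice \<kappa> m \<bullet> axis i 1 = \<kappa> * of_int (m $ i)"
  by (simp add: lattice_def inner_axis)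

lemma integral_cube_cis:
  fixes m :: "int^'n"
  assumes R: "0 < R"
  shows "(LINT x:cube R|lborel. cis (lattice (1 / R) m \<bullet> x)) = (if m = 0 then of_real ((2 * pi * R) ^ CARD('n)) else 0)"
proof -
  define \<omega> where "\<omega> = lattice (1 / R) m"
  have "(LINT x:cube R|lborel. cis (\<omega> \<bullet> x)) =
    (\<integral>x. (\<Prod>b\<in>Basis. indicator {- (pi * R)..pi * R} (x \<bullet> b) *\<^sub>R cis ((\<omega> \<bullet> b) * (x \<bullet> b))) \<partial>lborel)"
    unfolding set_lebesgue_integral_def
  proof (intro Bochner_Integration.integral_cong refl)
    fix x :: "real^'n"
    have "(\<Prod>b\<in>Basis. indicator {- (pi * R)..pi * R} (x \<bullet> b) *\<^sub>R cis ((\<omega> \<bullet> b) * (x \<bullet> b))) =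
      (\<Prod>b\<in>Basis. of_real (indicator {- (pi * R)..pi * R} (x \<bullet> b))) * cis (\<omega> \<bullet> x)"
      by (simp add: scaleR_conv_of_real prod.distrib cis_sum euclidean_inner[of \<omega> x])
    also have "(\<Prod>b\<in>Basis. of_real (indicator {- (pi * R)..pi * R} (x \<bullet> b))) = (of_real (indicator (cube R) x) :: complex)"
    proof (cases "x \<in> cube R")
      case True
      then have "indicator {- (pi * R)..pi * R} (x \<bullet> b) = (1::real)" if "b \<in> Basis" for b
        using that by (auto simp: mem_cube abs_le_iff minus_le_iff indicator_def)
      then show ?thesis using True by simp
    next
      case False
      then obtain b where "b \<in> Basis" "x \<bullet> b \<notin> {- (pi * R)..pi * R}"
        by (auto simp: mem_cube abs_le_iff minus_le_iff)
      then show ?thesis using False by (auto simp: indicator_def intro!: bexI[of _ b])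
    qed
    finally show "indicator (cube R) x *\<^sub>R cis (\<omega> \<bullet> x) =
      (\<Prod>b\<in>Basis. indicator {- (pi * R)..pi * R} (x \<bullet> b) *\<^sub>R cis ((\<omega> \<bullet> b) * (x \<bullet> b)))"
      by (simp add: scaleR_conv_of_real)
  qed
  also have "\<dots> = (\<Prod>b\<in>Basis. \<integral>t. indicator {- (pi * R)..pi * R} t *\<^sub>R cis ((\<omega> \<bullet> b) * t) \<partial>lborel)"
    using integral_cis_period(2)[OF R] by (intro integral_coordinate_product) auto
  also have "\<dots> = (\<Prod>i\<in>UNIV. if m $ i = 0 then of_real (2 * pi * R) else 0)"
  proof -
    have "Basis = range (\<lambda>i::'n. axis i (1::real))" by (auto simp: Basis_vec_def)
    moreover have "inj (\<lambda>i::'n. axis i (1::real))" by (auto simp: inj_on_def axis_eq_axis)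
    ultimately have "(\<Prod>b\<in>Basis. f b) = (\<Prod>i\<in>UNIV. f (axis i (1::real)))" for f :: "real^'n \<Rightarrow> complex"
      using prod.reindex[of "\<lambda>i::'n. axis i (1::real)" UNIV f] by simp
    then show ?thesis by (simp only: \<omega>_def lattice_inner_axis integral_cis_period(1)[OF R])
  qed
  also have "\<dots> = (if m = 0 then of_real ((2 * pi * R) ^ CARD('n)) else 0)"
  proof (cases "m = 0")
    case False
    then obtain i where "m $ i \<noteq> 0" by (auto simp: vec_eq_iff)
    then show ?thesis using False by (auto intro!: prod_zero)
  qed simp
  finally show ?thesis by (simp add: \<omega>_def)
qed

text \<open>Powers of T concentrate at its strict maximum: T stays above \<open>M'\<close> near x0
  and below \<open>M < M'\<close> away from it, so the far part loses against the near part, on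
  which E is positive, by a factor of order \<open>(M / M')^N\<close>.\<close>

lemma power_concentration:
  fixes E T :: "'a::euclidean_space \<Rightarrow> real"
  assumes B: "compact B" and E: "continuous_on B E" and T: "continuous_on B T" "\<And>y. y \<in> B \<Longrightarrow> 0 \<le> T y"
    and x0: "x0 \<in> interior B" "0 < E x0" "\<And>y. y \<in> B \<Longrightarrow> y \<noteq> x0 \<Longrightarrow> T y < T x0"
  shows "\<exists>N. (LINT y:B|lborel. E y * T y ^ N) \<noteq> 0"
proof -
  obtain r0 where r0: "r0 > 0" "ball x0 r0 \<subseteq> B"
    using x0(1) by (auto simp: mem_interior)
  have x0B: "x0 \<in> B" using x0(1) interior_subset by blast
  obtain r1 where r1: "r1 > 0" "\<And>y. y \<in> B \<Longrightarrow> dist y x0 < r1 \<Longrightarrow> dist (E y) (E x0) < E x0 / 2"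
    using E x0B x0(2) unfolding continuous_on_iff by (metis half_gt_zero)
  define r where "r = min r0 r1"
  have r: "0 < r" "ball x0 r \<subseteq> B" using r0 r1 by (auto simp: r_def)
  have Er: "E x0 / 2 \<le> E y" if "y \<in> ball x0 r" for y
  proof -
    have "dist (E y) (E x0) < E x0 / 2" using r1(2)[of y] that r(2) by (auto simp: r_def dist_commute)
    then show ?thesis unfolding dist_real_def by linarith
  qed
  have "\<exists>M. 0 \<le> M \<and> M < T x0 \<and> (\<forall>y\<in>B - ball x0 r. T y \<le> M)"
  proof (cases "B - ball x0 r = {}")
    case True
    \<comment> \<open>With nothing outside the ball, M is taken to be 0. That \<open>T x0\<close> is
      positive then follows by comparison with any other point of B.\<close>
    have "\<exists>y\<in>B. y \<noteq> x0"
    proof -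
      obtain b :: 'a where b: "b \<in> Basis" using nonempty_Basis by blast
      have "x0 + (r/2) *\<^sub>R b \<in> ball x0 r" "x0 + (r/2) *\<^sub>R b \<noteq> x0"
        using b r(1) by (auto simp: dist_norm nonzero_Basis)
      then show ?thesis using r(2) by blast
    qed
    then have "0 < T x0" using T(2) x0(3) by fastforce
    then show ?thesis using True by (intro exI[of _ 0]) auto
  next
    case False
    have "compact (B - ball x0 r)" using B by (simp add: compact_diff)
    then obtain y where y: "y \<in> B - ball x0 r" "\<And>z. z \<in> B - ball x0 r \<Longrightarrow> T z \<le> T y"
      using continuous_attains_sup[of "B - ball x0 r" T] False continuous_on_subset[OF T(1)] by blast
    have "y \<noteq> x0" using y(1) r(1) by auto
    then show ?thesis using y T(2)[of y] x0(3)[of y] by (intro exI[of _ "T y"]) auto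
  qed
  then obtain M where M: "0 \<le> M" "M < T x0" "\<And>y. y \<in> B - ball x0 r \<Longrightarrow> T y \<le> M" by blast
  define M' where "M' = (M + T x0) / 2"
  have M': "M < M'" "M' < T x0" "0 < M'" using M by (auto simp: M'_def)
  obtain r2 where r2: "r2 > 0" "\<And>y. y \<in> B \<Longrightarrow> dist y x0 < r2 \<Longrightarrow> dist (T y) (T x0) < T x0 - M'"
    using T(1) x0B M'(2) unfolding continuous_on_iff by (metis diff_gt_0_iff_gt)
  define r' where "r' = min r r2"
  have r': "0 < r'" "ball x0 r' \<subseteq> ball x0 r" using r r2 by (auto simp: r'_def)
  have Tr': "M' \<le> T y" if "y \<in> ball x0 r'" for y
  proof -
    have "y \<in> B" using that r(2) r'(2) by blast
    then have "dist (T y) (T x0) < T x0 - M'" using r2(2)[of y] that by (simp add: r'_def dist_commute)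
    then show ?thesis unfolding dist_real_def by linarith
  qed
  obtain K where K: "\<And>y. y \<in> B \<Longrightarrow> \<bar>E y\<bar> \<le> K"
    using compact_imp_bounded[OF compact_continuous_image[OF E B]] by (auto simp: bounded_iff)
  have K0: "0 \<le> K" using K[OF x0B] by simp
  define b where "b = measure lborel (ball x0 r')"
  define V where "V = measure lborel B"
  have fin: "emeasure lborel B < \<infinity>" using B by (intro emeasure_bounded_finite compact_imp_bounded)
  have b: "0 < b" using r'(1) by (simp add: b_def content_ball_pos)
  have lower: "E x0 / 2 * M' ^ N * b - K * M ^ N * V \<le> (LINT y:B|lborel. E y * T y ^ N)" for N
  proof -
    have i1: "integrable lborel (\<lambda>y. indicator B y *\<^sub>R (E y * T y ^ N))"
      using B E T by (intro borel_integrable_compact continuous_intros) auto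
    have ib: "integrable lborel (\<lambda>y. indicator (ball x0 r') y :: real)"
      by (intro integrable_real_indicator emeasure_bounded_finite) auto
    have iB: "integrable lborel (\<lambda>y. indicator B y :: real)"
      using B fin by (intro integrable_real_indicator) (auto simp: borel_compact)
    have "(\<integral>y. (E x0 / 2 * M' ^ N) * indicator (ball x0 r') y - (K * M ^ N) * indicator B y \<partial>lborel) \<le>
        (\<integral>y. indicator B y *\<^sub>R (E y * T y ^ N) \<partial>lborel)"
    proof (rule integral_mono)
      show "integrable lborel (\<lambda>y. (E x0 / 2 * M' ^ N) * indicator (ball x0 r') y - (K * M ^ N) * indicator B y)"
        using ib iB by (intro Bochner_Integration.integrable_diff integrable_mult_right) auto
      fix y
      show "(E x0 / 2 * M' ^ N) * indicator (ball x0 r') y - (K * M ^ N) * indicator B y \<le> indicator B y *\<^sub>R (E y * T y ^ N)"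
      proof (cases "y \<in> B")
        case False
        then have "y \<notin> ball x0 r'" using r'(2) r(2) by blast
        then show ?thesis using False by simp
      next
        case True
        have KM: "0 \<le> K * M ^ N" using K0 M(1) by simp
        show ?thesis
        proof (cases "y \<in> ball x0 r")
          case True
          have "0 \<le> E y * T y ^ N" using Er[OF True] x0(2) T(2)[OF \<open>y \<in> B\<close>] by simp
          moreover have "E x0 / 2 * M' ^ N \<le> E y * T y ^ N" if "y \<in> ball x0 r'"
            using Er[OF True] Tr'[OF that] M'(3) x0(2) by (intro mult_mono power_mono) auto
          ultimately show ?thesis using KM \<open>y \<in> B\<close> by (auto simp: indicator_def)
        next
          case False
          then have "T y ^ N \<le> M ^ N" using M(3)[of y] T(2)[of y] \<open>y \<in> B\<close> by (intro power_mono) auto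
          then have "\<bar>E y\<bar> * T y ^ N \<le> K * M ^ N"
            using K[OF \<open>y \<in> B\<close>] K0 T(2)[OF \<open>y \<in> B\<close>] by (intro mult_mono) auto
          moreover have "- (\<bar>E y\<bar> * T y ^ N) \<le> E y * T y ^ N"
            using T(2)[OF \<open>y \<in> B\<close>] mult_right_mono[of "- \<bar>E y\<bar>" "E y" "T y ^ N"] by simp
          moreover have "y \<notin> ball x0 r'" using False r'(2) by blast
          ultimately show ?thesis using \<open>y \<in> B\<close> by (simp add: indicator_def)
        qed
      qed
    qed (rule i1)
    moreover have "(\<integral>y. (E x0 / 2 * M' ^ N) * indicator (ball x0 r') y - (K * M ^ N) * indicator B y \<partial>lborel)
        = E x0 / 2 * M' ^ N * b - K * M ^ N * V"
      using ib iB by (subst Bochner_Integration.integral_diff) (auto simp: b_def V_def)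
    ultimately show ?thesis by (simp add: set_lebesgue_integral_def)
  qed
  have "norm (M / M') < 1" using M(1) M' by simp
  then have "(\<lambda>N. (M / M') ^ N) \<longlonglongrightarrow> 0" by (rule LIMSEQ_power_zero)
  then have "(\<lambda>N. K * V * (M / M') ^ N) \<longlonglongrightarrow> K * V * 0" by (rule tendsto_mult_left)
  then have "\<forall>\<^sub>F N in sequentially. K * V * (M / M') ^ N < E x0 / 2 * b"
    using b x0(2) by (intro order_tendstoD) auto
  then obtain N where N: "K * V * (M / M') ^ N < E x0 / 2 * b" by (auto simp: eventually_sequentially)
  have "K * V * M ^ N < E x0 / 2 * b * M' ^ N"
    using mult_strict_right_mono[OF N, of "M' ^ N"] M'(3) by (simp add: power_divide)
  then have "0 < (LINT y:B|lborel. E y * T y ^ N)" using lower[of N] by (simp add: algebra_simps)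
  then show ?thesis by (intro exI[of _ N]) simp
qed

lemma cos_cis: "of_real (cos t) = (cis t + cis (- t)) / 2"
  by (simp add: complex_eq_iff)

text \<open>A nonnegative trigonometric polynomial with its strict maximum at x0 has powers that
  concentrate there. These powers are trigonometric polynomials too, hence orthogonal to D, which is
  impossible if D is nonzero at x0.\<close>

lemma fourier_complete:
  fixes D :: "real^'n \<Rightarrow> complex"
  assumes R: "0 < R" and D: "continuous_on (cube R) D"
    and 0: "\<And>m. (LINT x:cube R|lborel. D x * cis (lattice (1 / R) m \<bullet> x)) = 0"
    and x0: "norm x0 < R"
  shows "D x0 = 0"
proof (rule ccontr)
  assume nz: "D x0 \<noteq> 0"
  \<comment> \<open>Each summand reaches its maximum 2 exactly where the coordinate agrees with that
    of x0 up to multiples of the period \<open>2 * pi * R\<close>.\<close>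
  define T where "T x = (\<Sum>i\<in>UNIV. 1 + cos (1 / R * (x $ i - x0 $ i)))" for x :: "real^'n"
  have Tcont: "continuous_on S T" for S unfolding T_def by (intro continuous_intros)
  have int: "integrable lborel (\<lambda>x. indicator (cube R) x *\<^sub>R (f x :: complex))" if "continuous_on (cube R) f" for f
    using that compact_cube by (intro borel_integrable_compact)
  \<comment> \<open>The cosine is the mean of two exponentials, so multiplying by T only shifts the
    lattice frequency by unit vectors; this is why m varies in the induction on N.\<close>
  have orth: "(LINT x:cube R|lborel. D x * of_real (T x ^ N) * cis (lattice (1 / R) m \<bullet> x)) = 0" for N m
  proof (induction N arbitrary: m)
    case 0
    then show ?case using assms(3) by simp
  next
    case (Suc N)
    define e where "e m x = D x * of_real (T x ^ N) * cis (lattice (1 / R) m \<bullet> x)" for m x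
    have econt: "continuous_on (cube R) (e m)" for m
      unfolding e_def using D Tcont by (intro continuous_intros)
    have si: "set_integrable lborel (cube R) (\<lambda>x. c * e m x)" for c m
      unfolding set_integrable_def using econt by (intro int continuous_intros)
    have shift: "of_real (1 + cos (1 / R * (x $ i - x0 $ i))) * e m x =
        e m x + (cis (- (1 / R * x0 $ i)) / 2 * e (m + axis i 1) x + cis (1 / R * x0 $ i) / 2 * e (m - axis i 1) x)" for i x m
    proof -
      have p: "cis (lattice (1 / R) (m + axis i 1) \<bullet> x) = cis (lattice (1 / R) m \<bullet> x) * cis (1 / R * x $ i)"
        "cis (lattice (1 / R) (m - axis i 1) \<bullet> x) = cis (lattice (1 / R) m \<bullet> x) * cis (- (1 / R * x $ i))"
      proof -
        have "lattice (1 / R) (m + axis i 1) = lattice (1 / R) m + axis i (1 / R)"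
          "lattice (1 / R) (m - axis i 1) = lattice (1 / R) m - axis i (1 / R)"
          by (auto simp: lattice_def vec_eq_iff axis_def algebra_simps)
        then show "cis (lattice (1 / R) (m + axis i 1) \<bullet> x) = cis (lattice (1 / R) m \<bullet> x) * cis (1 / R * x $ i)"
          "cis (lattice (1 / R) (m - axis i 1) \<bullet> x) = cis (lattice (1 / R) m \<bullet> x) * cis (- (1 / R * x $ i))"
          by (simp_all add: inner_add_left inner_diff_left inner_axis' cis_mult)
      qed
      have "of_real (1 + cos (1 / R * (x $ i - x0 $ i))) =
         (1 :: complex) + (cis (- (1 / R * x0 $ i)) / 2 * cis (1 / R * x $ i) + cis (1 / R * x0 $ i) / 2 * cis (- (1 / R * x $ i)))"
        by (simp add: cos_cis cis_mult algebra_simps add_divide_distrib)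
      then show ?thesis unfolding e_def p by (simp only: algebra_simps mult_1_left)
    qed
    have "(LINT x:cube R|lborel. D x * of_real (T x ^ Suc N) * cis (lattice (1 / R) m \<bullet> x)) =
      (LINT x:cube R|lborel. \<Sum>i\<in>UNIV. e m x + (cis (- (1 / R * x0 $ i)) / 2 * e (m + axis i 1) x + cis (1 / R * x0 $ i) / 2 * e (m - axis i 1) x))"
    proof -
      have "D x * of_real (T x ^ Suc N) * cis (lattice (1 / R) m \<bullet> x) = of_real (T x) * e m x" for x
        by (simp add: e_def mult_ac)
      also have "of_real (T x) * e m x = (\<Sum>i\<in>UNIV. of_real (1 + cos (1 / R * (x $ i - x0 $ i))) * e m x)" for x
        by (simp only: T_def of_real_sum sum_distrib_right)
      finally show ?thesis by (simp only: shift)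
    qed
    also have "\<dots> = (\<Sum>i\<in>UNIV. LINT x:cube R|lborel. e m x + (cis (- (1 / R * x0 $ i)) / 2 * e (m + axis i 1) x + cis (1 / R * x0 $ i) / 2 * e (m - axis i 1) x))"
      unfolding set_lebesgue_integral_def scaleR_sum_right
      using econt by (intro Bochner_Integration.integral_sum int continuous_intros)
    also have "\<dots> = (\<Sum>i\<in>(UNIV::'n set). 0)"
    proof (intro sum.cong refl)
      fix i
      have e0: "(LINT x:cube R|lborel. e m x) = 0" for m using Suc.IH by (simp add: e_def)
      have "(LINT x:cube R|lborel. e m x + (cis (- (1 / R * x0 $ i)) / 2 * e (m + axis i 1) x + cis (1 / R * x0 $ i) / 2 * e (m - axis i 1) x))
        = (LINT x:cube R|lborel. 1 * e m x) + (LINT x:cube R|lborel. cis (- (1 / R * x0 $ i)) / 2 * e (m + axis i 1) x + cis (1 / R * x0 $ i) / 2 * e (m - axis i 1) x)"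
        unfolding mult_1_left by (rule set_integral_add(2)[OF si[of 1 m, unfolded mult_1_left] set_integral_add(1)[OF si si]])
      also have "\<dots> = 0"
        unfolding set_integral_add(2)[OF si si] by (simp only: set_integral_mult_right e0)  simp
      finally show "(LINT x:cube R|lborel. e m x + (cis (- (1 / R * x0 $ i)) / 2 * e (m + axis i 1) x + cis (1 / R * x0 $ i) / 2 * e (m - axis i 1) x)) = 0" .
    qed
    finally show ?case by simp
  qed
  \<comment> \<open>The constant factor makes the real part positive at x0, where it is the squared
    modulus of \<open>D x0\<close>.\<close>
  define E where "E x = Re (cnj (D x0) * D x)" for x
  have "(LINT x:cube R|lborel. E x * T x ^ N) = 0" for N
  proof -
    have i: "integrable lborel (\<lambda>x. indicator (cube R) x *\<^sub>R (cnj (D x0) * (D x * of_real (T x ^ N))))"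
      using D Tcont by (intro int continuous_intros)
    have "(LINT x:cube R|lborel. cnj (D x0) * (D x * of_real (T x ^ N))) = 0"
      using orth[of N 0] by (simp add: lattice_0)
    then have "Re (\<integral>x. indicator (cube R) x *\<^sub>R (cnj (D x0) * (D x * of_real (T x ^ N))) \<partial>lborel) = 0"
      unfolding set_lebesgue_integral_def by (simp only: zero_complex.simps)
    then have "(\<integral>x. Re (indicator (cube R) x *\<^sub>R (cnj (D x0) * (D x * of_real (T x ^ N)))) \<partial>lborel) = 0"
      unfolding integral_Re[OF i] .
    moreover have "Re (indicator (cube R) x *\<^sub>R (cnj (D x0) * (D x * of_real (T x ^ N)))) = indicator (cube R) x *\<^sub>R (E x * T x ^ N)" for x
      by (simp add: E_def algebra_simps)
    ultimately show ?thesis by (simp only: set_lebesgue_integral_def)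
  qed
  moreover have "\<exists>N. (LINT x:cube R|lborel. E x * T x ^ N) \<noteq> 0"
  proof (rule power_concentration[OF compact_cube _ Tcont, of R E x0])
    show "continuous_on (cube R) E" unfolding E_def using D by (intro continuous_intros)
    show "0 \<le> T x" for x
      unfolding T_def by (intro sum_nonneg) (smt (verit) cos_ge_minus_one)
    show "x0 \<in> interior (cube R)"
      using ball_subset_cube[of R R] R x0 by (intro interiorI[of "ball 0 R"]) auto
    show "0 < E x0" using complex_neq_0[THEN iffD1, OF nz] by (simp add: E_def power2_eq_square)
    fix y :: "real^'n" assume y: "y \<in> cube R" "y \<noteq> x0"
    then obtain i where i: "y $ i \<noteq> x0 $ i" by (auto simp: vec_eq_iff)
    have Tx0: "T x0 = (\<Sum>i\<in>(UNIV::'n set). 2)" by (simp add: T_def)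
    have "cos (1 / R * (y $ i - x0 $ i)) \<noteq> 1"
    proof
      assume "cos (1 / R * (y $ i - x0 $ i)) = 1"
      then obtain k :: int where k: "1 / R * (y $ i - x0 $ i) = of_int k * 2 * pi" unfolding cos_one_2pi_int by blast
      \<comment> \<open>A coordinate of a point of the closed cube and one of x0, whose norm is
        below R, differ by strictly less than the period, so congruent coordinates are
        equal.\<close>
      have "\<bar>y \<bullet> axis i 1\<bar> \<le> pi * R" using y(1) axis_Basis[of i] unfolding mem_cube by blast
      then have "\<bar>y $ i\<bar> \<le> pi * R" by (simp add: inner_axis)
      moreover have "\<bar>x0 $ i\<bar> < R" using component_le_norm_cart[of x0 i] x0 by simp
      moreover have "R \<le> pi * R" using R pi_gt3 by simp
      ultimately have "\<bar>y $ i - x0 $ i\<bar> < 2 * pi * R" by simp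
      then have "\<bar>1 / R * (y $ i - x0 $ i)\<bar> < 2 * pi" using R by (simp add: abs_mult field_simps)
      then have "\<bar>of_int k\<bar> * (2 * pi) < 1 * (2 * pi)" unfolding k by (simp add: abs_mult)
      then have "\<bar>of_int k :: real\<bar> < 1" by (simp only: mult_less_cancel_right_pos pi_gt_zero mult_pos_pos zero_less_numeral)
      then have "k = 0" by linarith
      then show False using k i R by simp
    qed
    then have "cos (1 / R * (y $ i - x0 $ i)) < 1" using cos_le_one less_le by blast
    then show "T y < T x0"
      unfolding Tx0 unfolding T_def by (intro sum_strict_mono_ex1) (auto intro!: bexI[of _ i])
  qed
  ultimately show False by blast
qed

text \<open>The function is cut off inside a period cell, and decay makes its series absolutely
  convergent. The sum has the same Fourier coefficients as the cut off function, so completeness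
  identifies the two in the ball of radius R, where the cutoff is 1.\<close>

theorem fourier_representation:
  fixes \<phi> :: "real^'n \<Rightarrow> real"
  assumes R: "0 < R" and \<phi>: "\<And>k. C_k_on k UNIV \<phi>"
  obtains c where "weighted_summable N c (lattice (1 / R))"
    "\<And>x. norm x < R \<Longrightarrow> of_real (\<phi> x) = exp_sum c (lattice (1 / R)) x"
proof -
  define \<psi> where "\<psi> x = \<phi> x * cutoff R x" for x
  define L where "L = (2 * pi * R) ^ CARD('n)"
  have L: "L > 0" using R by (simp add: L_def)
  have \<psi>: "C_k_on k UNIV \<psi>" for k
    unfolding \<psi>_def by (intro C_k_on_mult \<phi> cutoff_smooth R open_UNIV)
  have supp: "\<psi> x = 0" if "2 * R < norm x" for x using cutoff_0[OF that R] by (simp add: \<psi>_def)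
  define c where "c m = fourier (3 * R) \<psi> (lattice (1 / R) m) / of_real L" for m :: "int^'n"
  have r: "0 < 3 * R" "2 * R < 3 * R" using R by auto
  obtain C where C: "\<And>\<xi>. (1 + (norm \<xi>)\<^sup>2) ^ (N + CARD('n)) * norm (fourier (3 * R) \<psi> \<xi>) \<le> C"
    using fourier_decay[OF \<psi> supp r] by metis
  have "(1 + (norm (lattice (1 / R) m))\<^sup>2) ^ (N + CARD('n)) * norm (c m) \<le> C / L" for m
    using divide_right_mono[OF C[of "lattice (1 / R) m"], of L] L by (simp add: c_def norm_divide)
  then have w: "weighted_summable N c (lattice (1 / R))"
    using R by (intro weighted_summable_lattice) auto
  have w0: "weighted_summable 0 c (lattice (1 / R))" using w by (rule weighted_summable_mono) simp
  \<comment> \<open>N may be 0, while continuity of the sum is derived from weight 2; so the decay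
    estimate is taken a second time with a fixed order.\<close>
  obtain C2 where C2: "\<And>\<xi>. (1 + (norm \<xi>)\<^sup>2) ^ (2 + CARD('n)) * norm (fourier (3 * R) \<psi> \<xi>) \<le> C2"
    using fourier_decay[OF \<psi> supp r] by metis
  have "(1 + (norm (lattice (1 / R) m))\<^sup>2) ^ (2 + CARD('n)) * norm (c m) \<le> C2 / L" for m
    using divide_right_mono[OF C2[of "lattice (1 / R) m"], of L] L by (simp add: c_def norm_divide)
  then have w2: "weighted_summable 2 c (lattice (1 / R))"
    using R by (intro weighted_summable_lattice) auto
  define S where "S = exp_sum c (lattice (1 / R))"
  have Scont: "continuous_on A S" for A
    unfolding S_def using has_derivative_continuous[OF exp_sum_has_derivative[OF w2]]
    by (intro continuous_at_imp_continuous_on) auto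
  have \<psi>cont: "continuous_on A \<psi>" for A
    using C_k_on_imp_continuous_on[OF \<psi>[of 0]] continuous_on_subset by blast
  have si: "set_integrable lborel (cube R) f" if "continuous_on (cube R) f" for f :: "real^'n \<Rightarrow> complex"
    unfolding set_integrable_def using that compact_cube by (intro borel_integrable_compact)
  have Scoeff: "(LINT x:cube R|lborel. S x * cis (- (lattice (1 / R) k \<bullet> x))) = of_real L * c k" for k
  proof -
    have "norm ((LINT x:cube R|lborel. S x * cis (- (lattice (1 / R) k \<bullet> x))) - of_real L * c k) \<le> 0 + e" if e: "0 < e" for e
    proof -
      \<comment> \<open>L is the volume of the cell, so a tail below this bound contributes at most
        \<open>e / 2\<close> to the integral, and a coefficient outside F, multiplied by L, at most
        \<open>e / 2\<close> as well.\<close>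
      have e': "0 < e / (2 * L)" using e L by simp
      obtain F where F: "finite F" "weighted_summable 0 (\<lambda>i. if i \<in> F then 0 else c i) (lattice (1 / R))"
        "weighted_norm 0 (\<lambda>i. if i \<in> F then 0 else c i) (lattice (1 / R)) < e / (2 * L)"
        "\<And>x. exp_sum c (lattice (1 / R)) x = (\<Sum>i\<in>F. c i * cis (lattice (1 / R) i \<bullet> x)) + exp_sum (\<lambda>i. if i \<in> F then 0 else c i) (lattice (1 / R)) x"
        by (rule exp_sum_approx[OF w0 e'], rule that)
      define c' where "c' i = (if i \<in> F then 0 else c i)" for i
      define S' where "S' = exp_sum c' (lattice (1 / R))"
      have S'le: "norm (S' x) \<le> e / (2 * L)" for x
        using exp_sum_norm_le[OF F(2), of x] F(3) by (simp add: S'_def c'_def[abs_def] weighted_norm_def)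
      have Seq: "S' x = S x - (\<Sum>i\<in>F. c i * cis (lattice (1 / R) i \<bullet> x))" for x
        using F(4)[of x] by (simp add: S_def S'_def c'_def[abs_def])
      have S'cont: "continuous_on A S'" for A
        unfolding Seq[abs_def] by (intro continuous_intros Scont)
      have fin: "(LINT x:cube R|lborel. (\<Sum>i\<in>F. c i * cis (lattice (1 / R) i \<bullet> x)) * cis (- (lattice (1 / R) k \<bullet> x))) =
          (if k \<in> F then of_real L * c k else 0)"
      proof -
        have "(\<Sum>i\<in>F. c i * cis (lattice (1 / R) i \<bullet> x)) * cis (- (lattice (1 / R) k \<bullet> x)) =
           (\<Sum>i\<in>F. c i * cis (lattice (1 / R) (i - k) \<bullet> x))" for x
        proof -
          have "lattice (1 / R) (i - k) = lattice (1 / R) i - lattice (1 / R) k" for i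
            by (simp add: lattice_def vec_eq_iff right_diff_distrib)
          then show ?thesis by (simp add: sum_distrib_right mult.assoc cis_mult inner_diff_left)
        qed
        then have "(LINT x:cube R|lborel. (\<Sum>i\<in>F. c i * cis (lattice (1 / R) i \<bullet> x)) * cis (- (lattice (1 / R) k \<bullet> x))) =
          (LINT x:cube R|lborel. (\<Sum>i\<in>F. c i * cis (lattice (1 / R) (i - k) \<bullet> x)))" by simp
        also have "\<dots> = (\<Sum>i\<in>F. LINT x:cube R|lborel. c i * cis (lattice (1 / R) (i - k) \<bullet> x))"
          unfolding set_lebesgue_integral_def scaleR_sum_right
          by (intro Bochner_Integration.integral_sum si[unfolded set_integrable_def] continuous_intros)
        also have "\<dots> = (\<Sum>i\<in>F. if i = k then of_real L * c k else 0)"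
          by (intro sum.cong refl) (simp add: integral_cube_cis[OF R] L_def mult.commute)
        also have "\<dots> = (if k \<in> F then of_real L * c k else 0)" using F(1) by simp
        finally show ?thesis .
      qed
      have split: "(LINT x:cube R|lborel. S x * cis (- (lattice (1 / R) k \<bullet> x))) =
        (if k \<in> F then of_real L * c k else 0) + (LINT x:cube R|lborel. S' x * cis (- (lattice (1 / R) k \<bullet> x)))"
      proof -
        have "S x * cis (- (lattice (1 / R) k \<bullet> x)) = (\<Sum>i\<in>F. c i * cis (lattice (1 / R) i \<bullet> x)) * cis (- (lattice (1 / R) k \<bullet> x))
          + S' x * cis (- (lattice (1 / R) k \<bullet> x))" for x by (simp add: Seq algebra_simps)
        then have "(LINT x:cube R|lborel. S x * cis (- (lattice (1 / R) k \<bullet> x))) =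
          (LINT x:cube R|lborel. (\<Sum>i\<in>F. c i * cis (lattice (1 / R) i \<bullet> x)) * cis (- (lattice (1 / R) k \<bullet> x))
          + S' x * cis (- (lattice (1 / R) k \<bullet> x)))" by simp
        also have "\<dots> = (LINT x:cube R|lborel. (\<Sum>i\<in>F. c i * cis (lattice (1 / R) i \<bullet> x)) * cis (- (lattice (1 / R) k \<bullet> x)))
          + (LINT x:cube R|lborel. S' x * cis (- (lattice (1 / R) k \<bullet> x)))"
          by (intro set_integral_add(2) si continuous_intros S'cont)
        finally show ?thesis unfolding fin .
      qed
      have tail: "norm (LINT x:cube R|lborel. S' x * cis (- (lattice (1 / R) k \<bullet> x))) \<le> e / 2"
      proof -
        have i1: "integrable lborel (\<lambda>x. indicator (cube R) x *\<^sub>R (S' x * cis (- (lattice (1 / R) k \<bullet> x))))"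
          using si[unfolded set_integrable_def] S'cont by (intro si[unfolded set_integrable_def] continuous_intros)
        have mc: "emeasure lborel (cube R :: (real^'n) set) = ennreal L"
        proof -
          have b: "(\<Sum>b\<in>Basis. (- (pi * R)) *\<^sub>R b) \<bullet> i = - (pi * R)" "(\<Sum>b\<in>Basis. (pi * R) *\<^sub>R b) \<bullet> i = pi * R"
            if "i \<in> Basis" for i :: "real^'n" using that by (simp_all only: inner_sum_left_Basis)
          have "emeasure lborel (cube R :: (real^'n) set) = (\<Prod>b\<in>(Basis::(real^'n) set).
              ((\<Sum>b\<in>Basis. (pi * R) *\<^sub>R b) - (\<Sum>b\<in>Basis. (- (pi * R)) *\<^sub>R b)) \<bullet> b)"
            unfolding cube_def using R by (intro emeasure_lborel_cbox) (simp only: b, simp)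
          also have "(\<Prod>b\<in>(Basis::(real^'n) set).
              ((\<Sum>b\<in>Basis. (pi * R) *\<^sub>R b) - (\<Sum>b\<in>Basis. (- (pi * R)) *\<^sub>R b)) \<bullet> b) = (\<Prod>b\<in>(Basis::(real^'n) set). 2 * pi * R)"
          proof (intro prod.cong refl)
            fix i :: "real^'n" assume i: "i \<in> Basis"
            show "((\<Sum>b\<in>Basis. (pi * R) *\<^sub>R b) - (\<Sum>b\<in>Basis. (- (pi * R)) *\<^sub>R b)) \<bullet> i = 2 * pi * R"
              unfolding inner_diff_left b[OF i] by simp
          qed
          finally show ?thesis by (simp add: L_def)
        qed
        have iI: "integrable lborel (\<lambda>x. indicator (cube R :: (real^'n) set) x * (e / (2 * L)))"
          using mc by (intro integrable_mult_left integrable_real_indicator) (auto simp: cube_borel)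
        have "norm (LINT x:cube R|lborel. S' x * cis (- (lattice (1 / R) k \<bullet> x))) \<le>
           (\<integral>x. indicator (cube R :: (real^'n) set) x * (e / (2 * L)) \<partial>lborel)"
          unfolding set_lebesgue_integral_def
        proof (rule order_trans[OF integral_norm_bound integral_mono])
          show "integrable lborel (\<lambda>x. norm (indicator (cube R) x *\<^sub>R (S' x * cis (- (lattice (1 / R) k \<bullet> x)))))"
            using i1 by (rule integrable_norm)
        qed (use iI in \<open>auto simp: indicator_def norm_mult S'le\<close>)
        also have "\<dots> = e / 2"
          using mc L by (simp add: measure_def cube_borel)
        finally show ?thesis .
      qed
      have "norm (if k \<in> F then 0 else of_real L * c k) \<le> e / 2"
      proof (cases "k \<in> F")
        case False
        have "norm (c' k) \<le> (\<Sum>\<^sub>\<infinity>i. norm (c' i))"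
          using finite_sum_le_infsum[OF exp_sum_terms_summable(2)[OF F(2)], of "{k}"] by (simp add: c'_def)
        also have "\<dots> < e / (2 * L)" using F(3) by (simp add: weighted_norm_def c'_def)
        finally have "L * norm (c k) \<le> L * (e / (2 * L))" using False L by (intro mult_left_mono) (auto simp: c'_def)
        then show ?thesis using False L by (simp add: norm_mult)
      qed (use e in simp)
      then have "norm ((LINT x:cube R|lborel. S' x * cis (- (lattice (1 / R) k \<bullet> x))) - (if k \<in> F then 0 else of_real L * c k)) \<le> e / 2 + e / 2"
        using tail by (intro order_trans[OF norm_triangle_ineq4] add_mono)
      moreover have "(LINT x:cube R|lborel. S x * cis (- (lattice (1 / R) k \<bullet> x))) - of_real L * c k =
        (LINT x:cube R|lborel. S' x * cis (- (lattice (1 / R) k \<bullet> x))) - (if k \<in> F then 0 else of_real L * c k)"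
        unfolding split by simp
      ultimately show ?thesis by simp
    qed
    then have "norm ((LINT x:cube R|lborel. S x * cis (- (lattice (1 / R) k \<bullet> x))) - of_real L * c k) \<le> 0"
      by (rule field_le_epsilon)
    then show ?thesis by simp
  qed
  have \<psi>coeff: "(LINT x:cube R|lborel. of_real (\<psi> x) * cis (- (lattice (1 / R) k \<bullet> x))) = of_real L * c k" for k
  proof -
    have "indicator (cube R) x *\<^sub>R (of_real (\<psi> x) * cis (- (lattice (1 / R) k \<bullet> x))) =
      indicator (ball 0 (3 * R)) x *\<^sub>R (\<psi> x *\<^sub>R cis (- (lattice (1 / R) k \<bullet> x)))" for x
    proof (cases "x \<in> ball 0 (3 * R)")
      case True
      then show ?thesis using ball_subset_cube[of "3 * R" R] by (auto simp: indicator_def scaleR_conv_of_real)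
    next
      case False
      then have "\<psi> x = 0" using R by (intro supp) auto
      then show ?thesis by simp
    qed
    then have "(LINT x:cube R|lborel. of_real (\<psi> x) * cis (- (lattice (1 / R) k \<bullet> x))) = fourier (3 * R) \<psi> (lattice (1 / R) k)"
      unfolding fourier_def set_lebesgue_integral_def by (simp only:)
    then show ?thesis using L by (simp add: c_def)
  qed
  have "of_real (\<psi> x) - S x = 0" if x: "norm x < R" for x
  proof (rule fourier_complete[OF R _ _ x, where D = "\<lambda>x. of_real (\<psi> x) - S x"])
    show "continuous_on (cube R) (\<lambda>x. of_real (\<psi> x) - S x)" by (intro continuous_intros \<psi>cont Scont)
    fix m :: "int^'n"
    have m: "lattice (1 / R) m \<bullet> x = - (lattice (1 / R) (- m) \<bullet> x)" for x
    proof -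
      have "lattice (1 / R) (- m) = - lattice (1 / R) m" by (simp add: lattice_def vec_eq_iff)
      then show ?thesis by simp
    qed
    have "(of_real (\<psi> x) - S x) * cis (lattice (1 / R) m \<bullet> x) =
       of_real (\<psi> x) * cis (- (lattice (1 / R) (- m) \<bullet> x)) - S x * cis (- (lattice (1 / R) (- m) \<bullet> x))" for x
      unfolding m by (rule left_diff_distrib)
    then have "(LINT x:cube R|lborel. (of_real (\<psi> x) - S x) * cis (lattice (1 / R) m \<bullet> x)) =
       (LINT x:cube R|lborel. of_real (\<psi> x) * cis (- (lattice (1 / R) (- m) \<bullet> x)) - S x * cis (- (lattice (1 / R) (- m) \<bullet> x)))"
      by (simp only:)
    also have "\<dots> = (LINT x:cube R|lborel. of_real (\<psi> x) * cis (- (lattice (1 / R) (- m) \<bullet> x)))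
       - (LINT x:cube R|lborel. S x * cis (- (lattice (1 / R) (- m) \<bullet> x)))"
      by (intro set_integral_diff(2) si continuous_intros \<psi>cont Scont)
    also have "\<dots> = 0" unfolding Scoeff \<psi>coeff by simp
    finally show "(LINT x:cube R|lborel. (of_real (\<psi> x) - S x) * cis (lattice (1 / R) m \<bullet> x)) = 0" .
  qed
  then have \<psi>S: "of_real (\<psi> x) = exp_sum c (lattice (1 / R)) x" if "norm x < R" for x
    using that by (simp add: S_def)
  have "of_real (\<phi> x) = exp_sum c (lattice (1 / R)) x" if x: "norm x < R" for x
  proof -
    have "\<psi> x = \<phi> x" using cutoff_1[of x R] x R by (simp add: \<psi>_def)
    then show ?thesis using \<psi>S[OF x] by simp
  qed
  with w show ?thesis by (rule that)
qed

corollary complex_fourier_representation: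
  fixes F :: "real^'n \<Rightarrow> complex"
  assumes R: "0 < R" and F: "\<And>k. complex_C_k k F"
  obtains c where "weighted_summable N c (lattice (1 / R))"
    "\<And>x. norm x < R \<Longrightarrow> F x = exp_sum c (lattice (1 / R)) x"
proof -
  have s: "C_k_on k UNIV (\<lambda>x. Re (F x))" "C_k_on k UNIV (\<lambda>x. Im (F x))" for k
    using F by (auto simp: complex_C_k_def)
  obtain c1 where c1: "weighted_summable N c1 (lattice (1 / R))"
    "\<And>x. norm x < R \<Longrightarrow> of_real (Re (F x)) = exp_sum c1 (lattice (1 / R)) x"
    using fourier_representation[OF R s(1)] by metis
  obtain c2 where c2: "weighted_summable N c2 (lattice (1 / R))"
    "\<And>x. norm x < R \<Longrightarrow> of_real (Im (F x)) = exp_sum c2 (lattice (1 / R)) x"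
    using fourier_representation[OF R s(2)] by metis
  have c2': "weighted_summable N (\<lambda>i. \<i> * c2 i) (lattice (1 / R))"
    using c2(1) by (simp add: weighted_summable_def norm_mult)
  show ?thesis
  proof
    have sum: "(\<lambda>i. norm (c1 i) * (1 + norm (lattice (1 / R) i)) ^ N + norm (\<i> * c2 i) * (1 + norm (lattice (1 / R) i)) ^ N) summable_on UNIV"
      using c1(1) c2' unfolding weighted_summable_def by (rule summable_on_add)
    show "weighted_summable N (\<lambda>i. c1 i + \<i> * c2 i) (lattice (1 / R))"
      unfolding weighted_summable_def
      by (rule summable_on_nonneg_comparison[OF sum])
        (auto simp: distrib_right[symmetric] intro!: mult_right_mono norm_triangle_ineq)
    fix x :: "real^'n" assume x: "norm x < R"
    have "exp_sum (\<lambda>i. c1 i + \<i> * c2 i) (lattice (1 / R)) x = exp_sum c1 (lattice (1 / R)) x + \<i> * exp_sum c2 (lattice (1 / R)) x"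
      using exp_sum_add[OF weighted_summable_mono[OF c1(1)] weighted_summable_mono[OF c2']] by (simp add: exp_sum_cmult)
    then show "F x = exp_sum (\<lambda>i. c1 i + \<i> * c2 i) (lattice (1 / R)) x"
      using c1(2)[OF x] c2(2)[OF x] complex_eq[of "F x"] by simp
  qed
qed

subsection \<open>Sums over lists\<close>

lemma sum_prod_list_length:
  fixes v :: "'m \<Rightarrow> real"
  assumes "finite M"
  shows "(\<Sum>l\<in>{l. set l \<subseteq> M \<and> length l = j}. prod_list (map v l)) = (\<Sum>m\<in>M. v m) ^ j"
proof (induction j)
  case 0
  have "{l. set l \<subseteq> M \<and> length l = 0} = {[]}" by auto
  then show ?case by simp
next
  case (Suc j)
  define A where "A = {l. set l \<subseteq> M \<and> length l = j}"
  have "{l. set l \<subseteq> M \<and> length l = Suc j} = (\<lambda>(m, l). m # l) ` (M \<times> A)"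
  proof -
    have "l \<in> (\<lambda>(m, l). m # l) ` (M \<times> A)" if "set l \<subseteq> M" "length l = Suc j" for l
      using that by (cases l) (auto simp: A_def)
    then show ?thesis by (auto simp: A_def)
  qed
  then have "(\<Sum>l\<in>{l. set l \<subseteq> M \<and> length l = Suc j}. prod_list (map v l)) =
     (\<Sum>(m, l)\<in>M \<times> A. v m * prod_list (map v l))"
    by (simp add: sum.reindex inj_on_def case_prod_beta)
  also have "\<dots> = (\<Sum>m\<in>M. v m) * (\<Sum>l\<in>A. prod_list (map v l))"
    by (simp add: sum_product sum.cartesian_product)
  finally show ?case using Suc by (simp add: A_def)
qed

text \<open>Lists of length j over a finite set sum up to the j-th power of a sum that is at most
  \<open>infsum v UNIV\<close>, so all lists together are bounded by a geometric series.\<close>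

lemma summable_prod_list:
  fixes v :: "'m \<Rightarrow> real"
  assumes v: "v summable_on UNIV" "\<And>m. 0 \<le> v m" and less: "infsum v UNIV < 1"
  shows "(\<lambda>l. prod_list (map v l)) summable_on UNIV"
    "(\<Sum>\<^sub>\<infinity>l. prod_list (map v l)) \<le> 1 / (1 - infsum v UNIV)"
proof -
  define \<epsilon> where "\<epsilon> = infsum v UNIV"
  have \<epsilon>: "0 \<le> \<epsilon>" "\<epsilon> < 1" using less v(2) by (auto simp: \<epsilon>_def infsum_nonneg)
  have nn: "0 \<le> prod_list (map v l)" for l using v(2) by (induction l) auto
  have bound: "(\<Sum>l\<in>F. prod_list (map v l)) \<le> 1 / (1 - \<epsilon>)" if F: "finite F" for F
  proof -
    define M where "M = \<Union>(set ` F)"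
    define J where "J = Max (insert 0 (length ` F))"
    have M: "finite M" using F by (auto simp: M_def)
    have "F \<subseteq> (\<Union>j\<in>{..J}. {l. set l \<subseteq> M \<and> length l = j})"
      using F by (auto simp: M_def J_def intro!: Max_ge)
    then have "(\<Sum>l\<in>F. prod_list (map v l)) \<le> (\<Sum>l\<in>(\<Union>j\<in>{..J}. {l. set l \<subseteq> M \<and> length l = j}). prod_list (map v l))"
      using M nn by (intro sum_mono2) (auto intro: finite_lists_length_eq)
    also have "\<dots> = (\<Sum>j\<le>J. \<Sum>l\<in>{l. set l \<subseteq> M \<and> length l = j}. prod_list (map v l))"
      using M by (intro sum.UNION_disjoint) (auto intro: finite_lists_length_eq)
    also have "\<dots> = (\<Sum>j\<le>J. (\<Sum>m\<in>M. v m) ^ j)" by (simp add: sum_prod_list_length[OF M])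
    also have "\<dots> \<le> (\<Sum>j\<le>J. \<epsilon> ^ j)"
      unfolding \<epsilon>_def using v M by (intro sum_mono power_mono finite_sum_le_infsum sum_nonneg) auto
    also have "\<dots> \<le> (\<Sum>j. \<epsilon> ^ j)"
      using \<epsilon> by (intro sum_le_suminf) (auto intro: summable_geometric)
    also have "\<dots> = 1 / (1 - \<epsilon>)" using \<epsilon> by (simp add: suminf_geometric)
    finally show ?thesis .
  qed
  show s: "(\<lambda>l. prod_list (map v l)) summable_on UNIV"
    by (rule nonneg_bdd_above_summable_on) (auto intro!: bdd_aboveI2[of _ _ "1 / (1 - \<epsilon>)"] bound nn)
  show "(\<Sum>\<^sub>\<infinity>l. prod_list (map v l)) \<le> 1 / (1 - infsum v UNIV)"
    unfolding \<epsilon>_def[symmetric] by (rule infsum_le_finite_sums[OF s]) (auto intro: bound)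
qed

subsection \<open>Complex geometric optics solutions\<close>

text \<open>The equation \<open>\<Delta>P + 2 \<zeta> \<cdot> \<nabla>P = q P\<close> with \<open>\<zeta> = \<alpha> + i \<beta>\<close> is solved by iterating \<open>P \<mapsto> 1 + G (q P)\<close>, where
  \<open>G\<close> divides Fourier coefficients by the symbol. Expanding all products of Fourier series, the
  solution becomes an exponential sum indexed by lists of frequencies. The first application of \<open>q\<close>, to
  the constant 1, uses an expansion of \<open>q\<close> in frequencies shifted by \<open>\<theta>\<close>, which keeps all
  frequencies away from the zeros of the symbol.\<close>

definition symbol :: "'a::euclidean_space \<Rightarrow> 'a \<Rightarrow> 'a \<Rightarrow> complex" where
  "symbol \<alpha> \<beta> \<xi> = Complex (- 2 * (\<beta> \<bullet> \<xi>) - (norm \<xi>)\<^sup>2) (2 * (\<alpha> \<bullet> \<xi>))"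

text \<open>The head belongs to the outermost application of the potential. Only the last entry, the
  innermost application, carries the shift, and the empty list stands for the constant 1.\<close>

primrec list_freq :: "('m \<Rightarrow> 'a::euclidean_space) \<Rightarrow> 'a \<Rightarrow> 'm list \<Rightarrow> 'a" where
  "list_freq \<omega> \<theta> [] = 0"
| "list_freq \<omega> \<theta> (m # l) = \<omega> m + (if l = [] then \<theta> else list_freq \<omega> \<theta> l)"

primrec list_coeff :: "('a::euclidean_space \<Rightarrow> complex) \<Rightarrow> ('m \<Rightarrow> 'a) \<Rightarrow> 'a \<Rightarrow> ('m \<Rightarrow> complex) \<Rightarrow>
    ('m \<Rightarrow> complex) \<Rightarrow> 'm list \<Rightarrow> complex" where
  "list_coeff p \<omega> \<theta> q s [] = 1"
| "list_coeff p \<omega> \<theta> q s (m # l) =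
     (if l = [] then s m else q m * list_coeff p \<omega> \<theta> q s l) / p (list_freq \<omega> \<theta> (m # l))"

text \<open>Dividing by the symbol gains \<open>1 / \<tau>\<close> per entry, which cancels the
  factor \<tau> in the bounds on the coefficients. The weight is submultiplicative under addition of
  frequencies and so distributes over the list.\<close>

lemma list_coeff_le:
  assumes \<tau>: "0 < \<tau>" "\<And>m l. \<tau> \<le> norm (p (list_freq \<omega> \<theta> (m # l)))"
    and q: "\<And>m. norm (q m) * (1 + norm (\<omega> m)) ^ N \<le> \<tau> * v m"
    and s: "\<And>m. norm (s m) * (1 + norm (\<omega> m + \<theta>)) ^ N \<le> \<tau> * v m"
  shows "norm (list_coeff p \<omega> \<theta> q s l) * (1 + norm (list_freq \<omega> \<theta> l)) ^ N \<le> prod_list (map v l)"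
proof (induction l)
  case (Cons m l)
  define c where "c = list_coeff p \<omega> \<theta> q s l"
  define f where "f = list_freq \<omega> \<theta> l"
  define P where "P = norm (p (list_freq \<omega> \<theta> (m # l)))"
  have P: "\<tau> \<le> P" "0 < P" using \<tau>(2)[of m l] \<tau>(1) unfolding P_def by linarith+
  have v: "0 \<le> v m"
  proof -
    have "0 \<le> norm (q m) * (1 + norm (\<omega> m)) ^ N" by simp
    then have "0 \<le> \<tau> * v m" using q[of m] by linarith
    then show ?thesis using \<tau>(1) by (simp add: zero_le_mult_iff)
  qed
  have pl: "0 \<le> prod_list (map v l)"
    using Cons.IH by (intro order_trans[OF _ Cons.IH]) simp
  show ?case
  proof (cases "l = []")
    case True
    have "norm (s m) * (1 + norm (\<omega> m + \<theta>)) ^ N / P \<le> \<tau> * v m / \<tau>"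
      using s[of m] P \<tau>(1) v by (intro frac_le) auto
    then show ?thesis using True \<tau>(1) by (simp add: norm_divide P_def)
  next
    case False
    have "(1 + norm (\<omega> m + f)) ^ N \<le> ((1 + norm (\<omega> m)) * (1 + norm f)) ^ N"
    proof (rule power_mono)
      have "0 \<le> norm (\<omega> m) * norm f" by simp
      then show "1 + norm (\<omega> m + f) \<le> (1 + norm (\<omega> m)) * (1 + norm f)"
        using norm_triangle_ineq[of "\<omega> m" f] unfolding distrib_left distrib_right by linarith
    qed simp
    then have "norm (q m) * norm c * (1 + norm (\<omega> m + f)) ^ N \<le>
        norm (q m) * norm c * ((1 + norm (\<omega> m)) ^ N * (1 + norm f) ^ N)"
      by (intro mult_left_mono) (auto simp: power_mult_distrib)
    also have "\<dots> = (norm (q m) * (1 + norm (\<omega> m)) ^ N) * (norm c * (1 + norm f) ^ N)" by simp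
    also have "\<dots> \<le> (\<tau> * v m) * prod_list (map v l)"
      unfolding c_def f_def by (rule mult_mono) (use q[of m] Cons.IH v \<tau>(1) in auto)
    finally have "norm (q m) * norm c * (1 + norm (\<omega> m + f)) ^ N / P \<le> (\<tau> * v m) * prod_list (map v l) / \<tau>"
      using P \<tau>(1) v pl by (intro frac_le) auto
    then show ?thesis
      using False \<tau>(1) by (simp add: norm_divide norm_mult c_def f_def P_def)
  qed
qed simp

lemma has_sum_product:
  fixes f :: "'i \<Rightarrow> complex" and g :: "'j \<Rightarrow> complex"
  assumes f: "(\<lambda>i. norm (f i)) summable_on UNIV" and g: "(\<lambda>j. norm (g j)) summable_on UNIV"
  shows "((\<lambda>(i, j). f i * g j) has_sum (infsum f UNIV * infsum g UNIV)) UNIV"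
proof -
  have fs: "f summable_on UNIV" "g summable_on UNIV" using f g by (auto intro: abs_summable_summable)
  have "(\<lambda>z. norm (case z of (i, j) \<Rightarrow> f i * g j)) summable_on Sigma UNIV (\<lambda>_. UNIV)"
    unfolding Infinite_Sum.abs_summable_on_Sigma_iff
  proof (intro conjI ballI)
    show "(\<lambda>j. norm (case (i, j) of (i, j) \<Rightarrow> f i * g j)) summable_on UNIV" for i
      using summable_on_cmult_right[OF g, of "norm (f i)"] by (simp add: norm_mult)
    have "(\<Sum>\<^sub>\<infinity>j. norm (case (i, j) of (i, j) \<Rightarrow> f i * g j)) = norm (f i) * (\<Sum>\<^sub>\<infinity>j. norm (g j))" for i
      by (simp add: norm_mult infsum_cmult_right')
    moreover have "0 \<le> (\<Sum>\<^sub>\<infinity>j. norm (g j))" by (intro infsum_nonneg) auto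
    ultimately show "(\<lambda>i. norm (\<Sum>\<^sub>\<infinity>j. norm (case (i, j) of (i, j) \<Rightarrow> f i * g j))) summable_on UNIV"
      using summable_on_cmult_left[OF f, of "\<Sum>\<^sub>\<infinity>j. norm (g j)"] by (simp add: norm_mult)
  qed
  then have "(\<lambda>(i, j). f i * g j) summable_on Sigma UNIV (\<lambda>_. UNIV)" by (rule abs_summable_summable)
  moreover have "((\<lambda>j. case (i, j) of (i, j) \<Rightarrow> f i * g j) has_sum f i * infsum g UNIV) UNIV" for i
    using has_sum_cmult_right[OF has_sum_infsum[OF fs(2)], of "f i"] by simp
  moreover have "((\<lambda>i. f i * infsum g UNIV) has_sum infsum f UNIV * infsum g UNIV) UNIV"
    by (rule has_sum_cmult_left[OF has_sum_infsum[OF fs(1)]])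
  ultimately have "((\<lambda>(i, j). f i * g j) has_sum infsum f UNIV * infsum g UNIV) (Sigma UNIV (\<lambda>_. UNIV))"
    by (intro has_sum_SigmaI)
  then show ?thesis by simp
qed

text \<open>Multiplying by the symbol undoes the outermost division and leaves a potential
  coefficient times the coefficient of the tail, so \<open>m # l\<close> corresponds to a term of
  the product. The empty list drops out since \<open>p 0 = 0\<close>.\<close>

lemma list_exp_sum_equation:
  fixes \<omega> :: "'m \<Rightarrow> 'a::euclidean_space"
  assumes p: "p 0 = 0" "\<And>m l. p (list_freq \<omega> \<theta> (m # l)) \<noteq> 0"
    and q: "weighted_summable 0 q \<omega>" and s: "weighted_summable 0 s \<omega>"
    and c: "weighted_summable 0 (list_coeff p \<omega> \<theta> q s) (list_freq \<omega> \<theta>)"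
    and eq: "cis (\<theta> \<bullet> x) * exp_sum s \<omega> x = exp_sum q \<omega> x"
  shows "exp_sum (\<lambda>l. p (list_freq \<omega> \<theta> l) * list_coeff p \<omega> \<theta> q s l) (list_freq \<omega> \<theta>) x =
    exp_sum q \<omega> x * exp_sum (list_coeff p \<omega> \<theta> q s) (list_freq \<omega> \<theta>) x"
proof -
  define C where "C = list_coeff p \<omega> \<theta> q s"
  define \<xi> where "\<xi> = list_freq \<omega> \<theta>"
  define t where "t l = p (\<xi> l) * C l * cis (\<xi> l \<bullet> x)" for l
  define A where "A = (\<lambda>(m, l). (q m * cis (\<omega> m \<bullet> x)) * (C l * cis (\<xi> l \<bullet> x)))"
  \<comment> \<open>Corrects the singleton lists, whose coefficients come from the shifted expansion
    s instead of q. The corrections add up to 0 because both expansions represent the same value at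
    x, which is \<open>eq\<close>.\<close>
  define B :: "'m \<times> 'm list \<Rightarrow> complex" where "B = (\<lambda>(m, l). if l = [] then cis (\<theta> \<bullet> x) * (s m * cis (\<omega> m \<bullet> x)) - q m * cis (\<omega> m \<bullet> x) else 0)"
  have "(A has_sum (exp_sum q \<omega> x * exp_sum C \<xi> x)) UNIV"
    unfolding A_def exp_sum_def
    using exp_sum_terms_summable(2)[OF q] exp_sum_terms_summable(2)[OF c]
    by (intro has_sum_product) (simp_all add: norm_mult C_def \<xi>_def)
  moreover have "(B has_sum 0) UNIV"
  proof -
    have "((\<lambda>m. cis (\<theta> \<bullet> x) * (s m * cis (\<omega> m \<bullet> x)) - q m * cis (\<omega> m \<bullet> x)) has_sum
        (cis (\<theta> \<bullet> x) * exp_sum s \<omega> x - exp_sum q \<omega> x)) UNIV"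
      unfolding exp_sum_def
      using exp_sum_terms_summable(1)[OF q] exp_sum_terms_summable(1)[OF s]
      by (intro has_sum_minus has_sum_cmult_right has_sum_infsum)
    then have "((\<lambda>m. B (m, [])) has_sum 0) UNIV" by (simp add: B_def eq)
    then have "(B has_sum 0) (range (\<lambda>m. (m, [])))"
      by (subst has_sum_reindex) (auto simp: inj_on_def o_def)
    then show ?thesis
      by (rule has_sum_cong_neutral[THEN iffD1, rotated -1]) (auto simp: B_def)
  qed
  ultimately have "((\<lambda>z. A z + B z) has_sum (exp_sum q \<omega> x * exp_sum C \<xi> x + 0)) UNIV"
    by (rule has_sum_add)
  moreover have "A z + B z = t (case z of (m, l) \<Rightarrow> m # l)" for z
  proof (cases z)
    case (Pair m l)
    show ?thesis
    proof (cases "l = []")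
      case True
      have "p (\<omega> m + \<theta>) \<noteq> 0" using p(2)[of m "[]"] by simp
      then show ?thesis using True Pair
        by (simp add: A_def B_def t_def C_def \<xi>_def inner_add_left cis_mult[symmetric] mult_ac)
    next
      case False
      have "p (\<omega> m + list_freq \<omega> \<theta> l) \<noteq> 0" using p(2)[of m l] False by simp
      then show ?thesis using False Pair
        by (simp add: A_def B_def t_def C_def \<xi>_def inner_add_left cis_mult[symmetric] mult_ac)
    qed
  qed
  ultimately have "((\<lambda>z. t (case z of (m, l) \<Rightarrow> m # l)) has_sum (exp_sum q \<omega> x * exp_sum C \<xi> x)) UNIV" by simp
  then have "(t has_sum (exp_sum q \<omega> x * exp_sum C \<xi> x)) (range (\<lambda>(m, l). m # l))"
    by (subst has_sum_reindex) (auto simp: inj_on_def o_def case_prod_beta)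
  moreover have "t l = 0" if "l \<notin> range (\<lambda>(m, l). m # l)" for l
    using that p(1) by (cases l) (auto simp: t_def \<xi>_def)
  ultimately have "(t has_sum (exp_sum q \<omega> x * exp_sum C \<xi> x)) UNIV"
    by (rule has_sum_cong_neutral[THEN iffD1, rotated -1]) auto
  then show ?thesis
    unfolding C_def[symmetric] \<xi>_def[symmetric] exp_sum_def[of "\<lambda>l. p (\<xi> l) * C l"] by (simp add: infsumI t_def[abs_def])
qed

lemma exp_sum_sum:
  assumes "finite I" "\<And>i. i \<in> I \<Longrightarrow> weighted_summable 0 (C i) \<xi>"
  shows "exp_sum (\<lambda>l. \<Sum>i\<in>I. C i l) \<xi> x = (\<Sum>i\<in>I. exp_sum (C i) \<xi> x) \<and> weighted_summable 0 (\<lambda>l. \<Sum>i\<in>I. C i l) \<xi>"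
  using assms
proof (induction I)
  case (insert i I)
  have 1: "weighted_summable 0 (C i) \<xi>" and 2: "weighted_summable 0 (\<lambda>l. \<Sum>i\<in>I. C i l) \<xi>" using insert by auto
  have "(\<lambda>l. norm (C i l) + norm (\<Sum>i\<in>I. C i l)) summable_on UNIV"
    by (rule summable_on_add[OF exp_sum_terms_summable(2)[OF 1] exp_sum_terms_summable(2)[OF 2]])
  then have "(\<lambda>l. norm (C i l + (\<Sum>i\<in>I. C i l))) summable_on UNIV"
    by (rule summable_on_nonneg_comparison) (auto intro: norm_triangle_ineq)
  then have "weighted_summable 0 (\<lambda>l. C i l + (\<Sum>i\<in>I. C i l)) \<xi>" by (simp add: weighted_summable_def)
  then show ?case using insert exp_sum_add[OF 1 2] by simp
qed (simp add: exp_sum_def weighted_summable_def)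

text \<open>\<open>symbol\<close> is the Fourier multiplier of the Laplacian plus twice the
  derivative along the complex vector with real part \<alpha> and imaginary part \<beta>.\<close>

lemma exp_sum_symbol:
  assumes C: "weighted_summable 4 C \<xi>"
  shows "exp_sum (\<lambda>l. symbol \<alpha> \<beta> (\<xi> l) * C l) \<xi> x =
    (\<Sum>b\<in>Basis. pd b (pd b (exp_sum C \<xi>)) x) +
    2 * (\<Sum>b\<in>Basis. Complex (\<alpha> \<bullet> b) (\<beta> \<bullet> b) * pd b (exp_sum C \<xi>) x)"
proof -
  have w: "weighted_summable n (\<lambda>l. \<i> * of_real (\<xi> l \<bullet> b) * C l) \<xi>" if "n \<le> 3" for b n
  proof -
    have "weighted_summable (Suc 3) C \<xi>" using C by simp
    then show ?thesis using that by (intro weighted_summable_mono[OF weighted_summable_pd])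
  qed
  have w2: "weighted_summable 0 (\<lambda>l. \<i> * of_real (\<xi> l \<bullet> b) * (\<i> * of_real (\<xi> l \<bullet> b) * C l)) \<xi>" for b
    using weighted_summable_pd[OF w[of "Suc 0" b]] by simp
  have c2: "weighted_summable 2 C \<xi>" using C by (rule weighted_summable_mono) simp
  have p1: "pd b (exp_sum C \<xi>) = exp_sum (\<lambda>l. \<i> * of_real (\<xi> l \<bullet> b) * C l) \<xi>" for b
    by (rule pd_exp_sum[OF c2])
  have p2: "pd b (pd b (exp_sum C \<xi>)) = exp_sum (\<lambda>l. \<i> * of_real (\<xi> l \<bullet> b) * (\<i> * of_real (\<xi> l \<bullet> b) * C l)) \<xi>" for b
    unfolding p1 by (rule pd_exp_sum[OF w]) simp
  have wc: "weighted_summable 0 (\<lambda>l. c * (\<i> * of_real (\<xi> l \<bullet> b) * C l)) \<xi>" for b c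
    by (rule weighted_summable_le[OF w[of 0 b], of _ _ _ "norm c"]) (auto simp: norm_mult)
  have "(\<Sum>b\<in>Basis. pd b (pd b (exp_sum C \<xi>)) x) + 2 * (\<Sum>b\<in>Basis. Complex (\<alpha> \<bullet> b) (\<beta> \<bullet> b) * pd b (exp_sum C \<xi>) x) =
    (\<Sum>b\<in>Basis. exp_sum (\<lambda>l. \<i> * of_real (\<xi> l \<bullet> b) * (\<i> * of_real (\<xi> l \<bullet> b) * C l)) \<xi> x) +
    (\<Sum>b\<in>Basis. exp_sum (\<lambda>l. (2 * Complex (\<alpha> \<bullet> b) (\<beta> \<bullet> b)) * (\<i> * of_real (\<xi> l \<bullet> b) * C l)) \<xi> x)"
    unfolding p2 unfolding p1 exp_sum_cmult by (simp only: sum_distrib_left mult.assoc)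
  also have "\<dots> = exp_sum (\<lambda>l. \<Sum>b\<in>Basis. \<i> * of_real (\<xi> l \<bullet> b) * (\<i> * of_real (\<xi> l \<bullet> b) * C l)) \<xi> x +
      exp_sum (\<lambda>l. \<Sum>b\<in>Basis. (2 * Complex (\<alpha> \<bullet> b) (\<beta> \<bullet> b)) * (\<i> * of_real (\<xi> l \<bullet> b) * C l)) \<xi> x"
    by (simp only: exp_sum_sum[OF finite_Basis w2, THEN conjunct1] exp_sum_sum[OF finite_Basis wc, THEN conjunct1])
  also have "\<dots> = exp_sum (\<lambda>l. (\<Sum>b\<in>Basis. \<i> * of_real (\<xi> l \<bullet> b) * (\<i> * of_real (\<xi> l \<bullet> b) * C l)) +
      (\<Sum>b\<in>Basis. (2 * Complex (\<alpha> \<bullet> b) (\<beta> \<bullet> b)) * (\<i> * of_real (\<xi> l \<bullet> b) * C l))) \<xi> x"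
    by (intro exp_sum_add[symmetric] exp_sum_sum[OF finite_Basis w2, THEN conjunct2] exp_sum_sum[OF finite_Basis wc, THEN conjunct2])
  also have "(\<lambda>l. (\<Sum>b\<in>Basis. \<i> * of_real (\<xi> l \<bullet> b) * (\<i> * of_real (\<xi> l \<bullet> b) * C l)) +
      (\<Sum>b\<in>Basis. (2 * Complex (\<alpha> \<bullet> b) (\<beta> \<bullet> b)) * (\<i> * of_real (\<xi> l \<bullet> b) * C l))) = (\<lambda>l. symbol \<alpha> \<beta> (\<xi> l) * C l)"
  proof
    fix l
    have a: "(\<Sum>b\<in>Basis. \<i> * of_real (\<xi> l \<bullet> b) * (\<i> * of_real (\<xi> l \<bullet> b) * C l)) = - of_real ((norm (\<xi> l))\<^sup>2) * C l"
    proof -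
      have "(norm (\<xi> l))\<^sup>2 = (\<Sum>b\<in>Basis. (\<xi> l \<bullet> b) * (\<xi> l \<bullet> b))"
        unfolding power2_norm_eq_inner euclidean_inner[of "\<xi> l" "\<xi> l"] ..
      moreover have "\<i> * of_real r * (\<i> * of_real r * z) = - of_real (r * r) * z" for r z
        by (simp add: complex_eq_iff algebra_simps)
      ultimately show ?thesis by (simp only: of_real_sum sum_distrib_right sum_negf[symmetric] mult_minus_left)
    qed
    have "Complex (\<alpha> \<bullet> \<xi> l) (\<beta> \<bullet> \<xi> l) = (\<Sum>b\<in>Basis. Complex (\<alpha> \<bullet> b) (\<beta> \<bullet> b) * of_real (\<xi> l \<bullet> b))"
      by (simp add: complex_eq_iff euclidean_inner[of \<alpha> "\<xi> l"] euclidean_inner[of \<beta> "\<xi> l"])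
    then have b: "(\<Sum>b\<in>Basis. (2 * Complex (\<alpha> \<bullet> b) (\<beta> \<bullet> b)) * (\<i> * of_real (\<xi> l \<bullet> b) * C l)) = 2 * \<i> * Complex (\<alpha> \<bullet> \<xi> l) (\<beta> \<bullet> \<xi> l) * C l"
      by (simp add: sum_distrib_left sum_distrib_right mult_ac)
    have "- of_real ((norm (\<xi> l))\<^sup>2) + 2 * \<i> * Complex (\<alpha> \<bullet> \<xi> l) (\<beta> \<bullet> \<xi> l) = symbol \<alpha> \<beta> (\<xi> l)"
      by (simp add: symbol_def complex_eq_iff)
    then show "(\<Sum>b\<in>Basis. \<i> * of_real (\<xi> l \<bullet> b) * (\<i> * of_real (\<xi> l \<bullet> b) * C l)) +
      (\<Sum>b\<in>Basis. (2 * Complex (\<alpha> \<bullet> b) (\<beta> \<bullet> b)) * (\<i> * of_real (\<xi> l \<bullet> b) * C l)) = symbol \<alpha> \<beta> (\<xi> l) * C l"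
      unfolding a b by (simp only: distrib_right[symmetric])
  qed
  finally show ?thesis by simp
qed

section \<open>Exponential waves with complex exponent\<close>

definition exp_wave :: "'a::euclidean_space \<Rightarrow> 'a \<Rightarrow> 'a \<Rightarrow> complex" where
  "exp_wave \<alpha> \<beta> x = exp (Complex (\<alpha> \<bullet> x) (\<beta> \<bullet> x))"

lemma exp_wave_has_derivative:
  "(exp_wave \<alpha> \<beta> has_derivative (\<lambda>h. Complex (\<alpha> \<bullet> h) (\<beta> \<bullet> h) * exp_wave \<alpha> \<beta> x)) (at x)"
proof -
  have "((\<lambda>x. of_real (\<alpha> \<bullet> x) + \<i> * of_real (\<beta> \<bullet> x)) has_derivative (\<lambda>h. of_real (\<alpha> \<bullet> h) + \<i> * of_real (\<beta> \<bullet> h))) (at x)"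
    by (intro has_derivative_add has_derivative_mult_right has_derivative_of_real has_derivative_inner_right
        has_derivative_ident)
  from has_derivative_compose[OF this DERIV_exp[unfolded has_field_derivative_def]]
  show ?thesis by (simp add: exp_wave_def[abs_def] Complex_eq mult.commute)
qed

lemma complex_C_k_cmult: "complex_C_k k F \<Longrightarrow> complex_C_k k (\<lambda>x. c * F x)"
  by (rule complex_C_k_mult) (auto simp: complex_C_k_def intro: C_k_on_const)

lemma complex_C_k_exp_wave: "complex_C_k k (exp_wave \<alpha> \<beta>)"
proof (induction k)
  case 0
  have "continuous_on UNIV (exp_wave \<alpha> \<beta>)"
    using has_derivative_continuous[OF exp_wave_has_derivative]
    by (auto intro!: continuous_at_imp_continuous_on)
  then show ?case by (auto simp: complex_C_k_def C_k_on_0 intro!: continuous_intros)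
next
  case (Suc k)
  show ?case by (rule complex_C_k_SucI[OF exp_wave_has_derivative complex_C_k_cmult[OF Suc]])
qed

text \<open>The conditions on \<alpha> and \<beta> say that the complex vector \<alpha> + i \<beta>
  has square 0, so the wave is harmonic and no term of order zero in P remains.\<close>

lemma lap_exp_wave_mult:
  assumes P: "complex_C_k 2 P" "\<And>b. b \<in> Basis \<Longrightarrow> complex_C_k 1 (pd b P)"
    and orth: "norm \<alpha> = norm \<beta>" "\<alpha> \<bullet> \<beta> = 0"
  shows "lap (\<lambda>x. exp_wave \<alpha> \<beta> x * P x) x = exp_wave \<alpha> \<beta> x * ((\<Sum>b\<in>Basis. pd b (pd b P) x) +
    2 * (\<Sum>b\<in>Basis. Complex (\<alpha> \<bullet> b) (\<beta> \<bullet> b) * pd b P x))"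
proof -
  have dP: "P differentiable (at x)" "b \<in> Basis \<Longrightarrow> pd b P differentiable (at x)" for b x
    using complex_C_k_differentiable[of 1 P] complex_C_k_differentiable[of 0 "pd b P"] P
    by (auto simp: numeral_2_eq_2)
  define \<zeta> where "\<zeta> b = Complex (\<alpha> \<bullet> b) (\<beta> \<bullet> b)" for b
  have d1: "((\<lambda>x. exp_wave \<alpha> \<beta> x * P x) has_derivative
     (\<lambda>h. exp_wave \<alpha> \<beta> x * pd h P x + \<zeta> h * exp_wave \<alpha> \<beta> x * P x)) (at x)" for x
    unfolding \<zeta>_def by (intro has_derivative_mult exp_wave_has_derivative has_derivative_pd dP)
  have p1: "pd b (\<lambda>x. exp_wave \<alpha> \<beta> x * P x) = (\<lambda>x. exp_wave \<alpha> \<beta> x * (pd b P x + \<zeta> b * P x))" for b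
    using pd_eqI[OF d1] by (auto simp: algebra_simps)
  have "pd b (pd b (\<lambda>x. exp_wave \<alpha> \<beta> x * P x)) x =
     exp_wave \<alpha> \<beta> x * (pd b (pd b P) x + 2 * (\<zeta> b * pd b P x) + \<zeta> b * \<zeta> b * P x)" if b: "b \<in> Basis" for b
  proof -
    have "((\<lambda>x. exp_wave \<alpha> \<beta> x * (pd b P x + \<zeta> b * P x)) has_derivative
      (\<lambda>h. exp_wave \<alpha> \<beta> x * (pd h (pd b P) x + \<zeta> b * pd h P x) + \<zeta> h * exp_wave \<alpha> \<beta> x * (pd b P x + \<zeta> b * P x))) (at x)"
      unfolding \<zeta>_def
      by (intro has_derivative_mult[OF exp_wave_has_derivative] has_derivative_add has_derivative_mult_right has_derivative_pd dP b)
    from pd_eqI[OF this, of b] show ?thesis unfolding p1 by (simp add: algebra_simps)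
  qed
  then have "lap (\<lambda>x. exp_wave \<alpha> \<beta> x * P x) x =
     (\<Sum>b\<in>Basis. exp_wave \<alpha> \<beta> x * (pd b (pd b P) x + 2 * (\<zeta> b * pd b P x) + \<zeta> b * \<zeta> b * P x))"
    by (simp add: lap_def)
  also have "\<dots> = exp_wave \<alpha> \<beta> x * ((\<Sum>b\<in>Basis. pd b (pd b P) x) + 2 * (\<Sum>b\<in>Basis. \<zeta> b * pd b P x) + (\<Sum>b\<in>Basis. \<zeta> b * \<zeta> b) * P x)"
    by (simp add: sum.distrib sum_distrib_left sum_distrib_right algebra_simps)
  also have "(\<Sum>b\<in>Basis. \<zeta> b * \<zeta> b) = 0"
  proof -
    have "(norm \<alpha>)\<^sup>2 = (norm \<beta>)\<^sup>2" using orth by simp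
    then have "\<alpha> \<bullet> \<alpha> = \<beta> \<bullet> \<beta>" by (simp only: power2_norm_eq_inner)
    then have "(\<Sum>b\<in>Basis. (\<alpha> \<bullet> b) * (\<alpha> \<bullet> b)) = (\<Sum>b\<in>Basis. (\<beta> \<bullet> b) * (\<beta> \<bullet> b))"
      by (simp only: euclidean_inner[of \<alpha> \<alpha>] euclidean_inner[of \<beta> \<beta>])
    moreover have "(\<Sum>b\<in>Basis. (\<alpha> \<bullet> b) * (\<beta> \<bullet> b)) = 0" using orth(2) by (simp only: euclidean_inner[of \<alpha> \<beta>])
    ultimately show ?thesis
      by (simp add: complex_eq_iff \<zeta>_def sum_subtractf sum.distrib mult.commute sum_distrib_left[symmetric])
  qed
  finally show ?thesis by (simp add: \<zeta>_def)
qed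

text \<open>Inner products of the integer vector w with lattice points are multiples of \<kappa>,
  and \<theta> is scaled such that \<open>w \<bullet> \<theta> = \<kappa> / 2\<close>. A nonempty
  list contains the shift exactly once.\<close>

lemma list_freq_lattice:
  fixes W :: "int^'n"
  assumes W: "W \<noteq> 0" and w: "w = (\<chi> i. real_of_int (W $ i))" and \<theta>: "\<theta> = (\<kappa> / (2 * (norm w)\<^sup>2)) *\<^sub>R w"
  shows "\<exists>n::int. w \<bullet> list_freq (lattice \<kappa>) \<theta> (m # l) = \<kappa> * (of_int n + 1 / 2)"
proof (induction l arbitrary: m)
  have wnz: "w \<noteq> 0" using W by (auto simp: w vec_eq_iff)
  have \<theta>w: "w \<bullet> \<theta> = \<kappa> / 2" using wnz by (simp add: \<theta> power2_norm_eq_inner)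
  have lat: "w \<bullet> lattice \<kappa> m = \<kappa> * of_int (\<Sum>i\<in>UNIV. W $ i * m $ i)" for m
    by (simp add: inner_vec_def w lattice_def sum_distrib_left mult_ac)
  {
    case Nil
    show ?case by (intro exI[of _ "\<Sum>i\<in>UNIV. W $ i * m $ i"]) (simp add: inner_add_right lat \<theta>w distrib_left)
  next
    case (Cons a l)
    from Cons[of a] obtain n where n: "w \<bullet> list_freq (lattice \<kappa>) \<theta> (a # l) = \<kappa> * (of_int n + 1 / 2)" by blast
    have "list_freq (lattice \<kappa>) \<theta> (m # a # l) = lattice \<kappa> m + list_freq (lattice \<kappa>) \<theta> (a # l)" by simp
    then show ?case
      by (intro exI[of _ "n + (\<Sum>i\<in>UNIV. W $ i * m $ i)"]) (simp only: inner_add_right lat n of_int_add distrib_left ac_simps)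
  }
qed

lemma half_integer_bound: "1 / 2 \<le> \<bar>of_int n + 1 / 2 :: real\<bar>"
proof -
  have "n \<ge> 0 \<or> n \<le> - 1" by linarith
  then show ?thesis
  proof
    assume "n \<le> - 1"
    then have "real_of_int n \<le> -1" by (simp only: of_int_le_iff[symmetric, where 'a=real] of_int_minus of_int_1)
    then show ?thesis by linarith
  qed simp
qed

text \<open>The imaginary part of the symbol is \<open>2 * c * (w \<bullet> \<xi>)\<close>, whose
  modulus is at least \<open>\<bar>c\<bar> * \<kappa>\<close> on the frequencies of nonempty lists.
  A large c thus makes every division small. The threshold is uniform in \<beta>, which matters
  because the length of \<beta> grows with c.\<close>

theorem geometric_optics_solution:
  fixes q :: "real^'n \<Rightarrow> real" and W :: "int^'n"
  assumes R: "0 < R" and q: "\<And>k. C_k_on k UNIV q" and W: "W \<noteq> 0" and w: "w = (\<chi> i. real_of_int (W $ i))" and e: "0 < e"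
  shows "\<exists>s\<^sub>0. \<forall>\<alpha> \<beta> c. \<bar>c\<bar> > s\<^sub>0 \<and> \<alpha> = c *\<^sub>R w \<and> norm \<beta> = norm \<alpha> \<and> \<alpha> \<bullet> \<beta> = 0 \<longrightarrow>
    (\<exists>P. complex_C_k 3 P \<and> (\<forall>x. norm (P x - 1) \<le> e) \<and> (\<forall>b\<in>Basis. \<forall>x. norm (pd b P x) \<le> e) \<and>
      (\<forall>x. norm x < R \<longrightarrow> lap (\<lambda>x. exp_wave \<alpha> \<beta> x * P x) x = of_real (q x) * (exp_wave \<alpha> \<beta> x * P x)))"
proof -
  define \<kappa> where "\<kappa> = 1 / R"
  have \<kappa>: "0 < \<kappa>" using R by (simp add: \<kappa>_def)
  define \<theta> where "\<theta> = (\<kappa> / (2 * (norm w)\<^sup>2)) *\<^sub>R w"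
  have qC: "complex_C_k k (\<lambda>x. of_real (q x))" for k
    using q by (simp add: complex_C_k_def C_k_on_const)
  have eC: "complex_C_k k (\<lambda>x. exp_wave 0 (- \<theta>) x * of_real (q x))" for k
    by (intro complex_C_k_mult complex_C_k_exp_wave qC)
  \<comment> \<open>Weight 5 pays for three derivatives of P and for the two units that
    differentiating a sum requires.\<close>
  obtain Q :: "int^'n \<Rightarrow> complex" where Q: "weighted_summable 5 Q (lattice (1 / R))"
    "\<And>x. norm x < R \<Longrightarrow> of_real (q x) = exp_sum Q (lattice (1 / R)) x"
    using complex_fourier_representation[OF R qC] by metis
  obtain S :: "int^'n \<Rightarrow> complex" where S: "weighted_summable 5 S (lattice (1 / R))"
    "\<And>x. norm x < R \<Longrightarrow> exp_wave 0 (- \<theta>) x * of_real (q x) = exp_sum S (lattice (1 / R)) x"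
    using complex_fourier_representation[OF R eC] by metis
  define \<omega> :: "int^'n \<Rightarrow> real^'n" where "\<omega> = lattice \<kappa>"
  note Q = Q[folded \<kappa>_def, folded \<omega>_def] and S = S[folded \<kappa>_def, folded \<omega>_def]
  \<comment> \<open>A common majorant for both expansions. The factor with \<theta> moves the weight
    of the shifted expansion from \<open>\<omega> m + \<theta>\<close> to
    \<open>\<omega> m\<close>.\<close>
  define u where "u m = norm (Q m) * (1 + norm (\<omega> m)) ^ 5 + (1 + norm \<theta>) ^ 5 * (norm (S m) * (1 + norm (\<omega> m)) ^ 5)" for m
  have u: "u summable_on UNIV" "\<And>m. 0 \<le> u m"
    unfolding u_def using Q(1) S(1) unfolding weighted_summable_def
    by (auto intro!: summable_on_add summable_on_cmult_right)
  define A where "A = infsum u UNIV"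
  have A: "0 \<le> A" unfolding A_def using u(2) by (intro infsum_nonneg) auto
  \<comment> \<open>chosen so that \<open>\<epsilon> / (1 - \<epsilon>) \<le> e\<close> for every \<open>\<epsilon> \<le> \<epsilon>\<^sub>0\<close>\<close>
  define \<epsilon>\<^sub>0 where "\<epsilon>\<^sub>0 = e / (1 + e)"
  have \<epsilon>\<^sub>0: "0 < \<epsilon>\<^sub>0" "\<epsilon>\<^sub>0 < 1" using e by (auto simp: \<epsilon>\<^sub>0_def)
  show ?thesis
  \<comment> \<open>Beyond this threshold \<open>\<tau> * \<epsilon>\<^sub>0\<close> exceeds
    \<open>A + 1\<close>, so \<tau> is positive and \<open>A / \<tau>\<close>, the sum of v, is at
    most \<open>\<epsilon>\<^sub>0\<close>.\<close>
  proof (intro exI[of _ "(A + 1) / (\<kappa> * \<epsilon>\<^sub>0)"] allI impI)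
    fix \<alpha> \<beta> :: "real^'n" and c :: real
    assume *: "\<bar>c\<bar> > (A + 1) / (\<kappa> * \<epsilon>\<^sub>0) \<and> \<alpha> = c *\<^sub>R w \<and> norm \<beta> = norm \<alpha> \<and> \<alpha> \<bullet> \<beta> = 0"
    define \<tau> where "\<tau> = \<bar>c\<bar> * \<kappa>"
    have "A + 1 < \<bar>c\<bar> * (\<kappa> * \<epsilon>\<^sub>0)" using * \<kappa> \<epsilon>\<^sub>0(1) by (simp add: divide_less_eq)
    then have \<tau>1: "A + 1 < \<tau> * \<epsilon>\<^sub>0" by (simp add: \<tau>_def mult.assoc)
    then have \<tau>: "0 < \<tau>" using A \<epsilon>\<^sub>0(1) by (smt (verit) mult_nonpos_nonneg)
    define p where "p = symbol \<alpha> \<beta>"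
    have p0: "p 0 = 0" by (simp add: p_def symbol_def complex_eq_iff)
    have p\<tau>: "\<tau> \<le> norm (p (list_freq \<omega> \<theta> (m # l)))" for m l
    proof -
      obtain n :: int where n: "w \<bullet> list_freq \<omega> \<theta> (m # l) = \<kappa> * (of_int n + 1 / 2)"
        using list_freq_lattice[OF W w \<theta>_def] unfolding \<omega>_def by blast
      have "\<tau> \<le> 2 * \<bar>c\<bar> * \<kappa> * \<bar>of_int n + 1 / 2\<bar>"
        using mult_left_mono[OF half_integer_bound[of n], of "2 * \<bar>c\<bar> * \<kappa>"] \<kappa> by (simp add: \<tau>_def)
      also have "\<dots> = \<bar>Im (p (list_freq \<omega> \<theta> (m # l)))\<bar>"
        using * n \<kappa> unfolding p_def symbol_def by (simp add: abs_mult del: list_freq.simps)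
      also have "\<dots> \<le> norm (p (list_freq \<omega> \<theta> (m # l)))" by (rule abs_Im_le_cmod)
      finally show ?thesis .
    qed
    then have pnz: "p (list_freq \<omega> \<theta> (m # l)) \<noteq> 0" for m l using \<tau> by (metis norm_zero not_less)
    define v where "v m = u m / \<tau>" for m
    have v: "v summable_on UNIV" "\<And>m. 0 \<le> v m" "infsum v UNIV = A / \<tau>"
    proof -
      have eq: "v = (\<lambda>m. u m * (1 / \<tau>))" by (simp add: v_def[abs_def])
      show "v summable_on UNIV" unfolding eq by (rule summable_on_cmult_left[OF u(1)])
      show "infsum v UNIV = A / \<tau>" unfolding eq infsum_cmult_left' by (simp add: A_def)
      show "0 \<le> v m" for m using u(2)[of m] \<tau> by (simp add: v_def)
    qed
    define \<epsilon> where "\<epsilon> = A / \<tau>"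
    have \<epsilon>: "0 \<le> \<epsilon>" "\<epsilon> \<le> \<epsilon>\<^sub>0" "\<epsilon> < 1"
      using A \<tau> \<tau>1 \<epsilon>\<^sub>0 by (auto simp: \<epsilon>_def divide_le_eq divide_less_eq mult.commute)
        (smt (verit) mult_less_cancel_right2)
    have qv: "norm (Q m) * (1 + norm (\<omega> m)) ^ 5 \<le> \<tau> * v m" for m
      using \<tau> by (simp add: v_def u_def)
    have sv: "norm (S m) * (1 + norm (\<omega> m + \<theta>)) ^ 5 \<le> \<tau> * v m" for m
    proof -
      have "(1 + norm (\<omega> m + \<theta>)) ^ 5 \<le> ((1 + norm \<theta>) * (1 + norm (\<omega> m))) ^ 5"
      proof (rule power_mono)
        have "0 \<le> norm (\<omega> m) * norm \<theta>" by simp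
        then show "1 + norm (\<omega> m + \<theta>) \<le> (1 + norm \<theta>) * (1 + norm (\<omega> m))"
          using norm_triangle_ineq[of "\<omega> m" \<theta>] unfolding distrib_left distrib_right mult.commute[of "norm \<theta>"] by linarith
      qed simp
      then have "norm (S m) * (1 + norm (\<omega> m + \<theta>)) ^ 5 \<le> norm (S m) * ((1 + norm \<theta>) ^ 5 * (1 + norm (\<omega> m)) ^ 5)"
        unfolding power_mult_distrib by (intro mult_left_mono) auto
      also have "\<dots> \<le> u m" by (simp add: u_def mult.left_commute)
      finally show ?thesis using \<tau> by (simp add: v_def)
    qed
    define C where "C = list_coeff p \<omega> \<theta> Q S"
    define \<xi> where "\<xi> = list_freq \<omega> \<theta>"
    note Cle = list_coeff_le[where p = p and \<omega> = \<omega> and \<theta> = \<theta> and q = Q and s = S and v = v and N = 5, OF \<tau> p\<tau> qv sv, folded C_def \<xi>_def]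
    have inf1: "infsum v UNIV < 1" using \<epsilon>(3) by (simp add: v(3) \<epsilon>_def)
    note pl = summable_prod_list[OF v(1,2) inf1]
    have wC: "weighted_summable 5 C \<xi>"
      unfolding weighted_summable_def by (rule summable_on_nonneg_comparison[OF pl(1)]) (auto intro: Cle)
    \<comment> \<open>Majorant of all terms except that of the empty list, which is the constant 1
      and disappears both in \<open>P x - 1\<close> and under differentiation. One sum thus bounds
      the remainder and its first derivatives.\<close>
    define d where "d l = (if l = [] then 0 else prod_list (map v l))" for l
    have d: "(d has_sum (infsum (\<lambda>l. prod_list (map v l)) UNIV - 1)) UNIV"
    proof -
      have "((\<lambda>l. prod_list (map v l)) has_sum infsum (\<lambda>l. prod_list (map v l)) UNIV) UNIV" by (rule has_sum_infsum[OF pl(1)])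
      moreover have "((\<lambda>l. if l = [] then - 1 else 0) has_sum (- 1 :: real)) UNIV"
        by (rule has_sum_cong_neutral[THEN iffD1, OF _ _ _ has_sum_finiteI[of "{[]}" "-1" "\<lambda>_. - 1"]]) auto
      ultimately have "((\<lambda>l. prod_list (map v l) + (if l = [] then - 1 else 0)) has_sum
          (infsum (\<lambda>l. prod_list (map v l)) UNIV + - 1)) UNIV" by (rule has_sum_add)
      moreover have "(\<lambda>l. prod_list (map v l) + (if l = [] then - 1 else 0)) = d" by (auto simp: d_def)
      ultimately show ?thesis by simp
    qed
    have dle: "infsum (\<lambda>l. prod_list (map v l)) UNIV - 1 \<le> e"
    proof -
      have "infsum (\<lambda>l. prod_list (map v l)) UNIV \<le> 1 / (1 - \<epsilon>)" using pl(2) by (simp add: v(3) \<epsilon>_def)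
      also have "\<dots> \<le> 1 / (1 - \<epsilon>\<^sub>0)" using \<epsilon> \<epsilon>\<^sub>0 by (intro divide_left_mono mult_pos_pos) auto
      also have "\<dots> = 1 + e" using e by (simp add: \<epsilon>\<^sub>0_def field_simps)
      finally show ?thesis by simp
    qed
    define P where "P = exp_sum C \<xi>"
    have C_Nil: "C [] = 1" "\<xi> [] = 0" by (simp_all add: C_def \<xi>_def)
    have C0: "norm (C l) \<le> prod_list (map v l)" for l
    proof -
      have "norm (C l) * 1 \<le> norm (C l) * (1 + norm (\<xi> l)) ^ 5" by (intro mult_left_mono) auto
      then show ?thesis using Cle[of l] by simp
    qed
    have C1: "norm (\<xi> l) * norm (C l) \<le> prod_list (map v l)" for l
    proof -
      have "norm (\<xi> l) \<le> (1 + norm (\<xi> l)) ^ 1" by simp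
      also have "\<dots> \<le> (1 + norm (\<xi> l)) ^ 5" by (rule power_increasing) auto
      finally have "norm (C l) * norm (\<xi> l) \<le> norm (C l) * (1 + norm (\<xi> l)) ^ 5" by (intro mult_left_mono) auto
      then show ?thesis using Cle[of l] by (simp add: mult.commute)
    qed
    have "complex_C_k 3 P" unfolding P_def using wC by (intro complex_C_k_exp_sum) simp
    moreover have "norm (P x - 1) \<le> e" for x
    proof -
      have "((\<lambda>l. C l * cis (\<xi> l \<bullet> x)) has_sum P x) UNIV"
        unfolding P_def exp_sum_def by (rule has_sum_infsum[OF exp_sum_terms_summable(1)[OF wC]])
      moreover have "((\<lambda>l. if l = [] then 1 else 0) has_sum (1 :: complex)) UNIV"
        by (rule has_sum_cong_neutral[THEN iffD1, OF _ _ _ has_sum_finiteI[of "{[]}" "1" "\<lambda>_. 1"]]) auto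
      ultimately have "((\<lambda>l. C l * cis (\<xi> l \<bullet> x) - (if l = [] then 1 else 0)) has_sum (P x - 1)) UNIV" by (rule has_sum_minus)
      then have "norm (P x - 1) \<le> infsum (\<lambda>l. prod_list (map v l)) UNIV - 1"
        by (rule norm_infsum_le[OF _ d]) (auto simp: d_def C_Nil norm_mult C0)
      then show ?thesis using dle by simp
    qed
    moreover have "norm (pd b P x) \<le> e" if b: "b \<in> Basis" for b x
    proof -
      have w2: "weighted_summable 2 C \<xi>" "weighted_summable (Suc 0) C \<xi>" using wC by (auto intro: weighted_summable_mono)
      have "((\<lambda>l. \<i> * of_real (\<xi> l \<bullet> b) * C l * cis (\<xi> l \<bullet> x)) has_sum pd b P x) UNIV"
        unfolding P_def pd_exp_sum[OF w2(1)] unfolding exp_sum_def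
        by (rule has_sum_infsum[OF exp_sum_terms_summable(1)[OF weighted_summable_pd[OF w2(2)]]])
      then have "norm (pd b P x) \<le> infsum (\<lambda>l. prod_list (map v l)) UNIV - 1"
      proof (rule norm_infsum_le[OF _ d])
        fix l
        have "\<bar>\<xi> l \<bullet> b\<bar> \<le> norm (\<xi> l)" using Basis_le_norm[OF b] .
        then have "\<bar>\<xi> l \<bullet> b\<bar> * norm (C l) \<le> norm (\<xi> l) * norm (C l)" by (intro mult_right_mono) auto
        then show "norm (\<i> * of_real (\<xi> l \<bullet> b) * C l * cis (\<xi> l \<bullet> x)) \<le> d l"
          using C1[of l] by (cases "l = []") (auto simp: d_def C_Nil norm_mult)
      qed
      then show ?thesis using dle by simp
    qed
    moreover have "lap (\<lambda>x. exp_wave \<alpha> \<beta> x * P x) x = of_real (q x) * (exp_wave \<alpha> \<beta> x * P x)" if x: "norm x < R" for x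
    proof -
      have "complex_C_k 2 P" unfolding P_def using wC by (intro complex_C_k_exp_sum weighted_summable_mono[OF wC]) simp
      moreover have "complex_C_k 1 (pd b P)" for b
      proof -
        have w: "weighted_summable 2 C \<xi>" "weighted_summable (Suc 4) C \<xi>" using wC by (auto intro: weighted_summable_mono)
        show ?thesis unfolding P_def pd_exp_sum[OF w(1)]
          by (rule complex_C_k_exp_sum[OF weighted_summable_mono[OF weighted_summable_pd[OF w(2)]]]) simp
      qed
      ultimately have "lap (\<lambda>x. exp_wave \<alpha> \<beta> x * P x) x = exp_wave \<alpha> \<beta> x * ((\<Sum>b\<in>Basis. pd b (pd b P) x) +
          2 * (\<Sum>b\<in>Basis. Complex (\<alpha> \<bullet> b) (\<beta> \<bullet> b) * pd b P x))"
        using * by (intro lap_exp_wave_mult) auto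
      also have "(\<Sum>b\<in>Basis. pd b (pd b P) x) + 2 * (\<Sum>b\<in>Basis. Complex (\<alpha> \<bullet> b) (\<beta> \<bullet> b) * pd b P x) =
          exp_sum (\<lambda>l. p (\<xi> l) * C l) \<xi> x"
        unfolding P_def p_def using wC by (intro exp_sum_symbol[symmetric] weighted_summable_mono[OF wC]) simp
      also have "\<dots> = exp_sum Q \<omega> x * P x"
        unfolding P_def C_def \<xi>_def
      proof (rule list_exp_sum_equation[OF p0 pnz])
        show "weighted_summable 0 Q \<omega>" "weighted_summable 0 S \<omega>" using Q(1) S(1) by (auto intro: weighted_summable_mono)
        show "weighted_summable 0 (list_coeff p \<omega> \<theta> Q S) (list_freq \<omega> \<theta>)"
          using wC unfolding C_def \<xi>_def by (rule weighted_summable_mono) simp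
        have "cis (\<theta> \<bullet> x) * exp_wave 0 (- \<theta>) x = 1"
          by (simp add: exp_wave_def cis_conv_exp exp_add[symmetric] Complex_eq)
        then show "cis (\<theta> \<bullet> x) * exp_sum S \<omega> x = exp_sum Q \<omega> x"
          unfolding S(2)[OF x, symmetric] Q(2)[OF x, symmetric] by (simp add: mult.assoc[symmetric])
      qed
      finally show ?thesis using Q(2)[OF x] by (simp add: mult_ac)
    qed
    ultimately show "\<exists>P. complex_C_k 3 P \<and> (\<forall>x. norm (P x - 1) \<le> e) \<and> (\<forall>b\<in>Basis. \<forall>x. norm (pd b P x) \<le> e) \<and>
      (\<forall>x. norm x < R \<longrightarrow> lap (\<lambda>x. exp_wave \<alpha> \<beta> x * P x) x = of_real (q x) * (exp_wave \<alpha> \<beta> x * P x))"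
      by blast
  qed
qed

subsection \<open>Uniqueness for the conductivity equation\<close>

lemma complex_C_k_pd:
  assumes "complex_C_k (Suc k) F" "b \<in> Basis"
  shows "complex_C_k k (pd b F)"
proof -
  have "pd b (\<lambda>x. Re (F x)) = (\<lambda>x. Re (pd b F x))" "pd b (\<lambda>x. Im (F x)) = (\<lambda>x. Im (pd b F x))"
    using pd_Re_Im[OF complex_C_k_differentiable[OF assms(1)]] by auto
  then show ?thesis
    using C_k_on_pd[OF _ assms(2), of k UNIV "\<lambda>x. Re (F x)"] C_k_on_pd[OF _ assms(2), of k UNIV "\<lambda>x. Im (F x)"] assms(1)
    by (auto simp: complex_C_k_def)
qed

lemma lap_Re_Im:
  assumes "complex_C_k 2 F"
  shows "lap (\<lambda>x. Re (F x)) x = Re (lap F x)" "lap (\<lambda>x. Im (F x)) x = Im (lap F x)"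
proof -
  have F: "F differentiable (at x)" for x
    using assms complex_C_k_differentiable[of 1 F] by (simp add: numeral_2_eq_2)
  have pF: "pd b F differentiable (at x)" if "b \<in> Basis" for b x
    using complex_C_k_differentiable[of 0] complex_C_k_pd[of 1 F, OF _ that] assms by (simp add: numeral_2_eq_2)
  have "pd b (\<lambda>x. Re (F x)) = (\<lambda>x. Re (pd b F x))" "pd b (\<lambda>x. Im (F x)) = (\<lambda>x. Im (pd b F x))" for b
    using pd_Re_Im[OF F] by auto
  then show "lap (\<lambda>x. Re (F x)) x = Re (lap F x)" "lap (\<lambda>x. Im (F x)) x = Im (lap F x)"
    by (simp_all add: lap_def pd_Re_Im[OF pF])
qed

lemma C_k_on_lap:
  assumes "\<And>k. C_k_on k UNIV u"
  shows "C_k_on k UNIV (lap u)"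
  unfolding lap_def[abs_def] by (intro C_k_on_sum C_k_on_pd assms open_UNIV)

lemma complex_C_k_diff: "complex_C_k k F \<Longrightarrow> complex_C_k k G \<Longrightarrow> complex_C_k k (\<lambda>x. F x - G x)"
  by (simp add: complex_C_k_def C_k_on_diff)

lemma complex_C_k_sum: "(\<And>i. i \<in> I \<Longrightarrow> complex_C_k k (F i)) \<Longrightarrow> complex_C_k k (\<lambda>x. \<Sum>i\<in>I. F i x)"
  by (simp add: complex_C_k_def C_k_on_sum)

context conductivity_pair
begin

lemma functional_set_integrable:
  assumes G: "C_k_on 1 UNIV G"
  shows "set_integrable lborel \<Omega> (\<lambda>x. \<Sum>b\<in>Basis. pd b gap x * (pd b G x - G x * (pd b mean x / mean x)))"
proof -
  have G': "continuous_on UNIV G" "\<And>b. b \<in> Basis \<Longrightarrow> continuous_on UNIV (pd b G)"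
    "\<And>b. b \<in> Basis \<Longrightarrow> continuous_on UNIV (pd b gap)" "\<And>b. b \<in> Basis \<Longrightarrow> continuous_on UNIV (pd b mean)"
    "continuous_on UNIV mean"
    using C_k_on_imp_continuous_on[OF G] C_k_on_pd[of 0 UNIV G] C_k_on_pd[OF gap_smooth, of _ 0]
      C_k_on_pd[OF mean_smooth, of _ 0] C_k_on_imp_continuous_on[OF mean_smooth[of 0]] G by (auto simp: C_k_on_0)
  have "mean x \<noteq> 0" for x using mean_pos[of x] by simp
  then have "continuous_on UNIV (\<lambda>x. \<Sum>b\<in>Basis. pd b gap x * (pd b G x - G x * (pd b mean x / mean x)))"
    by (intro continuous_intros G') auto
  then show ?thesis
    using \<Omega> by (intro set_integrable_continuous_bounded bounded_image_continuous) (auto intro: continuous_on_subset)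
qed

lemma functional_linear:
  assumes "C_k_on 1 UNIV G" "C_k_on 1 UNIV H"
  shows "functional (\<lambda>x. c * G x + d * H x) = c * functional G + d * functional H"
proof -
  have "pd b (\<lambda>x. c * G x + d * H x) x = c * pd b G x + d * pd b H x" for b x
  proof (rule pd_eqI)
    show "((\<lambda>x. c * G x + d * H x) has_derivative (\<lambda>h. c * pd h G x + d * pd h H x)) (at x)"
      using assms by (intro has_derivative_add has_derivative_mult_right has_derivative_pd)
        (auto intro: C_k_on_imp_differentiable)
  qed
  then have "(\<Sum>b\<in>Basis. pd b gap x * (pd b (\<lambda>x. c * G x + d * H x) x - (c * G x + d * H x) * (pd b mean x / mean x))) =
      c * (\<Sum>b\<in>Basis. pd b gap x * (pd b G x - G x * (pd b mean x / mean x))) +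
      d * (\<Sum>b\<in>Basis. pd b gap x * (pd b H x - H x * (pd b mean x / mean x)))" for x
    by (simp only: sum_distrib_left sum.distrib[symmetric]) (intro sum.cong refl, simp only: algebra_simps)
  then show ?thesis
    unfolding functional_def using assms[THEN functional_set_integrable]
    by (simp only: set_integral_add set_integrable_mult_right set_integral_mult_right)
qed

text \<open>Continuity with respect to the C^1 norm on \<Omega>, the norm in which plane waves and
  Fourier series are approximated below.\<close>

lemma functional_bound:
  "\<exists>K. \<forall>G M. C_k_on 1 UNIV G \<and> (\<forall>x\<in>\<Omega>. \<bar>G x\<bar> \<le> M) \<and> (\<forall>b\<in>Basis. \<forall>x\<in>\<Omega>. \<bar>pd b G x\<bar> \<le> M) \<longrightarrow>
    \<bar>functional G\<bar> \<le> K * M"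
proof -
  define f where "f x = (\<Sum>b\<in>Basis. \<bar>pd b gap x\<bar> * (1 + \<bar>pd b mean x / mean x\<bar>))" for x
  have "continuous_on UNIV f"
  proof -
    have "continuous_on UNIV (pd b gap)" "continuous_on UNIV (pd b mean)" if "b \<in> Basis" for b
      using C_k_on_pd[OF gap_smooth that, of 0] C_k_on_pd[OF mean_smooth that, of 0] by (simp_all add: C_k_on_0)
    moreover have "continuous_on UNIV mean" using C_k_on_imp_continuous_on[OF mean_smooth] .
    moreover have "mean x \<noteq> 0" for x using mean_pos[of x] by simp
    ultimately show ?thesis unfolding f_def by (intro continuous_intros) auto
  qed
  then have f: "set_integrable lborel \<Omega> f"
    using \<Omega> by (intro set_integrable_continuous_bounded bounded_image_continuous) (auto intro: continuous_on_subset)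
  have "\<bar>functional G\<bar> \<le> (LINT x:\<Omega>|lborel. f x) * M"
    if G: "C_k_on 1 UNIV G" and le: "\<And>x. x \<in> \<Omega> \<Longrightarrow> \<bar>G x\<bar> \<le> M" "\<And>b x. b \<in> Basis \<Longrightarrow> x \<in> \<Omega> \<Longrightarrow> \<bar>pd b G x\<bar> \<le> M"
    for G M
  proof -
    define g where "g x = (\<Sum>b\<in>Basis. pd b gap x * (pd b G x - G x * (pd b mean x / mean x)))" for x
    have g: "set_integrable lborel \<Omega> g" using functional_set_integrable[OF G] by (simp add: g_def[abs_def])
    have fM: "set_integrable lborel \<Omega> (\<lambda>x. f x * M)" using f by simp
    have gf: "\<bar>g x\<bar> \<le> f x * M" if x: "x \<in> \<Omega>" for x
      unfolding g_def f_def sum_distrib_right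
    proof (rule order_trans[OF sum_abs sum_mono])
      fix b :: 'a assume b: "b \<in> Basis"
      have "\<bar>pd b G x - G x * (pd b mean x / mean x)\<bar> \<le> \<bar>pd b G x\<bar> + \<bar>G x\<bar> * \<bar>pd b mean x / mean x\<bar>"
        unfolding abs_mult[symmetric] by (rule abs_triangle_ineq4)
      also have "\<dots> \<le> M + M * \<bar>pd b mean x / mean x\<bar>"
        by (intro add_mono mult_right_mono le x b) auto
      finally have "\<bar>pd b gap x\<bar> * \<bar>pd b G x - G x * (pd b mean x / mean x)\<bar> \<le> \<bar>pd b gap x\<bar> * (M + M * \<bar>pd b mean x / mean x\<bar>)"
        by (rule mult_left_mono) simp
      then show "\<bar>pd b gap x * (pd b G x - G x * (pd b mean x / mean x))\<bar> \<le> \<bar>pd b gap x\<bar> * (1 + \<bar>pd b mean x / mean x\<bar>) * M"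
        unfolding abs_mult by (simp only: mult.assoc) (simp add: algebra_simps)
    qed
    have "(LINT x:\<Omega>|lborel. g x) \<le> (LINT x:\<Omega>|lborel. f x * M)" "(LINT x:\<Omega>|lborel. - g x) \<le> (LINT x:\<Omega>|lborel. f x * M)"
      using gf g set_integrable_mult_right[of "-1::real", OF g] by (intro set_integral_mono fM; force)+
    then show ?thesis
      unfolding functional_def g_def[symmetric] by (simp add: set_integral_uminus[OF g] abs_le_iff)
  qed
  then show ?thesis by blast
qed

lemma functional_mean_gap:
  "functional (\<lambda>x. mean x * gap x) = (LINT x:\<Omega>|lborel. mean x * (\<Sum>b\<in>Basis. (pd b gap x)\<^sup>2))"
proof -
  have "mean differentiable (at x)" "gap differentiable (at x)" for x
    using mean_smooth[of 1] gap_smooth[of 1] by (auto intro: C_k_on_imp_differentiable)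
  then have "(\<Sum>b\<in>Basis. pd b gap x * (pd b (\<lambda>x. mean x * gap x) x - mean x * gap x * (pd b mean x / mean x))) =
      mean x * (\<Sum>b\<in>Basis. (pd b gap x)\<^sup>2)" for x
    unfolding sum_distrib_left using mean_pos[of x]
    by (intro sum.cong refl) (simp add: pd_mult power2_eq_square field_simps)
  then show ?thesis unfolding functional_def by (simp only:)
qed

lemma conductivities_eq:
  assumes 0: "functional (\<lambda>x. mean x * gap x) = 0" and x: "x \<in> \<Omega>"
  shows "\<rho>\<^sub>1 x = \<rho>\<^sub>2 x"
proof -
  have c: "continuous_on UNIV (\<lambda>x. mean x * (\<Sum>b\<in>Basis. (pd b gap x)\<^sup>2))"
    using C_k_on_imp_continuous_on[OF mean_smooth] C_k_on_imp_continuous_on[OF C_k_on_pd[OF gap_smooth]]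
    by (intro continuous_intros) auto
  have g0: "pd b gap y = 0" if b: "b \<in> Basis" and y: "y \<in> \<Omega>" for b y
  proof -
    have "mean y * (\<Sum>b\<in>Basis. (pd b gap y)\<^sup>2) = 0"
    proof (rule continuous_nonneg_integral_zero[OF \<Omega>(1,3) _ _ _ _ y])
      show "0 \<le> mean x * (\<Sum>b\<in>Basis. (pd b gap x)\<^sup>2)" for x
        using mean_pos[of x] by (intro mult_nonneg_nonneg sum_nonneg) auto
      show "continuous_on \<Omega> (\<lambda>x. mean x * (\<Sum>b\<in>Basis. (pd b gap x)\<^sup>2))" using c continuous_on_subset by blast
      show "bounded ((\<lambda>x. mean x * (\<Sum>b\<in>Basis. (pd b gap x)\<^sup>2)) ` \<Omega>)" by (rule bounded_image_continuous[OF \<Omega>(3) c])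
      show "(LINT x:\<Omega>|lborel. mean x * (\<Sum>b\<in>Basis. (pd b gap x)\<^sup>2)) = 0" using 0 by (simp only: functional_mean_gap)
    qed
    then have "(\<Sum>b\<in>Basis. (pd b gap y)\<^sup>2) = 0" using mean_pos[of y] by simp
    then show ?thesis using b by (simp add: sum_nonneg_eq_0_iff)
  qed
  have "gap x = 0"
  proof (rule zero_gradient_imp_zero[OF \<Omega>(1-3) _ _ _ g0 x])
    show "continuous_on (closure \<Omega>) gap"
      using C_k_on_imp_continuous_on[OF gap_smooth[of 0]] by (rule continuous_on_subset) simp
    show "gap y = 0" if "y \<in> frontier \<Omega>" for y using boundary[OF that] by (simp add: gap_def)
    show "gap differentiable (at y)" for y using gap_smooth[of 1] by (auto intro: C_k_on_imp_differentiable)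
  qed
  then show ?thesis using pos[of x] by (simp add: gap_def)
qed

text \<open>The functional is defined for real functions; its complex linear extension vanishes
  exactly when it vanishes on both parts.\<close>

definition annihilated :: "('a \<Rightarrow> complex) \<Rightarrow> bool" where
  "annihilated F \<longleftrightarrow> functional (\<lambda>x. Re (F x)) = 0 \<and> functional (\<lambda>x. Im (F x)) = 0"

text \<open>Real and imaginary part of the product are combinations of four products of real
  solutions, each in the kernel of \<open>functional\<close>.\<close>

lemma annihilated_product:
  assumes "schroedinger \<rho>\<^sub>1 (\<lambda>x. Re (F x))" "schroedinger \<rho>\<^sub>1 (\<lambda>x. Im (F x))"
    and "schroedinger \<rho>\<^sub>2 (\<lambda>x. Re (G x))" "schroedinger \<rho>\<^sub>2 (\<lambda>x. Im (G x))"
  shows "annihilated (\<lambda>x. F x * G x)"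
proof -
  have C1: "C_k_on 1 UNIV (\<lambda>x. u x * v x)" if "schroedinger \<rho> u" "schroedinger \<sigma> v" for \<rho> \<sigma> u v
    using that unfolding schroedinger_def by (intro C_k_on_mult open_UNIV) (auto intro: C_k_on_mono)
  show ?thesis
    using functional_linear[OF C1[OF assms(1,3)] C1[OF assms(2,4)], of 1 "-1"]
      functional_linear[OF C1[OF assms(1,4)] C1[OF assms(2,3)], of 1 1]
      functional_product[OF assms(1,3)] functional_product[OF assms(2,4)]
      functional_product[OF assms(1,4)] functional_product[OF assms(2,3)]
    by (simp add: annihilated_def)
qed

lemma annihilated_cmult:
  assumes "complex_C_k 1 F" "annihilated F"
  shows "annihilated (\<lambda>x. c * F x)"
proof -
  have "C_k_on 1 UNIV (\<lambda>x. Re (F x))" "C_k_on 1 UNIV (\<lambda>x. Im (F x))" using assms(1) by (auto simp: complex_C_k_def)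
  from functional_linear[OF this, of "Re c" "- Im c"] functional_linear[OF this, of "Im c" "Re c"]
  show ?thesis using assms(2) by (simp add: annihilated_def add.commute)
qed

lemma annihilated_add:
  assumes "complex_C_k 1 F" "complex_C_k 1 G" "annihilated F" "annihilated G"
  shows "annihilated (\<lambda>x. F x + G x)"
  using functional_linear[of "\<lambda>x. Re (F x)" "\<lambda>x. Re (G x)" 1 1] functional_linear[of "\<lambda>x. Im (F x)" "\<lambda>x. Im (G x)" 1 1] assms
  by (simp add: annihilated_def complex_C_k_def)

lemma annihilated_sum:
  assumes "finite I" "\<And>i. i \<in> I \<Longrightarrow> complex_C_k 1 (F i)" "\<And>i. i \<in> I \<Longrightarrow> annihilated (F i)"
  shows "annihilated (\<lambda>x. \<Sum>i\<in>I. F i x)"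
  using assms
proof (induction I rule: finite_induct)
  case empty
  have "functional (\<lambda>x. 0) = 0"
    using functional_linear[of "\<lambda>x. 0" "\<lambda>x. 0" 0 0] by (simp add: C_k_on_const)
  then show ?case by (simp add: annihilated_def)
next
  case (insert i I)
  have "annihilated (\<lambda>x. F i x + (\<Sum>i\<in>I. F i x))"
    by (intro annihilated_add complex_C_k_sum insert.IH) (use insert.prems in auto)
  then show ?case using insert.hyps by simp
qed

lemma annihilated_limit:
  assumes F: "complex_C_k 1 F"
    and approx: "\<And>e. 0 < e \<Longrightarrow> \<exists>G. complex_C_k 1 G \<and> annihilated G \<and> (\<forall>x\<in>\<Omega>. norm (F x - G x) \<le> e) \<and>
      (\<forall>b\<in>Basis. \<forall>x\<in>\<Omega>. norm (pd b F x - pd b G x) \<le> e)"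
  shows "annihilated F"
proof -
  obtain K where K: "\<And>G M. C_k_on 1 UNIV G \<Longrightarrow> (\<And>x. x \<in> \<Omega> \<Longrightarrow> \<bar>G x\<bar> \<le> M) \<Longrightarrow>
    (\<And>b x. b \<in> Basis \<Longrightarrow> x \<in> \<Omega> \<Longrightarrow> \<bar>pd b G x\<bar> \<le> M) \<Longrightarrow> \<bar>functional G\<bar> \<le> K * M"
    using functional_bound by metis
  have FC: "C_k_on 1 UNIV (\<lambda>x. Re (F x))" "C_k_on 1 UNIV (\<lambda>x. Im (F x))" using F by (auto simp: complex_C_k_def)
  have bnd: "\<bar>functional (\<lambda>x. Re (F x))\<bar> \<le> K * e \<and> \<bar>functional (\<lambda>x. Im (F x))\<bar> \<le> K * e" if "0 < e" for e
  proof -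
    obtain G where G: "complex_C_k 1 G" "annihilated G" "\<And>x. x \<in> \<Omega> \<Longrightarrow> norm (F x - G x) \<le> e"
      "\<And>b x. b \<in> Basis \<Longrightarrow> x \<in> \<Omega> \<Longrightarrow> norm (pd b F x - pd b G x) \<le> e"
      using approx[OF \<open>0 < e\<close>] by blast
    have GC: "C_k_on 1 UNIV (\<lambda>x. Re (G x))" "C_k_on 1 UNIV (\<lambda>x. Im (G x))" using G(1) by (auto simp: complex_C_k_def)
    have d: "F differentiable (at x)" "G differentiable (at x)" for x
      using complex_C_k_differentiable[of 0] F G(1) by auto
    have D: "complex_C_k 1 (\<lambda>x. F x - G x)" using F G(1) by (rule complex_C_k_diff)
    have dD: "(\<lambda>x. F x - G x) differentiable (at x)" for x using d by (intro differentiable_diff)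
    have le: "\<bar>Re z\<bar> \<le> e" "\<bar>Im z\<bar> \<le> e" if "norm z \<le> e" for z
      using abs_Re_le_cmod[of z] abs_Im_le_cmod[of z] that by auto
    have "\<bar>functional (\<lambda>x. Re (F x - G x))\<bar> \<le> K * e"
    proof (rule K)
      show "C_k_on 1 UNIV (\<lambda>x. Re (F x - G x))" using D by (simp only: complex_C_k_def)
      show "\<bar>Re (F x - G x)\<bar> \<le> e" if "x \<in> \<Omega>" for x by (rule le(1)[OF G(3)[OF that]])
      show "\<bar>pd b (\<lambda>x. Re (F x - G x)) x\<bar> \<le> e" if "b \<in> Basis" "x \<in> \<Omega>" for b x
        unfolding pd_Re_Im[OF dD] pd_diff[OF d] by (rule le(1)[OF G(4)[OF that]])
    qed
    moreover have "\<bar>functional (\<lambda>x. Im (F x - G x))\<bar> \<le> K * e"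
    proof (rule K)
      show "C_k_on 1 UNIV (\<lambda>x. Im (F x - G x))" using D by (simp only: complex_C_k_def)
      show "\<bar>Im (F x - G x)\<bar> \<le> e" if "x \<in> \<Omega>" for x by (rule le(2)[OF G(3)[OF that]])
      show "\<bar>pd b (\<lambda>x. Im (F x - G x)) x\<bar> \<le> e" if "b \<in> Basis" "x \<in> \<Omega>" for b x
        unfolding pd_Re_Im[OF dD] pd_diff[OF d] by (rule le(2)[OF G(4)[OF that]])
    qed
    ultimately show ?thesis
      using functional_linear[OF FC(1) GC(1), of 1 "-1"] functional_linear[OF FC(2) GC(2), of 1 "-1"] G(2)
      by (simp add: annihilated_def)
  qed
  have "c = 0" if "\<And>e. 0 < e \<Longrightarrow> \<bar>c\<bar> \<le> K * e" for c :: real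
  proof -
    have "\<bar>c\<bar> \<le> 0"
    proof (rule field_le_epsilon)
      fix e :: real assume e: "0 < e"
      \<comment> \<open>The sign of K is unknown, and K may be 0; dividing by
        \<open>\<bar>K\<bar> + 1\<close> covers all cases.\<close>
      have "\<bar>c\<bar> \<le> K * (e / (\<bar>K\<bar> + 1))" using e by (intro that divide_pos_pos) auto
      also have "\<dots> \<le> e" using e mult_right_mono[of K "\<bar>K\<bar> + 1" e] by (simp add: field_simps)
      finally show "\<bar>c\<bar> \<le> 0 + e" by simp
    qed
    then show ?thesis by simp
  qed
  with bnd show ?thesis unfolding annihilated_def by blast
qed

end

section \<open>Plane waves and Fourier series in the kernel of the functional\<close>

lemma exp_wave_add: "exp_wave \<alpha> \<beta> x * exp_wave \<alpha>' \<beta>' x = exp_wave (\<alpha> + \<alpha>') (\<beta> + \<beta>') x"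
proof -
  have "Complex (\<alpha> \<bullet> x) (\<beta> \<bullet> x) + Complex (\<alpha>' \<bullet> x) (\<beta>' \<bullet> x) = Complex ((\<alpha> + \<alpha>') \<bullet> x) ((\<beta> + \<beta>') \<bullet> x)"
    by (simp add: complex_eq_iff inner_add_left)
  then show ?thesis unfolding exp_wave_def exp_add[symmetric] by simp
qed

lemma norm_exp_wave_imaginary: "norm (exp_wave 0 k x) = 1"
  by (simp add: exp_wave_def)

lemma exp_wave_imaginary: "exp_wave 0 k x = cis (k \<bullet> x)"
  by (simp add: exp_wave_def cis_conv_exp Complex_eq)

text \<open>Exchange two components and change one sign, starting from a nonzero component.
  Integrality makes the inner products of W with lattice frequencies discrete, which the geometric
  optics solutions rely on.\<close>

lemma integer_vector_orthogonal:
  fixes K :: "int^'n"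
  assumes "2 \<le> CARD('n)"
  obtains W :: "int^'n" where "W \<noteq> 0" "(\<Sum>i\<in>UNIV. W $ i * K $ i) = 0"
proof (cases "K = 0")
  case True
  show ?thesis by (rule that[of 1]) (simp_all add: True)
next
  case False
  then obtain i where i: "K $ i \<noteq> 0" by (auto simp: vec_eq_iff)
  have "UNIV \<noteq> {i}"
  proof
    assume "UNIV = {i}"
    then have "CARD('n) = card {i}" by (rule arg_cong)
    then show False using assms by simp
  qed
  then obtain j where j: "j \<noteq> i" by auto
  define W :: "int^'n" where "W = (\<chi> l. if l = i then K $ j else if l = j then - K $ i else 0)"
  have "(\<Sum>l\<in>UNIV. W $ l * K $ l) = (\<Sum>l\<in>{i, j}. W $ l * K $ l)"
    by (rule sum.mono_neutral_right) (auto simp: W_def)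
  also have "\<dots> = 0" using j by (simp add: W_def)
  finally have "(\<Sum>l\<in>UNIV. W $ l * K $ l) = 0" .
  moreover have "W \<noteq> 0" using i j by (auto simp: W_def vec_eq_iff intro!: exI[of _ j])
  ultimately show ?thesis by (rule that[rotated])
qed

lemma unit_vector_orthogonal:
  fixes u v :: "'a::euclidean_space"
  assumes "3 \<le> DIM('a)"
  obtains e where "norm e = 1" "u \<bullet> e = 0" "v \<bullet> e = 0"
proof -
  have "dim {u, v} \<le> card {u, v}" by (rule dim_le_card[OF span_superset]) simp
  also have "\<dots> \<le> 2" by (simp add: card_insert_if)
  finally have "dim {u, v} < DIM('a)" using assms by simp
  then obtain x where x: "x \<noteq> 0" "\<And>y. y \<in> span {u, v} \<Longrightarrow> orthogonal x y"
    by (rule orthogonal_to_subspace_exists) (rule that)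
  show ?thesis
  proof (rule that[of "x /\<^sub>R norm x"])
    show "norm (x /\<^sub>R norm x) = 1" using x(1) by simp
    show "u \<bullet> (x /\<^sub>R norm x) = 0" "v \<bullet> (x /\<^sub>R norm x) = 0"
      using x(2)[of u] x(2)[of v] by (auto simp: orthogonal_def inner_commute intro: span_base)
  qed
qed

locale vector_conductivity_pair = conductivity_pair \<Omega> \<alpha> \<rho>\<^sub>1 \<rho>\<^sub>2
  for \<Omega> :: "(real^'n) set" and \<alpha> \<rho>\<^sub>1 \<rho>\<^sub>2 +
  fixes R :: real
  assumes R: "0 < R" "\<Omega> \<subseteq> ball 0 R" and dim: "3 \<le> CARD('n)"
begin

text \<open>The potential is real, so the equation splits into its real and imaginary part.\<close>

lemma schroedinger_Re_Im:
  assumes F: "complex_C_k 3 F"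
    and eq: "\<And>x. norm x < R \<Longrightarrow> lap F x = of_real (lap (\<lambda>x. \<rho> x powr (1/2)) x / \<rho> x powr (1/2)) * F x"
  shows "schroedinger \<rho> (\<lambda>x. Re (F x))" "schroedinger \<rho> (\<lambda>x. Im (F x))"
proof -
  have "complex_C_k 2 F" using F by (rule complex_C_k_mono) simp
  moreover have "norm x < R" if "x \<in> \<Omega>" for x using R(2) that by auto
  ultimately show "schroedinger \<rho> (\<lambda>x. Re (F x))" "schroedinger \<rho> (\<lambda>x. Im (F x))"
    using F by (auto simp: schroedinger_def complex_C_k_def[of 3] lap_Re_Im eq)
qed

text \<open>With \<open>f\<close> orthogonal to \<open>w\<close> and \<open>k\<close> (here dimension three is needed), the exponents
  \<open>c w + i (k / 2 + t f)\<close> and \<open>- c w + i (k / 2 - t f)\<close> add up to \<open>i k\<close>, and both have square 0 for a suitable \<open>t\<close>.\<close>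

lemma exp_wave_lattice_approx:
  fixes K :: "int^'n"
  assumes e: "0 < e" and k: "k = lattice (1 / R) K"
  shows "\<exists>P1 P2. complex_C_k 3 P1 \<and> complex_C_k 3 P2 \<and> annihilated (\<lambda>x. exp_wave 0 k x * (P1 x * P2 x)) \<and>
    (\<forall>x. norm (P1 x - 1) \<le> e) \<and> (\<forall>x. norm (P2 x - 1) \<le> e) \<and>
    (\<forall>b\<in>Basis. \<forall>x. norm (pd b P1 x) \<le> e) \<and> (\<forall>b\<in>Basis. \<forall>x. norm (pd b P2 x) \<le> e)"
proof -
  obtain W :: "int^'n" where W: "W \<noteq> 0" "(\<Sum>i\<in>UNIV. W $ i * K $ i) = 0"
    by (rule integer_vector_orthogonal[of K]) (use dim in auto)
  define w :: "real^'n" where w: "w = (\<chi> i. real_of_int (W $ i))"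
  have w0: "w \<noteq> 0" using W(1) by (auto simp: w vec_eq_iff)
  have wk: "w \<bullet> k = 0"
  proof -
    have "w \<bullet> k = 1 / R * real_of_int (\<Sum>i\<in>UNIV. W $ i * K $ i)"
      unfolding w k lattice_def inner_vec_def of_int_sum sum_distrib_left by (intro sum.cong) auto
    then show ?thesis by (simp add: W(2))
  qed
  obtain f where f: "norm f = 1" "w \<bullet> f = 0" "k \<bullet> f = 0"
    by (rule unit_vector_orthogonal[of w k]) (use dim in auto)
  define q where "q \<rho> x = lap (\<lambda>x. \<rho> x powr (1/2)) x / \<rho> x powr (1/2)" for \<rho> :: "real^'n \<Rightarrow> real" and x
  have qs: "C_k_on j UNIV (q \<rho>)" if \<rho>: "\<And>k. C_k_on k UNIV \<rho>" "\<And>x. 0 < \<rho> x" for \<rho> j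
  proof -
    have a: "C_k_on k UNIV (\<lambda>x. \<rho> x powr (1/2))" for k by (rule C_k_on_powr[OF open_UNIV \<rho>(2,1)])
    have p: "0 < \<rho> x powr (1/2)" for x using \<rho>(2)[of x] by (simp add: powr_gt_zero)
    have "C_k_on j UNIV (lap (\<lambda>x. \<rho> x powr (1/2)))" by (rule C_k_on_lap) (rule a)
    from C_k_on_divide[OF open_UNIV p this a] show ?thesis by (simp only: q_def[abs_def])
  qed
  note q = qs[OF smooth(1) pos(1)] qs[OF smooth(2) pos(2)]
  obtain s1 where s1: "\<forall>\<alpha> \<beta> c. \<bar>c\<bar> > s1 \<and> \<alpha> = c *\<^sub>R w \<and> norm \<beta> = norm \<alpha> \<and> \<alpha> \<bullet> \<beta> = 0 \<longrightarrow>
    (\<exists>P. complex_C_k 3 P \<and> (\<forall>x. norm (P x - 1) \<le> e) \<and> (\<forall>b\<in>Basis. \<forall>x. norm (pd b P x) \<le> e) \<and>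
      (\<forall>x. norm x < R \<longrightarrow> lap (\<lambda>x. exp_wave \<alpha> \<beta> x * P x) x = of_real (q \<rho>\<^sub>1 x) * (exp_wave \<alpha> \<beta> x * P x)))"
    by (rule exE[OF geometric_optics_solution[OF R(1) q(1) W(1) w e]])
  obtain s2 where s2: "\<forall>\<alpha> \<beta> c. \<bar>c\<bar> > s2 \<and> \<alpha> = c *\<^sub>R w \<and> norm \<beta> = norm \<alpha> \<and> \<alpha> \<bullet> \<beta> = 0 \<longrightarrow>
    (\<exists>P. complex_C_k 3 P \<and> (\<forall>x. norm (P x - 1) \<le> e) \<and> (\<forall>b\<in>Basis. \<forall>x. norm (pd b P x) \<le> e) \<and>
      (\<forall>x. norm x < R \<longrightarrow> lap (\<lambda>x. exp_wave \<alpha> \<beta> x * P x) x = of_real (q \<rho>\<^sub>2 x) * (exp_wave \<alpha> \<beta> x * P x)))"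
    by (rule exE[OF geometric_optics_solution[OF R(1) q(2) W(1) w e]])
  \<comment> \<open>Exceeds both thresholds, and the last summand makes \<open>c * norm w\<close> at
    least \<open>norm k\<close>, so the radicand in t below is nonnegative.\<close>
  define c where "c = \<bar>s1\<bar> + \<bar>s2\<bar> + 1 + norm k / norm w"
  have c0: "0 \<le> norm k / norm w" by simp
  then have c: "s1 < \<bar>c\<bar>" "s2 < \<bar>- c\<bar>" "0 < c" "norm k / norm w \<le> c" unfolding c_def by linarith+
  have ck: "norm k \<le> c * norm w" using c(4) w0 by (simp add: pos_divide_le_eq)
  \<comment> \<open>By Pythagoras \<open>k /\<^sub>R 2 + t *\<^sub>R f\<close> and
    \<open>k /\<^sub>R 2 - t *\<^sub>R f\<close> then both have the length \<open>c * norm w\<close>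
    of the real parts.\<close>
  define t where "t = sqrt ((c * norm w)\<^sup>2 - (norm k / 2)\<^sup>2)"
  have "(norm k / 2)\<^sup>2 \<le> (c * norm w)\<^sup>2" using ck by (intro power_mono) (auto, smt (verit) norm_ge_zero)
  then have t: "t\<^sup>2 = (c * norm w)\<^sup>2 - (norm k / 2)\<^sup>2" by (simp add: t_def)
  have nb: "norm (k /\<^sub>R 2 + s *\<^sub>R f) = c * norm w" if "s\<^sup>2 = t\<^sup>2" for s
  proof -
    have "(norm (k /\<^sub>R 2 + s *\<^sub>R f))\<^sup>2 = (norm (k /\<^sub>R 2))\<^sup>2 + (norm (s *\<^sub>R f))\<^sup>2"
      by (rule norm_add_Pythagorean) (simp add: orthogonal_def f)
    also have "\<dots> = (c * norm w)\<^sup>2" using that t f(1) by (simp add: power_divide power_mult_distrib)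
    finally show ?thesis using c(3) by (simp add: power2_eq_iff_nonneg)
  qed
  have ortho: "w \<bullet> (k /\<^sub>R 2 + s *\<^sub>R f) = 0" for s by (simp add: inner_add_right wk f)
  obtain P1 where P1: "complex_C_k 3 P1" "\<forall>x. norm (P1 x - 1) \<le> e" "\<forall>b\<in>Basis. \<forall>x. norm (pd b P1 x) \<le> e"
    "\<And>x. norm x < R \<Longrightarrow> lap (\<lambda>x. exp_wave (c *\<^sub>R w) (k /\<^sub>R 2 + t *\<^sub>R f) x * P1 x) x =
       of_real (q \<rho>\<^sub>1 x) * (exp_wave (c *\<^sub>R w) (k /\<^sub>R 2 + t *\<^sub>R f) x * P1 x)"
    using s1[rule_format, of c "c *\<^sub>R w" "k /\<^sub>R 2 + t *\<^sub>R f"] nb[of t] ortho c(1,3) by auto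
  obtain P2 where P2: "complex_C_k 3 P2" "\<forall>x. norm (P2 x - 1) \<le> e" "\<forall>b\<in>Basis. \<forall>x. norm (pd b P2 x) \<le> e"
    "\<And>x. norm x < R \<Longrightarrow> lap (\<lambda>x. exp_wave (- c *\<^sub>R w) (k /\<^sub>R 2 + (- t) *\<^sub>R f) x * P2 x) x =
       of_real (q \<rho>\<^sub>2 x) * (exp_wave (- c *\<^sub>R w) (k /\<^sub>R 2 + (- t) *\<^sub>R f) x * P2 x)"
    using s2[rule_format, of "- c" "- c *\<^sub>R w" "k /\<^sub>R 2 + (- t) *\<^sub>R f"] nb[of "- t"] ortho[of "- t"] c(2,3) by auto
  have C1: "complex_C_k 3 (\<lambda>x. exp_wave (c *\<^sub>R w) (k /\<^sub>R 2 + t *\<^sub>R f) x * P1 x)"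
    and C2: "complex_C_k 3 (\<lambda>x. exp_wave (- c *\<^sub>R w) (k /\<^sub>R 2 + (- t) *\<^sub>R f) x * P2 x)"
    by (intro complex_C_k_mult complex_C_k_exp_wave P1(1) P2(1))+
  note S1 = schroedinger_Re_Im[OF C1 P1(4)[unfolded q_def]] and S2 = schroedinger_Re_Im[OF C2 P2(4)[unfolded q_def]]
  have "(exp_wave (c *\<^sub>R w) (k /\<^sub>R 2 + t *\<^sub>R f) x * P1 x) * (exp_wave (- c *\<^sub>R w) (k /\<^sub>R 2 + (- t) *\<^sub>R f) x * P2 x) =
      exp_wave 0 k x * (P1 x * P2 x)" for x
  proof -
    have "k /\<^sub>R 2 + t *\<^sub>R f + (k /\<^sub>R 2 + (- t) *\<^sub>R f) = k" by (simp add: scaleR_add_left[symmetric])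
    then have "exp_wave (c *\<^sub>R w) (k /\<^sub>R 2 + t *\<^sub>R f) x * exp_wave (- c *\<^sub>R w) (k /\<^sub>R 2 + (- t) *\<^sub>R f) x = exp_wave 0 k x"
      unfolding exp_wave_add by simp
    then show ?thesis by (metis (no_types, opaque_lifting) mult.assoc mult.left_commute)
  qed
  then have "annihilated (\<lambda>x. exp_wave 0 k x * (P1 x * P2 x))"
    using annihilated_product[OF S1 S2] by (simp only:)
  then show ?thesis using P1(1-3) P2(1-3) by blast
qed

text \<open>The amplitudes can be taken as close to 1 in C^1 as desired, while their product with
  the fixed wave stays in the kernel, which is closed under such limits.\<close>

lemma annihilated_exp_wave:
  fixes K :: "int^'n"
  assumes k: "k = lattice (1 / R) K"
  shows "annihilated (exp_wave 0 k)"
proof (rule annihilated_limit[OF complex_C_k_exp_wave])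
  fix e :: real assume e: "0 < e"
  \<comment> \<open>The product rule gives an error of at most \<open>4 * d + 3 * norm k * d\<close>
    in the derivatives; \<open>d \<le> 1\<close> keeps the modulus of both amplitudes at most
    2.\<close>
  define d where "d = min 1 (e / (4 + 3 * norm k))"
  have "0 < 4 + 3 * norm k" using norm_ge_zero[of k] by linarith
  then have d: "0 < d" "d \<le> 1" "d * (4 + 3 * norm k) \<le> e"
    using e by (auto simp: d_def pos_le_divide_eq[symmetric])
  obtain P1 P2 where P: "complex_C_k 3 P1" "complex_C_k 3 P2" "annihilated (\<lambda>x. exp_wave 0 k x * (P1 x * P2 x))"
    "\<And>x. norm (P1 x - 1) \<le> d" "\<And>x. norm (P2 x - 1) \<le> d"
    "\<And>b x. b \<in> Basis \<Longrightarrow> norm (pd b P1 x) \<le> d" "\<And>b x. b \<in> Basis \<Longrightarrow> norm (pd b P2 x) \<le> d"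
    using exp_wave_lattice_approx[OF d(1) k] by blast
  have dP: "P1 differentiable (at x)" "P2 differentiable (at x)" for x
    using complex_C_k_differentiable[of 2 P1] complex_C_k_differentiable[of 2 P2] P(1,2) by (auto simp: numeral_3_eq_3)
  have PP: "norm (P1 x * P2 x - 1) \<le> 3 * d" for x
  proof -
    have "P1 x * P2 x - 1 = (P1 x - 1) * (P2 x - 1) + ((P1 x - 1) + (P2 x - 1))" by (simp add: algebra_simps)
    also have "norm \<dots> \<le> norm (P1 x - 1) * norm (P2 x - 1) + (norm (P1 x - 1) + norm (P2 x - 1))"
      by (intro norm_triangle_le add_mono norm_triangle_ineq) (simp add: norm_mult)
    also have "\<dots> \<le> d * 1 + (d + d)" using P(4,5)[of x] d by (intro add_mono mult_mono) auto
    finally show ?thesis by simp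
  qed
  have P12: "norm (P1 x) \<le> 2" "norm (P2 x) \<le> 2" for x
    using norm_triangle_ineq[of "P1 x - 1" 1] norm_triangle_ineq[of "P2 x - 1" 1] P(4,5)[of x] d(2) by auto
  have e3: "3 * d \<le> e"
  proof -
    have "3 * d \<le> d * (4 + 3 * norm k)" using d(1) by (simp add: algebra_simps)
    then show ?thesis using d(3) by linarith
  qed
  show "\<exists>G. complex_C_k 1 G \<and> annihilated G \<and> (\<forall>x\<in>\<Omega>. norm (exp_wave 0 k x - G x) \<le> e) \<and>
      (\<forall>b\<in>Basis. \<forall>x\<in>\<Omega>. norm (pd b (exp_wave 0 k) x - pd b G x) \<le> e)"
  proof (intro exI[of _ "\<lambda>x. exp_wave 0 k x * (P1 x * P2 x)"] conjI ballI P(3))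
    show "complex_C_k 1 (\<lambda>x. exp_wave 0 k x * (P1 x * P2 x))"
      by (intro complex_C_k_mult complex_C_k_exp_wave) (use P(1,2) complex_C_k_mono[of 3 _ 1] in auto)
    show "norm (exp_wave 0 k x - exp_wave 0 k x * (P1 x * P2 x)) \<le> e" for x
    proof -
      have "norm (exp_wave 0 k x - exp_wave 0 k x * (P1 x * P2 x)) = norm (exp_wave 0 k x * (P1 x * P2 x - 1))"
        by (simp add: norm_minus_commute right_diff_distrib)
      also have "\<dots> = norm (P1 x * P2 x - 1)" by (simp add: norm_mult norm_exp_wave_imaginary)
      finally show ?thesis using PP[of x] e3 by linarith
    qed
    show "norm (pd b (exp_wave 0 k) x - pd b (\<lambda>x. exp_wave 0 k x * (P1 x * P2 x)) x) \<le> e" if b: "b \<in> Basis" for b x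
    proof -
      have "((\<lambda>x. exp_wave 0 k x * (P1 x * P2 x)) has_derivative
        (\<lambda>h. exp_wave 0 k x * (P1 x * pd h P2 x + pd h P1 x * P2 x) + Complex (0 \<bullet> h) (k \<bullet> h) * exp_wave 0 k x * (P1 x * P2 x))) (at x)"
        by (intro has_derivative_mult exp_wave_has_derivative has_derivative_pd dP)
      note p = pd_eqI[OF this, of b] pd_eqI[OF exp_wave_has_derivative, of b 0 k x]
      have "pd b (exp_wave 0 k) x - pd b (\<lambda>x. exp_wave 0 k x * (P1 x * P2 x)) x =
         exp_wave 0 k x * (- (P1 x * pd b P2 x + pd b P1 x * P2 x) - Complex (0 \<bullet> b) (k \<bullet> b) * (P1 x * P2 x - 1))"
        unfolding p by (simp add: algebra_simps)
      then have "norm (pd b (exp_wave 0 k) x - pd b (\<lambda>x. exp_wave 0 k x * (P1 x * P2 x)) x) =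
        norm (- (P1 x * pd b P2 x + pd b P1 x * P2 x) - Complex (0 \<bullet> b) (k \<bullet> b) * (P1 x * P2 x - 1))"
        by (simp only: norm_mult norm_exp_wave_imaginary)
      also have "\<dots> \<le> norm (P1 x) * norm (pd b P2 x) + norm (pd b P1 x) * norm (P2 x) + norm (Complex (0 \<bullet> b) (k \<bullet> b)) * norm (P1 x * P2 x - 1)"
        unfolding norm_mult[symmetric]
        by (rule order_trans[OF norm_triangle_ineq4]) (simp only: norm_minus_cancel add_right_mono norm_triangle_ineq)
      also have "norm (Complex (0 \<bullet> b) (k \<bullet> b)) = \<bar>k \<bullet> b\<bar>" by (simp add: cmod_def)
      also have "norm (P1 x) * norm (pd b P2 x) + norm (pd b P1 x) * norm (P2 x) + \<bar>k \<bullet> b\<bar> * norm (P1 x * P2 x - 1)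
         \<le> 2 * d + d * 2 + norm k * (3 * d)"
        using P12 P(6,7)[OF b] PP Basis_le_norm[OF b] d(1) by (intro add_mono mult_mono) auto
      also have "\<dots> \<le> e" using d(3) by (simp add: algebra_simps)
      finally show ?thesis .
    qed
  qed
qed

text \<open>Finite partial sums are combinations of plane waves. The rest is small in C^1, since the
  weighted norm of the tail bounds the sum of the moduli of its coefficients and of those of its
  first derivatives.\<close>

lemma annihilated_exp_sum:
  assumes C: "weighted_summable 3 C (lattice (1 / R))"
  shows "annihilated (exp_sum C (lattice (1 / R)))"
proof (rule annihilated_limit)
  define \<xi> :: "int^'n \<Rightarrow> real^'n" where "\<xi> = lattice (1 / R)"
  note C = C[folded \<xi>_def]
  show "complex_C_k 1 (exp_sum C (lattice (1 / R)))"
    using C unfolding \<xi>_def by (intro complex_C_k_exp_sum) (simp add: numeral_3_eq_3)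
  fix e :: real assume e: "0 < e"
  obtain F where F: "finite F" "weighted_summable 3 (\<lambda>i. if i \<in> F then 0 else C i) \<xi>"
    "weighted_norm 3 (\<lambda>i. if i \<in> F then 0 else C i) \<xi> < e"
    "\<And>x. exp_sum C \<xi> x = (\<Sum>i\<in>F. C i * cis (\<xi> i \<bullet> x)) + exp_sum (\<lambda>i. if i \<in> F then 0 else C i) \<xi> x"
    by (rule exp_sum_approx[OF C e], rule that)
  define T where "T i = (if i \<in> F then 0 else C i)" for i
  note F = F[folded T_def]
  define G where "G x = (\<Sum>i\<in>F. C i * exp_wave 0 (\<xi> i) x)" for x
  have G: "complex_C_k k G" for k
    unfolding G_def[abs_def] by (intro complex_C_k_sum complex_C_k_cmult complex_C_k_exp_wave)
  have FG: "exp_sum C \<xi> x - G x = exp_sum T \<xi> x" for x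
    using F(4)[of x] by (simp add: G_def exp_wave_imaginary)
  have le: "norm (exp_sum D \<xi> x) \<le> e" if D: "weighted_summable 0 D \<xi>" "\<And>i. norm (D i) \<le> norm (T i) * (1 + norm (\<xi> i)) ^ 3" for D x
  proof -
    have "norm (exp_sum D \<xi> x) \<le> (\<Sum>\<^sub>\<infinity>i. norm (D i))" by (rule exp_sum_norm_le[OF D(1)])
    also have "\<dots> \<le> weighted_norm 3 T \<xi>"
      unfolding weighted_norm_def using exp_sum_terms_summable(2)[OF D(1)] F(2)[unfolded weighted_summable_def] D(2)
      by (intro infsum_mono)
    finally show ?thesis using F(3) by linarith
  qed
  have pw: "1 + norm (\<xi> i) \<le> (1 + norm (\<xi> i)) ^ 3" for i by (rule self_le_power) auto
  show "\<exists>G. complex_C_k 1 G \<and> annihilated G \<and> (\<forall>x\<in>\<Omega>. norm (exp_sum C (lattice (1 / R)) x - G x) \<le> e) \<and>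
      (\<forall>b\<in>Basis. \<forall>x\<in>\<Omega>. norm (pd b (exp_sum C (lattice (1 / R))) x - pd b G x) \<le> e)"
    unfolding \<xi>_def[symmetric]
  proof (intro exI[of _ G] conjI ballI G)
    show "annihilated G"
      unfolding G_def[abs_def]
      by (intro annihilated_sum F(1) annihilated_cmult complex_C_k_cmult complex_C_k_exp_wave annihilated_exp_wave) (simp add: \<xi>_def)
    show "norm (exp_sum C \<xi> x - G x) \<le> e" for x
      unfolding FG
    proof (rule le)
      show "weighted_summable 0 T \<xi>" using F(2) by (rule weighted_summable_mono) simp
      show "norm (T i) \<le> norm (T i) * (1 + norm (\<xi> i)) ^ 3" for i
        using mult_left_mono[of 1 "(1 + norm (\<xi> i)) ^ 3" "norm (T i)"] pw[of i] norm_ge_zero[of "\<xi> i"] by simp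
    qed
    show "norm (pd b (exp_sum C \<xi>) x - pd b G x) \<le> e" if b: "b \<in> Basis" for b x
    proof -
      have C2: "weighted_summable 2 C \<xi>" and T2: "weighted_summable 2 T \<xi>" and T1: "weighted_summable (Suc 0) T \<xi>"
        using C F(2) by (auto intro: weighted_summable_mono)
      have "exp_sum C \<xi> differentiable (at x)" "G differentiable (at x)"
        using exp_sum_has_derivative[OF C2, of x] complex_C_k_differentiable[OF G] unfolding differentiable_def by blast+
      from pd_diff[OF this, of b] have "pd b (exp_sum C \<xi>) x - pd b G x = pd b (exp_sum T \<xi>) x"
        unfolding FG[abs_def] by simp
      also have "\<dots> = exp_sum (\<lambda>i. \<i> * of_real (\<xi> i \<bullet> b) * T i) \<xi> x" by (simp only: pd_exp_sum[OF T2])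
      finally have eq: "pd b (exp_sum C \<xi>) x - pd b G x = exp_sum (\<lambda>i. \<i> * of_real (\<xi> i \<bullet> b) * T i) \<xi> x" .
      show ?thesis unfolding eq
      proof (rule le[OF weighted_summable_pd[OF T1]])
        fix i
        have "\<bar>\<xi> i \<bullet> b\<bar> \<le> (1 + norm (\<xi> i)) ^ 3" using Basis_le_norm[OF b, of "\<xi> i"] pw[of i] by linarith
        then have "norm (T i) * \<bar>\<xi> i \<bullet> b\<bar> \<le> norm (T i) * (1 + norm (\<xi> i)) ^ 3" by (intro mult_left_mono) auto
        then show "norm (\<i> * of_real (\<xi> i \<bullet> b) * T i) \<le> norm (T i) * (1 + norm (\<xi> i)) ^ 3"
          by (simp add: norm_mult mult.commute)
      qed
    qed
  qed
qed

theorem conductivities_agree: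
  assumes "x \<in> \<Omega>"
  shows "\<rho>\<^sub>1 x = \<rho>\<^sub>2 x"
proof (rule conductivities_eq[OF _ assms])
  have s: "C_k_on k UNIV (\<lambda>x. mean x * gap x)" for k by (intro C_k_on_mult mean_smooth gap_smooth open_UNIV)
  obtain C :: "int^'n \<Rightarrow> complex" where C: "weighted_summable 3 C (lattice (1 / R))"
    "\<And>x. norm x < R \<Longrightarrow> of_real (mean x * gap x) = exp_sum C (lattice (1 / R)) x"
    by (rule fourier_representation[OF R(1) s], rule that)
  have eq: "mean x * gap x = Re (exp_sum C (lattice (1 / R)) x)" if "x \<in> \<Omega>" for x
    using C(2)[of x, symmetric] R(2) that by (auto simp del: of_real_mult)
  \<comment> \<open>The series represents the function only in the ball of radius R. That is enough
    because \<open>functional\<close> evaluates its argument and the derivatives on the open set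
    \<Omega> inside this ball.\<close>
  have "functional (\<lambda>x. mean x * gap x) = functional (\<lambda>x. Re (exp_sum C (lattice (1 / R)) x))"
    unfolding functional_def
    by (intro set_lebesgue_integral_cong allI impI sum.cong refl) (use \<Omega>(1) eq pd_cong_open[OF \<Omega>(1) _ eq] in auto)
  then show "functional (\<lambda>x. mean x * gap x) = 0" using annihilated_exp_sum[OF C(1)] by (simp add: annihilated_def)
qed

end

theorem theorem7p7:
  fixes \<Omega> :: "(real^'n) set"
    and \<alpha> \<delta>\<^sub>1 \<delta>\<^sub>2 :: real
    and a\<^sub>1 a\<^sub>2 :: "(real^'n) \<times> (real^'n) \<Rightarrow> real"
    and \<rho>\<^sub>1 \<rho>\<^sub>2 :: "real^'n \<Rightarrow> real"
    and V\<^sub>1 V\<^sub>2 :: "(real^'n \<Rightarrow> real) set"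
  assumes "CARD('n) \<ge> 3"
    and "0 < \<alpha>" and "\<alpha> < 1"
    and "bounded \<Omega>" and "holder_domain 2 \<alpha> \<Omega>"
    and "holder_on 1 \<alpha> (\<Omega> \<times> UNIV) a\<^sub>1" and "holder_on 1 \<alpha> (\<Omega> \<times> UNIV) a\<^sub>2"
    and "\<And>x p. x \<in> closure \<Omega> \<Longrightarrow> a\<^sub>1 (x, p) > 0"
    and "\<And>x p. x \<in> closure \<Omega> \<Longrightarrow> a\<^sub>2 (x, p) > 0"
    and "C_b_infinity \<rho>\<^sub>1" and "C_b_infinity \<rho>\<^sub>2"
    and "\<And>x. \<rho>\<^sub>1 x > 0" and "\<And>x. \<rho>\<^sub>2 x > 0"
    and "\<And>x p. x \<in> closure \<Omega> \<Longrightarrow> a\<^sub>1 (x, p) = \<rho>\<^sub>1 x / \<rho>\<^sub>1 p"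
    and "\<And>x p. x \<in> closure \<Omega> \<Longrightarrow> a\<^sub>2 (x, p) = \<rho>\<^sub>2 x / \<rho>\<^sub>2 p"
    and "\<And>x. x \<in> frontier \<Omega> \<Longrightarrow> \<rho>\<^sub>1 x = \<rho>\<^sub>2 x"
    and "locally_well_posed \<alpha> \<Omega> a\<^sub>1 \<delta>\<^sub>1 V\<^sub>1"
    and "locally_well_posed \<alpha> \<Omega> a\<^sub>2 \<delta>\<^sub>2 V\<^sub>2"
    and "nonlinear_cauchy_data \<alpha> \<Omega> a\<^sub>1 \<delta>\<^sub>1 V\<^sub>1 = nonlinear_cauchy_data \<alpha> \<Omega> a\<^sub>2 \<delta>\<^sub>2 V\<^sub>2"
  shows "\<forall>x\<in>\<Omega>. \<rho>\<^sub>1 x = \<rho>\<^sub>2 x"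
proof
  have \<Omega>: "open \<Omega>" "connected \<Omega>" "\<Omega> \<noteq> {}" using assms(5) by (auto simp: holder_domain_def)
  have \<alpha>: "\<alpha> \<le> 1" using assms(3) by simp
  have nf: "negligible (frontier \<Omega>)"
    using negligible_frontier_holder_domain[of 1] assms(5) by (simp add: numeral_2_eq_2)
  have smooth: "C_k_on k UNIV \<rho>\<^sub>1" "C_k_on k UNIV \<rho>\<^sub>2" for k
    using assms(10,11) by (auto simp: C_b_infinity_def)
  obtain R where R: "0 < R" "\<Omega> \<subseteq> ball 0 R" using bounded_subset_ballD[OF assms(4), of 0] by blast
  interpret vector_conductivity_pair \<Omega> \<alpha> \<rho>\<^sub>1 \<rho>\<^sub>2 R
  proof (unfold_locales; (rule \<Omega> assms(1,4) nf \<alpha> smooth assms(12,13) assms(16) R)?)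
    \<comment> \<open>What remains is the assumption \<open>cauchy\<close>. The witnesses are the
      derivatives of the two solution maps in the same direction h, which is also their common
      boundary value.\<close>
    fix h :: "real^'n \<Rightarrow> real" assume h: "C_k_on 3 UNIV h"
    have hh: "holder_on 2 \<alpha> \<Omega> h"
      using h \<alpha> by (intro C_k_on_imp_holder_on assms(4)) (simp_all add: numeral_3_eq_3 numeral_2_eq_2)
    obtain v1 where v1: "linearized \<alpha> \<Omega> a\<^sub>1 \<delta>\<^sub>1 V\<^sub>1 h v1"
      by (rule linearized_exists[OF \<Omega>(1) assms(4) \<Omega>(3) \<alpha> assms(17) hh])
    obtain v2 where v2: "linearized \<alpha> \<Omega> a\<^sub>2 \<delta>\<^sub>2 V\<^sub>2 h v2"
      by (rule linearized_exists[OF \<Omega>(1) assms(4) \<Omega>(3) \<alpha> assms(18) hh])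
    have "conductivity_solution \<rho>\<^sub>1 \<Omega> v1"
      unfolding conductivity_solution_def lap_def
      using linearized_equation[OF \<Omega>(1) v1 smooth(1) assms(12,14)] by blast
    moreover have "conductivity_solution \<rho>\<^sub>2 \<Omega> v2"
      unfolding conductivity_solution_def lap_def
      using linearized_equation[OF \<Omega>(1) v2 smooth(2) assms(13,15)] by blast
    moreover have "((\<lambda>x. pd b v1 x - pd b v2 x) \<longlongrightarrow> 0) (at z within \<Omega>)" if "z \<in> frontier \<Omega>" "b \<in> Basis" for z b
      by (rule linearized_gradients_agree[OF assms(5) that(1) v1 v2 assms(19) that(2)])
    moreover have "holder_on 2 \<alpha> \<Omega> v1" "holder_on 2 \<alpha> \<Omega> v2" using v1 v2 by (auto simp: linearized_def)
    ultimately show "\<exists>v\<^sub>1 v\<^sub>2. holder_on 2 \<alpha> \<Omega> v\<^sub>1 \<and> conductivity_solution \<rho>\<^sub>1 \<Omega> v\<^sub>1 \<and> (\<forall>x\<in>frontier \<Omega>. v\<^sub>1 x = h x) \<and>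
      holder_on 2 \<alpha> \<Omega> v\<^sub>2 \<and> conductivity_solution \<rho>\<^sub>2 \<Omega> v\<^sub>2 \<and> (\<forall>x\<in>frontier \<Omega>. v\<^sub>2 x = h x) \<and>
      (\<forall>z\<in>frontier \<Omega>. \<forall>b\<in>Basis. ((\<lambda>x. pd b v\<^sub>1 x - pd b v\<^sub>2 x) \<longlongrightarrow> 0) (at z within \<Omega>))"
      using linearized_boundary[OF v1] linearized_boundary[OF v2] by blast
  qed
  show "\<rho>\<^sub>1 x = \<rho>\<^sub>2 x" if "x \<in> \<Omega>" for x using that by (rule conductivities_agree)
qed

end
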